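(* Let $k$ be an algebraically closed field of characteristic zero, let $r\geq1$ and $d\geq2$ be integers, let $m\ge 0$, let $M(u)\in\operatorname{GL}_r(k[u_1,\ldots,u_m])$, and let $P(u,\boldsymbol z)\in k[u_1,\ldots,u_m,z_1,\ldots,z_r]$ be a nonzero polynomial homogeneous of degree $d-1$ in $\boldsymbol z=(z_1,\ldots,z_r)$. For a polynomial endomorphism $T$ of $\mathbb A^m_k$ put $$F(u,\boldsymbol z)=\bigl(T(u),P(u,\boldsymbol z)M(u)\boldsymbol z\bigr)$$ on $\mathbb A^{m+r}_k$. (1) If $T:\mathbb A^m_k\to\mathbb A^m_k$ is affine-linear, then $F$ satisfies the Dynamical Mordell–Lang conjecture. (2) If $m\geq1$, $T:\mathbb A^m_k\to\mathbb A^m_k$ is an étale polynomial endomorphism, and $\deg(T^q)<d^q$ for some $q\geq1$, then $F$ satisfies the Dynamical Mordell–Lang conjecture.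
   Context: $F$ satisfies the Dynamical Mordell–Lang conjecture if for every $x\in\mathbb A^{m+r}(k)$ and every closed subvariety $V\subseteq\mathbb A^{m+r}_k$ the set $\{n\in\mathbb N_0:F^n(x)\in V\}$ is a finite union of arithmetic progressions $a+b\mathbb N_0$ with $a,b\in\mathbb N_0=\{0,1,2,\ldots\}$ ($b=0$, a singleton, is allowed). $u=(u_1,\ldots,u_m)$ are base coordinates and $\boldsymbol z$ is regarded as a column vector. $M\in\operatorname{GL}_r(k[u])$ means that $M$ and $M^{-1}$ have polynomial entries. A self-map of affine space is étale if its differential is everywhere invertible. The degree of a polynomial map is the maximum of the total degrees of its nonzero coordinate polynomials, and $\deg(T^q)$ is the degree of the $q$-th iterate (composed map). *)

theory Defs
  imports
    "HOL-Library.Poly_Mapping"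
    "HOL-Computational_Algebra.Polynomial"
    "Jordan_Normal_Form.Matrix"
begin

section \<open>Polynomials in finitely many variables\<close>

text \<open>Polynomials in countably many variables indexed by the natural numbers: exponent vectors are
  finitely supported, and a polynomial is a finitely supported family of coefficients.  The ring
  structure is the convolution product of \<^theory>\<open>HOL-Library.Poly_Mapping\<close>.  The polynomial ring
  in \<open>n\<close> variables is the subset \<open>poly_ring n\<close> of those using only the variables \<open>0, \<dots>, n - 1\<close>.\<close>

type_synonym 'a mpoly = "(nat \<Rightarrow>\<^sub>0 nat) \<Rightarrow>\<^sub>0 'a"

definition mconst :: "'a::zero \<Rightarrow> 'a mpoly" where
  "mconst c = Poly_Mapping.single 0 c"

definition mvar :: "nat \<Rightarrow> 'a::zero_neq_one mpoly" where
  "mvar i = Poly_Mapping.single (Poly_Mapping.single i 1) 1"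

definition poly_ring :: "nat \<Rightarrow> 'a::zero mpoly set" where
  "poly_ring n = {p. \<forall>\<alpha>\<in>Poly_Mapping.keys p. Poly_Mapping.keys \<alpha> \<subseteq> {..<n}}"

text \<open>Substitution of \<open>g i\<close> for the \<open>i\<close>-th variable, where the coefficients are sent to the target
  ring by \<open>h\<close>; this covers both evaluation at a point and composition of polynomials.\<close>

definition msubst :: "('a::zero \<Rightarrow> 'b::comm_semiring_1) \<Rightarrow> (nat \<Rightarrow> 'b) \<Rightarrow> 'a mpoly \<Rightarrow> 'b" where
  "msubst h g p =
     (\<Sum>\<alpha>\<in>Poly_Mapping.keys p. h (Poly_Mapping.lookup p \<alpha>) *
        (\<Prod>i\<in>Poly_Mapping.keys \<alpha>. g i ^ Poly_Mapping.lookup \<alpha> i))"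

definition meval :: "'a::comm_semiring_1 vec \<Rightarrow> 'a mpoly \<Rightarrow> 'a" where
  "meval x p = msubst (\<lambda>c. c) (\<lambda>i. x $ i) p"

text \<open>The total degree; by convention it is \<open>0\<close> for the zero polynomial.\<close>

definition total_degree :: "'a::zero mpoly \<Rightarrow> nat" where
  "total_degree p =
     Max (insert 0 ((\<lambda>\<alpha>. \<Sum>i\<in>Poly_Mapping.keys \<alpha>. Poly_Mapping.lookup \<alpha> i) ` Poly_Mapping.keys p))"

definition homogeneous_in :: "nat set \<Rightarrow> nat \<Rightarrow> 'a::zero mpoly \<Rightarrow> bool" where
  "homogeneous_in J e p \<longleftrightarrow> (\<forall>\<alpha>\<in>Poly_Mapping.keys p. (\<Sum>j\<in>J. Poly_Mapping.lookup \<alpha> j) = e)"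

text \<open>The subtraction of exponents truncates only when the exponent of the \<open>j\<close>-th variable is
  \<open>0\<close>, and then the coefficient vanishes.\<close>

definition mpderiv :: "nat \<Rightarrow> 'a::comm_semiring_1 mpoly \<Rightarrow> 'a mpoly" where
  "mpderiv j p =
     (\<Sum>\<alpha>\<in>Poly_Mapping.keys p. Poly_Mapping.single (\<alpha> - Poly_Mapping.single j 1)
        (of_nat (Poly_Mapping.lookup \<alpha> j) * Poly_Mapping.lookup p \<alpha>))"


section \<open>Polynomial endomorphisms of affine space\<close>

text \<open>The points of affine \<open>n\<close>-space are the vectors in \<open>carrier_vec n\<close>; a polynomial endomorphism
  is the vector of its \<open>n\<close> coordinate polynomials.\<close>

definition poly_endos :: "nat \<Rightarrow> 'a::zero mpoly vec set" where
  "poly_endos n = {F \<in> carrier_vec n. set\<^sub>v F \<subseteq> poly_ring n}"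

definition endo_apply :: "'a::comm_semiring_1 mpoly vec \<Rightarrow> 'a vec \<Rightarrow> 'a vec" where
  "endo_apply F x = map_vec (meval x) F"

definition endo_comp :: "'a::comm_semiring_1 mpoly vec \<Rightarrow> 'a mpoly vec \<Rightarrow> 'a mpoly vec" where
  "endo_comp F G = map_vec (msubst mconst (\<lambda>i. G $ i)) F"

primrec endo_iter :: "'a::comm_semiring_1 mpoly vec \<Rightarrow> nat \<Rightarrow> 'a mpoly vec" where
  "endo_iter F 0 = vec (dim_vec F) mvar"
| "endo_iter F (Suc q) = endo_comp F (endo_iter F q)"

text \<open>If all coordinate polynomials vanish, the degree is \<open>0\<close> by convention.\<close>

definition endo_degree :: "'a::zero mpoly vec \<Rightarrow> nat" where
  "endo_degree F = Max (insert 0 (total_degree ` (set\<^sub>v F - {0})))"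

text \<open>The maps \<open>u \<mapsto> A u + b\<close>; the matrix \<open>A\<close> need not be invertible.\<close>

definition affine_linear :: "nat \<Rightarrow> 'a::comm_semiring_1 mpoly vec \<Rightarrow> bool" where
  "affine_linear n T \<longleftrightarrow>
     (\<exists>A\<in>carrier_mat n n. \<exists>b\<in>carrier_vec n.
        T = map_mat mconst A *\<^sub>v vec n mvar + map_vec mconst b)"

definition jacobian_at :: "'a::comm_semiring_1 mpoly vec \<Rightarrow> 'a vec \<Rightarrow> 'a mat" where
  "jacobian_at F x = mat (dim_vec F) (dim_vec F) (\<lambda>(i, j). meval x (mpderiv j (F $ i)))"

definition etale :: "nat \<Rightarrow> 'a::comm_semiring_1 mpoly vec \<Rightarrow> bool" where
  "etale n F \<longleftrightarrow> F \<in> poly_endos n \<and> (\<forall>x\<in>carrier_vec n. invertible_mat (jacobian_at F x))"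


section \<open>The Dynamical Mordell--Lang property\<close>

text \<open>Closed subvarieties are the Zariski closed subsets; they may be reducible or empty.\<close>

definition closed_subvariety :: "nat \<Rightarrow> 'a::comm_semiring_1 vec set \<Rightarrow> bool" where
  "closed_subvariety n V \<longleftrightarrow>
     (\<exists>S\<subseteq>poly_ring n. V = {x \<in> carrier_vec n. \<forall>p\<in>S. meval x p = 0})"

definition arith_prog :: "nat \<Rightarrow> nat \<Rightarrow> nat set" where
  "arith_prog a b = {a + b * l |l. True}"

definition finite_union_of_APs :: "nat set \<Rightarrow> bool" where
  "finite_union_of_APs N \<longleftrightarrow> (\<exists>I. finite I \<and> N = (\<Union>(a, b)\<in>I. arith_prog a b))"

definition satisfies_DML :: "nat \<Rightarrow> 'a::comm_semiring_1 mpoly vec \<Rightarrow> bool" where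
  "satisfies_DML n F \<longleftrightarrow>
     (\<forall>x\<in>carrier_vec n. \<forall>V. closed_subvariety n V \<longrightarrow>
        finite_union_of_APs {l. (endo_apply F ^^ l) x \<in> V})"


section \<open>The skew product\<close>

definition GL_poly :: "nat \<Rightarrow> nat \<Rightarrow> 'a::comm_semiring_1 mpoly mat set" where
  "GL_poly r m = {M \<in> carrier_mat r r. elements_mat M \<subseteq> poly_ring m \<and>
     (\<exists>N\<in>carrier_mat r r. elements_mat N \<subseteq> poly_ring m \<and> inverts_mat M N \<and> inverts_mat N M)}"

text \<open>The coordinates of affine \<open>(m + r)\<close>-space are \<open>u\<close>, at the indices \<open>0, \<dots>, m - 1\<close>, followed by
  \<open>z\<close>, at the indices \<open>m, \<dots>, m + r - 1\<close>; the map is \<open>(u, z) \<mapsto> (T(u), P(u, z) M(u) z)\<close>.\<close>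

definition skew_map ::
  "nat \<Rightarrow> nat \<Rightarrow> 'a::comm_semiring_1 mpoly vec \<Rightarrow> 'a mpoly \<Rightarrow> 'a mpoly mat \<Rightarrow> 'a mpoly vec" where
  "skew_map m r T P M = T @\<^sub>v (P \<cdot>\<^sub>v (M *\<^sub>v vec r (\<lambda>j. mvar (m + j))))"

end

theory Submission
  imports Defs "Jordan_Normal_Form.Determinant" "HOL-Computational_Algebra.Computational_Algebra"
begin

text \<open>Write \<open>F\<^sup>n(u, z) = (u\<^sub>n, c\<^sub>n w\<^sub>n)\<close>, where \<open>(u\<^sub>n, w\<^sub>n)\<close> is the orbit of \<open>(u, z)\<close> under the linear skew
  product \<open>(T(u), M(u) z)\<close> and \<open>c\<^sub>n\<^sub>+\<^sub>1 = c\<^sub>n\<^sup>d P(u\<^sub>n, w\<^sub>n)\<close>.  All data lie in a finitely generated domain \<open>A\<close>, and a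
  polynomial \<open>f\<close> vanishes at \<open>F\<^sup>n(u, z)\<close> iff the sum of the \<open>c\<^sub>n\<^sup>e f\<^sub>e(u\<^sub>n, w\<^sub>n)\<close> over the homogeneous
  parts \<open>f\<^sub>e\<close> does.

  If some nonzero value \<open>P(u\<^sub>j, w\<^sub>j)\<close> is essentially not a unit of \<open>A\<close>, it can be divided out of an
  element of \<open>A\<close> at most linearly often in the size of the element.  As \<open>c\<^sub>n\<close> is divisible by its
  power with exponent \<open>d\<^bsup>n-1-j\<^esup>\<close>, while the sizes of the \<open>f\<^sub>e(u\<^sub>n, w\<^sub>n)\<close> are \<open>o(d\<^sup>n)\<close> by the degree hypothesis,
  all \<open>f\<^sub>e(u\<^sub>n, w\<^sub>n)\<close> vanish for large \<open>n\<close>; so the problem is about the linear skew product.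
  Otherwise all \<open>c\<^sub>n\<close> are units, and one treats the orbit of \<open>(u\<^sub>n, w\<^sub>n, c\<^sub>n)\<close>.

  In both cases the system is etale along the orbit.  Specialise \<open>A\<close> to a ring that is finite over
  the localisation of the integers at a prime \<open>p \<ge> 3\<close>.  Modulo \<open>p\<close>, a suitable iterate becomes the
  identity after recentring, so that the difference operator gains a factor \<open>p\<close>, the values of \<open>f\<close>
  along an arithmetic progression are a series in \<open>p\<^sup>k (l choose k)\<close>, and Hansel's argument for the
  Skolem--Mahler--Lech theorem applies.  The period depends only on \<open>p\<close> and on the rank of the
  specialisation, and the specialisations with fixed \<open>p\<close> and rank separate the points of \<open>A\<close>.\<close>


section \<open>Subrings, sizes and polynomials\<close>

hide_const (open) Module.smult

text \<open>Specialising may kill nonzero values, so no single specialisation serves a whole orbit.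
  The argument is therefore by contradiction: if a progression has infinitely many zeros and one
  nonzero value, a specialisation is chosen that keeps this value alive. Zeros survive any
  homomorphism, and nothing else has to be protected. This is why the modulus must be known before
  the specialisation is chosen. Completions are avoided. Specialisations take values in subrings of
  the same algebraically closed field. Finiteness over the localised integers replaces p-adic
  analysis in two ways: there are finitely many residues mod p, and an element divisible by all
  powers of p is 0. Newton series are cut off to polynomials, so nothing has to converge. What is
  carried through the triangular system (base, fibre, scalar) is injectivity mod p^2 on residue
  discs, a condition that can be checked one block of coordinates at a time. The common difference
  is the square of a factorial: one factor returns the orbit to its residue class, the other makes
  the recentred return map the identity mod p.\<close>

definition subring_set :: "'a::comm_ring_1 set \<Rightarrow> bool" where
  "subring_set A \<longleftrightarrow> 1 \<in> A \<and> (\<forall>x\<in>A. \<forall>y\<in>A. x + y \<in> A \<and> x * y \<in> A) \<and> (\<forall>x\<in>A. - x \<in> A)"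

context
  fixes A :: "'a::comm_ring_1 set"
  assumes A: "subring_set A"
begin

lemma sr_one: "1 \<in> A" and sr_add: "x \<in> A \<Longrightarrow> y \<in> A \<Longrightarrow> x + y \<in> A"
  and sr_mult: "x \<in> A \<Longrightarrow> y \<in> A \<Longrightarrow> x * y \<in> A" and sr_uminus: "x \<in> A \<Longrightarrow> - x \<in> A"
  using A by (auto simp: subring_set_def)

lemma sr_zero: "0 \<in> A"
  using sr_add[OF sr_one sr_uminus[OF sr_one]] by simp

lemma sr_diff: "x \<in> A \<Longrightarrow> y \<in> A \<Longrightarrow> x - y \<in> A"
  using sr_add[of x "- y"] sr_uminus[of y] by simp

lemma sr_power: "x \<in> A \<Longrightarrow> x ^ n \<in> A"
  by (induction n) (auto intro: sr_one sr_mult)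

lemma sr_sum: "(\<And>i. i \<in> I \<Longrightarrow> f i \<in> A) \<Longrightarrow> sum f I \<in> A"
  by (induction I rule: infinite_finite_induct) (auto intro: sr_zero sr_add)

lemma sr_prod: "(\<And>i. i \<in> I \<Longrightarrow> f i \<in> A) \<Longrightarrow> prod f I \<in> A"
  by (induction I rule: infinite_finite_induct) (auto intro: sr_one sr_mult)

lemma sr_of_nat: "of_nat n \<in> A"
  by (induction n) (auto intro: sr_zero sr_add sr_one)

lemma sr_of_int: "of_int n \<in> A"
  by (cases n) (auto intro: sr_of_nat sr_uminus simp del: of_nat_Suc)

end

lemmas sr_intros = sr_one sr_zero sr_add sr_mult sr_uminus sr_diff sr_power sr_sum sr_prod
  sr_of_nat sr_of_int

text \<open>\<open>sz G s R y\<close> bounds the size of \<open>y\<close>: it is the value at \<open>G\<close> of an integer polynomial of degree at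
  most \<open>s\<close> whose coefficients have absolute values summing up to at most \<open>R\<close>.\<close>

inductive sz :: "'a::comm_ring_1 set \<Rightarrow> nat \<Rightarrow> nat \<Rightarrow> 'a \<Rightarrow> bool" for G where
  sz_zero: "sz G s R 0"
| sz_one: "1 \<le> R \<Longrightarrow> sz G s R 1"
| sz_gen: "a \<in> G \<Longrightarrow> 1 \<le> s \<Longrightarrow> 1 \<le> R \<Longrightarrow> sz G s R a"
| sz_uminus: "sz G s R x \<Longrightarrow> sz G s R (- x)"
| sz_add: "sz G s R x \<Longrightarrow> sz G s R' y \<Longrightarrow> sz G s (R + R') (x + y)"
| sz_mult: "sz G s R x \<Longrightarrow> sz G s' R' y \<Longrightarrow> sz G (s + s') (R * R') (x * y)"

lemma sz_mono: "sz G s R x \<Longrightarrow> s \<le> s' \<Longrightarrow> R \<le> R' \<Longrightarrow> sz G s' R' x"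
proof -
  assume x: "sz G s R x" and "s \<le> s'" "R \<le> R'"
  \<comment> \<open>Multiplying by 1 raises the degree bound, adding 0 the coefficient
    bound.\<close>
  have "sz G (s + (s' - s)) (R * 1) (x * 1)"
    by (intro sz_mult x sz_one) simp
  then have "sz G s' R x" using \<open>s \<le> s'\<close> by simp
  then have "sz G s' (R + (R' - R)) (x + 0)"
    by (intro sz_add sz_zero)
  then show ?thesis using \<open>R \<le> R'\<close> by simp
qed

lemma sz_sum:
  "finite I \<Longrightarrow> (\<And>i. i \<in> I \<Longrightarrow> sz G s (R i) (f i)) \<Longrightarrow> sz G s (sum R I) (sum f I)"
  by (induction I rule: finite_induct) (auto intro: sz_zero sz_add)

lemma sz_prod:
  "finite I \<Longrightarrow> (\<And>i. i \<in> I \<Longrightarrow> sz G (s i) (R i) (f i)) \<Longrightarrow> sz G (sum s I) (prod R I) (prod f I)"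
  by (induction I rule: finite_induct) (auto intro: sz_one sz_mult)

lemma sz_power: "sz G s R x \<Longrightarrow> sz G (n * s) (R ^ n) (x ^ n)"
  by (induction n) (auto intro: sz_one sz_mult)

lemma sz_gens_mono: "sz G s R x \<Longrightarrow> G \<subseteq> G' \<Longrightarrow> sz G' s R x"
  by (induction rule: sz.induct) (auto intro: sz.intros)

definition gen :: "'a::comm_ring_1 set \<Rightarrow> 'a set" where
  "gen G = {y. \<exists>s R. sz G s R y}"

lemma genI: "sz G s R y \<Longrightarrow> y \<in> gen G"
  by (auto simp: gen_def)

lemma subring_gen: "subring_set (gen G)"
proof -
  have "x + y \<in> gen G" if "x \<in> gen G" "y \<in> gen G" for x y
  proof -
    from that obtain s R s' R' where "sz G s R x" "sz G s' R' y" by (auto simp: gen_def)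
    then have "sz G (max s s') R x" "sz G (max s s') R' y" by (auto elim: sz_mono)
    then show ?thesis by (blast intro: genI sz_add)
  qed
  moreover have "x * y \<in> gen G" if "x \<in> gen G" "y \<in> gen G" for x y
    using that sz_mult unfolding gen_def by blast
  moreover have "- x \<in> gen G" if "x \<in> gen G" for x
    using that sz_uminus unfolding gen_def by blast
  moreover have "1 \<in> gen G" by (rule genI[OF sz_one[OF order_refl]])
  ultimately show ?thesis
    unfolding subring_set_def by blast
qed

lemma gen_superset: "G \<subseteq> gen G"
  by (auto intro!: genI sz_gen)

lemma gen_mono: "G \<subseteq> G' \<Longrightarrow> gen G \<subseteq> gen G'"
  unfolding gen_def using sz_gens_mono by blast

text \<open>Writing the coefficient bound as \<open>2 ^ s\<close> lets one number measure degree and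
  height together; the growth estimates along orbits use this diagonal form.\<close>

lemma finite_sz_common:
  assumes "finite F" "F \<subseteq> gen G"
  obtains s where "\<And>y. y \<in> F \<Longrightarrow> sz G s (2 ^ s) y"
proof -
  have "\<exists>s. \<forall>y\<in>F. sz G s (2 ^ s) y"
    using assms
  proof (induction F rule: finite_induct)
    case (insert y F)
    then obtain s where s: "\<forall>y\<in>F. sz G s (2 ^ s) y" by auto
    from insert obtain t R where t: "sz G t R y" by (auto simp: gen_def)
    define u where "u = max s (max t R)"
    have "R < 2 ^ R" by (rule less_exp)
    also have "(2::nat) ^ R \<le> 2 ^ u" by (rule power_increasing) (auto simp: u_def)
    finally have "R \<le> 2 ^ u" by simp
    then have "sz G u (2 ^ u) y" using t by (auto simp: u_def elim: sz_mono)
    moreover have "sz G u (2 ^ u) x" if "x \<in> F" for x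
      using s that by (auto simp: u_def elim!: sz_mono intro: power_increasing)
    ultimately show ?case by auto
  qed auto
  with that show ?thesis by auto
qed

section \<open>Polynomials over a subring and the adjunction of one generator\<close>

definition polyover :: "'a::comm_ring_1 set \<Rightarrow> 'a poly set" where
  "polyover A = {Y. \<forall>i. coeff Y i \<in> A}"

lemma polyover_coeff: "Y \<in> polyover A \<Longrightarrow> coeff Y i \<in> A"
  by (auto simp: polyover_def)

context
  fixes A :: "'a::comm_ring_1 set"
  assumes A: "subring_set A"
begin

lemma polyover_add: "Y \<in> polyover A \<Longrightarrow> Z \<in> polyover A \<Longrightarrow> Y + Z \<in> polyover A"
  and polyover_diff: "Y \<in> polyover A \<Longrightarrow> Z \<in> polyover A \<Longrightarrow> Y - Z \<in> polyover A"
  and polyover_uminus: "Y \<in> polyover A \<Longrightarrow> - Y \<in> polyover A"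
  and polyover_mult: "Y \<in> polyover A \<Longrightarrow> Z \<in> polyover A \<Longrightarrow> Y * Z \<in> polyover A"
  and polyover_smult: "c \<in> A \<Longrightarrow> Y \<in> polyover A \<Longrightarrow> smult c Y \<in> polyover A"
  and polyover_zero: "0 \<in> polyover A"
  and polyover_monom: "c \<in> A \<Longrightarrow> monom c n \<in> polyover A"
  by (auto simp: polyover_def coeff_mult intro!: sr_intros[OF A])

lemma polyover_one: "1 \<in> polyover A"
  using polyover_monom[of 1 0] sr_one[OF A] by simp

lemma polyover_power: "Y \<in> polyover A \<Longrightarrow> Y ^ n \<in> polyover A"
  by (induction n) (auto intro: polyover_one polyover_mult)

lemma polyover_pCons: "c \<in> A \<Longrightarrow> Y \<in> polyover A \<Longrightarrow> pCons c Y \<in> polyover A"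
  by (auto simp: polyover_def coeff_pCons split: nat.splits)

lemma polyover_poly: "Y \<in> polyover A \<Longrightarrow> a \<in> A \<Longrightarrow> poly Y a \<in> A"
  by (auto simp: poly_altdef polyover_def intro!: sr_intros[OF A])

end

lemmas polyover_intros = polyover_add polyover_diff polyover_uminus polyover_mult polyover_smult
  polyover_zero polyover_monom polyover_one polyover_power polyover_pCons

lemma polyover_mono: "A \<subseteq> B \<Longrightarrow> Y \<in> polyover A \<Longrightarrow> Y \<in> polyover B"
  by (auto simp: polyover_def)

lemma poly_nat_one_ge_coeff: "coeff (\<rho> :: nat poly) i \<le> poly \<rho> 1"
proof (cases "i \<le> degree \<rho>")
  case True
  then show ?thesis
    by (simp add: poly_altdef) (rule member_le_sum, auto)
qed (simp add: coeff_eq_0)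

text \<open>\<open>\<rho>\<close> majorises \<open>Y\<close> coefficient by coefficient, and
  \<open>poly \<rho> 1\<close> is the sum of its coefficients. Keeping the majorant as a polynomial
  settles the product case: the coefficients of both convolve alike, and values at 1
  multiply.\<close>

lemma sz_insertD:
  assumes "sz (insert a G) s R y"
  obtains Y \<rho> where "poly Y a = y" "degree Y \<le> s" "\<forall>i. sz G s (coeff \<rho> i) (coeff Y i)"
    "poly \<rho> (1::nat) \<le> R"
proof -
  have "\<exists>Y \<rho>. poly Y a = y \<and> degree Y \<le> s \<and> (\<forall>i. sz G s (coeff \<rho> i) (coeff Y i)) \<and>
    poly \<rho> (1::nat) \<le> R"
    using assms
  proof induction
    case (sz_zero s R)
    show ?case by (rule exI[of _ 0], rule exI[of _ 0]) (auto intro: sz.intros)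
  next
    case (sz_one R s)
    then show ?case
      by (intro exI[of _ 1] exI[of _ 1])
        (auto intro: sz.intros simp: one_pCons coeff_pCons split: nat.splits)
  next
    case (sz_gen b s R)
    show ?case
    proof (cases "b = a")
      case True
      show ?thesis using sz_gen True
        by (intro exI[of _ "[:0, 1:]"] exI[of _ "[:0, 1:]"])
          (auto intro: sz.intros simp: coeff_pCons split: nat.splits)
    next
      case False
      show ?thesis using sz_gen False
        by (intro exI[of _ "[:b:]"] exI[of _ "[:1:]"])
          (auto intro: sz.intros simp: coeff_pCons split: nat.splits)
    qed
  next
    case (sz_uminus s R x)
    then obtain Y \<rho> where "poly Y a = x" "degree Y \<le> s" "\<forall>i. sz G s (coeff \<rho> i) (coeff Y i)"
      "poly \<rho> (1::nat) \<le> R" by auto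
    then show ?case
      by (intro exI[of _ "- Y"] exI[of _ \<rho>]) (auto intro: sz.intros)
  next
    case (sz_add s R x R' y)
    then obtain Y \<rho> Z \<rho>' where "poly Y a = x" "degree Y \<le> s" "\<forall>i. sz G s (coeff \<rho> i) (coeff Y i)"
      "poly \<rho> (1::nat) \<le> R" "poly Z a = y" "degree Z \<le> s" "\<forall>i. sz G s (coeff \<rho>' i) (coeff Z i)"
      "poly \<rho>' (1::nat) \<le> R'" by auto
    then show ?case
      by (intro exI[of _ "Y + Z"] exI[of _ "\<rho> + \<rho>'"]) (auto intro: sz.intros degree_add_le)
  next
    case (sz_mult s R x s' R' y)
    then obtain Y \<rho> Z \<rho>' where *: "poly Y a = x" "degree Y \<le> s" "\<forall>i. sz G s (coeff \<rho> i) (coeff Y i)"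
      "poly \<rho> (1::nat) \<le> R" "poly Z a = y" "degree Z \<le> s'" "\<forall>i. sz G s' (coeff \<rho>' i) (coeff Z i)"
      "poly \<rho>' (1::nat) \<le> R'" by auto
    have "sz G (s + s') (coeff (\<rho> * \<rho>') i) (coeff (Y * Z) i)" for i
      unfolding coeff_mult using * by (intro sz_sum sz.sz_mult) auto
    moreover have "degree (Y * Z) \<le> s + s'"
      using degree_mult_le[of Y Z] * by linarith
    ultimately show ?case using *
      by (intro exI[of _ "Y * Z"] exI[of _ "\<rho> * \<rho>'"]) (auto intro: mult_mono)
  qed
  with that show ?thesis by blast
qed

lemma gen_insert: "gen (insert a G) = (\<lambda>Y. poly Y a) ` polyover (gen G)"
proof (intro equalityI subsetI)
  fix y assume "y \<in> gen (insert a G)"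
  then obtain s R where "sz (insert a G) s R y" by (auto simp: gen_def)
  then show "y \<in> (\<lambda>Y. poly Y a) ` polyover (gen G)"
    by (elim sz_insertD) (auto simp: polyover_def intro: genI)
next
  fix y assume "y \<in> (\<lambda>Y. poly Y a) ` polyover (gen G)"
  then obtain Y where Y: "y = poly Y a" "Y \<in> polyover (gen G)" by auto
  then have "Y \<in> polyover (gen (insert a G))"
    by (blast intro: polyover_mono[OF gen_mono])
  moreover have "a \<in> gen (insert a G)" using gen_superset by blast
  ultimately show "y \<in> gen (insert a G)"
    unfolding Y by (rule polyover_poly[OF subring_gen])
qed

lemma sz_empty: "sz {} s R y \<Longrightarrow> \<exists>n. y = of_int n \<and> \<bar>n\<bar> \<le> int R"
proof (induction rule: sz.induct)
  case (sz_zero s R) show ?case by (rule exI[of _ 0]) auto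
next
  case (sz_one R s) then show ?case by (intro exI[of _ 1]) auto
next
  case (sz_gen a s R) then show ?case by simp
next
  case (sz_uminus s R x) then show ?case by (metis abs_minus_cancel of_int_minus)
next
  case (sz_add s R x R' y)
  then obtain n m where "x = of_int n" "y = of_int m" "\<bar>n\<bar> \<le> int R" "\<bar>m\<bar> \<le> int R'" by auto
  then show ?case by (intro exI[of _ "n + m"]) auto
next
  case (sz_mult s R x s' R' y)
  then obtain n m where "x = of_int n" "y = of_int m" "\<bar>n\<bar> \<le> int R" "\<bar>m\<bar> \<le> int R'" by auto
  then show ?case by (intro exI[of _ "n * m"]) (auto simp: abs_mult intro: mult_mono)
qed

lemma gen_empty: "gen {} = range of_int"
proof
  show "gen {} \<subseteq> range of_int" unfolding gen_def using sz_empty by blast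
  show "range of_int \<subseteq> gen {}" by (auto intro: sr_of_int[OF subring_gen])
qed

section \<open>Algebraic elements, pseudo-division and minimal polynomials\<close>

definition alg_over :: "'a::comm_ring_1 set \<Rightarrow> 'a \<Rightarrow> bool" where
  "alg_over A a \<longleftrightarrow> (\<exists>Y\<in>polyover A. Y \<noteq> 0 \<and> poly Y a = 0)"

lemma alg_over_mono: "A \<subseteq> B \<Longrightarrow> alg_over A a \<Longrightarrow> alg_over B a"
  unfolding alg_over_def using polyover_mono by blast

text \<open>Long division with denominators cleared: each step multiplies \<open>Y\<close> by the
  leading coefficient of \<open>W\<close>, so that quotient and remainder keep their coefficients in
  the ring \<open>A\<close>.\<close>

lemma pseudo_division:
  fixes W :: "'a::idom poly"
  assumes A: "subring_set A" and W: "W \<in> polyover A" "W \<noteq> 0" and Y: "Y \<in> polyover A"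
  obtains j Q S where "smult (lead_coeff W ^ j) Y = Q * W + S" "Q \<in> polyover A" "S \<in> polyover A"
    "S = 0 \<or> degree S < degree W"
proof -
  let ?c = "lead_coeff W"
  have "\<exists>j Q S. smult (?c ^ j) Y = Q * W + S \<and> Q \<in> polyover A \<and> S \<in> polyover A \<and>
    (S = 0 \<or> degree S < degree W)"
    using Y
  proof (induction "degree Y" arbitrary: Y rule: less_induct)
    case less
    show ?case
    proof (cases "Y = 0 \<or> degree Y < degree W")
      case True
      then show ?thesis using less.prems
        by (intro exI[of _ 0] exI[of _ Y]) (auto intro: polyover_intros[OF A])
    next
      case False
      define n where "n = degree Y - degree W"
      define Z where "Z = monom (lead_coeff Y) n"
      define Y' where "Y' = smult ?c Y - Z * W"
      have Z: "Z \<in> polyover A"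
        unfolding Z_def using less.prems by (intro polyover_intros[OF A] polyover_coeff)
      have Y': "Y' \<in> polyover A"
        unfolding Y'_def using less.prems W Z by (intro polyover_intros[OF A] polyover_coeff)
      have "lead_coeff Y \<noteq> 0" using False by auto
      then have "Z \<noteq> 0" "degree Z = n"
        unfolding Z_def using Polynomial.degree_monom_eq[of "lead_coeff Y" n] by auto
      from this(1) have "degree (Z * W) = degree Z + degree W"
        using W(2) by (rule degree_mult_eq)
      then have dZW: "degree (Z * W) = degree Y"
        using False \<open>degree Z = n\<close> unfolding n_def by linarith
      have lZW: "lead_coeff (Z * W) = ?c * lead_coeff Y"
        using \<open>degree Z = n\<close> by (simp only: lead_coeff_mult) (simp add: Z_def)
      have *: "coeff Y' (degree Y) = 0"
        using lZW by (simp add: Y'_def dZW)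
      have dle: "degree Y' \<le> degree Y"
        unfolding Y'_def using dZW by (intro degree_diff_le) auto
      show ?thesis
      proof (cases "degree Y' < degree Y")
        case True
        from less.hyps[OF True Y'] obtain j Q S where jQS:
          "smult (?c ^ j) Y' = Q * W + S" "Q \<in> polyover A" "S \<in> polyover A"
          "S = 0 \<or> degree S < degree W" by auto
        have "smult (?c ^ Suc j) Y = smult (?c ^ j) (Y' + Z * W)"
          by (simp add: Y'_def mult.commute)
        also have "\<dots> = (Q + smult (?c ^ j) Z) * W + S"
          using jQS(1) by (simp add: smult_add_right algebra_simps)
        finally have "smult (?c ^ Suc j) Y = (Q + smult (?c ^ j) Z) * W + S" .
        moreover have "Q + smult (?c ^ j) Z \<in> polyover A"
          using jQS Z W by (intro polyover_intros[OF A] sr_power[OF A] polyover_coeff)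
        ultimately show ?thesis using jQS by blast
      next
        \<comment> \<open>As \<open>degree 0 = 0\<close>, the degree can fail to drop only for
          constant \<open>Y\<close>; the vanishing top coefficient then gives
          \<open>Y' = 0\<close>.\<close>
        case False2: False
        then have "Y' = 0 \<or> degree Y = 0"
          using * dle by (metis leading_coeff_0_iff le_neq_implies_less)
        moreover have "Y' = 0" if "degree Y = 0"
        proof -
          from that dle have "degree Y' = 0" by simp
          with * that show ?thesis by (metis leading_coeff_0_iff)
        qed
        ultimately have "Y' = 0" by blast
        then have "smult (?c ^ 1) Y = Z * W + 0" by (simp add: Y'_def)
        then show ?thesis using Z polyover_zero[OF A] by blast
      qed
    qed
  qed
  with that show ?thesis by blast
qed

text \<open>The minimal polynomial over the fraction field with denominators cleared. It is not
  monic, and it divides the other relations only up to powers of its leading coefficient, see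
  \<open>min_poly_dvd\<close>.\<close>

definition min_poly :: "'a::idom set \<Rightarrow> 'a \<Rightarrow> 'a poly \<Rightarrow> bool" where
  "min_poly A a W \<longleftrightarrow> W \<in> polyover A \<and> W \<noteq> 0 \<and> poly W a = 0 \<and>
     (\<forall>Y\<in>polyover A. poly Y a = 0 \<longrightarrow> Y = 0 \<or> degree W \<le> degree Y)"

lemma min_poly_exists:
  assumes "alg_over A a"
  obtains W where "min_poly A a W"
proof -
  define P where "P W \<longleftrightarrow> W \<in> polyover A \<and> W \<noteq> 0 \<and> poly W a = 0" for W
  from assms obtain W0 where "P W0" by (auto simp: P_def alg_over_def)
  then obtain W where "P W" "\<And>Y. P Y \<Longrightarrow> degree W \<le> degree Y"
    using ex_has_least_nat[of P W0 degree] by blast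
  then have "min_poly A a W" unfolding min_poly_def P_def by blast
  with that show ?thesis by blast
qed

lemma min_poly_degree_pos: "min_poly A a W \<Longrightarrow> degree W > 0"
  unfolding min_poly_def by (metis degree_eq_zeroE gr0I pCons_0_0 poly_const_conv)

lemma min_poly_dvd:
  assumes A: "subring_set A" and W: "min_poly A a W" and Y: "Y \<in> polyover A" "poly Y a = 0"
  obtains j Q where "smult (lead_coeff W ^ j) Y = Q * W" "Q \<in> polyover A"
proof -
  from W have W': "W \<in> polyover A" "W \<noteq> 0" "poly W a = 0" by (auto simp: min_poly_def)
  obtain j Q S where *: "smult (lead_coeff W ^ j) Y = Q * W + S" "Q \<in> polyover A" "S \<in> polyover A"
    "S = 0 \<or> degree S < degree W"
    using pseudo_division[OF A W'(1,2) Y(1)] by blast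
  have "poly S a = 0" using arg_cong[OF *(1), of "\<lambda>p. poly p a"] Y W' by simp
  with * W have "S = 0" unfolding min_poly_def by fastforce
  with * that show ?thesis by simp
qed

text \<open>Among the nonzero multiples of \<open>y\<close>, take one that is the value at
  \<open>a\<close> of a polynomial \<open>R\<close> of least degree. If \<open>R\<close> were not
  constant, dividing \<open>W\<close> by it would leave a remainder whose value is again a multiple
  of \<open>y\<close>, hence 0 by minimality. Then \<open>R\<close> would divide a constant multiple
  of \<open>W\<close>, and the cofactor would be too short a polynomial vanishing at
  \<open>a\<close>. The lemma moves questions of nonvanishing and of units from the extension to the
  base.\<close>

lemma algebraic_multiple_in_base:
  fixes a :: "'a::idom"
  assumes alg: "alg_over (gen G) a" and y: "y \<in> gen (insert a G)" "y \<noteq> 0"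
  obtains y' where "y' \<in> gen (insert a G)" "y * y' \<in> gen G" "y * y' \<noteq> 0"
proof -
  let ?A = "gen G"
  note A = subring_gen[of G] and A' = subring_gen[of "insert a G"]
  obtain W where W: "min_poly ?A a W" using min_poly_exists[OF alg] .
  then have W': "W \<in> polyover ?A" "W \<noteq> 0" "poly W a = 0" by (auto simp: min_poly_def)
  define P where "P R \<longleftrightarrow> R \<in> polyover ?A \<and> poly R a \<noteq> 0 \<and>
    (\<exists>z\<in>gen (insert a G). poly R a = y * z)" for R
  obtain R0 where "R0 \<in> polyover ?A" "poly R0 a = y"
    using y(1) by (auto simp: gen_insert)
  then have "P R0" using y sr_one[OF A'] by (auto simp: P_def intro!: bexI[of _ 1])
  then obtain R where R: "P R" and least: "\<And>Y. P Y \<Longrightarrow> degree R \<le> degree Y"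
    using ex_has_least_nat[of P R0 degree] by blast
  from R obtain z where z: "z \<in> gen (insert a G)" "poly R a = y * z" and R': "R \<in> polyover ?A"
    "poly R a \<noteq> 0" by (auto simp: P_def)
  have "degree R = 0"
  proof (rule ccontr)
    assume d: "degree R \<noteq> 0"
    have "R \<noteq> 0" using R' by auto
    obtain j Q S where *: "smult (lead_coeff R ^ j) W = Q * R + S" "Q \<in> polyover ?A"
      "S \<in> polyover ?A" "S = 0 \<or> degree S < degree R"
      using pseudo_division[OF A R'(1) \<open>R \<noteq> 0\<close> W'(1)] by blast
    have Qa: "poly Q a \<in> gen (insert a G)" using *(2) by (auto simp: gen_insert)
    have "poly S a = y * (- (poly Q a * z))"
      using arg_cong[OF *(1), of "\<lambda>p. poly p a"] W' z by (simp add: algebra_simps eq_neg_iff_add_eq_0)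
    moreover have "- (poly Q a * z) \<in> gen (insert a G)"
      using Qa z by (intro sr_intros[OF A'])
    ultimately have "poly S a \<noteq> 0 \<Longrightarrow> P S" using *(3) unfolding P_def by blast
    with least[of S] * have S0: "poly S a = 0" by force
    \<comment> \<open>Otherwise reducing \<open>R\<close> modulo \<open>W\<close> would give a
      competitor of smaller degree.\<close>
    have RW: "degree R \<le> degree W"
    proof (rule ccontr)
      assume RW: "\<not> degree R \<le> degree W"
      obtain j Q S where *: "smult (lead_coeff W ^ j) R = Q * W + S" "Q \<in> polyover ?A"
        "S \<in> polyover ?A" "S = 0 \<or> degree S < degree W"
        using pseudo_division[OF A W'(1,2) R'(1)] by blast
      have S: "poly S a = lead_coeff W ^ j * poly R a"
        using arg_cong[OF *(1), of "\<lambda>p. poly p a"] W' by simp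
      then have "poly S a = y * (lead_coeff W ^ j * z)" using z by simp
      moreover have "lead_coeff W ^ j * z \<in> gen (insert a G)"
        using z W' gen_mono[of G "insert a G"] polyover_coeff[OF W'(1)]
        by (intro sr_intros[OF A']) auto
      ultimately have "P S" using R' W' *(3) S by (auto simp: P_def)
      with least[of S] * RW show False by (auto simp: P_def)
    qed
    have "S = 0 \<or> degree W \<le> degree S" using S0 * W by (auto simp: min_poly_def)
    with * RW have "S = 0" by auto
    with * have eq: "smult (lead_coeff R ^ j) W = Q * R" by simp
    have "poly (Q * R) a = 0" unfolding eq[symmetric] using W' by simp
    then have "poly Q a = 0" using R' by simp
    with *(2) W have "Q = 0 \<or> degree W \<le> degree Q" by (auto simp: min_poly_def)
    moreover have "Q \<noteq> 0" using eq W' \<open>R \<noteq> 0\<close> by auto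
    moreover have "degree W = degree Q + degree R"
      using arg_cong[OF eq, of degree] \<open>Q \<noteq> 0\<close> \<open>R \<noteq> 0\<close> W'
      by (simp add: degree_mult_eq)
    ultimately show False using d by simp
  qed
  then obtain c where "R = [:c:]" by (rule degree_eq_zeroE)
  with R' have "y * z \<in> ?A" using polyover_coeff[OF R'(1), of 0] z by simp
  with R' z that show ?thesis by metis
qed


section \<open>Specialisations over localisations of the integers\<close>

definition hom_on :: "'a::comm_ring_1 set \<Rightarrow> ('a \<Rightarrow> 'b::comm_ring_1) \<Rightarrow> bool" where
  "hom_on A \<phi> \<longleftrightarrow> \<phi> 1 = 1 \<and> (\<forall>x\<in>A. \<forall>y\<in>A. \<phi> (x + y) = \<phi> x + \<phi> y \<and> \<phi> (x * y) = \<phi> x * \<phi> y)"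

lemma hom_on_subset: "hom_on B \<phi> \<Longrightarrow> A \<subseteq> B \<Longrightarrow> hom_on A \<phi>"
  by (auto simp: hom_on_def)

context
  fixes A :: "'a::comm_ring_1 set" and \<phi> :: "'a \<Rightarrow> 'b::comm_ring_1"
  assumes A: "subring_set A" and \<phi>: "hom_on A \<phi>"
begin

lemma hom_on_one: "\<phi> 1 = 1" and hom_on_add: "x \<in> A \<Longrightarrow> y \<in> A \<Longrightarrow> \<phi> (x + y) = \<phi> x + \<phi> y"
  and hom_on_mult: "x \<in> A \<Longrightarrow> y \<in> A \<Longrightarrow> \<phi> (x * y) = \<phi> x * \<phi> y"
  using \<phi> by (auto simp: hom_on_def)

lemma hom_on_zero: "\<phi> 0 = 0"
  using hom_on_add[of 0 0] sr_zero[OF A] by simp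

lemma hom_on_uminus: "x \<in> A \<Longrightarrow> \<phi> (- x) = - \<phi> x"
  using hom_on_add[of x "- x"] sr_uminus[OF A] hom_on_zero by (simp add: eq_neg_iff_add_eq_0 add.commute)

lemma hom_on_diff: "x \<in> A \<Longrightarrow> y \<in> A \<Longrightarrow> \<phi> (x - y) = \<phi> x - \<phi> y"
  using hom_on_add[of x "- y"] hom_on_uminus[of y] sr_uminus[OF A] by simp

lemma hom_on_sum: "(\<And>i. i \<in> I \<Longrightarrow> f i \<in> A) \<Longrightarrow> \<phi> (sum f I) = (\<Sum>i\<in>I. \<phi> (f i))"
  by (induction I rule: infinite_finite_induct)
    (auto simp: hom_on_zero hom_on_add sr_sum[OF A])

lemma hom_on_power: "x \<in> A \<Longrightarrow> \<phi> (x ^ n) = \<phi> x ^ n"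
  by (induction n) (auto simp: hom_on_one hom_on_mult sr_power[OF A])

lemma hom_on_of_nat: "\<phi> (of_nat n) = of_nat n"
  by (induction n) (auto simp: hom_on_zero hom_on_add hom_on_one sr_one[OF A] sr_of_nat[OF A])

lemma map_poly_hom_on_add:
  "Y \<in> polyover A \<Longrightarrow> Z \<in> polyover A \<Longrightarrow> map_poly \<phi> (Y + Z) = map_poly \<phi> Y + map_poly \<phi> Z"
  by (auto intro!: poly_eqI simp: coeff_map_poly hom_on_zero polyover_def hom_on_add)

lemma map_poly_hom_on_diff:
  "Y \<in> polyover A \<Longrightarrow> Z \<in> polyover A \<Longrightarrow> map_poly \<phi> (Y - Z) = map_poly \<phi> Y - map_poly \<phi> Z"
  by (auto intro!: poly_eqI simp: coeff_map_poly hom_on_zero polyover_def hom_on_diff)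

lemma map_poly_hom_on_mult:
  "Y \<in> polyover A \<Longrightarrow> Z \<in> polyover A \<Longrightarrow> map_poly \<phi> (Y * Z) = map_poly \<phi> Y * map_poly \<phi> Z"
  by (auto intro!: poly_eqI sum.cong
      simp: coeff_map_poly hom_on_zero polyover_def coeff_mult hom_on_sum hom_on_mult sr_mult[OF A])

lemma map_poly_hom_on_smult:
  "c \<in> A \<Longrightarrow> Y \<in> polyover A \<Longrightarrow> map_poly \<phi> (smult c Y) = smult (\<phi> c) (map_poly \<phi> Y)"
  by (auto intro!: poly_eqI simp: coeff_map_poly hom_on_zero polyover_def hom_on_mult)

end

text \<open>\<open>a\<close> is sent to \<open>t\<close>. An element of the extension is evaluated
  through an arbitrary polynomial representing it, and \<open>rel\<close> makes the choice
  irrelevant. A transcendental \<open>a\<close> has only the zero relation, so \<open>t\<close> is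
  free; for an algebraic \<open>a\<close>, \<open>t\<close> will be a root of the specialised
  minimal polynomial.\<close>

lemma hom_on_extend:
  fixes \<phi> :: "'a::comm_ring_1 \<Rightarrow> 'b::comm_ring_1"
  assumes \<phi>: "hom_on (gen G) \<phi>"
    and rel: "\<And>Y. Y \<in> polyover (gen G) \<Longrightarrow> poly Y a = 0 \<Longrightarrow> poly (map_poly \<phi> Y) t = 0"
  obtains \<psi> where "hom_on (gen (insert a G)) \<psi>"
    "\<And>Y. Y \<in> polyover (gen G) \<Longrightarrow> \<psi> (poly Y a) = poly (map_poly \<phi> Y) t"
    "\<And>x. x \<in> gen G \<Longrightarrow> \<psi> x = \<phi> x"
proof -
  let ?A = "gen G"
  note A = subring_gen[of G]
  define \<psi> where "\<psi> y = poly (map_poly \<phi> (SOME Y. Y \<in> polyover ?A \<and> poly Y a = y)) t" for y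
  have \<psi>: "\<psi> (poly Y a) = poly (map_poly \<phi> Y) t" if Y: "Y \<in> polyover ?A" for Y
  proof -
    define Z where "Z = (SOME Z. Z \<in> polyover ?A \<and> poly Z a = poly Y a)"
    have "\<exists>Z. Z \<in> polyover ?A \<and> poly Z a = poly Y a" using Y by blast
    then have Z: "Z \<in> polyover ?A" "poly Z a = poly Y a"
      unfolding Z_def by (metis (mono_tags, lifting) someI_ex)+
    then have "poly (map_poly \<phi> (Z - Y)) t = 0"
      using Y by (intro rel polyover_diff[OF A]) auto
    then show ?thesis
      unfolding \<psi>_def Z_def[symmetric] by (simp add: map_poly_hom_on_diff[OF A \<phi>] Z Y)
  qed
  have const: "\<psi> x = \<phi> x" if "x \<in> ?A" for x
    using \<psi>[of "[:x:]"] that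
    by (simp add: polyover_pCons[OF A] polyover_zero[OF A] map_poly_pCons hom_on_zero[OF A \<phi>])
  have "hom_on (gen (insert a G)) \<psi>"
    unfolding hom_on_def gen_insert
  proof (intro conjI ballI)
    show "\<psi> 1 = 1" using const sr_one[OF A] hom_on_one[OF A \<phi>] by simp
  next
    fix x y assume "x \<in> (\<lambda>Y. poly Y a) ` polyover ?A" "y \<in> (\<lambda>Y. poly Y a) ` polyover ?A"
    then obtain Y Z where *: "x = poly Y a" "Y \<in> polyover ?A" "y = poly Z a" "Z \<in> polyover ?A"
      by auto
    then show "\<psi> (x + y) = \<psi> x + \<psi> y"
      using \<psi>[of "Y + Z"] by (simp add: \<psi> polyover_add[OF A] map_poly_hom_on_add[OF A \<phi>])
    show "\<psi> (x * y) = \<psi> x * \<psi> y"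
      using * \<psi>[of "Y * Z"] by (simp add: \<psi> polyover_mult[OF A] map_poly_hom_on_mult[OF A \<phi>])
  qed
  with \<psi> const that show ?thesis by blast
qed


text \<open>The image of the localisation of the integers at \<open>p\<close>.\<close>

definition ZP :: "nat \<Rightarrow> 'a::field_char_0 set" where
  "ZP p = {of_int a / of_int b |a b. \<not> int p dvd b}"

lemma ZP_I: "\<not> int p dvd b \<Longrightarrow> of_int a / of_int b \<in> ZP p"
  unfolding ZP_def by blast

lemma not_dvd_nonzero: "\<not> int p dvd b \<Longrightarrow> b \<noteq> 0" by auto

lemma subring_ZP: assumes "prime p" shows "subring_set (ZP p :: 'a::field_char_0 set)"
  unfolding subring_set_def
proof (intro conjI ballI)
  have "\<not> int p dvd 1" using prime_gt_1_nat[OF assms] by (simp add: zdvd1_eq)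
  then show "1 \<in> (ZP p :: 'a set)" using ZP_I[of p 1 1] by simp
next
  fix x y :: 'a assume "x \<in> ZP p" "y \<in> ZP p"
  then obtain a b c d where *: "x = of_int a / of_int b" "\<not> int p dvd b" "y = of_int c / of_int d"
    "\<not> int p dvd d" by (auto simp: ZP_def)
  have bd: "\<not> int p dvd b * d" using * assms by (simp add: prime_dvd_mult_iff)
  have "x + y = of_int (a * d + c * b) / of_int (b * d)"
    using * by (auto simp: field_simps dest!: not_dvd_nonzero)
  then show "x + y \<in> ZP p" using bd by (simp only: ZP_I not_False_eq_True)
  have "x * y = of_int (a * c) / of_int (b * d)" using * by simp
  then show "x * y \<in> ZP p" using bd by (simp only: ZP_I not_False_eq_True)
next
  fix x :: 'a assume "x \<in> ZP p"
  then obtain a b where *: "x = of_int a / of_int b" "\<not> int p dvd b" by (auto simp: ZP_def)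
  then have "- x = of_int (- a) / of_int b" by simp
  then show "- x \<in> ZP p" using * by (simp only: ZP_I not_False_eq_True)
qed

lemma ZP_Krull:
  fixes x :: "'a::field_char_0"
  assumes p: "prime p" and x: "\<And>j. \<exists>q\<in>ZP p. x = of_nat p ^ j * q"
  shows "x = 0"
proof -
  obtain a b where ab: "x = of_int a / of_int b" "\<not> int p dvd b" using x[of 0] by (auto simp: ZP_def)
  have "int p ^ j dvd a" for j
  proof -
    obtain c d where cd: "x = of_nat p ^ j * (of_int c / of_int d)" "\<not> int p dvd d"
      using x[of j] by (auto simp: ZP_def)
    have "of_int (a * d) = (of_int (int p ^ j * c * b) :: 'a)"
      using ab cd by (auto simp: field_simps dest!: not_dvd_nonzero)
    then have "int p ^ j dvd a * d" by (simp only: of_int_eq_iff) simp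
    moreover have "coprime (int p ^ j) d"
      using p cd by (simp add: prime_imp_coprime)
    ultimately show ?thesis by (simp add: coprime_dvd_mult_left_iff)
  qed
  then have "a = 0"
  proof (rule_tac ccontr)
    assume "a \<noteq> 0" and *: "\<And>j. int p ^ j dvd a"
    have "int (nat \<bar>a\<bar>) < int (2 ^ nat \<bar>a\<bar>)" using less_exp[of "nat \<bar>a\<bar>"] by linarith
    also have "\<dots> \<le> int p ^ nat \<bar>a\<bar>"
      using prime_ge_2_nat[OF p] by (simp add: power_mono)
    also have "\<dots> \<le> \<bar>a\<bar>" using dvd_imp_le_int[OF \<open>a \<noteq> 0\<close> *[of "nat \<bar>a\<bar>"]] by simp
    finally show False by simp
  qed
  with ab show ?thesis by simp
qed

section \<open>Finitely generated modules over the localisation at \<open>p\<close>\<close>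

primrec zspan :: "nat \<Rightarrow> 'a::field_char_0 list \<Rightarrow> 'a set" where
  "zspan p [] = {0}"
| "zspan p (e # es) = {q * e + s |q s. q \<in> ZP p \<and> s \<in> zspan p es}"

lemma zspan_ConsI: "q \<in> ZP p \<Longrightarrow> s \<in> zspan p es \<Longrightarrow> q * e + s \<in> zspan p (e # es)"
  by auto

context
  fixes p :: nat
  assumes p: "prime p"
begin

lemma zspan_zero: "0 \<in> (zspan p es :: 'a::field_char_0 set)"
proof (induction es)
  case (Cons e es)
  have "0 \<in> (ZP p :: 'a set)" by (intro sr_zero subring_ZP p)
  from zspan_ConsI[OF this Cons, of e] show ?case by simp
qed auto

lemma zspan_add: "x \<in> zspan p es \<Longrightarrow> y \<in> zspan p es \<Longrightarrow> x + y \<in> (zspan p es :: 'a::field_char_0 set)"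
proof (induction es arbitrary: x y)
  case (Cons e es)
  then obtain q s q' s' where *: "x = q * e + s" "y = q' * e + s'" "q \<in> ZP p" "q' \<in> ZP p"
    "s \<in> zspan p es" "s' \<in> zspan p es" by auto
  then have "x + y = (q + q') * e + (s + s')" by (simp add: algebra_simps)
  then show ?case by (simp only:) (intro zspan_ConsI * Cons.IH sr_add[OF subring_ZP[OF p]])
qed auto

lemma zspan_scale: "q \<in> ZP p \<Longrightarrow> y \<in> zspan p es \<Longrightarrow> q * y \<in> (zspan p es :: 'a::field_char_0 set)"
proof (induction es arbitrary: y)
  case (Cons e es)
  then obtain q' s' where *: "y = q' * e + s'" "q' \<in> ZP p" "s' \<in> zspan p es" by auto
  then have "q * y = (q * q') * e + q * s'" by (simp add: algebra_simps)
  then show ?case by (simp only:) (intro zspan_ConsI * Cons sr_mult[OF subring_ZP[OF p]])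
qed auto

lemma zspan_diff:
  assumes "x \<in> zspan p es" "y \<in> zspan p es" shows "x - y \<in> (zspan p es :: 'a::field_char_0 set)"
proof -
  have "- 1 \<in> (ZP p :: 'a set)" by (intro sr_uminus sr_one subring_ZP p)
  from zspan_add[OF assms(1) zspan_scale[OF this assms(2)]] show ?thesis by simp
qed

lemma zspan_append:
  "x \<in> zspan p es \<Longrightarrow> y \<in> zspan p fs \<Longrightarrow> x + y \<in> (zspan p (es @ fs) :: 'a::field_char_0 set)"
proof (induction es arbitrary: x)
  case (Cons e es)
  then obtain q s where *: "x = q * e + s" "q \<in> ZP p" "s \<in> zspan p es" by auto
  have "x + y = q * e + (s + y)" using * by simp
  then show ?case by (simp only: append.simps) (intro zspan_ConsI * Cons)
qed auto

lemma zspan_map_mult: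
  "x \<in> zspan p es \<Longrightarrow> x * c \<in> (zspan p (map (\<lambda>e. e * c) es) :: 'a::field_char_0 set)"
proof (induction es arbitrary: x)
  case (Cons e es)
  then obtain q s where *: "x = q * e + s" "q \<in> ZP p" "s \<in> zspan p es" by auto
  have "x * c = q * (e * c) + s * c" using * by (simp add: algebra_simps)
  then show ?case by (simp only: list.map) (intro zspan_ConsI * Cons)
qed auto

text \<open>Krull's intersection theorem, by induction on generators that may be dependent. If a
  nonzero multiple of \<open>e\<close> lies in the span of the others, multiplying \<open>y\<close>
  by that scalar removes \<open>e\<close>. Otherwise the coefficient of \<open>e\<close> in
  \<open>y\<close> is unique, hence divisible by all powers of \<open>p\<close>, hence 0.\<close>

lemma zspan_Krull:
  fixes y :: "'a::field_char_0"
  assumes "\<And>j. \<exists>z\<in>zspan p es. y = of_nat p ^ j * z"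
  shows "y = 0"
  using assms
proof (induction es arbitrary: y)
  case (Cons e es)
  have ZP: "subring_set (ZP p :: 'a set)" by (rule subring_ZP[OF p])
  show ?case
  proof (cases "\<exists>c\<in>ZP p. c \<noteq> 0 \<and> c * e \<in> zspan p es")
    case True
    then obtain c where c: "c \<in> ZP p" "c \<noteq> 0" "c * e \<in> zspan p es" by auto
    have "\<exists>z\<in>zspan p es. c * y = of_nat p ^ j * z" for j
    proof -
      obtain q s where *: "y = of_nat p ^ j * (q * e + s)" "q \<in> ZP p" "s \<in> zspan p es"
        using Cons.prems[of j] by auto
      then have "c * y = of_nat p ^ j * (q * (c * e) + c * s)" by (simp add: algebra_simps)
      moreover have "q * (c * e) + c * s \<in> zspan p es"
        by (intro zspan_add zspan_scale * c)
      ultimately show ?thesis by blast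
    qed
    then have "c * y = 0" by (rule Cons.IH)
    with c show ?thesis by simp
  next
    case False
    obtain q0 s0 where 0: "y = q0 * e + s0" "q0 \<in> ZP p" "s0 \<in> zspan p es"
      using Cons.prems[of 0] by auto
    have *: "\<exists>q\<in>ZP p. \<exists>s\<in>zspan p es. y = of_nat p ^ j * (q * e + s) \<and> q0 = of_nat p ^ j * q" for j
    proof -
      obtain q s where *: "y = of_nat p ^ j * (q * e + s)" "q \<in> ZP p" "s \<in> zspan p es"
        using Cons.prems[of j] by auto
      have pj: "of_nat p ^ j \<in> (ZP p :: 'a set)" by (intro sr_power sr_of_nat ZP)
      have "(q0 - of_nat p ^ j * q) * e = of_nat p ^ j * s - s0"
        using 0(1) *(1) by (simp add: algebra_simps)
      also have "\<dots> \<in> zspan p es" by (intro zspan_diff zspan_scale * 0 pj)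
      finally have "q0 - of_nat p ^ j * q = 0"
        using False sr_diff[OF ZP 0(2) sr_mult[OF ZP pj *(2)]] by blast
      with * show ?thesis by auto
    qed
    have "q0 = 0" using * by (intro ZP_Krull[OF p]) blast
    have "\<exists>z\<in>zspan p es. y = of_nat p ^ j * z" for j
      using *[of j] \<open>q0 = 0\<close> p by (auto simp: prime_gt_0_nat)
    then show ?thesis by (rule Cons.IH)
  qed
qed auto

text \<open>Denominators are invertible mod \<open>p\<close>, so every coefficient is congruent to
  one of \<open>p\<close> integers. The representatives may be congruent to each other; the count is
  an upper bound.\<close>

lemma zspan_reps:
  fixes es :: "'a::field_char_0 list"
  shows "\<exists>F. finite F \<and> card F \<le> p ^ length es \<and>
    (\<forall>y\<in>zspan p es. \<exists>r\<in>F. \<exists>z\<in>zspan p es. y = r + of_nat p * z)"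
proof (induction es)
  case Nil
  show ?case by (rule exI[of _ "{0}"]) auto
next
  case (Cons e es)
  have ZP: "subring_set (ZP p :: 'a set)" by (rule subring_ZP[OF p])
  from Cons obtain F where F: "finite F" "card F \<le> p ^ length es"
    "\<And>y. y \<in> zspan p es \<Longrightarrow> \<exists>r\<in>F. \<exists>z\<in>zspan p es. y = r + of_nat p * z" by blast
  define F' where "F' = (\<lambda>(n, r). of_nat n * e + r) ` ({..<p} \<times> F)"
  have "card F' \<le> card ({..<p} \<times> F)" unfolding F'_def using F by (intro card_image_le) auto
  also have "\<dots> \<le> p ^ length (e # es)" using F by (simp add: card_cartesian_product)
  finally have "card F' \<le> p ^ length (e # es)" .
  moreover have "\<exists>r\<in>F'. \<exists>z\<in>zspan p (e # es). y = r + of_nat p * z" if "y \<in> zspan p (e # es)" for y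
  proof -
    from that obtain q s where y: "y = q * e + s" "q \<in> ZP p" "s \<in> zspan p es" by auto
    then obtain a b where ab: "q = of_int a / of_int b" "\<not> int p dvd b" by (auto simp: ZP_def)
    have "coprime (int p) b" using p ab by (simp add: prime_imp_coprime)
    then obtain u v where uv: "u * int p + v * b = 1"
      using bezout_int[of "int p" b] by auto
    \<comment> \<open>\<open>v\<close> inverts \<open>b\<close> mod \<open>p\<close>, so
      \<open>n\<close> represents the fraction \<open>a / b\<close>.\<close>
    define n where "n = v * a"
    have "a = a * (u * int p + v * b)" using uv by simp
    also have "\<dots> = b * n + int p * (u * a)" by (simp add: n_def algebra_simps)
    also have "n = n mod int p + int p * (n div int p)" by simp
    finally have k: "a = b * (n mod int p) + int p * (b * (n div int p) + u * a)"
      by (simp only: distrib_left distrib_right ac_simps)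
    define k where "k = b * (n div int p) + u * a"
    note k = k[folded k_def]
    define m where "m = nat (n mod int p)"
    have m: "m < p" "int m = n mod int p"
      using prime_gt_0_nat[OF p] by (auto simp: m_def nat_less_iff)
    have q: "q = of_nat m + of_nat p * (of_int k / of_int b)"
    proof -
      have "(of_int b :: 'a) \<noteq> 0" using ab by (auto dest!: not_dvd_nonzero)
      moreover have "(of_int a :: 'a) = of_int b * of_nat m + of_nat p * of_int k"
        using arg_cong[OF k, of "of_int :: int \<Rightarrow> 'a"] m(2) by (metis of_int_add of_int_mult of_int_of_nat_eq)
      ultimately show ?thesis using ab by (simp add: field_simps)
    qed
    obtain r z where rz: "r \<in> F" "z \<in> zspan p es" "s = r + of_nat p * z" using F(3)[OF y(3)] by blast
    have "y = (of_nat m * e + r) + of_nat p * ((of_int k / of_int b) * e + z)"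
      using y q rz by (simp add: algebra_simps)
    moreover have "(of_int k / of_int b) * e + z \<in> zspan p (e # es)"
      by (intro zspan_ConsI rz ZP_I ab)
    moreover have "of_nat m * e + r \<in> F'" using m rz by (auto simp: F'_def)
    ultimately show ?thesis by blast
  qed
  moreover have "finite F'" using F by (auto simp: F'_def)
  ultimately show ?case by blast
qed

end

text \<open>The number \<open>D\<close> of generators is recorded because it bounds the number of
  residues mod \<open>p\<close> by \<open>p ^ D\<close>; the later periods are computed from this
  number and not from the ring.\<close>

definition good_ring :: "nat \<Rightarrow> nat \<Rightarrow> 'a::field_char_0 set \<Rightarrow> bool" where
  "good_ring p D R \<longleftrightarrow> prime p \<and> subring_set R \<and> ZP p \<subseteq> R \<and> (\<exists>es. length es = D \<and> R = zspan p es)"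

lemma good_ring_ZP: "prime p \<Longrightarrow> good_ring p 1 (ZP p)"
  unfolding good_ring_def
  by (intro conjI subring_ZP order_refl exI[of _ "[1]"]) auto

text \<open>Division by the monic \<open>W\<close> brings every polynomial below degree n =
  \<open>degree W\<close>, so the products of the generators of \<open>R\<close> with the powers of
  \<open>\<rho>\<close> below n generate the new ring.\<close>

lemma good_ring_adjoin:
  fixes \<rho> :: "'a::field_char_0"
  assumes R: "good_ring p D R" and W: "W \<in> polyover R" "lead_coeff W = 1" "poly W \<rho> = 0"
  shows "good_ring p (D * degree W) ((\<lambda>Y. poly Y \<rho>) ` polyover R)"
proof -
  let ?S = "(\<lambda>Y. poly Y \<rho>) ` polyover R"
  from R obtain es where p: "prime p" and Rs: "subring_set R" and ZP: "ZP p \<subseteq> R"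
    and es: "length es = D" "R = zspan p es"
    by (auto simp: good_ring_def)
  define fs where "fs n = concat (map (\<lambda>j. map (\<lambda>e. e * \<rho> ^ j) es) [0..<n])" for n
  have len: "length (fs n) = D * n" for n
    by (induction n) (auto simp: fs_def es)
  have low: "poly Y \<rho> \<in> zspan p (fs n)" if "Y \<in> polyover R" "degree Y < n" for Y n
  proof -
    have "(\<Sum>j<n. coeff Y j * \<rho> ^ j) \<in> zspan p (fs n)"
    proof (induction n)
      case (Suc n)
      have "coeff Y n * \<rho> ^ n \<in> zspan p (map (\<lambda>e. e * \<rho> ^ n) es)"
        using that es by (intro zspan_map_mult p) (auto simp: polyover_def)
      with Suc show ?case by (auto simp: fs_def intro!: zspan_append p)
    qed (auto simp: fs_def)
    moreover have "(\<Sum>j<n. coeff Y j * \<rho> ^ j) = poly Y \<rho>"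
      unfolding poly_altdef using that(2)
      by (intro sum.mono_neutral_right) (auto simp: coeff_eq_0)
    ultimately show ?thesis by simp
  qed
  have sub: "zspan p (map (\<lambda>e. e * c) es') \<subseteq> {x * c |x. x \<in> zspan p es'}" for c and es' :: "'a list"
  proof (induction es')
    case (Cons e es')
    show ?case
    proof
      fix x assume "x \<in> zspan p (map (\<lambda>e. e * c) (e # es'))"
      then obtain q s where *: "x = q * (e * c) + s" "q \<in> ZP p" "s \<in> zspan p (map (\<lambda>e. e * c) es')"
        by auto
      with Cons obtain s' where "s = s' * c" "s' \<in> zspan p es'" by auto
      then have "x = (q * e + s') * c" "q * e + s' \<in> zspan p (e # es')"
        using * by (simp add: algebra_simps) (intro zspan_ConsI * \<open>s' \<in> _\<close>)
      then show "x \<in> {x * c |x. x \<in> zspan p (e # es')}" by blast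
    qed
  qed auto
  have split: "\<exists>x\<in>zspan p xs. \<exists>y\<in>zspan p ys. z = x + y" if "z \<in> zspan p (xs @ ys)" for xs ys and z :: 'a
    using that
  proof (induction xs arbitrary: z)
    case (Cons e xs)
    then obtain q s where *: "z = q * e + s" "q \<in> ZP p" "s \<in> zspan p (xs @ ys)" by auto
    with Cons.IH obtain x y where "x \<in> zspan p xs" "y \<in> zspan p ys" "s = x + y" by blast
    then have "z = (q * e + x) + y" "q * e + x \<in> zspan p (e # xs)"
      using * by (simp add: algebra_simps) (intro zspan_ConsI * \<open>x \<in> _\<close>)
    with \<open>y \<in> _\<close> show ?case by blast
  qed auto
  have up: "zspan p (fs n) \<subseteq> ?S" for n
  proof (induction n)
    case 0
    show ?case using polyover_zero[OF Rs] by (auto simp: fs_def intro!: image_eqI[of _ _ 0])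
  next
    case (Suc n)
    show ?case
    proof
      fix z assume "z \<in> zspan p (fs (Suc n))"
      then have "z \<in> zspan p (fs n @ map (\<lambda>e. e * \<rho> ^ n) es)" by (simp add: fs_def)
      from split[OF this] obtain x y where xy: "z = x + y" "x \<in> zspan p (fs n)"
        "y \<in> zspan p (map (\<lambda>e. e * \<rho> ^ n) es)" by blast
      from sub[of "\<rho> ^ n" es] xy(3) es obtain r where r: "r \<in> R" "y = r * \<rho> ^ n" by auto
      from Suc xy(2) obtain Y where "x = poly Y \<rho>" "Y \<in> polyover R" by auto
      with xy r show "z \<in> ?S"
        by (intro image_eqI[of _ _ "Y + monom r n"]) (auto simp: poly_monom intro: polyover_intros[OF Rs])
    qed
  qed
  have "W \<noteq> 0" using W(2) by auto
  have "poly Y \<rho> \<in> zspan p (fs (degree W))" if Y: "Y \<in> polyover R" for Y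
  proof -
    obtain j Q S where *: "smult (lead_coeff W ^ j) Y = Q * W + S" "Q \<in> polyover R" "S \<in> polyover R"
      "S = 0 \<or> degree S < degree W"
      using pseudo_division[OF Rs W(1) \<open>W \<noteq> 0\<close> Y] by blast
    have "Y = Q * W + S" using * W by simp
    then have "poly Y \<rho> = poly S \<rho>" using W by simp
    moreover have "poly S \<rho> \<in> zspan p (fs (degree W))"
      using * low[of S "degree W"] zspan_zero[OF p] by (cases "S = 0") auto
    ultimately show ?thesis by simp
  qed
  with up[of "degree W"] have "?S = zspan p (fs (degree W))" by blast
  moreover have "subring_set ?S"
    unfolding subring_set_def
  proof (intro conjI ballI)
    show "1 \<in> ?S" using polyover_one[OF Rs] by (intro image_eqI[of _ _ 1]) auto
  next
    fix x y assume "x \<in> ?S" "y \<in> ?S"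
    then obtain Y Z where *: "x = poly Y \<rho>" "y = poly Z \<rho>" "Y \<in> polyover R" "Z \<in> polyover R" by auto
    show "x + y \<in> ?S" using * by (intro image_eqI[of _ _ "Y + Z"]) (auto intro: polyover_intros[OF Rs])
    show "x * y \<in> ?S" using * by (intro image_eqI[of _ _ "Y * Z"]) (auto intro: polyover_intros[OF Rs])
  next
    fix x assume "x \<in> ?S"
    then obtain Y where *: "x = poly Y \<rho>" "Y \<in> polyover R" by auto
    show "- x \<in> ?S" using * by (intro image_eqI[of _ _ "- Y"]) (auto intro: polyover_intros[OF Rs])
  qed
  moreover have "R \<subseteq> ?S"
    by (auto intro!: image_eqI[of _ _ "[:_:]"] polyover_intros[OF Rs])
  ultimately show ?thesis
    using p ZP len unfolding good_ring_def by blast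
qed

lemma poly_diff_dvd: "(x - y :: 'a::comm_ring_1) dvd poly f x - poly f y"
proof -
  have f: "[:- y, 1:] * synthetic_div f y + [:poly f y:] = f"
    by (rule synthetic_div_correct')
  have "poly f x = (x - y) * poly (synthetic_div f y) x + poly f y"
    by (subst f[symmetric]) (simp add: algebra_simps)
  then show ?thesis by simp
qed

text \<open>A polynomial over the field with \<open>p\<close> elements has no more roots than its
  degree. An arbitrary set \<open>S\<close> of residues allows the induction to discard the root
  that has been split off.\<close>

lemma int_poly_nonroot_mod_prime:
  fixes f :: "int poly"
  assumes p: "prime p" and "\<not> int p dvd lead_coeff f" "finite S" "S \<subseteq> {0..<int p}" "degree f < card S"
  shows "\<exists>t\<in>S. \<not> int p dvd poly f t"
  using assms(2-)
proof (induction "degree f" arbitrary: f S)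
  case 0
  then obtain c where "f = [:c:]" by (metis degree_eq_zeroE)
  moreover from 0 obtain t where "t \<in> S" by fastforce
  ultimately show ?case using 0 by auto
next
  case (Suc n)
  from Suc.prems obtain s where s: "s \<in> S" by fastforce
  show ?case
  proof (cases "int p dvd poly f s")
    case True
    define g where "g = synthetic_div f s"
    have f: "f = [:- s, 1:] * g + [:poly f s:]"
      unfolding g_def by (rule synthetic_div_correct'[symmetric])
    have dg: "degree g = n" unfolding g_def using Suc.hyps(2) by (simp add: degree_synthetic_div)
    have "lead_coeff f = coeff ([:- s, 1:] * g + [:poly f s:]) (Suc n)"
      using f Suc.hyps(2) by metis
    also have "\<dots> = - s * coeff g (Suc n) + coeff g n" by (simp add: mult_pCons_left)
    also have "\<dots> = lead_coeff g" using dg by (simp add: coeff_eq_0)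
    finally have lg: "lead_coeff f = lead_coeff g" .
    have "\<exists>t\<in>S - {s}. \<not> int p dvd poly g t"
      using Suc.prems s dg lg Suc.hyps(2) by (intro Suc.hyps(1)) auto
    then obtain t where t: "t \<in> S" "t \<noteq> s" "\<not> int p dvd poly g t" by auto
    have "\<not> int p dvd t - s"
    proof
      assume "int p dvd t - s"
      then have "int p \<le> \<bar>t - s\<bar>" using t dvd_imp_le_int[of "t - s" "int p"] by auto
      moreover have "t \<in> {0..<int p}" "s \<in> {0..<int p}" using t s Suc.prems by auto
      ultimately show False by auto
    qed
    then have "\<not> int p dvd (t - s) * poly g t" using t p by (simp add: prime_dvd_mult_iff)
    moreover have "poly f t = (t - s) * poly g t + poly f s"
      using arg_cong[OF f, of "\<lambda>q. poly q t"] by (simp add: algebra_simps)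
    ultimately have "\<not> int p dvd poly f t" using True by (metis dvd_add_left_iff)
    with t show ?thesis by blast
  qed (use s in blast)
qed

section \<open>Specialising transcendental and algebraic generators\<close>

inductive free_gens :: "'a::comm_ring_1 set \<Rightarrow> bool" where
  free_gens_empty: "free_gens {}"
| free_gens_insert: "free_gens G \<Longrightarrow> \<not> alg_over (gen G) a \<Longrightarrow> free_gens (insert a G)"

lemma degree_map_poly_hom:
  assumes "\<phi> (lead_coeff f) \<noteq> 0" "\<phi> 0 = 0"
  shows "degree (map_poly \<phi> f) = degree f" "lead_coeff (map_poly \<phi> f) = \<phi> (lead_coeff f)"
proof -
  show *: "degree (map_poly \<phi> f) = degree f"
    using assms by (intro antisym map_poly_degree_leq le_degree) (simp add: coeff_map_poly)
  show "lead_coeff (map_poly \<phi> f) = \<phi> (lead_coeff f)"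
    using assms by (simp only: *) (simp add: coeff_map_poly)
qed

text \<open>The bound \<open>B\<close> has to be independent of \<open>y\<close>, so the two
  conditions are met one after the other. First the image of \<open>a\<close> is fixed mod
  \<open>p\<close> away from the roots of the specialised \<open>H\<close>, which is possible
  because \<open>p\<close> exceeds \<open>degree H\<close>. Infinitely many integers remain in that
  residue class, and one of them is not a root of the specialised \<open>Y\<close>.\<close>

lemma free_gens_int_hom:
  assumes "free_gens G" "h \<in> gen G" "h \<noteq> (0 :: 'a::field_char_0)"
  shows "\<exists>B. \<forall>p>B. prime p \<longrightarrow> (\<forall>y\<in>gen G - {0}.
    \<exists>\<phi> :: 'a \<Rightarrow> int. hom_on (gen G) \<phi> \<and> \<not> int p dvd \<phi> h \<and> \<phi> y \<noteq> 0)"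
  using assms
proof (induction arbitrary: h)
  case free_gens_empty
  then obtain n where n: "h = of_int n" "n \<noteq> 0" by (auto simp: gen_empty)
  define \<phi> where "\<phi> x = (THE n. x = of_int n)" for x :: 'a
  have \<phi>: "\<phi> (of_int n) = n" for n by (auto simp: \<phi>_def)
  have "hom_on (range of_int) \<phi>"
    unfolding hom_on_def using \<phi>[of 1]
    by (auto simp: \<phi> simp flip: of_int_add of_int_mult)
  moreover have "\<not> int p dvd n" if "p > nat \<bar>n\<bar>" for p
    using dvd_imp_le_int[of n "int p"] n that by auto
  ultimately show ?case using n
    by (intro exI[of _ "nat \<bar>n\<bar>"] allI impI ballI exI[of _ \<phi>]) (auto simp: gen_empty \<phi>)
next
  case (free_gens_insert G a)
  note A = subring_gen[of G]
  have trans: "Y = 0" if "Y \<in> polyover (gen G)" "poly Y a = 0" for Y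
    using free_gens_insert that by (auto simp: alg_over_def)
  from free_gens_insert.prems obtain H where H: "H \<in> polyover (gen G)" "h = poly H a"
    by (auto simp: gen_insert)
  with free_gens_insert.prems have "H \<noteq> 0" by auto
  note H = H this
  then have "lead_coeff H \<in> gen G" "lead_coeff H \<noteq> 0" by (auto simp: polyover_def)
  from free_gens_insert.IH[OF this] obtain B where B: "\<And>p y. p > B \<Longrightarrow> prime p \<Longrightarrow> y \<in> gen G - {0} \<Longrightarrow>
    \<exists>\<phi> :: 'a \<Rightarrow> int. hom_on (gen G) \<phi> \<and> \<not> int p dvd \<phi> (lead_coeff H) \<and> \<phi> y \<noteq> 0" by blast
  show ?case
  proof (intro exI[of _ "max B (degree H)"] allI impI ballI)
    fix p y assume p: "p > max B (degree H)" "prime p" and y: "y \<in> gen (insert a G) - {0}"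
    then obtain Y where Y: "Y \<in> polyover (gen G)" "y = poly Y a" by (auto simp: gen_insert)
    with y have "Y \<noteq> 0" by auto
    note Y = Y this
    then have "lead_coeff Y \<in> gen G - {0}" by (auto simp: polyover_def)
    with B p obtain \<phi> :: "'a \<Rightarrow> int" where \<phi>: "hom_on (gen G) \<phi>" "\<not> int p dvd \<phi> (lead_coeff H)"
      "\<phi> (lead_coeff Y) \<noteq> 0" by (meson max_less_iff_conj)
    note \<phi>0 = hom_on_zero[OF A \<phi>(1)]
    have "\<phi> (lead_coeff H) \<noteq> 0" using \<phi>(2) by auto
    note dH = degree_map_poly_hom[OF this \<phi>0]
    obtain t0 where t0: "\<not> int p dvd poly (map_poly \<phi> H) t0"
      using int_poly_nonroot_mod_prime[OF p(2), of "map_poly \<phi> H" "{0..<int p}"] p(1) \<phi>(2) dH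
      by auto
    have "map_poly \<phi> Y \<noteq> 0"
      using degree_map_poly_hom[OF \<phi>(3) \<phi>0] \<phi>(3) by auto
    then have "finite {t. poly (map_poly \<phi> Y) t = 0}" by (rule poly_roots_finite)
    moreover have "infinite (range (\<lambda>l. t0 + int p * int l))"
      using prime_gt_0_nat[OF p(2)] by (intro range_inj_infinite) (auto simp: inj_def)
    ultimately have "\<not> range (\<lambda>l. t0 + int p * int l) \<subseteq> {t. poly (map_poly \<phi> Y) t = 0}"
      using finite_subset by blast
    then obtain l where l: "poly (map_poly \<phi> Y) (t0 + int p * int l) \<noteq> 0" by auto
    define t where "t = t0 + int p * int l"
    obtain \<psi> where \<psi>: "hom_on (gen (insert a G)) \<psi>"
      "\<And>Z. Z \<in> polyover (gen G) \<Longrightarrow> \<psi> (poly Z a) = poly (map_poly \<phi> Z) t"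
      using hom_on_extend[OF \<phi>(1), of a t] trans by (metis map_poly_0 poly_0)
    have "int p dvd t - t0" by (simp add: t_def)
    then have "int p dvd poly (map_poly \<phi> H) t - poly (map_poly \<phi> H) t0"
      by (rule dvd_trans[OF _ poly_diff_dvd])
    with t0 have "\<not> int p dvd poly (map_poly \<phi> H) t" by (metis dvd_diff_right_iff)
    then have "\<not> int p dvd \<psi> h" using \<psi>(2)[OF H(1)] H(2) by simp
    moreover have "\<psi> y \<noteq> 0" using \<psi>(2)[OF Y(1)] Y(2) l by (simp add: t_def)
    ultimately show "\<exists>\<psi> :: 'a \<Rightarrow> int. hom_on (gen (insert a G)) \<psi> \<and> \<not> int p dvd \<psi> h \<and> \<psi> y \<noteq> 0"
      using \<psi>(1) by blast
  qed
qed

text \<open>The point is that \<open>p\<close> and \<open>D\<close> do not depend on \<open>y\<close>: this makes the periods found below uniform.\<close>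

definition has_specialisations :: "'a::field_char_0 set \<Rightarrow> bool" where
  "has_specialisations G \<longleftrightarrow> (\<forall>h\<in>gen G - {0}. \<forall>B. \<exists>p>B. prime p \<and> (\<exists>D. \<forall>y\<in>gen G - {0}. \<exists>\<phi> R.
     hom_on (gen G) \<phi> \<and> \<phi> ` gen G \<subseteq> R \<and> good_ring p D (R :: 'a set) \<and> \<phi> y \<noteq> 0 \<and> (\<exists>u\<in>R. \<phi> h * u = 1)))"

lemma free_gens_has_specialisations:
  fixes G :: "'a::field_char_0 set"
  assumes "free_gens G" shows "has_specialisations G"
  unfolding has_specialisations_def
proof (intro ballI allI)
  fix h :: 'a and B :: nat assume h: "h \<in> gen G - {0}"
  then obtain B' where B': "\<And>p y. p > B' \<Longrightarrow> prime p \<Longrightarrow> y \<in> gen G - {0} \<Longrightarrow>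
    \<exists>\<phi> :: 'a \<Rightarrow> int. hom_on (gen G) \<phi> \<and> \<not> int p dvd \<phi> h \<and> \<phi> y \<noteq> 0"
    using free_gens_int_hom[OF assms, of h] by blast
  obtain p where p: "prime p" "p > max B B'" using bigger_prime by blast
  show "\<exists>p>B. prime p \<and> (\<exists>D. \<forall>y\<in>gen G - {0}. \<exists>\<phi> R.
     hom_on (gen G) \<phi> \<and> \<phi> ` gen G \<subseteq> R \<and> good_ring p D (R :: 'a set) \<and> \<phi> y \<noteq> 0 \<and> (\<exists>u\<in>R. \<phi> h * u = 1))"
  proof (rule exI[of _ p], intro conjI, use p in simp, use p in simp, rule exI[of _ 1], rule ballI)
    fix y assume "y \<in> gen G - {0}"
    with B'[of p y] p obtain \<phi> :: "'a \<Rightarrow> int" where \<phi>: "hom_on (gen G) \<phi>" "\<not> int p dvd \<phi> h" "\<phi> y \<noteq> 0"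
      by auto
    show "\<exists>\<phi> R. hom_on (gen G) \<phi> \<and> \<phi> ` gen G \<subseteq> R \<and> good_ring p 1 (R :: 'a set) \<and> \<phi> y \<noteq> 0 \<and>
      (\<exists>u\<in>R. \<phi> h * u = 1)"
    proof (intro exI[of _ "\<lambda>x. of_int (\<phi> x)"] exI[of _ "ZP p"] conjI)
      show "hom_on (gen G) (\<lambda>x. of_int (\<phi> x) :: 'a)"
        using \<phi>(1) by (auto simp: hom_on_def)
      show "(\<lambda>x. of_int (\<phi> x)) ` gen G \<subseteq> (ZP p :: 'a set)"
        by (auto intro!: sr_of_int subring_ZP p)
      show "good_ring p 1 (ZP p)" by (rule good_ring_ZP[OF p(1)])
      show "\<exists>u\<in>ZP p. of_int (\<phi> h) * u = (1::'a)"
        using \<phi>(2) ZP_I[OF \<phi>(2), of 1] by (intro bexI[of _ "1 / of_int (\<phi> h)"]) auto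
    qed (use \<phi> in auto)
  qed
qed

text \<open>\<open>a\<close> goes to a root of the specialised minimal polynomial, found in the same
  field. Asking the base to make \<open>c * (h * h')\<close> a unit serves two ends: the specialised
  polynomial can be scaled to be monic, which keeps the target finite over the localisation, and
  \<open>h\<close> becomes a unit. The rank is multiplied by \<open>degree W\<close>, whatever
  \<open>y\<close> is.\<close>

lemma has_specialisations_alg:
  fixes G :: "'a::{field_char_0, alg_closed_field} set"
  assumes G: "has_specialisations G" and a: "alg_over (gen G) a"
  shows "has_specialisations (insert a G)"
  unfolding has_specialisations_def
proof (intro ballI allI)
  fix h :: 'a and B :: nat assume h: "h \<in> gen (insert a G) - {0}"
  let ?A = "gen G"
  note A = subring_gen[of G]
  have sub: "?A \<subseteq> gen (insert a G)" by (rule gen_mono) auto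
  obtain W where W: "min_poly ?A a W" using min_poly_exists[OF a] .
  then have W': "W \<in> polyover ?A" "W \<noteq> 0" "poly W a = 0" by (auto simp: min_poly_def)
  define c where "c = lead_coeff W"
  have c: "c \<in> ?A" "c \<noteq> 0" using W' by (auto simp: c_def polyover_def)
  obtain h' where h': "h' \<in> gen (insert a G)" "h * h' \<in> ?A" "h * h' \<noteq> 0"
    using algebraic_multiple_in_base[OF a] h by blast
  have "c * (h * h') \<in> ?A - {0}" using c h' by (auto intro: sr_mult[OF A])
  then obtain p D where p: "p > B" "prime p" and D: "\<And>y. y \<in> ?A - {0} \<Longrightarrow> \<exists>\<phi> R.
     hom_on ?A \<phi> \<and> \<phi> ` ?A \<subseteq> R \<and> good_ring p D (R :: 'a set) \<and> \<phi> y \<noteq> 0 \<and>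
     (\<exists>u\<in>R. \<phi> (c * (h * h')) * u = 1)"
    using G unfolding has_specialisations_def by meson
  show "\<exists>p>B. prime p \<and> (\<exists>D. \<forall>y\<in>gen (insert a G) - {0}. \<exists>\<phi> R.
     hom_on (gen (insert a G)) \<phi> \<and> \<phi> ` gen (insert a G) \<subseteq> R \<and> good_ring p D (R :: 'a set) \<and> \<phi> y \<noteq> 0 \<and>
     (\<exists>u\<in>R. \<phi> h * u = 1))"
  proof (rule exI[of _ p], intro conjI p, rule exI[of _ "D * degree W"], rule ballI)
    fix y assume "y \<in> gen (insert a G) - {0}"
    then obtain y' where y': "y' \<in> gen (insert a G)" "y \<in> gen (insert a G)" "y * y' \<in> ?A" "y * y' \<noteq> 0"
      using algebraic_multiple_in_base[OF a] by blast
    then have "y * y' \<in> ?A - {0}" by simp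
    from D[OF this] obtain \<phi> R where *: "hom_on ?A \<phi> \<and> \<phi> ` ?A \<subseteq> R \<and> good_ring p D (R :: 'a set) \<and>
      \<phi> (y * y') \<noteq> 0 \<and> (\<exists>u\<in>R. \<phi> (c * (h * h')) * u = 1)"
      by (elim exE) (rule that, assumption)
    then obtain u where \<phi>: "hom_on ?A \<phi>" "\<phi> ` ?A \<subseteq> R" and R: "good_ring p D R"
      and \<phi>y: "\<phi> (y * y') \<noteq> 0" and u: "u \<in> R" "\<phi> (c * (h * h')) * u = 1"
      by blast
    have Rs: "subring_set R" using R by (auto simp: good_ring_def)
    note \<phi>0 = hom_on_zero[OF A \<phi>(1)]
    have ch: "\<phi> c * \<phi> (h * h') * u = 1"
      using u hom_on_mult[OF A \<phi>(1) c(1) h'(2)] by simp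
    then have "\<phi> c \<noteq> 0" by auto
    note dW = degree_map_poly_hom[of \<phi> W, OF this[unfolded c_def] \<phi>0]
    define v where "v = \<phi> (h * h') * u"
    have v: "v \<in> R" "\<phi> c * v = 1"
      using ch u \<phi>(2) h' by (auto simp: v_def mult.assoc intro!: sr_mult[OF Rs])
    have mapR: "map_poly \<phi> Y \<in> polyover R" if "Y \<in> polyover ?A" for Y
      using that \<phi>(2) by (auto simp: polyover_def coeff_map_poly \<phi>0)
    have "degree (map_poly \<phi> W) > 0" using dW min_poly_degree_pos[OF W] by simp
    then obtain \<rho> where \<rho>: "poly (map_poly \<phi> W) \<rho> = 0" using alg_closed_imp_poly_has_root by blast
    have rel: "poly (map_poly \<phi> Y) \<rho> = 0" if Y: "Y \<in> polyover ?A" "poly Y a = 0" for Y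
    proof -
      \<comment> \<open>\<open>W\<close> divides \<open>Y\<close> up to a power of \<open>c\<close>
        only, but \<open>\<phi> c\<close> is nonzero and can be cancelled.\<close>
      obtain j Q where jQ: "smult (c ^ j) Y = Q * W" "Q \<in> polyover ?A"
        using min_poly_dvd[OF A W Y] unfolding c_def by blast
      have "smult (\<phi> (c ^ j)) (map_poly \<phi> Y) = map_poly \<phi> Q * map_poly \<phi> W"
        using arg_cong[OF jQ(1), of "map_poly \<phi>"] map_poly_hom_on_smult[OF A \<phi>(1) sr_power[OF A c(1)] Y(1)]
          map_poly_hom_on_mult[OF A \<phi>(1) jQ(2) W'(1)] by simp
      from arg_cong[OF this, of "\<lambda>q. poly q \<rho>"] \<rho> show ?thesis
        using \<open>\<phi> c \<noteq> 0\<close> by (simp add: hom_on_power[OF A \<phi>(1) c(1)])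
    qed
    from hom_on_extend[OF \<phi>(1) rel] obtain \<psi> where \<psi>: "hom_on (gen (insert a G)) \<psi>"
      "\<And>Y. Y \<in> polyover ?A \<Longrightarrow> \<psi> (poly Y a) = poly (map_poly \<phi> Y) \<rho>" "\<And>x. x \<in> ?A \<Longrightarrow> \<psi> x = \<phi> x"
      by blast
    define V where "V = smult v (map_poly \<phi> W)"
    have "v \<noteq> 0" using v by auto
    have V: "V \<in> polyover R" "lead_coeff V = 1" "poly V \<rho> = 0" "degree V = degree W"
      using v \<rho> dW W' \<open>v \<noteq> 0\<close>
      by (auto simp: V_def c_def[symmetric] mult.commute intro!: polyover_smult[OF Rs] mapR)
    define S where "S = (\<lambda>Y. poly Y \<rho>) ` polyover R"
    have S: "good_ring p (D * degree W) S"
      using good_ring_adjoin[OF R V(1-3)] V(4) by (simp add: S_def)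
    have img: "\<psi> ` gen (insert a G) \<subseteq> S"
      using \<psi>(2) mapR by (auto simp: gen_insert S_def)
    have \<psi>h: "\<psi> h * \<psi> h' = \<phi> (h * h')" "\<psi> y * \<psi> y' = \<phi> (y * y')"
      using \<psi>(3) h' y' h hom_on_mult[OF subring_gen \<psi>(1)] by (metis DiffD1)+
    have Ss: "subring_set S" using S by (auto simp: good_ring_def)
    have RS: "R \<subseteq> S"
      by (auto simp: S_def intro!: image_eqI[of _ _ "[:_:]"] polyover_intros[OF Rs])
    have "\<psi> h * (\<psi> h' * (\<phi> c * u)) = 1" using ch \<psi>h by (simp add: algebra_simps)
    moreover have "\<psi> h' * (\<phi> c * u) \<in> S"
      using img h' RS u \<phi>(2) c by (intro sr_mult[OF Ss]) auto
    ultimately have "\<exists>w\<in>S. \<psi> h * w = 1" by blast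
    moreover have "\<psi> y \<noteq> 0" using \<psi>h \<phi>y by auto
    ultimately show "\<exists>\<phi> R. hom_on (gen (insert a G)) \<phi> \<and> \<phi> ` gen (insert a G) \<subseteq> R \<and>
      good_ring p (D * degree W) (R :: 'a set) \<and> \<phi> y \<noteq> 0 \<and> (\<exists>u\<in>R. \<phi> h * u = 1)"
      by (intro exI[of _ \<psi>] exI[of _ S] conjI \<psi>(1) img S)
  qed
qed

text \<open>A largest algebraically independent subset of \<open>G\<close> acts as a transcendence
  basis; the remaining generators are algebraic over it and are adjoined one at a time.\<close>

theorem finite_has_specialisations:
  fixes G :: "'a::{field_char_0, alg_closed_field} set"
  assumes "finite G" shows "has_specialisations G"
proof -
  obtain G1 where G1: "G1 \<subseteq> G" "free_gens G1"
    and max: "\<And>G2. G2 \<subseteq> G \<Longrightarrow> free_gens G2 \<Longrightarrow> card G2 \<le> card G1"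
  proof -
    have "\<exists>G1. (G1 \<subseteq> G \<and> free_gens G1) \<and> (\<forall>G2. G2 \<subseteq> G \<and> free_gens G2 \<longrightarrow> card G2 \<le> card G1)"
      using assms free_gens_empty
      by (intro ex_has_greatest_nat[where b = "Suc (card G)" and k = "{}"]) (auto simp: less_Suc_eq_le intro: card_mono)
    with that show ?thesis by blast
  qed
  have "has_specialisations (G1 \<union> F)" if "finite F" "F \<subseteq> G - G1" for F
    using that
  proof (induction F rule: finite_induct)
    case empty
    then show ?case using free_gens_has_specialisations[OF G1(2)] by simp
  next
    case (insert a F)
    have "alg_over (gen G1) a"
    proof (rule ccontr)
      assume "\<not> alg_over (gen G1) a"
      then have "free_gens (insert a G1)" using G1(2) by (intro free_gens_insert)
      then have "card (insert a G1) \<le> card G1" using insert G1 by (intro max) auto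
      moreover have "a \<notin> G1" "finite G1" using insert G1 assms finite_subset by auto
      ultimately show False by simp
    qed
    then have "alg_over (gen (G1 \<union> F)) a" by (rule alg_over_mono[OF gen_mono, rotated]) auto
    with insert show ?case by (auto intro: has_specialisations_alg)
  qed
  from this[of "G - G1"] assms G1(1) show ?thesis by (simp add: Un_absorb1)
qed


section \<open>Divisibility in finitely generated domains\<close>

text \<open>In the localisation at \<open>h\<close>, the multiplicity of \<open>y\<close> in an
  element is at most linear in the size of the element. The factor \<open>h ^ i\<close> serves the
  induction on generators: passing to a smaller ring introduces powers of leading
  coefficients.\<close>

definition bounded_mult :: "'a::comm_ring_1 set \<Rightarrow> 'a \<Rightarrow> 'a \<Rightarrow> bool" where
  "bounded_mult G h y \<longleftrightarrow> (\<exists>C. \<forall>s k i f z. f \<noteq> 0 \<longrightarrow> sz G s (2 ^ s) f \<longrightarrow> z \<in> gen G \<longrightarrow>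
     y ^ k * z = h ^ i * f \<longrightarrow> k \<le> C * (s + 1))"

lemma bounded_multI:
  "(\<And>s k i f z. f \<noteq> 0 \<Longrightarrow> sz G s (2 ^ s) f \<Longrightarrow> z \<in> gen G \<Longrightarrow> y ^ k * z = h ^ i * f \<Longrightarrow> k \<le> C * (s + 1))
    \<Longrightarrow> bounded_mult G h y"
  unfolding bounded_mult_def by blast

text \<open>A single \<open>H\<close> serves all \<open>y\<close>: inverting this one element turns
  every \<open>y\<close> without a multiplicity bound into a unit, and the ring stays finitely
  generated.\<close>

definition unit_or_bounded :: "'a::comm_ring_1 set \<Rightarrow> bool" where
  "unit_or_bounded G \<longleftrightarrow> (\<forall>h\<in>gen G - {0}. \<exists>H\<in>gen G - {0}. \<forall>y\<in>gen G - {0}.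
     (\<exists>i. \<exists>z\<in>gen G. y * z = H ^ i) \<or> bounded_mult G h y)"

lemma int_dvd_power_or_prime:
  fixes n h :: int
  assumes "n \<noteq> 0"
  shows "(\<exists>i. n dvd h ^ i) \<or> (\<exists>p. prime p \<and> p dvd n \<and> \<not> p dvd h)"
  using assms
proof (induction "nat \<bar>n\<bar>" arbitrary: n rule: less_induct)
  case less
  show ?case
  proof (cases "is_unit n")
    case True
    then have "n dvd h ^ 0" by simp
    then show ?thesis by blast
  next
    case False
    then obtain p where p: "prime p" "p dvd n" using less.prems prime_divisor_exists by blast
    then obtain m where m: "n = p * m" by auto
    with less.prems have "m \<noteq> 0" by auto
    have "nat \<bar>m\<bar> < nat \<bar>n\<bar>"
      using prime_gt_1_int[OF p(1)] \<open>m \<noteq> 0\<close> m by (simp add: abs_mult)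
    from less.hyps[OF this \<open>m \<noteq> 0\<close>] show ?thesis
    proof
      assume "\<exists>i. m dvd h ^ i"
      then obtain i where i: "m dvd h ^ i" by auto
      show ?thesis
      proof (cases "p dvd h")
        case True
        with i have "n dvd h ^ Suc i" unfolding m power_Suc by (rule mult_dvd_mono[rotated])
        then show ?thesis by blast
      qed (use p in blast)
    qed (use m in auto)
  qed
qed

text \<open>Over the integers \<open>H = h\<close> works. A prime that divides \<open>y\<close> but
  not \<open>h\<close> occurs at most \<open>s\<close> times in a nonzero integer of absolute value
  at most \<open>2 ^ s\<close>.\<close>

lemma unit_or_bounded_empty: "unit_or_bounded ({} :: 'a::field_char_0 set)"
  unfolding unit_or_bounded_def
proof
  fix h :: 'a assume h: "h \<in> gen {} - {0}"
  then obtain h' where h': "h = of_int h'" by (auto simp: gen_empty)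
  show "\<exists>H\<in>gen {} - {0}. \<forall>y\<in>gen {} - {0}. (\<exists>i. \<exists>z\<in>gen {}. y * z = H ^ i) \<or> bounded_mult {} h y"
  proof (rule bexI[OF _ h], rule ballI)
    fix y :: 'a assume "y \<in> gen {} - {0}"
    then obtain n where n: "y = of_int n" "n \<noteq> 0" by (auto simp: gen_empty)
    from int_dvd_power_or_prime[OF n(2), of h']
    show "(\<exists>i. \<exists>z\<in>gen {}. y * z = h ^ i) \<or> bounded_mult {} h y"
    proof
      assume "\<exists>i. n dvd h' ^ i"
      then obtain i m where "h' ^ i = n * m" by auto
      then have "y * of_int m = h ^ i" by (simp add: n h' flip: of_int_mult of_int_power)
      then show ?thesis by (auto simp: gen_empty)
    next
      assume "\<exists>p. prime p \<and> p dvd n \<and> \<not> p dvd h'"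
      then obtain p where p: "prime p" "p dvd n" "\<not> p dvd h'" by auto
      have "bounded_mult {} h y"
      proof (rule bounded_multI[where C = 1])
        fix s k i and f z :: 'a
        assume f: "f \<noteq> 0" "sz {} s (2 ^ s) f" and z: "z \<in> gen {}" and eq: "y ^ k * z = h ^ i * f"
        obtain f' where f': "f = of_int f'" "\<bar>f'\<bar> \<le> int (2 ^ s)" using sz_empty[OF f(2)] by auto
        obtain z' where "z = of_int z'" using z by (auto simp: gen_empty)
        with eq have "(of_int (n ^ k * z') :: 'a) = of_int (h' ^ i * f')"
          by (simp add: n h' f')
        then have eqi: "n ^ k * z' = h' ^ i * f'" by (simp only: of_int_eq_iff)
        have "p ^ k dvd n ^ k * z'" using p by (intro dvd_mult2 dvd_power_same)
        then have "p ^ k dvd h' ^ i * f'" by (simp only: eqi)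
        moreover have "coprime (p ^ k) (h' ^ i)" using p by (simp add: prime_imp_coprime)
        ultimately have "p ^ k dvd f'" by (simp add: coprime_dvd_mult_right_iff)
        moreover have "f' \<noteq> 0" using f f' by auto
        ultimately have "\<bar>p ^ k\<bar> \<le> \<bar>f'\<bar>" by (intro dvd_imp_le_int)
        then have "p ^ k \<le> \<bar>f'\<bar>" by linarith
        moreover have "2 ^ k \<le> p ^ k" using prime_ge_2_int[OF p(1)] by (intro power_mono) auto
        ultimately have "(2::int) ^ k \<le> 2 ^ s" using f'(2) by (simp only: of_nat_power of_nat_numeral)
        then show "k \<le> 1 * (s + 1)" by simp
      qed
      then show ?thesis ..
    qed
  qed
qed

text \<open>Each linear factor of \<open>Y\<close> is matched with one factor \<open>H\<close>, so
  \<open>degree Y\<close> factors suffice whatever the multiplicities are.\<close>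

lemma dvd_power_of_roots:
  fixes Y H :: "'a::alg_closed_field poly"
  assumes "Y \<noteq> 0" "\<And>x. poly Y x = 0 \<Longrightarrow> poly H x = 0"
  shows "Y dvd H ^ degree Y"
  using assms
proof (induction "degree Y" arbitrary: Y)
  case 0
  then have "Y dvd 1" by (simp add: is_unit_iff_degree)
  then show ?case using 0 by simp
next
  case (Suc n)
  then obtain x where x: "poly Y x = 0" using alg_closed_imp_poly_has_root[of Y] by auto
  then obtain Z where Z: "Y = [:- x, 1:] * Z" by (auto simp: poly_eq_0_iff_dvd)
  with Suc.prems have "Z \<noteq> 0" by auto
  have "degree Y = degree [:- x, 1:] + degree Z"
    unfolding Z using \<open>Z \<noteq> 0\<close> by (intro degree_mult_eq) auto
  then have "degree Z = n" using Suc.hyps(2) by simp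
  then have "Z dvd H ^ n" using Suc.hyps(1)[of Z] Suc.prems \<open>Z \<noteq> 0\<close> Z by auto
  moreover have "[:- x, 1:] dvd H" using Suc.prems x by (simp flip: poly_eq_0_iff_dvd)
  ultimately have "[:- x, 1:] * Z dvd H ^ Suc n" unfolding power_Suc by (intro mult_dvd_mono)
  then show ?case using Suc.hyps(2) Z by metis
qed

lemma order_power:
  fixes Y :: "'a::idom poly"
  assumes "Y \<noteq> 0" shows "order x (Y ^ k) = k * order x Y"
  using assms by (induction k) (auto simp: order_mult)

text \<open>Write \<open>y\<close> as a polynomial \<open>Y\<close> in \<open>a\<close>.  A root of \<open>Y\<close> that is not a root of \<open>h\<close> bounds \<open>k\<close> by a
  degree; if there is none, then \<open>Y\<close> divides a power of \<open>h\<close> up to its leading coefficient.\<close>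

lemma unit_or_bounded_transcendental:
  fixes G :: "'a::{field_char_0, alg_closed_field} set"
  assumes G: "unit_or_bounded G" and a: "\<not> alg_over (gen G) a"
  shows "unit_or_bounded (insert a G)"
  unfolding unit_or_bounded_def
proof
  fix h assume h: "h \<in> gen (insert a G) - {0}"
  let ?A = "gen G" and ?B = "gen (insert a G)"
  note A = subring_gen[of G] and B = subring_gen[of "insert a G"]
  have sub: "?A \<subseteq> ?B" by (rule gen_mono) auto
  have inj: "Y = Z" if "Y \<in> polyover ?A" "Z \<in> polyover ?A" "poly Y a = poly Z a" for Y Z
  proof -
    have "Y - Z \<in> polyover ?A" "poly (Y - Z) a = 0" using that by (auto intro: polyover_diff[OF A])
    with a have "Y - Z = 0" unfolding alg_over_def by blast
    then show ?thesis by simp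
  qed
  obtain Hh where Hh: "Hh \<in> polyover ?A" "h = poly Hh a" using h by (auto simp: gen_insert)
  then have "Hh \<noteq> 0" using h by auto
  then have "lead_coeff Hh \<in> ?A - {0}" using Hh by (auto simp: polyover_def)
  then obtain H0 where H0: "H0 \<in> ?A - {0}" "\<And>y. y \<in> ?A - {0} \<Longrightarrow>
     (\<exists>i. \<exists>z\<in>?A. y * z = H0 ^ i) \<or> bounded_mult G (lead_coeff Hh) y"
    using G unfolding unit_or_bounded_def by meson
  \<comment> \<open>In the witness \<open>H0 * h\<close>, the factor \<open>H0\<close> takes care of
    the leading coefficients and \<open>h\<close> of the roots.\<close>
  show "\<exists>H\<in>?B - {0}. \<forall>y\<in>?B - {0}. (\<exists>i. \<exists>z\<in>?B. y * z = H ^ i) \<or> bounded_mult (insert a G) h y"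
  proof (rule bexI[of _ "H0 * h"], rule ballI)
    fix y assume y: "y \<in> ?B - {0}"
    then obtain Y where Y: "Y \<in> polyover ?A" "y = poly Y a" by (auto simp: gen_insert)
    then have "Y \<noteq> 0" using y by auto
    have lift: "\<exists>F Z. f = poly F a \<and> F \<noteq> 0 \<and> degree F \<le> s \<and> (\<forall>i. sz G s (2 ^ s) (coeff F i)) \<and>
        Z \<in> polyover ?A \<and> Y ^ k * Z = Hh ^ i * F"
      if f: "f \<noteq> 0" "sz (insert a G) s (2 ^ s) f" and z: "z \<in> ?B" and eq: "y ^ k * z = h ^ i * f"
      for s k i f z
    proof -
      obtain F \<rho> where F: "poly F a = f" "degree F \<le> s" "\<forall>i. sz G s (coeff \<rho> i) (coeff F i)"
        "poly \<rho> (1::nat) \<le> 2 ^ s" by (rule sz_insertD[OF f(2)])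
      have "F \<noteq> 0" using F f by auto
      have "sz G s (2 ^ s) (coeff F i)" for i
        using F(3)[rule_format, of i] F(4) poly_nat_one_ge_coeff[of \<rho> i] by (auto elim: sz_mono)
      moreover from this have "F \<in> polyover ?A" by (auto simp: polyover_def intro: genI)
      moreover obtain Z where Z: "Z \<in> polyover ?A" "z = poly Z a" using z by (auto simp: gen_insert)
      moreover have "Y ^ k * Z = Hh ^ i * F"
        using \<open>F \<in> _\<close> Z Y Hh eq F(1)
        by (intro inj polyover_mult[OF A] polyover_power[OF A]) auto
      ultimately show ?thesis using F \<open>F \<noteq> 0\<close> by blast
    qed
    show "(\<exists>i. \<exists>z\<in>?B. y * z = (H0 * h) ^ i) \<or> bounded_mult (insert a G) h y"
    proof (cases "\<forall>x. poly Y x = 0 \<longrightarrow> poly Hh x = 0")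
      case False
      then obtain x where x: "poly Y x = 0" "poly Hh x \<noteq> 0" by auto
      have "bounded_mult (insert a G) h y"
      proof (rule bounded_multI[where C = 1])
        fix s k i f z
        assume "f \<noteq> 0" "sz (insert a G) s (2 ^ s) f" "z \<in> ?B" "y ^ k * z = h ^ i * f"
        from lift[OF this] obtain F Z where F: "F \<noteq> 0" "degree F \<le> s" "Y ^ k * Z = Hh ^ i * F"
          by blast
        have nz: "Y ^ k * Z \<noteq> 0" using F \<open>Hh \<noteq> 0\<close> by simp
        have "k \<le> k * order x Y" using x \<open>Y \<noteq> 0\<close> by (simp add: order_root)
        also have "\<dots> \<le> order x (Y ^ k * Z)"
          using nz \<open>Y \<noteq> 0\<close> by (simp add: order_mult order_power)
        also have "\<dots> = order x (Hh ^ i * F)" using F by simp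
        also have "\<dots> = order x F"
          using F nz \<open>Hh \<noteq> 0\<close> x by (simp add: order_mult order_power order_0I)
        also have "\<dots> \<le> s" using order_degree[OF F(1), of x] F(2) by simp
        finally show "k \<le> 1 * (s + 1)" by simp
      qed
      then show ?thesis ..
    next
      case True
      have "lead_coeff Y \<in> ?A - {0}" using Y \<open>Y \<noteq> 0\<close> by (auto simp: polyover_def)
      from H0(2)[OF this] show ?thesis
      proof
        assume "\<exists>i. \<exists>z\<in>?A. lead_coeff Y * z = H0 ^ i"
        then obtain i z where iz: "z \<in> ?A" "lead_coeff Y * z = H0 ^ i" by auto
        define m where "m = degree Y"
        obtain j Q S where jQS: "smult (lead_coeff Y ^ j) (Hh ^ m) = Q * Y + S" "Q \<in> polyover ?A"
          "S \<in> polyover ?A" "S = 0 \<or> degree S < degree Y"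
          using pseudo_division[OF A Y(1) \<open>Y \<noteq> 0\<close> polyover_power[OF A Hh(1)]] by blast
        \<comment> \<open>This divisibility holds over the field. Pseudo-division supplies the
          quotient over \<open>gen G\<close>, and the degree of its remainder shows that it is
          exact.\<close>
        have "Y dvd Hh ^ m" unfolding m_def using True \<open>Y \<noteq> 0\<close> by (intro dvd_power_of_roots) auto
        then have "Y dvd Q * Y + S" unfolding jQS(1)[symmetric] by (rule dvd_smult)
        then have "Y dvd S" by simp
        then have "S = 0" using jQS(4) dvd_imp_degree_le by force
        with jQS have Q: "smult (lead_coeff Y ^ j) (Hh ^ m) = Q * Y" by simp
        \<comment> \<open>Padding with \<open>H0 ^ m * h ^ (i * j)\<close> raises both factors to
          the common exponent \<open>N\<close>.\<close>
        define N where "N = i * j + m"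
        have "y * (poly Q a * z ^ j) = (z * lead_coeff Y) ^ j * h ^ m"
          using arg_cong[OF Q, of "\<lambda>q. poly q a"] Y Hh by (simp add: power_mult_distrib algebra_simps)
        also have "\<dots> = H0 ^ (i * j) * h ^ m" using iz by (simp add: mult.commute power_mult)
        finally have "y * (poly Q a * z ^ j * H0 ^ m * h ^ (i * j)) = (H0 * h) ^ N"
          by (simp add: N_def power_add power_mult_distrib algebra_simps)
        moreover have "poly Q a * z ^ j * H0 ^ m * h ^ (i * j) \<in> ?B"
          using jQS(2) iz sub H0 h by (intro sr_mult[OF B] sr_power[OF B]) (auto simp: gen_insert)
        ultimately show ?thesis by blast
      next
        assume "bounded_mult G (lead_coeff Hh) (lead_coeff Y)"
        then obtain C where C: "\<And>s k i f z. f \<noteq> 0 \<Longrightarrow> sz G s (2 ^ s) f \<Longrightarrow> z \<in> ?A \<Longrightarrow>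
          lead_coeff Y ^ k * z = lead_coeff Hh ^ i * f \<Longrightarrow> k \<le> C * (s + 1)"
          unfolding bounded_mult_def by blast
        have "bounded_mult (insert a G) h y"
        proof (rule bounded_multI)
          fix s k i f z
          assume "f \<noteq> 0" "sz (insert a G) s (2 ^ s) f" "z \<in> ?B" "y ^ k * z = h ^ i * f"
          from lift[OF this] obtain F Z where F: "F \<noteq> 0" "sz G s (2 ^ s) (lead_coeff F)"
            "Z \<in> polyover ?A" "Y ^ k * Z = Hh ^ i * F" by blast
          have "lead_coeff Y ^ k * lead_coeff Z = lead_coeff Hh ^ i * lead_coeff F"
            using arg_cong[OF F(4), of lead_coeff] by (simp only: lead_coeff_mult lead_coeff_power)
          with F show "k \<le> C * (s + 1)" by (intro C[of "lead_coeff F"]) (auto simp: polyover_def)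
        qed
        then show ?thesis ..
      qed
    qed
  qed (use H0 h sub in \<open>auto intro: sr_mult[OF B]\<close>)
qed

section \<open>Norms of algebraic extensions as determinants\<close>

lemma det_in_subring:
  assumes A: "subring_set A" and C: "C \<in> carrier_mat n n" "\<And>i j. i < n \<Longrightarrow> j < n \<Longrightarrow> C $$ (i, j) \<in> A"
  shows "det C \<in> A"
  unfolding det_def'[OF C(1)] using C(2)
  by (intro sr_sum[OF A] sr_mult[OF A] sr_prod[OF A]) (auto simp: permutes_in_image intro: sr_of_int[OF A])

lemma adj_mat_in_subring:
  assumes A: "subring_set A" and C: "C \<in> carrier_mat n n" "\<And>i j. i < n \<Longrightarrow> j < n \<Longrightarrow> C $$ (i, j) \<in> A"
    and ij: "i < n" "j < n"
  shows "adj_mat C $$ (i, j) \<in> A"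
proof -
  have "det (mat_delete C j i) \<in> A"
    using C ij by (intro det_in_subring[OF A, of _ "n - 1"]) (auto simp: mat_delete_def)
  then show ?thesis using C ij
    by (auto simp: adj_mat_def cofactor_def intro: sr_mult[OF A] sr_power[OF A] sr_uminus[OF A] sr_one[OF A])
qed

context
  fixes G :: "'a::field_char_0 set" and a :: 'a and W :: "'a poly"
  assumes W: "min_poly (gen G) a W"
begin

text \<open>\<open>B\<close> is the matrix of the multiplication by \<open>y\<close> in the basis \<open>1, a, a\<^sup>2, \<dots>\<close>, scaled by a power of
  the leading coefficient of \<open>W\<close> that clears the denominators.\<close>

definition rep :: "nat \<Rightarrow> 'a \<Rightarrow> 'a mat \<Rightarrow> bool" where
  "rep e y B \<longleftrightarrow> B \<in> carrier_mat (degree W) (degree W) \<and>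
     (\<forall>i<degree W. \<forall>j<degree W. B $$ (i, j) \<in> gen G) \<and>
     (\<forall>i<degree W. lead_coeff W ^ e * y * a ^ i = (\<Sum>j<degree W. B $$ (i, j) * a ^ j))"

lemma min_polyD: "W \<in> polyover (gen G)" "W \<noteq> 0" "poly W a = 0"
  and lead_coeff_min_poly: "lead_coeff W \<in> gen G" "lead_coeff W \<noteq> 0"
  using W by (auto simp: min_poly_def polyover_def)

text \<open>By minimality of \<open>W\<close>, the powers of \<open>a\<close> below
  \<open>degree W\<close> are linearly independent over \<open>gen G\<close>. This is what turns
  identities between elements into identities between matrices.\<close>

lemma rep_unique: assumes "rep e y B" "rep e y B'" shows "B = B'"
proof (rule eq_matI)
  note A = subring_gen[of G]
  fix i j assume "i < dim_row B'" "j < dim_col B'"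
  with assms have i: "i < degree W" and j: "j < degree W" by (auto simp: rep_def)
  define Y where "Y = (\<Sum>j<degree W. monom (B $$ (i, j) - B' $$ (i, j)) j)"
  have cf: "coeff Y l = (if l < degree W then B $$ (i, l) - B' $$ (i, l) else 0)" for l
    by (simp add: Y_def coeff_sum)
  have "Y \<in> polyover (gen G)"
    using assms i by (auto simp: polyover_def cf rep_def intro: sr_intros[OF A])
  moreover have "poly Y a = 0"
    using assms i by (simp add: Y_def poly_sum poly_monom left_diff_distrib sum_subtractf rep_def)
  moreover have "degree Y < degree W" if "Y \<noteq> 0"
    using that cf by (metis leading_coeff_0_iff)
  ultimately have "Y = 0" using W unfolding min_poly_def by fastforce
  with cf[of j] j show "B $$ (i, j) = B' $$ (i, j)" by simp
qed (use assms in \<open>auto simp: rep_def\<close>)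

lemma rep_mult: assumes "rep e y B" "rep e' y' B'" shows "rep (e + e') (y * y') (B * B')"
proof -
  note A = subring_gen[of G]
  let ?n = "degree W"
  have car: "B \<in> carrier_mat ?n ?n" "B' \<in> carrier_mat ?n ?n" using assms by (auto simp: rep_def)
  have ent: "(B * B') $$ (i, j) = (\<Sum>l<?n. B $$ (i, l) * B' $$ (l, j))" if "i < ?n" "j < ?n" for i j
    using car that by (simp add: scalar_prod_def atLeast0LessThan)
  have "(B * B') $$ (i, j) \<in> gen G" if "i < ?n" "j < ?n" for i j
    unfolding ent[OF that] using assms that by (auto simp: rep_def intro!: sr_intros[OF A])
  moreover have "lead_coeff W ^ (e + e') * (y * y') * a ^ i = (\<Sum>j<?n. (B * B') $$ (i, j) * a ^ j)"
    if i: "i < ?n" for i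
  proof -
    have eq1: "lead_coeff W ^ e * y * a ^ i = (\<Sum>l<?n. B $$ (i, l) * a ^ l)"
      using assms(1) i by (auto simp: rep_def)
    have eq2: "lead_coeff W ^ e' * y' * a ^ l = (\<Sum>j<?n. B' $$ (l, j) * a ^ j)" if "l < ?n" for l
      using assms(2) that by (auto simp: rep_def)
    have "lead_coeff W ^ (e + e') * (y * y') * a ^ i =
        (lead_coeff W ^ e * y * a ^ i) * (lead_coeff W ^ e' * y')"
      by (simp add: power_add algebra_simps)
    also have "\<dots> = (\<Sum>l<?n. B $$ (i, l) * (lead_coeff W ^ e' * y' * a ^ l))"
      unfolding eq1 sum_distrib_right by (intro sum.cong) auto
    also have "\<dots> = (\<Sum>l<?n. \<Sum>j<?n. B $$ (i, l) * B' $$ (l, j) * a ^ j)"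
      by (intro sum.cong refl, subst eq2) (auto simp: sum_distrib_left mult.assoc)
    also have "\<dots> = (\<Sum>j<?n. \<Sum>l<?n. B $$ (i, l) * B' $$ (l, j) * a ^ j)"
      by (rule sum.swap)
    also have "\<dots> = (\<Sum>j<?n. (B * B') $$ (i, j) * a ^ j)"
      by (intro sum.cong) (auto simp: ent[OF i] sum_distrib_right)
    finally show ?thesis .
  qed
  ultimately show ?thesis using car by (auto simp: rep_def)
qed

lemma rep_smult: assumes "rep e y B" "b \<in> gen G" shows "rep e (b * y) (b \<cdot>\<^sub>m B)"
proof -
  have car: "B \<in> carrier_mat (degree W) (degree W)" using assms by (auto simp: rep_def)
  have "lead_coeff W ^ e * (b * y) * a ^ i = (\<Sum>j<degree W. (b \<cdot>\<^sub>m B) $$ (i, j) * a ^ j)"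
    if "i < degree W" for i
  proof -
    have "lead_coeff W ^ e * (b * y) * a ^ i = b * (lead_coeff W ^ e * y * a ^ i)" by simp
    also have "\<dots> = (\<Sum>j<degree W. b * (B $$ (i, j) * a ^ j))"
      using assms that by (simp add: rep_def sum_distrib_left)
    also have "\<dots> = (\<Sum>j<degree W. (b \<cdot>\<^sub>m B) $$ (i, j) * a ^ j)"
      using car that by (intro sum.cong) auto
    finally show ?thesis .
  qed
  then show ?thesis
    using assms car by (auto simp: rep_def intro: sr_mult[OF subring_gen])
qed

lemma rep_shift: assumes "rep e y B" shows "rep (e + f) y (lead_coeff W ^ f \<cdot>\<^sub>m B)"
  using rep_smult[OF assms sr_power[OF subring_gen lead_coeff_min_poly(1), of f]]
  by (simp add: rep_def power_add algebra_simps)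

lemma rep_one: "rep 0 1 (1\<^sub>m (degree W))"
  by (auto simp: rep_def intro: sr_one[OF subring_gen] sr_zero[OF subring_gen]
      simp: if_distrib[of "\<lambda>x. x * _"] cong: if_cong)

lemma rep_power: "rep e y B \<Longrightarrow> rep (k * e) (y ^ k) (B ^\<^sub>m k)"
proof (induction k)
  case 0
  then have "dim_row B = degree W" by (auto simp: rep_def)
  with rep_one show ?case by simp
next
  case (Suc k)
  from rep_mult[OF Suc.IH[OF Suc.prems] Suc.prems] show ?case
    by (simp add: ac_simps)
qed

text \<open>The vector of powers of \<open>a\<close> is an eigenvector of \<open>B\<close> with
  eigenvalue \<open>lead_coeff W ^ e * y\<close>. Applying the adjugate and reading off row 0, where
  \<open>a ^ 0 = 1\<close>, exhibits \<open>det B\<close> as a multiple of \<open>y\<close>.\<close>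

lemma rep_det: assumes "rep e y B" shows "det B \<in> gen G" "\<exists>z\<in>gen (insert a G). y * z = det B"
proof -
  let ?n = "degree W"
  note A = subring_gen[of G] and A' = subring_gen[of "insert a G"]
  have sub: "gen G \<subseteq> gen (insert a G)" by (rule gen_mono) auto
  have B: "B \<in> carrier_mat ?n ?n" and BA: "\<And>i j. i < ?n \<Longrightarrow> j < ?n \<Longrightarrow> B $$ (i, j) \<in> gen G"
    and eq: "\<And>i. i < ?n \<Longrightarrow> lead_coeff W ^ e * y * a ^ i = (\<Sum>j<?n. B $$ (i, j) * a ^ j)"
    using assms by (auto simp: rep_def)
  show "det B \<in> gen G" by (rule det_in_subring[OF A B BA])
  have n: "0 < ?n" by (rule min_poly_degree_pos[OF W])
  have adj: "adj_mat B $$ (0, j) \<in> gen G" if "j < ?n" for j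
    by (rule adj_mat_in_subring[OF A B BA n that])
  define z where "z = (\<Sum>j<?n. adj_mat B $$ (0, j) * (lead_coeff W ^ e * a ^ j))"
  have "a \<in> gen (insert a G)" using gen_superset by blast
  then have "z \<in> gen (insert a G)"
    unfolding z_def using adj sub lead_coeff_min_poly
    by (intro sr_sum[OF A'] sr_mult[OF A'] sr_power[OF A']) auto
  moreover have "y * z = det B"
  proof -
    have "y * z = (\<Sum>j<?n. adj_mat B $$ (0, j) * (lead_coeff W ^ e * y * a ^ j))"
      by (simp add: z_def sum_distrib_left algebra_simps)
    also have "\<dots> = (\<Sum>j<?n. \<Sum>l<?n. adj_mat B $$ (0, j) * B $$ (j, l) * a ^ l)"
      by (intro sum.cong refl, subst eq) (auto simp: sum_distrib_left mult.assoc)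
    also have "\<dots> = (\<Sum>l<?n. (\<Sum>j<?n. adj_mat B $$ (0, j) * B $$ (j, l)) * a ^ l)"
      by (subst sum.swap) (simp add: sum_distrib_right)
    also have "\<dots> = (\<Sum>l<?n. (adj_mat B * B) $$ (0, l) * a ^ l)"
      using B adj_mat(1)[OF B] n by (intro sum.cong) (auto simp: scalar_prod_def atLeast0LessThan)
    also have "\<dots> = (\<Sum>l<?n. (if l = 0 then det B else 0) * a ^ l)"
      using n by (intro sum.cong) (auto simp: adj_mat(3)[OF B])
    also have "\<dots> = det B" using n by (simp add: if_distrib[of "\<lambda>x. x * _"] cong: if_cong)
    finally show ?thesis .
  qed
  ultimately show "\<exists>z\<in>gen (insert a G). y * z = det B" by blast
qed

text \<open>Multiplication by \<open>lead_coeff W * a\<close> shifts the coordinates, and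
  \<open>W\<close> rewrites the top power without division. One step adds \<open>s\<close> to the
  degree and \<open>s + 1\<close> to the logarithm of the height, the extra 1 coming from the sum of
  two terms; so the growth in \<open>j\<close> is linear.\<close>

lemma power_reduction:
  assumes s: "\<And>i. sz G s (2 ^ s) (coeff W i)"
  shows "\<exists>b. (\<forall>l. sz G (s * j) (2 ^ ((s + 1) * j)) (b l)) \<and>
    lead_coeff W ^ j * a ^ j = (\<Sum>l<degree W. b l * a ^ l)"
proof (induction j)
  case 0
  show ?case using min_poly_degree_pos[OF W]
    by (intro exI[of _ "\<lambda>l. if l = 0 then 1 else 0"]) (auto intro: sz.intros simp: if_distrib[of "\<lambda>x. x * _"] cong: if_cong)
next
  case (Suc j)
  then obtain b where b: "\<And>l. sz G (s * j) (2 ^ ((s + 1) * j)) (b l)"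
    "lead_coeff W ^ j * a ^ j = (\<Sum>l<degree W. b l * a ^ l)" by blast
  obtain n where n: "degree W = Suc n" using min_poly_degree_pos[OF W] by (cases "degree W") auto
  let ?c = "lead_coeff W"
  define b' where "b' l = (if l = 0 then 0 else ?c * b (l - 1)) + - (coeff W l * b n)" for l
  have "sz G (s + s * j) (2 ^ s * 2 ^ ((s + 1) * j)) (if l = 0 then 0 else ?c * b (l - 1))" for l
    using s b by (auto intro: sz.intros)
  moreover have "sz G (s + s * j) (2 ^ s * 2 ^ ((s + 1) * j)) (- (coeff W l * b n))" for l
    by (intro sz_uminus sz_mult s b)
  ultimately have "sz G (s + s * j) (2 ^ s * 2 ^ ((s + 1) * j) + 2 ^ s * 2 ^ ((s + 1) * j)) (b' l)" for l
    unfolding b'_def by (rule sz_add)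
  moreover have "2 ^ s * 2 ^ ((s + 1) * j) + 2 ^ s * 2 ^ ((s + 1) * j) = (2::nat) ^ ((s + 1) * Suc j)"
    by (simp add: power_add)
  ultimately have "sz G (s * Suc j) (2 ^ ((s + 1) * Suc j)) (b' l)" for l by simp
  moreover have "?c ^ Suc j * a ^ Suc j = (\<Sum>l<degree W. b' l * a ^ l)"
  proof -
    have top: "?c * a ^ Suc n = - (\<Sum>l<Suc n. coeff W l * a ^ l)"
    proof -
      have "(\<Sum>l<Suc n. coeff W l * a ^ l) + ?c * a ^ Suc n = 0"
        using min_polyD(3) n by (simp only: poly_altdef lessThan_Suc_atMost[symmetric] sum.lessThan_Suc)
      then show ?thesis by (simp only: add_eq_0_iff2 minus_minus) 
    qed
    have "?c ^ Suc j * a ^ Suc j = ?c * a * (?c ^ j * a ^ j)" by simp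
    also have "?c ^ j * a ^ j = (\<Sum>l<Suc n. b l * a ^ l)" unfolding b(2) by (simp only: n)
    also have "?c * a * \<dots> = (\<Sum>l<Suc n. ?c * b l * a ^ Suc l)"
      unfolding sum_distrib_left by (intro sum.cong) auto
    also have "\<dots> = (\<Sum>l<n. ?c * b l * a ^ Suc l) + b n * (?c * a ^ Suc n)" by (simp add: algebra_simps)
    also have "(\<Sum>l<n. ?c * b l * a ^ Suc l) = (\<Sum>l<Suc n. (if l = 0 then 0 else ?c * b (l - 1)) * a ^ l)"
      by (simp add: sum.lessThan_Suc_shift del: sum.lessThan_Suc)
    also have "\<dots> + b n * (?c * a ^ Suc n) = (\<Sum>l<Suc n. b' l * a ^ l)"
      unfolding top b'_def
      by (simp only: distrib_right sum.distrib sum_distrib_left sum_negf mult_minus_right mult_minus_left)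
        (simp only: ac_simps)
    finally show ?thesis by (simp only: n)
  qed
  ultimately show ?case by blast
qed

text \<open>\<open>N\<close> is at least every exponent \<open>j + i\<close> of \<open>a\<close>
  that occurs, so \<open>lead_coeff W ^ N\<close> clears all denominators. The entries have size
  linear in \<open>t\<close>, which is what keeps the multiplicity bounds linear.\<close>

lemma rep_exists:
  assumes s: "\<And>i. sz G s (2 ^ s) (coeff W i)" and y: "sz (insert a G) t R y"
  defines "N \<equiv> t + degree W"
  shows "\<exists>B. rep N y B \<and> (\<forall>i<degree W. \<forall>j<degree W. sz G (t + (s + 1) * N) (R * 2 ^ ((s + 1) * N)) (B $$ (i, j)))"
proof -
  let ?n = "degree W" and ?c = "lead_coeff W"
  obtain F \<rho> where F: "poly F a = y" "degree F \<le> t" "\<forall>i. sz G t (coeff \<rho> i) (coeff F i)"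
    "poly \<rho> (1::nat) \<le> R" by (rule sz_insertD[OF y])
  have "\<forall>j. \<exists>b. (\<forall>l. sz G (s * j) (2 ^ ((s + 1) * j)) (b l)) \<and> ?c ^ j * a ^ j = (\<Sum>l<?n. b l * a ^ l)"
    using power_reduction[OF s] by blast
  then obtain b where b: "\<And>j l. sz G (s * j) (2 ^ ((s + 1) * j)) (b j l)"
    "\<And>j. ?c ^ j * a ^ j = (\<Sum>l<?n. b j l * a ^ l)" by metis
  define B where "B = mat ?n ?n (\<lambda>(i, l). \<Sum>j\<le>t. coeff F j * (?c ^ (N - (j + i)) * b (j + i) l))"
  have szB: "sz G (t + (s + 1) * N) (R * 2 ^ ((s + 1) * N)) (B $$ (i, l))" if i: "i < ?n" and l: "l < ?n" for i l
  proof -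
    have "sz G (t + (s + 1) * N) (coeff \<rho> j * 2 ^ ((s + 1) * N)) (coeff F j * (?c ^ (N - (j + i)) * b (j + i) l))"
      if j: "j \<le> t" for j
    proof -
      define k where "k = j + i"
      have k: "k \<le> N" using i j by (simp add: k_def N_def)
      have "sz G (t + ((N - k) * s + s * k)) (coeff \<rho> j * ((2 ^ s) ^ (N - k) * 2 ^ ((s + 1) * k)))
        (coeff F j * (?c ^ (N - k) * b k l))"
        by (intro sz_mult F(3)[rule_format] sz_power s b)
      moreover have "(N - k) * s + s * k = s * N"
        using k by (metis add.commute distrib_left le_add_diff_inverse mult.commute)
      moreover have "(2 ^ s) ^ (N - k) * 2 ^ ((s + 1) * k) \<le> (2::nat) ^ ((s + 1) * N)"
      proof -
        have "s * (N - k) + (s + 1) * k \<le> (s + 1) * (N - k) + (s + 1) * k" by simp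
        also have "\<dots> = (s + 1) * N" using k by (metis distrib_left le_add_diff_inverse2)
        finally show ?thesis by (simp only: power_mult[symmetric] power_add[symmetric]) simp
      qed
      ultimately show ?thesis unfolding k_def[symmetric]
        by (elim sz_mono) auto
    qed
    then have "sz G (t + (s + 1) * N) (\<Sum>j\<le>t. coeff \<rho> j * 2 ^ ((s + 1) * N))
        (\<Sum>j\<le>t. coeff F j * (?c ^ (N - (j + i)) * b (j + i) l))"
      by (intro sz_sum) auto
    moreover have "(\<Sum>j\<le>t. coeff \<rho> j) \<le> R"
    proof -
      have "(\<Sum>j\<le>t. coeff \<rho> j) \<le> (\<Sum>j\<le>max t (degree \<rho>). coeff \<rho> j)"
        by (intro sum_mono2) auto
      also have "\<dots> = (\<Sum>j\<le>degree \<rho>. coeff \<rho> j)"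
        by (intro sum.mono_neutral_right) (auto simp: coeff_eq_0)
      also have "\<dots> = poly \<rho> 1" by (simp add: poly_altdef)
      finally show ?thesis using F by simp
    qed
    ultimately show ?thesis using i l
      by (auto simp: B_def sum_distrib_right[symmetric] elim!: sz_mono)
  qed
  have "?c ^ N * y * a ^ i = (\<Sum>l<?n. B $$ (i, l) * a ^ l)" if i: "i < ?n" for i
  proof -
    have "?c ^ N * y * a ^ i = (\<Sum>j\<le>degree F. ?c ^ N * (coeff F j * a ^ j) * a ^ i)"
      unfolding F(1)[symmetric] poly_altdef by (simp add: sum_distrib_left sum_distrib_right)
    also have "\<dots> = (\<Sum>j\<le>t. ?c ^ N * (coeff F j * a ^ j) * a ^ i)"
      using F(2) by (intro sum.mono_neutral_left) (auto simp: coeff_eq_0)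
    also have "\<dots> = (\<Sum>j\<le>t. coeff F j * (?c ^ (N - (j + i)) * (?c ^ (j + i) * a ^ (j + i))))"
    proof (intro sum.cong refl)
      fix j assume "j \<in> {..t}"
      then have "?c ^ N = ?c ^ (N - (j + i)) * ?c ^ (j + i)"
        using i by (simp add: N_def flip: power_add)
      then show "?c ^ N * (coeff F j * a ^ j) * a ^ i =
          coeff F j * (?c ^ (N - (j + i)) * (?c ^ (j + i) * a ^ (j + i)))"
        by (simp add: power_add)
    qed
    also have "\<dots> = (\<Sum>j\<le>t. \<Sum>l<?n. coeff F j * (?c ^ (N - (j + i)) * b (j + i) l) * a ^ l)"
      unfolding b(2) by (simp add: sum_distrib_left algebra_simps)
    also have "\<dots> = (\<Sum>l<?n. \<Sum>j\<le>t. coeff F j * (?c ^ (N - (j + i)) * b (j + i) l) * a ^ l)"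
      by (rule sum.swap)
    also have "\<dots> = (\<Sum>l<?n. B $$ (i, l) * a ^ l)"
      using i by (intro sum.cong) (auto simp: B_def sum_distrib_right)
    finally show ?thesis .
  qed
  then have "rep N y B" unfolding rep_def using szB by (auto simp: B_def intro: genI)
  with szB show ?thesis by blast
qed

end

lemma sz_det:
  assumes C: "C \<in> carrier_mat n n" "\<And>i j. i < n \<Longrightarrow> j < n \<Longrightarrow> sz G s R (C $$ (i, j))"
  shows "sz G (n * s) (fact n * R ^ n) (det C)"
proof -
  have "sz G (\<Sum>i=0..<n. s) (\<Prod>i=0..<n. R) (\<Prod>i=0..<n. C $$ (i, p i))" if "p permutes {0..<n}" for p
    using that C by (intro sz_prod) (auto simp: permutes_in_image)
  then have 1: "sz G (n * s) (R ^ n) (\<Prod>i=0..<n. C $$ (i, p i))" if "p permutes {0..<n}" for p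
    using that by simp
  have 2: "sz G (n * s) (R ^ n) (signof p * (\<Prod>i=0..<n. C $$ (i, p i)))" if "p permutes {0..<n}" for p
    using 1[OF that] sz_uminus[OF 1[OF that]] by (cases "sign p = 1") (auto simp: sign_def)
  have "sz G (n * s) (\<Sum>p\<in>{p. p permutes {0..<n}}. R ^ n)
      (\<Sum>p\<in>{p. p permutes {0..<n}}. signof p * (\<Prod>i=0..<n. C $$ (i, p i)))"
    using 2 by (intro sz_sum finite_permutations) auto
  then show ?thesis
    unfolding det_def'[OF C(1)] by (simp add: card_permutations[of "{0..<n}" n])
qed

lemma det_pow_mat:
  assumes "B \<in> carrier_mat n n" shows "det (B ^\<^sub>m k) = det B ^ k"
  using assms by (induction k) (auto simp: det_mult[of _ n] pow_carrier_mat)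

text \<open>The norm from \<open>gen (insert a G)\<close> to \<open>gen G\<close>, a determinant of a matrix as in \<open>rep\<close>, is
  multiplicative, distorts sizes at most linearly, and is a multiple of its argument.\<close>

lemma unit_or_bounded_algebraic:
  fixes G :: "'a::field_char_0 set"
  assumes G: "unit_or_bounded G" and a: "alg_over (gen G) a"
  shows "unit_or_bounded (insert a G)"
  unfolding unit_or_bounded_def
proof
  fix h assume h: "h \<in> gen (insert a G) - {0}"
  let ?A = "gen G" and ?B = "gen (insert a G)"
  note A = subring_gen[of G] and B = subring_gen[of "insert a G"]
  have sub: "?A \<subseteq> ?B" by (rule gen_mono) auto
  obtain W where W: "min_poly ?A a W" using min_poly_exists[OF a] .
  define n where "n = degree W"
  define c where "c = lead_coeff W"
  have c: "c \<in> ?A" "c \<noteq> 0" using lead_coeff_min_poly[OF W] by (auto simp: c_def)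
  obtain h2 where h2: "h2 \<in> ?B" "h * h2 \<in> ?A" "h * h2 \<noteq> 0"
    using algebraic_multiple_in_base[OF a] h by blast
  define h1 where "h1 = h * h2"
  have h1: "h1 \<in> ?A" "h1 \<noteq> 0" using h2 by (auto simp: h1_def)
  obtain s0 where s0: "\<And>i. sz G s0 (2 ^ s0) (coeff W i)"
  proof -
    have "range (coeff W) \<subseteq> insert 0 (coeff W ` {..degree W})"
      using coeff_eq_0[of W] by (auto simp: image_iff) (metis atMost_iff not_le)
    then have "finite (range (coeff W))" by (rule finite_subset) auto
    moreover have "range (coeff W) \<subseteq> ?A" using min_polyD(1)[OF W] by (auto simp: polyover_def)
    ultimately obtain s where "\<And>y. y \<in> range (coeff W) \<Longrightarrow> sz G s (2 ^ s) y"
      using finite_sz_common by metis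
    with that show ?thesis by blast
  qed
  have rep_ex: "\<exists>e C. rep G a W e y C" if y: "y \<in> ?B" for y
  proof -
    from y obtain t R where "sz (insert a G) t R y" by (auto simp: gen_def)
    from rep_exists[OF W s0 this] show ?thesis by blast
  qed
  \<comment> \<open>Some multiple \<open>y * y'\<close> is a nonzero element of the base, whose
    matrix is scalar with nonzero determinant.\<close>
  have det_nz: "det C \<noteq> 0" if C: "rep G a W e y C" and y: "y \<in> ?B" "y \<noteq> 0" for e y C
  proof -
    obtain y' where y': "y' \<in> ?B" "y * y' \<in> ?A" "y * y' \<noteq> 0"
      using algebraic_multiple_in_base[OF a y] by blast
    obtain e' C' where C': "rep G a W e' y' C'" using rep_ex[OF y'(1)] by blast
    have car: "C \<in> carrier_mat n n" "C' \<in> carrier_mat n n" using C C' by (auto simp: rep_def[OF W] n_def)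
    have "rep G a W (0 + (e + e')) (y * y') (c ^ (e + e') \<cdot>\<^sub>m ((y * y') \<cdot>\<^sub>m 1\<^sub>m n))"
      using rep_shift[OF W rep_smult[OF W rep_one[OF W] y'(2)]] by (simp add: c_def n_def)
    moreover have "rep G a W (e + e') (y * y') (C * C')" by (rule rep_mult[OF W C C'])
    ultimately have "C * C' = c ^ (e + e') \<cdot>\<^sub>m ((y * y') \<cdot>\<^sub>m 1\<^sub>m n)"
      using rep_unique[OF W] by (metis add_0)
    then have "det C * det C' = (c ^ (e + e')) ^ n * (y * y') ^ n"
      using car by (simp flip: det_mult)
    then show ?thesis using c y' by auto
  qed
  have "c * h1 \<in> ?A - {0}" using c h1 by (auto intro: sr_mult[OF A])
  then obtain H where H: "H \<in> ?A - {0}" "\<And>y. y \<in> ?A - {0} \<Longrightarrow>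
     (\<exists>i. \<exists>z\<in>?A. y * z = H ^ i) \<or> bounded_mult G (c * h1) y"
    using G unfolding unit_or_bounded_def by meson
  show "\<exists>H\<in>?B - {0}. \<forall>y\<in>?B - {0}. (\<exists>i. \<exists>z\<in>?B. y * z = H ^ i) \<or> bounded_mult (insert a G) h y"
  proof (rule bexI[of _ H], rule ballI)
    fix y assume y: "y \<in> ?B - {0}"
    then obtain ey Cy where Cy: "rep G a W ey y Cy" using rep_ex by blast
    have Cyc: "Cy \<in> carrier_mat n n" using Cy by (auto simp: rep_def[OF W] n_def)
    have "det Cy \<in> ?A - {0}" using rep_det(1)[OF W Cy] det_nz[OF Cy] y by auto
    from H(2)[OF this] show "(\<exists>i. \<exists>z\<in>?B. y * z = H ^ i) \<or> bounded_mult (insert a G) h y"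
    proof
      assume "\<exists>i. \<exists>z\<in>?A. det Cy * z = H ^ i"
      then obtain i z where iz: "z \<in> ?A" "det Cy * z = H ^ i" by auto
      obtain z' where z': "z' \<in> ?B" "y * z' = det Cy" using rep_det(2)[OF W Cy] by blast
      have "y * (z' * z) = H ^ i" using iz z' by (simp flip: mult.assoc)
      moreover have "z' * z \<in> ?B" using z' iz sub by (intro sr_mult[OF B]) auto
      ultimately show ?thesis by blast
    next
      assume "bounded_mult G (c * h1) (det Cy)"
      then obtain C where C: "\<And>s k i f z. f \<noteq> 0 \<Longrightarrow> sz G s (2 ^ s) f \<Longrightarrow> z \<in> ?A \<Longrightarrow>
          det Cy ^ k * z = (c * h1) ^ i * f \<Longrightarrow> k \<le> C * (s + 1)"
        unfolding bounded_mult_def by blast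
      \<comment> \<open>Chosen so that \<open>n * S + n * n + 1\<close>, the size of the norm of
        \<open>f\<close> plus 1, is at most \<open>(C1 + 1) * (s + 1)\<close>.\<close>
      define C1 where "C1 = n * (1 + (s0 + 1) * (1 + n)) + n * n"
      have "bounded_mult (insert a G) h y"
      proof (rule bounded_multI[where C = "C * (C1 + 1)"])
        fix s k i f z
        assume f: "f \<noteq> 0" "sz (insert a G) s (2 ^ s) f" and z: "z \<in> ?B" and eq: "y ^ k * z = h ^ i * f"
        define N where "N = s + n"
        define S where "S = s + (s0 + 1) * N"
        obtain Cf where Cf: "rep G a W N f Cf"
          "\<And>i j. i < n \<Longrightarrow> j < n \<Longrightarrow> sz G S (2 ^ s * 2 ^ ((s0 + 1) * N)) (Cf $$ (i, j))"
          using rep_exists[OF W s0 f(2)] unfolding N_def S_def n_def by blast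
        have Cfc: "Cf \<in> carrier_mat n n" using Cf by (auto simp: rep_def[OF W] n_def)
        have "sz G (n * S) (fact n * (2 ^ S) ^ n) (det Cf)"
          using Cf(2) by (intro sz_det Cfc) (simp add: S_def power_add)
        moreover have "fact n * (2 ^ S) ^ n \<le> (2::nat) ^ (n * S + n * n)"
        proof -
          have "fact n \<le> n ^ n" using fact_le_power[of n] by (metis of_nat_id)
          also have "\<dots> \<le> (2 ^ n) ^ n" using less_exp[of n] by (intro power_mono) auto
          finally have "fact n \<le> (2::nat) ^ (n * n)" by (simp add: power_mult)
          then show ?thesis by (simp add: power_add power_mult[symmetric] mult.commute)
        qed
        ultimately have szf: "sz G (n * S + n * n) (2 ^ (n * S + n * n)) (det Cf)"
          by (elim sz_mono) auto
        have "f \<in> ?B" using f by (auto intro: genI)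
        have "h2 ^ i * z \<in> ?B" using h2 z by (intro sr_mult[OF B] sr_power[OF B])
        then obtain ez Cz where Cz: "rep G a W ez (h2 ^ i * z) Cz" using rep_ex by blast
        have Czc: "Cz \<in> carrier_mat n n" using Cz by (auto simp: rep_def[OF W] n_def)
        \<comment> \<open>Both sides of \<open>y ^ k * (h2 ^ i * z) = h1 ^ i * f\<close> are brought
          to the exponent \<open>e + N\<close> of \<open>c\<close>, so that their matrices can be
          compared.\<close>
        define e where "e = k * ey + ez"
        have "y ^ k * (h2 ^ i * z) = h1 ^ i * f"
          using eq by (simp add: h1_def power_mult_distrib algebra_simps)
        moreover have "rep G a W (e + N) (y ^ k * (h2 ^ i * z)) (c ^ N \<cdot>\<^sub>m (Cy ^\<^sub>m k * Cz))"
          unfolding e_def c_def by (intro rep_shift[OF W] rep_mult[OF W] rep_power[OF W] Cy Cz)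
        moreover have "rep G a W (N + e) (h1 ^ i * f) (c ^ e \<cdot>\<^sub>m (h1 ^ i \<cdot>\<^sub>m Cf))"
          unfolding c_def by (intro rep_shift[OF W] rep_smult[OF W] Cf sr_power[OF A] h1)
        ultimately have "c ^ N \<cdot>\<^sub>m (Cy ^\<^sub>m k * Cz) = c ^ e \<cdot>\<^sub>m (h1 ^ i \<cdot>\<^sub>m Cf)"
          using rep_unique[OF W] by (metis add.commute)
        from arg_cong[OF this, of det]
        have "(c ^ N) ^ n * (det Cy ^ k * det Cz) = (c ^ e) ^ n * ((h1 ^ i) ^ n * det Cf)"
          using Cyc Czc Cfc by (simp add: det_mult[of _ n] pow_carrier_mat det_pow_mat)
        \<comment> \<open>The additional factor completes the powers of \<open>c\<close> and
          \<open>h1\<close> on the right to one power of \<open>c * h1\<close>, the form in which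
          the bound over the base is available.\<close>
        then have "(c ^ N) ^ n * (det Cy ^ k * det Cz) * (c ^ (i * n) * h1 ^ (e * n)) =
          (c ^ e) ^ n * ((h1 ^ i) ^ n * det Cf) * (c ^ (i * n) * h1 ^ (e * n))" by simp
        then have "det Cy ^ k * ((c ^ N) ^ n * det Cz * (c ^ (i * n) * h1 ^ (e * n))) = (c * h1) ^ (e * n + i * n) * det Cf"
          by (simp add: power_add power_mult power_mult_distrib algebra_simps)
        moreover have "(c ^ N) ^ n * det Cz * (c ^ (i * n) * h1 ^ (e * n)) \<in> ?A"
          using c h1 rep_det(1)[OF W Cz] by (intro sr_mult[OF A] sr_power[OF A])
        ultimately have "k \<le> C * (n * S + n * n + 1)"
          using C[OF det_nz[OF Cf(1) \<open>f \<in> ?B\<close> f(1)] szf] by blast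
        also have "\<dots> \<le> C * ((C1 + 1) * (s + 1))"
        proof (intro mult_le_mono2)
          have N: "N \<le> (1 + n) * (s + 1)" by (simp add: N_def)
          have "S \<le> (s + 1) + (s0 + 1) * ((1 + n) * (s + 1))"
            unfolding S_def using N by (intro add_mono mult_le_mono2) auto
          also have "\<dots> = (1 + (s0 + 1) * (1 + n)) * (s + 1)" by (simp add: algebra_simps)
          finally have "n * S \<le> n * ((1 + (s0 + 1) * (1 + n)) * (s + 1))" by (rule mult_le_mono2)
          moreover have "n * n \<le> n * n * (s + 1)" by simp
          ultimately have "n * S + n * n + 1 \<le> n * ((1 + (s0 + 1) * (1 + n)) * (s + 1)) + n * n * (s + 1) + (s + 1)"
            by linarith
          also have "\<dots> = (C1 + 1) * (s + 1)" by (simp add: C1_def algebra_simps)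
          finally show "n * S + n * n + 1 \<le> (C1 + 1) * (s + 1)" .
        qed
        finally show "k \<le> C * (C1 + 1) * (s + 1)" by (simp only: mult.assoc)
      qed
      then show ?thesis ..
    qed
  qed (use H sub in auto)
qed

theorem finite_unit_or_bounded:
  fixes G :: "'a::{field_char_0, alg_closed_field} set"
  assumes "finite G" shows "unit_or_bounded G"
  using assms
proof (induction G rule: finite_induct)
  case (insert a G)
  then show ?case
    using unit_or_bounded_algebraic[of G a] unit_or_bounded_transcendental[of G a] by blast
qed (rule unit_or_bounded_empty)


section \<open>Sequences with infinitely many zeros\<close>

text \<open>The multiples of \<open>p\<close> up to \<open>k\<close> contribute
  \<open>p ^ (k div p) * fact (k div p)\<close>; the other factors make up \<open>u\<close>.\<close>

lemma fact_prime_split: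
  assumes p: "prime p"
  shows "\<exists>u. fact k = p ^ (k div p) * fact (k div p) * u \<and> \<not> p dvd (u::nat)"
proof (induction k)
  case 0
  show ?case using prime_gt_1_nat[OF p] by (intro exI[of _ 1]) auto
next
  case (Suc k)
  then obtain u where u: "fact k = p ^ (k div p) * fact (k div p) * u" "\<not> p dvd u" by auto
  have "p > 0" using prime_gt_0_nat[OF p] .
  show ?case
  proof (cases "p dvd Suc k")
    case True
    then have d: "Suc k div p = Suc (k div p)"
      using \<open>p > 0\<close> by (simp add: div_Suc dvd_eq_mod_eq_0)
    have "Suc k = p * Suc (k div p)" using True by (simp flip: d)
    then have "fact (Suc k) = (p * Suc (k div p)) * fact k" by (metis fact_Suc of_nat_id)
    then show ?thesis using u by (intro exI[of _ u]) (auto simp: d algebra_simps)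
  next
    case False
    then have "Suc k div p = k div p" by (simp add: div_Suc dvd_eq_mod_eq_0)
    moreover have "\<not> p dvd Suc k * u" using False u p by (simp only: prime_dvd_mult_iff) simp
    ultimately show ?thesis using u(1) by (intro exI[of _ "Suc k * u"]) (simp add: algebra_simps)
  qed
qed

text \<open>Legendre's bound k/(p-1) for the multiplicity of \<open>p\<close> in the factorial is at
  most k/2 because \<open>p\<close> is at least 3. For the prime 2 the quotients 2^k/k! would not
  become more and more divisible.\<close>

lemma fact_prime_valuation:
  assumes p: "prime p" "p \<ge> 3"
  shows "\<exists>u v. fact k = p ^ v * u \<and> \<not> p dvd (u::nat) \<and> 2 * v \<le> k"
proof (induction k rule: less_induct)
  case (less k)
  show ?case
  proof (cases "k = 0")
    case True
    then show ?thesis using p by (intro exI[of _ 1] exI[of _ 0]) auto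
  next
    case False
    then have "k div p < k" using p by simp
    from less[OF this] obtain u v where uv: "fact (k div p) = p ^ v * u" "\<not> p dvd u" "2 * v \<le> k div p"
      by auto
    obtain w where w: "fact k = p ^ (k div p) * fact (k div p) * w" "\<not> p dvd w"
      using fact_prime_split[OF p(1)] by blast
    have "3 * (k div p) \<le> p * (k div p)" using p by (intro mult_le_mono1)
    also have "\<dots> \<le> k" by (rule times_div_less_eq_dividend)
    finally have "2 * (k div p + v) \<le> k" using uv(3) by (simp add: distrib_left)
    moreover have "fact k = p ^ (k div p + v) * (u * w)" using w uv by (simp add: power_add)
    moreover have "\<not> p dvd u * w" using uv w p by (simp add: prime_dvd_mult_iff)
    ultimately show ?thesis by blast
  qed
qed

definition pideal :: "nat \<Rightarrow> 'a::comm_ring_1 set \<Rightarrow> nat \<Rightarrow> 'a set" where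
  "pideal p R j = (\<lambda>z. of_nat p ^ j * z) ` R"

lemma prime_power_div_fact:
  assumes p: "prime p" "p \<ge> 3"
  shows "(of_nat p ^ k / fact k :: 'a::field_char_0) \<in> pideal p (ZP p) (k div 2)"
proof -
  obtain u v where uv: "fact k = p ^ v * u" "\<not> p dvd u" "2 * v \<le> k"
    using fact_prime_valuation[OF p] by blast
  have "\<not> int p dvd int u" using uv by simp
  from ZP_I[OF this, of "int p ^ (k - v - k div 2)"]
  have z: "(of_nat p ^ (k - v - k div 2) / of_nat u :: 'a) \<in> ZP p" by simp
  have f: "(fact k :: 'a) = of_nat p ^ v * of_nat u"
    using arg_cong[OF uv(1), of "of_nat :: nat \<Rightarrow> 'a"] by simp
  have "k = (k div 2 + (k - v - k div 2)) + v" using uv by linarith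
  then have "(of_nat p :: 'a) ^ k = (of_nat p ^ (k div 2) * of_nat p ^ (k - v - k div 2)) * of_nat p ^ v"
    by (metis power_add)
  then have "(of_nat p ^ k / fact k :: 'a) = of_nat p ^ (k div 2) * (of_nat p ^ (k - v - k div 2) / of_nat u)"
    using p unfolding f by simp
  with z show ?thesis unfolding pideal_def by blast
qed

context
  fixes p :: nat and R :: "'a::field_char_0 set"
  assumes R: "subring_set R"
begin

lemma pideal_zero: "0 \<in> pideal p R j"
  using sr_zero[OF R] by (auto simp: pideal_def)

lemma pideal_add: "x \<in> pideal p R j \<Longrightarrow> y \<in> pideal p R j \<Longrightarrow> x + y \<in> pideal p R j"
  by (auto simp: pideal_def simp flip: distrib_left intro!: sr_add[OF R])

lemma pideal_uminus: "x \<in> pideal p R j \<Longrightarrow> - x \<in> pideal p R j"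
  by (auto simp: pideal_def simp flip: mult_minus_right intro!: sr_uminus[OF R])

lemma pideal_diff: "x \<in> pideal p R j \<Longrightarrow> y \<in> pideal p R j \<Longrightarrow> x - y \<in> pideal p R j"
  using pideal_add[of x j "- y"] pideal_uminus[of y] by simp

lemma pideal_mult: "r \<in> R \<Longrightarrow> x \<in> pideal p R j \<Longrightarrow> r * x \<in> pideal p R j"
  by (auto simp: pideal_def mult.left_commute[of r] intro!: sr_mult[OF R])

lemma pideal_mult2: "r \<in> R \<Longrightarrow> x \<in> pideal p R j \<Longrightarrow> x * r \<in> pideal p R j"
  using pideal_mult by (simp add: mult.commute)

lemma pideal_sum: "(\<And>i. i \<in> I \<Longrightarrow> f i \<in> pideal p R j) \<Longrightarrow> sum f I \<in> pideal p R j"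
  by (induction I rule: infinite_finite_induct) (auto intro: pideal_zero pideal_add)

lemma pideal_antimono: assumes "x \<in> pideal p R j" "i \<le> j" shows "x \<in> pideal p R i"
proof -
  from assms obtain z where "x = of_nat p ^ j * z" "z \<in> R" by (auto simp: pideal_def)
  then have "x = of_nat p ^ i * (of_nat p ^ (j - i) * z)" "of_nat p ^ (j - i) * z \<in> R"
    using assms(2) by (auto simp flip: power_add mult.assoc intro: sr_intros[OF R])
  then show ?thesis unfolding pideal_def by blast
qed

text \<open>From the top down, coefficient \<open>j\<close> of \<open>T\<close> is coefficient
  \<open>j + 1\<close> of \<open>Q\<close> plus \<open>t\<close> times coefficient
  \<open>j + 1\<close> of \<open>T\<close>. The shift of the index by one is worth half a power of
  \<open>p\<close>; this is what a zero contributes.\<close>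

lemma pideal_coeff_linear_factor:
  assumes Q: "Q = [:- t, 1:] * T" "\<And>j. coeff Q j \<in> pideal p R ((j + K) div 2)" and t: "t \<in> R"
  shows "coeff T j \<in> pideal p R ((j + Suc K) div 2)"
proof -
  have "degree T + 1 \<le> j + d \<Longrightarrow> coeff T j \<in> pideal p R ((j + Suc K) div 2)" for d j
  proof (induction d arbitrary: j)
    case 0
    then show ?case by (simp add: coeff_eq_0 pideal_zero)
  next
    case (Suc d)
    have "coeff Q (Suc j) = coeff T j - t * coeff T (Suc j)" by (simp add: Q(1) mult_pCons_left)
    then have "coeff T j = coeff Q (Suc j) + t * coeff T (Suc j)" by simp
    also have "\<dots> \<in> pideal p R ((j + Suc K) div 2)"
    proof (intro pideal_add pideal_mult t)
      show "coeff Q (Suc j) \<in> pideal p R ((j + Suc K) div 2)" using Q(2)[of "Suc j"] by simp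
      have "coeff T (Suc j) \<in> pideal p R ((Suc j + Suc K) div 2)"
        by (rule Suc.IH) (use Suc.prems in simp)
      then show "coeff T (Suc j) \<in> pideal p R ((j + Suc K) div 2)"
        by (rule pideal_antimono) (simp add: div_le_mono)
    qed
    finally show ?case .
  qed
  from this[of j "degree T + 1"] show ?thesis by simp
qed

text \<open>Hansel's argument: dividing by the linear factors of \<open>K\<close> zeros shows that every value
  is divisible by \<open>p ^ (K div 2)\<close>.\<close>

lemma zero_of_infinite_zeros:
  fixes s :: "nat \<Rightarrow> 'a"
  assumes p: "prime p" "p \<ge> 3" and ZP: "ZP p \<subseteq> R"
    and Krull: "\<And>x. (\<And>j. x \<in> pideal p R j) \<Longrightarrow> x = 0"
    and s: "\<And>l. s l = (\<Sum>k\<le>l. of_nat (l choose k) * of_nat p ^ k * b k)" and b: "\<And>k. b k \<in> R"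
    and inf: "infinite {l. s l = 0}"
  shows "s l = 0"
proof (rule Krull)
  fix j :: nat
  \<comment> \<open>Each zero gains half a power of \<open>p\<close>, so \<open>2 * j\<close> zeros
    yield \<open>p ^ j\<close>.\<close>
  define K where "K = 2 * j"
  obtain Z where Z: "Z \<subseteq> {l. s l = 0}" "finite Z" "card Z = K"
    using infinite_arbitrarily_large[OF inf] by blast
  \<comment> \<open>The Newton series cut off at \<open>L\<close> is a polynomial that agrees with
    \<open>s\<close> at \<open>l\<close> and at all the zeros in \<open>Z\<close>.\<close>
  define L where "L = Max (insert l Z)"
  have L: "l \<le> L" "\<And>z. z \<in> Z \<Longrightarrow> z \<le> L" using Z by (auto simp: L_def)
  define ff :: "nat \<Rightarrow> 'a poly" where "ff k = (\<Prod>i<k. [:- of_nat i, 1:])" for k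
  define Q where "Q = (\<Sum>k\<le>L. smult (of_nat p ^ k / fact k * b k) (ff k))"
  have ffv: "poly (ff k) (of_nat n) / fact k = of_nat (n choose k)" for k n
    by (simp add: ff_def poly_prod binomial_gbinomial gbinomial_prod_rev lessThan_atLeast0)
  have Qv: "poly Q (of_nat n) = s n" if "n \<le> L" for n
  proof -
    have "poly Q (of_nat n) = (\<Sum>k\<le>L. of_nat p ^ k * b k * (poly (ff k) (of_nat n) / fact k))"
      by (simp add: Q_def poly_sum)
    also have "\<dots> = (\<Sum>k\<le>L. of_nat (n choose k) * of_nat p ^ k * b k)"
      by (simp add: ffv algebra_simps)
    also have "\<dots> = s n" unfolding s using that by (intro sum.mono_neutral_right) auto
    finally show ?thesis .
  qed
  have ffR: "ff k \<in> polyover R" for k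
    by (induction k) (auto simp: ff_def mult.commute intro!: polyover_intros[OF R] sr_intros[OF R]
        simp del: mult_pCons_left mult_pCons_right)
  have ffd: "degree (ff k) \<le> k" for k
    unfolding ff_def by (rule order_trans[OF degree_prod_sum_le]) auto
  have "coeff Q i \<in> pideal p R ((i + 0) div 2)" for i
    unfolding Q_def coeff_sum
  proof (intro pideal_sum)
    fix k assume "k \<in> {..L}"
    show "coeff (smult (of_nat p ^ k / fact k * b k) (ff k)) i \<in> pideal p R ((i + 0) div 2)"
    proof (cases "i \<le> k")
      case True
      have "(of_nat p ^ k / fact k :: 'a) \<in> pideal p R (k div 2)"
        using prime_power_div_fact[OF p, of k] ZP by (auto simp: pideal_def)
      then have "(of_nat p ^ k / fact k :: 'a) \<in> pideal p R ((i + 0) div 2)"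
        using True by (elim pideal_antimono) (auto intro: div_le_mono)
      then show ?thesis using b ffR[of k]
        by (simp only: coeff_smult) (intro pideal_mult2 polyover_coeff)
    next
      case False
      then show ?thesis using ffd[of k] by (simp add: coeff_eq_0 pideal_zero)
    qed
  qed
  moreover have "\<exists>T. Q = (\<Prod>z\<in>Z. [:- of_nat z, 1:]) * T \<and> (\<forall>j. coeff T j \<in> pideal p R ((j + card Z) div 2))"
    using Z(2) Z(1) L(2)
  proof (induction Z rule: finite_induct)
    case empty
    show ?case using \<open>\<And>i. coeff Q i \<in> _\<close> by simp
  next
    case (insert z Z)
    then obtain T where T: "Q = (\<Prod>z\<in>Z. [:- of_nat z, 1:]) * T" "\<And>j. coeff T j \<in> pideal p R ((j + card Z) div 2)"
      by auto
    have "poly Q (of_nat z) = 0" using Qv[of z] insert.prems by auto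
    moreover have "poly (\<Prod>z\<in>Z. [:- of_nat z, 1:]) (of_nat z) \<noteq> (0::'a)"
      using insert.hyps by (auto simp: poly_prod)
    ultimately have "poly T (of_nat z) = 0" using T(1) by simp
    then obtain T' where T': "T = [:- of_nat z, 1:] * T'" by (auto simp: poly_eq_0_iff_dvd)
    have "coeff T' j \<in> pideal p R ((j + Suc (card Z)) div 2)" for j
      using pideal_coeff_linear_factor[OF T' T(2)] sr_of_nat[OF R] by blast
    moreover have "Q = (\<Prod>z\<in>insert z Z. [:- of_nat z, 1:]) * T'"
      unfolding T(1) T' prod.insert[OF insert.hyps] by (simp only: ac_simps)
    ultimately show ?case using insert.hyps by auto
  qed
  ultimately obtain T where T: "Q = (\<Prod>z\<in>Z. [:- of_nat z, 1:]) * T"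
    "\<And>i. coeff T i \<in> pideal p R ((i + K) div 2)" using Z(3) by auto
  have "coeff T i \<in> pideal p R j" for i
    by (rule pideal_antimono[OF T(2)]) (simp add: K_def)
  then have "poly T (of_nat l) \<in> pideal p R j"
    unfolding poly_altdef by (intro pideal_sum pideal_mult2 sr_power[OF R] sr_of_nat[OF R])
  then have "poly Q (of_nat l) \<in> pideal p R j"
    unfolding T(1) poly_mult
    by (intro pideal_mult) (auto simp: poly_prod intro!: sr_intros[OF R])
  then show "s l \<in> pideal p R j" using Qv[OF L(1)] by simp
qed

end

text \<open>Expression trees over an arbitrary index type: substitution, derivatives, Taylor
  expansion and images under homomorphisms become structural recursions. Different trees may denote
  the same polynomial; only the values of trees and of their derivatives are used.\<close>

datatype (pvars: 'v, pconsts: 'a) pexp =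
  PConst 'a | PVar 'v | PAdd "('v, 'a) pexp" "('v, 'a) pexp" | PMul "('v, 'a) pexp" "('v, 'a) pexp"
  for map: pmap

primrec peval :: "('v \<Rightarrow> 'a::comm_ring_1) \<Rightarrow> ('v, 'a) pexp \<Rightarrow> 'a" where
  "peval x (PConst c) = c"
| "peval x (PVar v) = x v"
| "peval x (PAdd e f) = peval x e + peval x f"
| "peval x (PMul e f) = peval x e * peval x f"

primrec pder :: "'v \<Rightarrow> ('v, 'a::comm_ring_1) pexp \<Rightarrow> ('v, 'a) pexp" where
  "pder v (PConst c) = PConst 0"
| "pder v (PVar w) = PConst (if v = w then 1 else 0)"
| "pder v (PAdd e f) = PAdd (pder v e) (pder v f)"
| "pder v (PMul e f) = PAdd (PMul e (pder v f)) (PMul (pder v e) f)"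

primrec psubst :: "('v \<Rightarrow> ('w, 'a) pexp) \<Rightarrow> ('v, 'a) pexp \<Rightarrow> ('w, 'a) pexp" where
  "psubst \<sigma> (PConst c) = PConst c"
| "psubst \<sigma> (PVar v) = \<sigma> v"
| "psubst \<sigma> (PAdd e f) = PAdd (psubst \<sigma> e) (psubst \<sigma> f)"
| "psubst \<sigma> (PMul e f) = PMul (psubst \<sigma> e) (psubst \<sigma> f)"

definition pexps :: "'v set \<Rightarrow> 'a set \<Rightarrow> ('v, 'a) pexp set" where
  "pexps I A = {e. pvars e \<subseteq> I \<and> pconsts e \<subseteq> A}"

lemma pexps_simps [simp]:
  "PConst c \<in> pexps I A \<longleftrightarrow> c \<in> A"
  "PVar v \<in> pexps I A \<longleftrightarrow> v \<in> I"
  "PAdd e f \<in> pexps I A \<longleftrightarrow> e \<in> pexps I A \<and> f \<in> pexps I A"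
  "PMul e f \<in> pexps I A \<longleftrightarrow> e \<in> pexps I A \<and> f \<in> pexps I A"
  by (auto simp: pexps_def)

lemma pexps_mono: "e \<in> pexps I A \<Longrightarrow> I \<subseteq> J \<Longrightarrow> A \<subseteq> B \<Longrightarrow> e \<in> pexps J B"
  by (auto simp: pexps_def)

lemma peval_psubst: "peval x (psubst \<sigma> e) = peval (\<lambda>v. peval x (\<sigma> v)) e"
  by (induction e) auto

lemma psubst_pexps:
  "e \<in> pexps I A \<Longrightarrow> (\<And>v. v \<in> I \<Longrightarrow> \<sigma> v \<in> pexps J A) \<Longrightarrow> psubst \<sigma> e \<in> pexps J A"
  by (induction e) auto

lemma peval_cong: "e \<in> pexps I A \<Longrightarrow> (\<And>v. v \<in> I \<Longrightarrow> x v = y v) \<Longrightarrow> peval x e = peval y e"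
  by (induction e) auto

lemma peval_in: "subring_set A \<Longrightarrow> e \<in> pexps I A \<Longrightarrow> (\<And>v. v \<in> I \<Longrightarrow> x v \<in> A) \<Longrightarrow> peval x e \<in> A"
  by (induction e) (auto intro: sr_intros)

lemma pder_pexps: "subring_set A \<Longrightarrow> e \<in> pexps I A \<Longrightarrow> pder v e \<in> pexps I A"
  by (induction e) (auto intro: sr_intros)

lemma peval_hom:
  assumes A: "subring_set A" and \<phi>: "hom_on A \<phi>"
  shows "e \<in> pexps I A \<Longrightarrow> (\<And>v. v \<in> I \<Longrightarrow> x v \<in> A) \<Longrightarrow>
    \<phi> (peval x e) = peval (\<lambda>v. \<phi> (x v)) (pmap (\<lambda>v. v) \<phi> e)"
proof (induction e)
  case (PAdd e f)
  then show ?case using peval_in[OF A, of e I x] peval_in[OF A, of f I x]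
    by (simp add: hom_on_add[OF A \<phi>])
next
  case (PMul e f)
  then show ?case using peval_in[OF A, of e I x] peval_in[OF A, of f I x]
    by (simp add: hom_on_mult[OF A \<phi>])
qed auto

lemma pder_pmap: "\<phi> 0 = 0 \<Longrightarrow> \<phi> 1 = 1 \<Longrightarrow> pder v (pmap (\<lambda>v. v) \<phi> e) = pmap (\<lambda>v. v) \<phi> (pder v e)"
  by (induction e) auto

lemma pmap_pexps: "e \<in> pexps I A \<Longrightarrow> \<phi> ` A \<subseteq> R \<Longrightarrow> pmap (\<lambda>v. v) \<phi> e \<in> pexps I R"
  by (induction e) auto

lemma sum_pexp:
  assumes "finite J" "subring_set A" "\<And>j. j \<in> J \<Longrightarrow> e j \<in> pexps I A"
  shows "\<exists>f\<in>pexps I A. \<forall>y. peval y f = (\<Sum>j\<in>J. peval y (e j))"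
  using assms
proof (induction J rule: finite_induct)
  case empty
  then show ?case by (intro bexI[of _ "PConst 0"]) (auto intro: sr_zero)
next
  case (insert j J)
  then obtain f where f: "f \<in> pexps I A" "\<forall>y. peval y f = (\<Sum>j\<in>J. peval y (e j))" by auto
  with insert show ?case by (intro bexI[of _ "PAdd (e j) f"]) auto
qed

lemma linear_pexp:
  assumes "finite I" "subring_set A" "\<And>v. v \<in> I \<Longrightarrow> c v \<in> A"
  shows "\<exists>f\<in>pexps I A. \<forall>y. peval y f = (\<Sum>v\<in>I. c v * y v)"
  using sum_pexp[of I A "\<lambda>v. PMul (PConst (c v)) (PVar v)" I] assms by auto

primrec ppow :: "('v, 'a::comm_ring_1) pexp \<Rightarrow> nat \<Rightarrow> ('v, 'a) pexp" where
  "ppow e 0 = PConst 1"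
| "ppow e (Suc n) = PMul e (ppow e n)"

lemma peval_ppow [simp]: "peval x (ppow e n) = peval x e ^ n"
  by (induction n) auto

lemma ppow_pexps: "subring_set A \<Longrightarrow> e \<in> pexps I A \<Longrightarrow> ppow e n \<in> pexps I A"
  by (induction n) (auto intro: sr_one)

text \<open>The remainder \<open>f\<close> has coefficients in \<open>A\<close> and depends on the
  centre \<open>x\<close> but not on \<open>y\<close>, so the map seen from the centre is again
  polynomial over \<open>A\<close>.\<close>

lemma peval_taylor:
  assumes A: "subring_set A" and "finite I" and P: "P \<in> A" and x: "\<And>v. v \<in> I \<Longrightarrow> x v \<in> A"
  shows "e \<in> pexps I A \<Longrightarrow> \<exists>f\<in>pexps I A. \<forall>y. peval (\<lambda>v. x v + P * y v) e =
    peval x e + P * (\<Sum>v\<in>I. peval x (pder v e) * y v) + P\<^sup>2 * peval y f"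
proof (induction e)
  case (PConst c)
  show ?case by (intro bexI[of _ "PConst 0"]) (auto intro: sr_zero[OF A])
next
  case (PVar w)
  then have "(\<Sum>v\<in>I. peval x (pder v (PVar w)) * y v) = y w" for y
    using \<open>finite I\<close> by (simp add: if_distrib[of "\<lambda>x. x * _"] cong: if_cong)
  then show ?case by (intro bexI[of _ "PConst 0"]) (auto intro: sr_zero[OF A])
next
  case (PAdd e e')
  then obtain f f' where "f \<in> pexps I A" "f' \<in> pexps I A"
    "\<And>y. peval (\<lambda>v. x v + P * y v) e = peval x e + P * (\<Sum>v\<in>I. peval x (pder v e) * y v) + P\<^sup>2 * peval y f"
    "\<And>y. peval (\<lambda>v. x v + P * y v) e' = peval x e' + P * (\<Sum>v\<in>I. peval x (pder v e') * y v) + P\<^sup>2 * peval y f'"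
    by auto
  then show ?case
    by (intro bexI[of _ "PAdd f f'"]) (auto simp: algebra_simps sum.distrib)
next
  case (PMul e e')
  then have ee: "e \<in> pexps I A" "e' \<in> pexps I A" by auto
  from PMul obtain f f' where f: "f \<in> pexps I A" "f' \<in> pexps I A"
    "\<And>y. peval (\<lambda>v. x v + P * y v) e = peval x e + P * (\<Sum>v\<in>I. peval x (pder v e) * y v) + P\<^sup>2 * peval y f"
    "\<And>y. peval (\<lambda>v. x v + P * y v) e' = peval x e' + P * (\<Sum>v\<in>I. peval x (pder v e') * y v) + P\<^sup>2 * peval y f'"
    by auto
  have in_A: "peval x e \<in> A" "peval x e' \<in> A" "\<And>v. peval x (pder v e) \<in> A" "\<And>v. peval x (pder v e') \<in> A"
    using ee x by (auto intro!: peval_in[OF A] pder_pexps[OF A])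
  obtain g where g: "g \<in> pexps I A" "\<And>y. peval y g = (\<Sum>v\<in>I. peval x (pder v e) * y v)"
    using linear_pexp[OF \<open>finite I\<close> A, of "\<lambda>v. peval x (pder v e)"] in_A by blast
  obtain g' where g': "g' \<in> pexps I A" "\<And>y. peval y g' = (\<Sum>v\<in>I. peval x (pder v e') * y v)"
    using linear_pexp[OF \<open>finite I\<close> A, of "\<lambda>v. peval x (pder v e')"] in_A by blast
  have lin: "(\<Sum>v\<in>I. peval x (pder v (PMul e e')) * y v) = peval x e * peval y g' + peval x e' * peval y g" for y
    by (simp add: g(2) g'(2) sum_distrib_left sum.distrib algebra_simps)
  define G where "G = PAdd (PAdd (PMul (PConst (peval x e)) f') (PMul (PConst (peval x e')) f))
    (PAdd (PMul g g') (PAdd (PMul (PConst P) (PAdd (PMul g f') (PMul g' f))) (PMul (PConst (P\<^sup>2)) (PMul f f'))))"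
  have "G \<in> pexps I A" using f g g' in_A P by (auto simp: G_def intro: sr_power[OF A])
  moreover have "peval (\<lambda>v. x v + P * y v) (PMul e e') = peval x (PMul e e') +
      P * (\<Sum>v\<in>I. peval x (pder v (PMul e e')) * y v) + P\<^sup>2 * peval y G" for y
    unfolding lin peval.simps f(3,4) g(2)[symmetric] g'(2)[symmetric] G_def
    by (simp add: algebra_simps power2_eq_square)
  ultimately show ?case by blast
qed

lemma peval_diff_in:
  assumes A: "subring_set A" and e: "e \<in> pexps I A"
    and xy: "\<And>v. v \<in> I \<Longrightarrow> x v \<in> A" "\<And>v. v \<in> I \<Longrightarrow> y v \<in> A" "\<And>v. v \<in> I \<Longrightarrow> x v - y v \<in> pideal p A j"
  shows "peval x e - peval y e \<in> pideal p (A :: 'a::field_char_0 set) j"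
  using e
proof (induction e)
  case (PConst c)
  then show ?case by (simp add: pideal_zero[OF A])
next
  case (PAdd e f)
  then have "(peval x e - peval y e) + (peval x f - peval y f) \<in> pideal p A j"
    by (intro pideal_add[OF A]) auto
  then show ?case by (simp add: algebra_simps)
next
  case (PMul e f)
  then have "peval x e * (peval x f - peval y f) + (peval x e - peval y e) * peval y f \<in> pideal p A j"
    by (intro pideal_add[OF A] pideal_mult[OF A] pideal_mult2[OF A]) (auto intro: peval_in[OF A] xy)
  then show ?case by (simp add: algebra_simps)
qed (use xy in auto)


section \<open>Orbits modulo a prime\<close>

lemma pigeonhole_le:
  assumes "finite C" "card C \<le> S" "\<And>j. j \<le> S \<Longrightarrow> f j \<in> C"
  obtains i j :: nat where "i < j" "j \<le> S" "f i = f j"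
proof -
  have "card (f ` {..S}) \<le> card C" using assms by (intro card_mono) auto
  then have "card (f ` {..S}) < card {..S}" using assms(2) by simp
  then have "\<not> inj_on f {..S}" by (rule pigeonhole)
  then obtain a b where ab: "a \<le> S" "b \<le> S" "f a = f b" "a \<noteq> b" by (auto simp: inj_on_def)
  then show ?thesis using that[of a b] that[of b a] by (cases "a < b") auto
qed

text \<open>Vectors over \<open>R\<close> with index set \<open>I\<close> are functions with values in \<open>R\<close> on \<open>I\<close>; their
  values outside of \<open>I\<close> are irrelevant.\<close>

locale lattice_mod_p =
  fixes p D :: nat and R :: "'a::field_char_0 set" and I :: "'v set"
  assumes good: "good_ring p D R" and p3: "p \<ge> 3" and I: "finite I"
begin

lemma p: "prime p" and R: "subring_set R" and ZP: "ZP p \<subseteq> R"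
  using good by (auto simp: good_ring_def)

lemma pR: "of_nat p \<in> R"
  by (rule sr_of_nat[OF R])

lemma Krull: "(\<And>j. x \<in> pideal p R j) \<Longrightarrow> x = 0"
proof -
  assume x: "\<And>j. x \<in> pideal p R j"
  obtain es where "R = zspan p es" using good by (auto simp: good_ring_def)
  with x show "x = 0" by (intro zspan_Krull[OF p, of es]) (auto simp: pideal_def)
qed

definition pts :: "('v \<Rightarrow> 'a) set" where
  "pts = {y. \<forall>i\<in>I. y i \<in> R}"

definition cg :: "('v \<Rightarrow> 'a) \<Rightarrow> ('v \<Rightarrow> 'a) \<Rightarrow> bool" where
  "cg y y' \<longleftrightarrow> (\<forall>i\<in>I. y i - y' i \<in> pideal p R 1)"

text \<open>An upper bound for the number of residue classes mod \<open>p\<close> of points with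
  coordinates in \<open>R\<close>.\<close>

definition S where "S = (p ^ D) ^ card I"

text \<open>A code lists chosen representatives of the coordinates. Only one direction holds in
  general, equal codes imply congruence, and this is the one the pigeonhole principle asks
  for.\<close>

lemma coding:
  "\<exists>(code :: ('v \<Rightarrow> 'a) \<Rightarrow> 'v \<Rightarrow> 'a) C. finite C \<and> card C \<le> S \<and> (\<forall>y\<in>pts. code y \<in> C) \<and>
     (\<forall>y\<in>pts. \<forall>y'\<in>pts. code y = code y' \<longrightarrow> cg y y')"
proof -
  obtain es where es: "length es = D" "R = zspan p es" using good by (auto simp: good_ring_def)
  obtain F where F: "finite F" "card F \<le> p ^ D" "\<And>y. y \<in> R \<Longrightarrow> \<exists>r\<in>F. \<exists>z\<in>R. y = r + of_nat p * z"
    using zspan_reps[OF p, of es] es by metis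
  define \<kappa> where "\<kappa> y = (SOME r. r \<in> F \<and> (\<exists>z\<in>R. y = r + of_nat p * z))" for y
  have \<kappa>: "\<kappa> y \<in> F \<and> (\<exists>z\<in>R. y = \<kappa> y + of_nat p * z)" if "y \<in> R" for y
  proof -
    have "\<exists>r. r \<in> F \<and> (\<exists>z\<in>R. y = r + of_nat p * z)" using F(3)[OF that] by blast
    from someI_ex[OF this] show ?thesis unfolding \<kappa>_def .
  qed
  define code where "code y = (\<lambda>i\<in>I. \<kappa> (y i))" for y :: "'v \<Rightarrow> 'a"
  have "card (PiE I (\<lambda>_. F)) = card F ^ card I" using I by (simp add: card_PiE)
  also have "\<dots> \<le> S" unfolding S_def using F by (intro power_mono) auto
  finally have "card (PiE I (\<lambda>_. F)) \<le> S" .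
  moreover have "finite (PiE I (\<lambda>_. F))" using I F by (intro finite_PiE) auto
  moreover have "code y \<in> PiE I (\<lambda>_. F)" if "y \<in> pts" for y
    using that \<kappa> by (auto simp: code_def pts_def)
  moreover have "cg y y'" if "y \<in> pts" "y' \<in> pts" "code y = code y'" for y y'
    unfolding cg_def
  proof
    fix i assume i: "i \<in> I"
    then have "\<kappa> (y i) = \<kappa> (y' i)" using fun_cong[OF that(3), of i] by (simp add: code_def)
    moreover have yR: "y i \<in> R" "y' i \<in> R" using that(1,2) i by (auto simp: pts_def)
    obtain z where z: "z \<in> R" "y i = \<kappa> (y i) + of_nat p * z" using \<kappa>[OF yR(1)] by blast
    obtain z' where z': "z' \<in> R" "y' i = \<kappa> (y' i) + of_nat p * z'" using \<kappa>[OF yR(2)] by blast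
    have "y i - y' i = (\<kappa> (y i) + of_nat p * z) - (\<kappa> (y' i) + of_nat p * z')"
      using z(2) z'(2) by argo
    ultimately have "y i - y' i = of_nat p ^ 1 * (z - z')" by (simp add: right_diff_distrib)
    moreover have "z - z' \<in> R" using z z' by (intro sr_diff[OF R])
    ultimately
    show "y i - y' i \<in> pideal p R 1" unfolding pideal_def by blast
  qed
  ultimately show ?thesis by blast
qed

lemma pts_collision:
  assumes "\<And>j. f j \<in> pts"
  obtains i j :: nat where "i < j" "j \<le> S" "cg (f i) (f j)"
proof -
  obtain code :: "('v \<Rightarrow> 'a) \<Rightarrow> 'v \<Rightarrow> 'a" and C where C: "finite C" "card C \<le> S" "\<forall>y\<in>pts. code y \<in> C"
    "\<forall>y\<in>pts. \<forall>y'\<in>pts. code y = code y' \<longrightarrow> cg y y'" using coding by blast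
  obtain i j where "i < j" "j \<le> S" "code (f i) = code (f j)"
    using pigeonhole_le[OF C(1,2), of "\<lambda>j. code (f j)"] C(3) assms by blast
  with C(4) assms that show ?thesis by blast
qed

lemma cg_refl: "cg y y"
  by (simp add: cg_def pideal_zero[OF R])

lemma cg_sym: "cg y y' \<Longrightarrow> cg y' y"
  unfolding cg_def using pideal_uminus[OF R] by fastforce

lemma cg_trans: "cg y y' \<Longrightarrow> cg y' y'' \<Longrightarrow> cg y y''"
  unfolding cg_def using pideal_add[OF R] by fastforce

text \<open>The shape of a polynomial map on a residue disc after division by \<open>p\<close>:
  affine mod \<open>p\<close> with a polynomial error. Affineness matters because an affine map that
  is the identity on all residues is so coefficientwise, whereas y^p agrees with y on the integers
  mod \<open>p\<close> without being the same polynomial.\<close>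

definition paffine :: "(('v \<Rightarrow> 'a) \<Rightarrow> 'v \<Rightarrow> 'a) \<Rightarrow> bool" where
  "paffine \<Phi> \<longleftrightarrow> (\<exists>b d r. \<forall>i\<in>I. b i \<in> R \<and> (\<forall>v\<in>I. d i v \<in> R) \<and> r i \<in> pexps I R \<and>
     (\<forall>y. \<Phi> y i = b i + (\<Sum>v\<in>I. d i v * y v) + of_nat p * peval y (r i)))"

lemma paffine_pexp:
  assumes "paffine \<Phi>"
  obtains e where "\<And>i. i \<in> I \<Longrightarrow> e i \<in> pexps I R" "\<And>i y. i \<in> I \<Longrightarrow> \<Phi> y i = peval y (e i)"
proof -
  obtain b d r where *: "\<And>i. i \<in> I \<Longrightarrow> b i \<in> R \<and> (\<forall>v\<in>I. d i v \<in> R) \<and> r i \<in> pexps I R \<and>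
     (\<forall>y. \<Phi> y i = b i + (\<Sum>v\<in>I. d i v * y v) + of_nat p * peval y (r i))"
    using assms unfolding paffine_def by blast
  have "\<forall>i\<in>I. \<exists>e. e \<in> pexps I R \<and> (\<forall>y. \<Phi> y i = peval y e)"
  proof
    fix i assume i: "i \<in> I"
    obtain f where f: "f \<in> pexps I R" "\<And>y. peval y f = (\<Sum>v\<in>I. d i v * y v)"
      using linear_pexp[OF I R, of "d i"] *[OF i] by blast
    have "PAdd (PAdd (PConst (b i)) f) (PMul (PConst (of_nat p)) (r i)) \<in> pexps I R"
      using *[OF i] f pR by simp
    moreover have "\<Phi> y i = peval y (PAdd (PAdd (PConst (b i)) f) (PMul (PConst (of_nat p)) (r i)))" for y
      using *[OF i] f by simp
    ultimately show "\<exists>e. e \<in> pexps I R \<and> (\<forall>y. \<Phi> y i = peval y e)" by blast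
  qed
  then obtain e where "\<forall>i\<in>I. e i \<in> pexps I R \<and> (\<forall>y. \<Phi> y i = peval y (e i))" by metis
  with that show ?thesis by blast
qed

lemma paffine_pts: "paffine \<Phi> \<Longrightarrow> y \<in> pts \<Longrightarrow> \<Phi> y \<in> pts"
  by (erule paffine_pexp) (auto simp: pts_def intro: peval_in[OF R])

lemma paffine_cg: "paffine \<Phi> \<Longrightarrow> y \<in> pts \<Longrightarrow> y' \<in> pts \<Longrightarrow> cg y y' \<Longrightarrow> cg (\<Phi> y) (\<Phi> y')"
proof (erule paffine_pexp)
  fix e assume *: "y \<in> pts" "y' \<in> pts" "cg y y'" "\<And>i. i \<in> I \<Longrightarrow> e i \<in> pexps I R"
    "\<And>i y. i \<in> I \<Longrightarrow> \<Phi> y i = peval y (e i)"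
  have "peval y (e i) - peval y' (e i) \<in> pideal p R 1" if "i \<in> I" for i
    using *(1-3) by (intro peval_diff_in[OF R *(4)[OF that]]) (auto simp: pts_def cg_def)
  then show "cg (\<Phi> y) (\<Phi> y')" unfolding cg_def using *(5) by metis
qed

lemma paffine_id: "paffine (\<lambda>y. y)"
  unfolding paffine_def using I sr_zero[OF R] sr_one[OF R]
  by (intro exI[of _ "\<lambda>_. 0"] exI[of _ "\<lambda>i v. if i = v then 1 else 0"] exI[of _ "\<lambda>_. PConst 0"])
    (auto simp: if_distrib[of "\<lambda>x. x * _"] cong: if_cong)

lemma paffine_comp:
  assumes "paffine \<Psi>" "paffine \<Phi>" shows "paffine (\<lambda>y. \<Psi> (\<Phi> y))"
proof -
  obtain b d r where 1: "\<And>i. i \<in> I \<Longrightarrow> b i \<in> R \<and> (\<forall>v\<in>I. d i v \<in> R) \<and> r i \<in> pexps I R \<and>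
     (\<forall>y. \<Phi> y i = b i + (\<Sum>v\<in>I. d i v * y v) + of_nat p * peval y (r i))"
    using assms(2) unfolding paffine_def by blast
  obtain b' d' r' where 2: "\<And>i. i \<in> I \<Longrightarrow> b' i \<in> R \<and> (\<forall>v\<in>I. d' i v \<in> R) \<and> r' i \<in> pexps I R \<and>
     (\<forall>y. \<Psi> y i = b' i + (\<Sum>v\<in>I. d' i v * y v) + of_nat p * peval y (r' i))"
    using assms(1) unfolding paffine_def by blast
  obtain e where e: "\<And>i. i \<in> I \<Longrightarrow> e i \<in> pexps I R" "\<And>i y. i \<in> I \<Longrightarrow> \<Phi> y i = peval y (e i)"
    using paffine_pexp[OF assms(2)] by blast
  have "\<forall>i\<in>I. \<exists>f. f \<in> pexps I R \<and> (\<forall>y. peval y f = (\<Sum>v\<in>I. d' i v * peval y (r v)) + peval (\<Phi> y) (r' i))"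
  proof
    fix i assume i: "i \<in> I"
    have "\<exists>f\<in>pexps I R. \<forall>y. peval y f = (\<Sum>v\<in>I. peval y (PMul (PConst (d' i v)) (r v)))"
      using 1 2[OF i] by (intro sum_pexp I R) auto
    then obtain f where f: "f \<in> pexps I R" "\<And>y. peval y f = (\<Sum>v\<in>I. d' i v * peval y (r v))" by auto
    have "peval (\<Phi> y) (r' i) = peval y (psubst e (r' i))" for y
      unfolding peval_psubst using 2[OF i] e(2) by (intro peval_cong[of _ I R]) auto
    moreover have "psubst e (r' i) \<in> pexps I R" using 2[OF i] e(1) by (intro psubst_pexps[of _ I]) auto
    ultimately show "\<exists>f. f \<in> pexps I R \<and> (\<forall>y. peval y f = (\<Sum>v\<in>I. d' i v * peval y (r v)) + peval (\<Phi> y) (r' i))"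
      using f by (intro exI[of _ "PAdd f (psubst e (r' i))"]) auto
  qed
  then obtain f where f: "\<And>i. i \<in> I \<Longrightarrow> f i \<in> pexps I R"
    "\<And>i y. i \<in> I \<Longrightarrow> peval y (f i) = (\<Sum>v\<in>I. d' i v * peval y (r v)) + peval (\<Phi> y) (r' i)" by metis
  define b'' where "b'' i = b' i + (\<Sum>v\<in>I. d' i v * b v)" for i
  define d'' where "d'' i w = (\<Sum>v\<in>I. d' i v * d v w)" for i w
  have "b'' i \<in> R \<and> (\<forall>v\<in>I. d'' i v \<in> R) \<and> f i \<in> pexps I R \<and>
     (\<forall>y. \<Psi> (\<Phi> y) i = b'' i + (\<Sum>v\<in>I. d'' i v * y v) + of_nat p * peval y (f i))" if i: "i \<in> I" for i
  proof (intro conjI allI)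
    show "b'' i \<in> R" "\<forall>v\<in>I. d'' i v \<in> R" using 1 2 i
      by (auto simp: b''_def d''_def intro!: sr_add[OF R] sr_sum[OF R] sr_mult[OF R])
    fix y
    have "(\<Sum>v\<in>I. d' i v * \<Phi> y v) = (\<Sum>v\<in>I. d' i v * b v + (\<Sum>w\<in>I. d' i v * d v w * y w) + of_nat p * (d' i v * peval y (r v)))"
      using 1 by (intro sum.cong refl) (simp add: sum_distrib_left algebra_simps)
    also have "\<dots> = (\<Sum>v\<in>I. d' i v * b v) + (\<Sum>w\<in>I. d'' i w * y w) + of_nat p * (\<Sum>v\<in>I. d' i v * peval y (r v))"
      unfolding sum.distrib d''_def sum_distrib_right sum_distrib_left by (subst (2) sum.swap) simp
    finally show "\<Psi> (\<Phi> y) i = b'' i + (\<Sum>v\<in>I. d'' i v * y v) + of_nat p * peval y (f i)"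
      using 2[OF i] f(2)[OF i, of y] by (simp add: b''_def algebra_simps)
  qed (rule f(1)[OF i])
  then show ?thesis unfolding paffine_def by blast
qed

lemma paffine_funpow: "paffine \<Phi> \<Longrightarrow> paffine (\<Phi> ^^ n)"
proof (induction n)
  case 0
  show ?case using paffine_id by (simp add: id_def)
next
  case (Suc n)
  then show ?case using paffine_comp[of \<Phi> "\<Phi> ^^ n"] by (simp add: o_def)
qed

definition pinj :: "(('v \<Rightarrow> 'a) \<Rightarrow> 'v \<Rightarrow> 'a) \<Rightarrow> bool" where
  "pinj \<Phi> \<longleftrightarrow> (\<forall>y\<in>pts. \<forall>y'\<in>pts. cg (\<Phi> y) (\<Phi> y') \<longrightarrow> cg y y')"

lemma funpow_pts: "paffine \<Phi> \<Longrightarrow> y \<in> pts \<Longrightarrow> (\<Phi> ^^ n) y \<in> pts"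
  using paffine_pts[OF paffine_funpow] .

text \<open>Injectivity mod \<open>p\<close> turns a collision of two iterates into a return to
  \<open>y\<close> itself after at most \<open>S\<close> steps. The return time divides
  \<open>fact S\<close>, so one exponent serves all points.\<close>

lemma funpow_fact_cg:
  assumes \<Phi>: "paffine \<Phi>" "pinj \<Phi>" and y: "y \<in> pts"
  shows "cg ((\<Phi> ^^ fact S) y) y"
proof -
  obtain i j where ij: "i < j" "j \<le> S" "cg ((\<Phi> ^^ i) y) ((\<Phi> ^^ j) y)"
    using pts_collision[of "\<lambda>j. (\<Phi> ^^ j) y"] funpow_pts[OF \<Phi>(1) y] by blast
  have cancel: "cg ((\<Phi> ^^ i) z) ((\<Phi> ^^ i) z') \<Longrightarrow> z \<in> pts \<Longrightarrow> z' \<in> pts \<Longrightarrow> cg z z'" for i z z'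
  proof (induction i)
    case (Suc i)
    then show ?case using \<Phi> funpow_pts[OF \<Phi>(1)] by (auto simp: pinj_def)
  qed auto
  define m where "m = j - i"
  have "j = i + m" using ij by (simp add: m_def)
  then have "(\<Phi> ^^ j) y = (\<Phi> ^^ i) ((\<Phi> ^^ m) y)" by (simp only: funpow_add comp_apply)
  then have m: "cg y ((\<Phi> ^^ m) y)" using cancel[of i y "(\<Phi> ^^ m) y"] ij y funpow_pts[OF \<Phi>(1) y] by simp
  have "m dvd fact S" using ij by (intro dvd_fact) (auto simp: m_def)
  then obtain q where q: "fact S = m * q" by auto
  have "cg ((\<Phi> ^^ (m * q)) y) y" for q
  proof (induction q)
    case 0
    then show ?case by (simp add: cg_refl)
  next
    case (Suc q)
    have "cg ((\<Phi> ^^ m) ((\<Phi> ^^ (m * q)) y)) ((\<Phi> ^^ m) y)"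
      by (rule paffine_cg[OF paffine_funpow[OF \<Phi>(1)] funpow_pts[OF \<Phi>(1) y] y Suc])
    then have "cg ((\<Phi> ^^ m) ((\<Phi> ^^ (m * q)) y)) y" using cg_sym[OF m] cg_trans by blast
    then show ?case by (simp add: funpow_add)
  qed
  then show ?thesis by (simp add: q)
qed

text \<open>Evaluation at 0 shows that the constant part is divisible by \<open>p\<close>,
  evaluation at the unit vectors that the linear part is the identity mod \<open>p\<close>. The
  whole deviation from the identity is therefore \<open>p\<close> times a polynomial map.\<close>

lemma paffine_cg_id:
  assumes \<Gamma>: "paffine \<Gamma>" "\<And>y. y \<in> pts \<Longrightarrow> cg (\<Gamma> y) y"
  obtains E where "\<And>i. i \<in> I \<Longrightarrow> E i \<in> pexps I R" "\<And>i y. i \<in> I \<Longrightarrow> \<Gamma> y i = y i + of_nat p * peval y (E i)"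
proof -
  obtain b d r where *: "\<And>i. i \<in> I \<Longrightarrow> b i \<in> R \<and> (\<forall>v\<in>I. d i v \<in> R) \<and> r i \<in> pexps I R \<and>
     (\<forall>y. \<Gamma> y i = b i + (\<Sum>v\<in>I. d i v * y v) + of_nat p * peval y (r i))"
    using \<Gamma>(1) unfolding paffine_def by blast
  have "\<forall>i\<in>I. \<exists>e. e \<in> pexps I R \<and> (\<forall>y. \<Gamma> y i = y i + of_nat p * peval y e)"
  proof
    fix i assume i: "i \<in> I"
    have pr: "of_nat p * peval y (r i) \<in> pideal p R 1" if "y \<in> pts" for y
      using that *[OF i] by (auto simp: pideal_def pts_def intro!: imageI peval_in[OF R])
    have 0: "(\<lambda>_. 0) \<in> pts" by (auto simp: pts_def sr_zero[OF R])
    have eq: "\<Gamma> y i = b i + (\<Sum>v\<in>I. d i v * y v) + of_nat p * peval y (r i)" for y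
      using *[OF i] by blast
    have "b i + of_nat p * peval (\<lambda>_. 0) (r i) \<in> pideal p R 1"
      using \<Gamma>(2)[OF 0] eq[of "\<lambda>_. 0"] i by (auto simp: cg_def)
    from pideal_diff[OF R this pr[OF 0]] have bi: "b i \<in> pideal p R 1" by simp
    have di: "d i v - (if v = i then 1 else 0) \<in> pideal p R 1" if v: "v \<in> I" for v
    proof -
      define y where "y = (\<lambda>w. if w = v then 1 else 0 :: 'a)"
      have y: "y \<in> pts" by (auto simp: pts_def y_def sr_zero[OF R] sr_one[OF R])
      have "(\<Sum>w\<in>I. d i w * y w) = d i v" using I v by (simp add: y_def if_distrib cong: if_cong)
      then have "b i + d i v + of_nat p * peval y (r i) - y i \<in> pideal p R 1"
        using \<Gamma>(2)[OF y] eq[of y] i by (auto simp: cg_def)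
      from pideal_diff[OF R pideal_diff[OF R this pr[OF y]] bi]
      show ?thesis using v by (auto simp: y_def algebra_simps)
    qed
    obtain b' where b': "b' \<in> R" "b i = of_nat p * b'" using bi by (auto simp: pideal_def)
    have "\<forall>v\<in>I. \<exists>d'. d' \<in> R \<and> d i v - (if v = i then 1 else 0) = of_nat p * d'"
      using di by (force simp: pideal_def)
    then obtain d' where d': "\<And>v. v \<in> I \<Longrightarrow> d' v \<in> R" "\<And>v. v \<in> I \<Longrightarrow> d i v = (if v = i then 1 else 0) + of_nat p * d' v"
      by (metis diff_eq_eq add.commute)
    obtain f where f: "f \<in> pexps I R" "\<And>y. peval y f = (\<Sum>v\<in>I. d' v * y v)"
      using linear_pexp[OF I R, of d'] d'(1) by blast
    have "\<Gamma> y i = y i + of_nat p * peval y (PAdd (PConst b') (PAdd f (r i)))" for y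
    proof -
      have "(\<Sum>v\<in>I. d i v * y v) = (\<Sum>v\<in>I. (if v = i then y v else 0) + of_nat p * (d' v * y v))"
        using d' by (intro sum.cong) (auto simp: algebra_simps)
      also have "\<dots> = y i + of_nat p * peval y f"
        using I i by (simp add: sum.distrib f sum_distrib_left)
      finally show ?thesis using *[OF i] b' by (simp add: algebra_simps)
    qed
    moreover have "PAdd (PConst b') (PAdd f (r i)) \<in> pexps I R" using b' f *[OF i] by simp
    ultimately show "\<exists>e. e \<in> pexps I R \<and> (\<forall>y. \<Gamma> y i = y i + of_nat p * peval y e)" by blast
  qed
  then obtain E where "\<forall>i\<in>I. E i \<in> pexps I R \<and> (\<forall>y. \<Gamma> y i = y i + of_nat p * peval y (E i))" by metis
  with that show ?thesis by blast
qed

text \<open>\<open>\<Gamma>\<close> moves every coordinate by \<open>p\<close> times a polynomial,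
  so composition with \<open>\<Gamma>\<close> changes every polynomial by \<open>p\<close> times a
  polynomial; the product case is a discrete Leibniz rule.\<close>

lemma difference_operator:
  assumes E: "\<And>i. i \<in> I \<Longrightarrow> E i \<in> pexps I R" "\<And>i y. i \<in> I \<Longrightarrow> \<Gamma> y i = y i + of_nat p * peval y (E i)"
  shows "e \<in> pexps I R \<Longrightarrow> \<exists>f\<in>pexps I R. \<forall>y. peval (\<Gamma> y) e = peval y e + of_nat p * peval y f"
proof (induction e)
  case (PConst c)
  show ?case by (intro bexI[of _ "PConst 0"]) (auto intro: sr_zero[OF R])
next
  case (PVar i)
  then show ?case using E by (intro bexI[of _ "E i"]) auto
next
  case (PAdd e e')
  then obtain f f' where "f \<in> pexps I R" "f' \<in> pexps I R"
    "\<And>y. peval (\<Gamma> y) e = peval y e + of_nat p * peval y f"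
    "\<And>y. peval (\<Gamma> y) e' = peval y e' + of_nat p * peval y f'" by auto
  then show ?case by (intro bexI[of _ "PAdd f f'"]) (auto simp: algebra_simps)
next
  case (PMul e e')
  then obtain f f' where "e \<in> pexps I R" "e' \<in> pexps I R" "f \<in> pexps I R" "f' \<in> pexps I R"
    "\<And>y. peval (\<Gamma> y) e = peval y e + of_nat p * peval y f"
    "\<And>y. peval (\<Gamma> y) e' = peval y e' + of_nat p * peval y f'" by auto
  then show ?case using pR
    by (intro bexI[of _ "PAdd (PAdd (PMul e f') (PMul f e')) (PMul (PConst (of_nat p)) (PMul f f'))"])
      (auto simp: algebra_simps)
qed

text \<open>Newton's forward difference formula with a factor \<open>q\<close> taken out of each
  difference.\<close>

lemma newton_forward:
  fixes s :: "nat \<Rightarrow> nat \<Rightarrow> 'b::comm_ring_1"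
  assumes "\<And>k l. s k (Suc l) = s k l + q * s (Suc k) l"
  shows "s n l = (\<Sum>k\<le>l. of_nat (l choose k) * q ^ k * s (n + k) 0)"
proof (induction l arbitrary: n)
  case (Suc l)
  let ?t = "\<lambda>k. q ^ k * s (n + k) 0"
  have "s n (Suc l) = (\<Sum>k\<le>l. of_nat (l choose k) * ?t k) + q * (\<Sum>k\<le>l. of_nat (l choose k) * q ^ k * s (Suc n + k) 0)"
    unfolding assms Suc.IH by (simp add: mult.assoc)
  also have "q * (\<Sum>k\<le>l. of_nat (l choose k) * q ^ k * s (Suc n + k) 0) = (\<Sum>k\<le>l. of_nat (l choose k) * ?t (Suc k))"
    by (simp add: sum_distrib_left algebra_simps)
  also have "(\<Sum>k\<le>l. of_nat (l choose k) * ?t k) = (\<Sum>k\<le>Suc l. of_nat (l choose k) * ?t k)"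
    by (simp add: binomial_eq_0)
  also have "\<dots> = ?t 0 + (\<Sum>k\<le>l. of_nat (l choose Suc k) * ?t (Suc k))" by (simp add: sum.atMost_Suc_shift del: sum.atMost_Suc)
  also have "\<dots> + (\<Sum>k\<le>l. of_nat (l choose k) * ?t (Suc k)) = ?t 0 + (\<Sum>k\<le>l. of_nat (Suc l choose Suc k) * ?t (Suc k))"
    by (simp add: sum.distrib distrib_right)
  also have "\<dots> = (\<Sum>k\<le>Suc l. of_nat (Suc l choose k) * ?t k)" by (simp add: sum.atMost_Suc_shift del: sum.atMost_Suc binomial_Suc_Suc)
  finally show ?case by (simp only: mult.assoc)
qed simp

text \<open>With \<open>\<delta>\<close> the difference operator divided by \<open>p\<close>, the
  k-th difference of the values along the orbit is \<open>p ^ k\<close> times an element of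
  \<open>R\<close>, as Hansel's argument requires.\<close>

lemma iterate_zeros:
  assumes \<Gamma>: "paffine \<Gamma>" "\<And>y. y \<in> pts \<Longrightarrow> cg (\<Gamma> y) y" and g: "g \<in> pexps I R" and y: "y \<in> pts"
    and inf: "infinite {l. peval ((\<Gamma> ^^ l) y) g = 0}"
  shows "peval ((\<Gamma> ^^ l) y) g = 0"
proof -
  obtain E where E: "\<And>i. i \<in> I \<Longrightarrow> E i \<in> pexps I R" "\<And>i y. i \<in> I \<Longrightarrow> \<Gamma> y i = y i + of_nat p * peval y (E i)"
    using paffine_cg_id[OF \<Gamma>] by blast
  have "\<forall>e\<in>pexps I R. \<exists>f. f \<in> pexps I R \<and> (\<forall>y. peval (\<Gamma> y) e = peval y e + of_nat p * peval y f)"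
    using difference_operator[OF E] by blast
  then obtain \<delta> where \<delta>: "\<And>e. e \<in> pexps I R \<Longrightarrow> \<delta> e \<in> pexps I R"
    "\<And>e y. e \<in> pexps I R \<Longrightarrow> peval (\<Gamma> y) e = peval y e + of_nat p * peval y (\<delta> e)" by metis
  have \<delta>k: "(\<delta> ^^ k) g \<in> pexps I R" for k by (induction k) (auto simp: g \<delta>)
  define s where "s k l = peval ((\<Gamma> ^^ l) y) ((\<delta> ^^ k) g)" for k l
  have "s k (Suc l) = s k l + of_nat p * s (Suc k) l" for k l
    using \<delta>(2)[OF \<delta>k] by (simp add: s_def)
  from newton_forward[of s, OF this, of 0] have *: "s 0 l = (\<Sum>k\<le>l. of_nat (l choose k) * of_nat p ^ k * s k 0)" for l
    by simp
  have "s k 0 \<in> R" for k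
    using y \<delta>k by (auto simp: s_def pts_def intro!: peval_in[OF R])
  moreover have "infinite {l. s 0 l = 0}" using inf by (simp add: s_def)
  ultimately have "s 0 l = 0"
    using zero_of_infinite_zeros[OF R p p3 ZP Krull *] by blast
  then show ?thesis by (simp add: s_def)
qed

context
  fixes F :: "'v \<Rightarrow> ('v, 'a) pexp" and x :: "nat \<Rightarrow> 'v \<Rightarrow> 'a"
  assumes F: "\<And>i. i \<in> I \<Longrightarrow> F i \<in> pexps I R" and x: "\<And>n. x n \<in> pts"
    and step: "\<And>n i. i \<in> I \<Longrightarrow> x (Suc n) i = peval (x n) (F i)"
    and inj: "\<And>n y y'. y \<in> pts \<Longrightarrow> y' \<in> pts \<Longrightarrow>
      (\<And>i. i \<in> I \<Longrightarrow> peval (\<lambda>v. x n v + of_nat p * y v) (F i) - peval (\<lambda>v. x n v + of_nat p * y' v) (F i)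
         \<in> pideal p R 2) \<Longrightarrow> cg y y'"
begin

text \<open>A point of the disc around \<open>x n\<close> is \<open>x n + p * y\<close>. Taylor's
  formula puts its image into the disc around \<open>x (Suc n)\<close>, and after division by
  \<open>p\<close> the quadratic remainder still carries a factor \<open>p\<close>, so the map of
  coordinates is affine mod \<open>p\<close>. Injectivity mod \<open>p ^ 2\<close> before the
  division becomes injectivity mod \<open>p\<close> after it.\<close>

lemma local_map: "\<exists>H. paffine H \<and> pinj H \<and>
  (\<forall>i\<in>I. \<forall>y. peval (\<lambda>v. x n v + of_nat p * y v) (F i) = x (Suc n) i + of_nat p * H y i)"
proof -
  have xn: "x n v \<in> R" if "v \<in> I" for v using x that by (auto simp: pts_def)
  have *: "\<forall>i\<in>I. \<exists>f. f \<in> pexps I R \<and> (\<forall>y. peval (\<lambda>v. x n v + of_nat p * y v) (F i) =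
    peval (x n) (F i) + of_nat p * (\<Sum>v\<in>I. peval (x n) (pder v (F i)) * y v) + (of_nat p)\<^sup>2 * peval y f)"
    using peval_taylor[OF R I pR, of "x n", OF xn F] by blast
  obtain f where f: "\<And>i. i \<in> I \<Longrightarrow> f i \<in> pexps I R"
    "\<And>i y. i \<in> I \<Longrightarrow> peval (\<lambda>v. x n v + of_nat p * y v) (F i) =
    peval (x n) (F i) + of_nat p * (\<Sum>v\<in>I. peval (x n) (pder v (F i)) * y v) + (of_nat p)\<^sup>2 * peval y (f i)"
    using bchoice[OF *] by blast
  define H where "H y i = 0 + (\<Sum>v\<in>I. peval (x n) (pder v (F i)) * y v) + of_nat p * peval y (f i)" for y i
  have "paffine H" unfolding paffine_def
    using f(1) F xn sr_zero[OF R]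
    by (intro exI[of _ "\<lambda>_. 0"] exI[of _ "\<lambda>i v. peval (x n) (pder v (F i))"] exI[of _ f])
      (auto simp: H_def intro!: peval_in[OF R] pder_pexps[OF R])
  moreover have H: "peval (\<lambda>v. x n v + of_nat p * y v) (F i) = x (Suc n) i + of_nat p * H y i" if "i \<in> I" for i y
    unfolding f(2)[OF that] step[OF that] H_def by (simp add: algebra_simps power2_eq_square)
  moreover have "pinj H" unfolding pinj_def
  proof (intro ballI impI)
    fix y y' assume y: "y \<in> pts" "y' \<in> pts" "cg (H y) (H y')"
    show "cg y y'"
    proof (rule inj[OF y(1,2)])
      fix i assume i: "i \<in> I"
      then obtain z where "z \<in> R" "H y i - H y' i = of_nat p * z" using y(3) by (auto simp: cg_def pideal_def)
      moreover from this have "(x (Suc n) i + of_nat p * H y i) - (x (Suc n) i + of_nat p * H y' i) = of_nat p ^ 2 * z"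
        by (simp add: power2_eq_square mult.assoc flip: right_diff_distrib)
      ultimately show "peval (\<lambda>v. x n v + of_nat p * y v) (F i) - peval (\<lambda>v. x n v + of_nat p * y' v) (F i) \<in> pideal p R 2"
        unfolding H[OF i] by (auto simp: pideal_def)
    qed
  qed
  ultimately show ?thesis by blast
qed

definition stepf :: "('v \<Rightarrow> 'a) \<Rightarrow> 'v \<Rightarrow> 'a" where
  "stepf y i = peval y (F i)"

lemma stepf_Suc: "(stepf ^^ Suc n) y i = peval ((stepf ^^ n) y) (F i)"
  by (simp add: stepf_def)

lemma stepf_cong: "(\<And>i. i \<in> I \<Longrightarrow> y i = y' i) \<Longrightarrow> i \<in> I \<Longrightarrow> (stepf ^^ n) y i = (stepf ^^ n) y' i"
proof (induction n arbitrary: i)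
  case (Suc n)
  have "peval ((stepf ^^ n) y) (F i) = peval ((stepf ^^ n) y') (F i)"
    by (rule peval_cong[OF F[OF Suc.prems(2)] Suc.IH[OF Suc.prems(1)]])
  then show ?case by (simp only: stepf_Suc)
qed auto

lemma stepf_orbit: "i \<in> I \<Longrightarrow> (stepf ^^ n) (x a) i = x (a + n) i"
proof (induction n arbitrary: i)
  case (Suc n)
  have "peval ((stepf ^^ n) (x a)) (F i) = peval (x (a + n)) (F i)"
    by (rule peval_cong[OF F[OF Suc.prems] Suc.IH])
  then show ?case using step[OF Suc.prems] by (simp only: stepf_Suc add_Suc_right)
qed auto

lemma iterated_local_map: "\<exists>H. paffine H \<and> pinj H \<and>
  (\<forall>i\<in>I. \<forall>y. (stepf ^^ N) (\<lambda>v. x a v + of_nat p * y v) i = x (a + N) i + of_nat p * H y i)"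
proof (induction N)
  case 0
  show ?case using paffine_id by (intro exI[of _ "\<lambda>y. y"]) (auto simp: pinj_def)
next
  case (Suc N)
  then obtain H where H: "paffine H" "pinj H" "\<And>i y. i \<in> I \<Longrightarrow>
    (stepf ^^ N) (\<lambda>v. x a v + of_nat p * y v) i = x (a + N) i + of_nat p * H y i" by blast
  obtain H' where H': "paffine H'" "pinj H'" "\<And>i y. i \<in> I \<Longrightarrow>
    peval (\<lambda>v. x (a + N) v + of_nat p * y v) (F i) = x (Suc (a + N)) i + of_nat p * H' y i"
    using local_map by blast
  have "pinj (\<lambda>y. H' (H y))"
    using H H' paffine_pts unfolding pinj_def by blast
  moreover have "(stepf ^^ Suc N) (\<lambda>v. x a v + of_nat p * y v) i = x (a + Suc N) i + of_nat p * H' (H y) i"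
    if "i \<in> I" for i y
  proof -
    have "peval ((stepf ^^ N) (\<lambda>v. x a v + of_nat p * y v)) (F i) =
        peval (\<lambda>v. x (a + N) v + of_nat p * H y v) (F i)"
      by (rule peval_cong[OF F[OF that] H(3)])
    then show ?thesis using H'(3)[OF that, of "H y"] by (simp only: stepf_Suc add_Suc_right)
  qed
  ultimately show ?case using paffine_comp[OF H'(1) H(1)] by blast
qed

text \<open>The residues of the orbit are only known to be eventually periodic. A collision within
  the first \<open>S + 1\<close> points bounds both the preperiod and the period by
  \<open>S\<close>.\<close>

lemma orbit_periodic_mod_p:
  assumes "a \<ge> S" shows "cg (x (a + fact S)) (x a)"
proof -
  have cs: "cg (x m) (x n) \<Longrightarrow> cg (x (m + k)) (x (n + k))" for m n k
  proof (induction k)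
    case (Suc k)
    show ?case unfolding cg_def
    proof
      fix i assume i: "i \<in> I"
      have "peval (x (m + k)) (F i) - peval (x (n + k)) (F i) \<in> pideal p R 1"
        using Suc x by (intro peval_diff_in[OF R F[OF i]]) (auto simp: cg_def pts_def)
      then show "x (m + Suc k) i - x (n + Suc k) i \<in> pideal p R 1" using step[OF i] by simp
    qed
  qed auto
  obtain i j where ij: "i < j" "j \<le> S" "cg (x i) (x j)" using pts_collision[of x] x by blast
  define m where "m = j - i"
  have 1: "cg (x n) (x (n + m))" if "n \<ge> i" for n
  proof -
    have "i + (n - i) = n" "j + (n - i) = n + m" using that ij by (simp_all add: m_def)
    then show ?thesis using cs[OF ij(3), of "n - i"] by simp
  qed
  have 2: "cg (x n) (x (n + m * q))" if "n \<ge> i" for n q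
  proof (induction q)
    case (Suc q)
    from cg_trans[OF Suc 1[of "n + m * q"]] that show ?case by (simp add: ac_simps)
  qed (simp add: cg_refl)
  have "m dvd fact S" using ij by (intro dvd_fact) (auto simp: m_def)
  then obtain q where "fact S = m * q" by auto
  then show ?thesis using 2[of a q] assms ij cg_sym by simp
qed

text \<open>After \<open>N = fact S\<close> steps the orbit is back in the residue class of
  \<open>x a\<close>, so the N-step map acts on one disc, and the translation \<open>T\<close>
  recentres it at \<open>x a\<close>. The resulting \<open>\<Phi>\<close> permutes the residues of
  the coordinate, and its N-th iterate is the identity mod \<open>p\<close>; hence the difference
  \<open>N * N\<close>.\<close>

lemma orbit_zeros:
  assumes a: "a \<ge> S" and g: "g \<in> pexps I R"
    and inf: "infinite {l. peval (x (a + fact S * fact S * l)) g = 0}"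
  shows "peval (x (a + fact S * fact S * l)) g = 0"
proof -
  define N :: nat where "N = fact S"
  obtain H where H: "paffine H" "pinj H" "\<And>i y. i \<in> I \<Longrightarrow>
    (stepf ^^ N) (\<lambda>v. x a v + of_nat p * y v) i = x (a + N) i + of_nat p * H y i"
    using iterated_local_map by blast
  have "\<forall>i\<in>I. \<exists>b. b \<in> R \<and> x (a + N) i = x a i + of_nat p * b"
    using orbit_periodic_mod_p[OF a] by (force simp: N_def cg_def pideal_def algebra_simps)
  then obtain b where b: "\<And>i. i \<in> I \<Longrightarrow> b i \<in> R" "\<And>i. i \<in> I \<Longrightarrow> x (a + N) i = x a i + of_nat p * b i"
    by metis
  define T where "T = (\<lambda>(y::'v \<Rightarrow> 'a) i. b i + y i)"
  have "paffine T" unfolding paffine_def T_def using b(1) I sr_zero[OF R] sr_one[OF R]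
    by (intro exI[of _ b] exI[of _ "\<lambda>i v. if i = v then 1 else 0"] exI[of _ "\<lambda>_. PConst 0"])
      (auto simp: if_distrib[of "\<lambda>x. x * _"] cong: if_cong)
  define \<Phi> where "\<Phi> y = T (H y)" for y
  have \<Phi>: "paffine \<Phi>" unfolding \<Phi>_def by (rule paffine_comp[OF \<open>paffine T\<close> H(1)])
  have \<Phi>i: "pinj \<Phi>" using H(2) by (auto simp: pinj_def \<Phi>_def T_def cg_def)
  have main: "(stepf ^^ N) (\<lambda>v. x a v + of_nat p * y v) i = x a i + of_nat p * \<Phi> y i" if "i \<in> I" for i y
    unfolding H(3)[OF that] b(2)[OF that] by (simp add: \<Phi>_def T_def distrib_left)
  have orb: "x (a + N * l) i = x a i + of_nat p * (\<Phi> ^^ l) (\<lambda>_. 0) i" if "i \<in> I" for i l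
    using that
  proof (induction l arbitrary: i)
    case (Suc l)
    have "x (a + N * Suc l) i = (stepf ^^ N) (x (a + N * l)) i"
      using stepf_orbit[OF Suc.prems, of N "a + N * l"] by (simp add: ac_simps)
    also have "\<dots> = (stepf ^^ N) (\<lambda>v. x a v + of_nat p * (\<Phi> ^^ l) (\<lambda>_. 0) v) i"
      by (intro stepf_cong Suc)
    also have "\<dots> = x a i + of_nat p * \<Phi> ((\<Phi> ^^ l) (\<lambda>_. 0)) i" by (rule main[OF Suc.prems])
    finally show ?case by simp
  qed auto
  define \<Gamma> where "\<Gamma> = \<Phi> ^^ N"
  have \<Gamma>: "paffine \<Gamma>" "\<And>y. y \<in> pts \<Longrightarrow> cg (\<Gamma> y) y"
    using paffine_funpow[OF \<Phi>] funpow_fact_cg[OF \<Phi> \<Phi>i] by (auto simp: \<Gamma>_def N_def)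
  define g' where "g' = psubst (\<lambda>v. PAdd (PConst (x a v)) (PMul (PConst (of_nat p)) (PVar v))) g"
  have g': "g' \<in> pexps I R" unfolding g'_def using g x pR
    by (intro psubst_pexps[of _ I]) (auto simp: pts_def)
  have val: "peval (x (a + N * N * l)) g = peval ((\<Gamma> ^^ l) (\<lambda>_. 0)) g'" for l
  proof -
    have "(\<Gamma> ^^ l) (\<lambda>_. 0) = (\<Phi> ^^ (N * l)) (\<lambda>_. 0)" by (simp add: \<Gamma>_def funpow_mult mult.commute)
    then show ?thesis unfolding g'_def peval_psubst
      using orb[of _ "N * l"] by (intro peval_cong[OF g]) (simp add: mult.assoc)
  qed
  have "peval ((\<Gamma> ^^ l) (\<lambda>_. 0)) g' = 0"
    using inf sr_zero[OF R]
    by (intro iterate_zeros[OF \<Gamma> g']) (auto simp: pts_def N_def[symmetric] val)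
  then show ?thesis by (simp add: N_def[symmetric] val)
qed

end

end


section \<open>Orbits of injective systems\<close>

definition specialisation :: "'a::field_char_0 set \<Rightarrow> ('a \<Rightarrow> 'a) \<Rightarrow> nat \<Rightarrow> nat \<Rightarrow> 'a set \<Rightarrow> bool" where
  "specialisation A \<phi> p D R \<longleftrightarrow> hom_on A \<phi> \<and> \<phi> ` A \<subseteq> R \<and> good_ring p D R \<and> p \<ge> 3"

lemma specialisation_subset: "specialisation B \<phi> p D R \<Longrightarrow> A \<subseteq> B \<Longrightarrow> specialisation A \<phi> p D R"
  unfolding specialisation_def using hom_on_subset by blast

text \<open>The point with coordinate \<open>y\<close> in the residue disc around the specialised
  centre.\<close>

definition near :: "('a \<Rightarrow> 'a) \<Rightarrow> nat \<Rightarrow> ('v \<Rightarrow> 'a::field_char_0) \<Rightarrow> ('v \<Rightarrow> 'a) \<Rightarrow> 'v \<Rightarrow> 'a" where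
  "near \<phi> p x y v = \<phi> (x v) + of_nat p * y v"

definition pev :: "('a \<Rightarrow> 'a) \<Rightarrow> ('v \<Rightarrow> 'a::field_char_0) \<Rightarrow> ('v, 'a) pexp \<Rightarrow> 'a" where
  "pev \<phi> z e = peval z (pmap (\<lambda>v. v) \<phi> e)"

text \<open>In all specialisations, the map with coordinates \<open>F\<close> is injective modulo \<open>p\<^sup>2\<close> on the residue
  disc of \<open>x\<close>.\<close>

definition near_inj :: "'a::field_char_0 set \<Rightarrow> 'v set \<Rightarrow> ('v \<Rightarrow> ('v, 'a) pexp) \<Rightarrow> ('v \<Rightarrow> 'a) \<Rightarrow> bool" where
  "near_inj A I F x \<longleftrightarrow> (\<forall>\<phi> p D R y y'. specialisation A \<phi> p D R \<longrightarrow> y ` I \<subseteq> R \<longrightarrow> y' ` I \<subseteq> R \<longrightarrow>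
     (\<forall>i\<in>I. pev \<phi> (near \<phi> p x y) (F i) - pev \<phi> (near \<phi> p x y') (F i) \<in> pideal p R 2) \<longrightarrow>
     (\<forall>i\<in>I. y i - y' i \<in> pideal p R 1))"

lemma near_injD:
  assumes "near_inj A I F x" "specialisation A \<phi> p D R" "y ` I \<subseteq> R" "y' ` I \<subseteq> R"
    "\<forall>i\<in>I. pev \<phi> (near \<phi> p x y) (F i) - pev \<phi> (near \<phi> p x y') (F i) \<in> pideal p R 2"
  shows "\<forall>i\<in>I. y i - y' i \<in> pideal p R 1"
  by (rule near_inj_def[THEN iffD1, OF assms(1), THEN spec[of _ \<phi>], THEN spec[of _ p], THEN spec[of _ D],
      THEN spec[of _ R], THEN spec[of _ y], THEN spec[of _ y'], THEN mp, OF assms(2), THEN mp, OF assms(3),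
      THEN mp, OF assms(4), THEN mp, OF assms(5)])

lemma near_inj_mono: assumes "near_inj A I F x" "A \<subseteq> B" shows "near_inj B I F x"
  unfolding near_inj_def
  by (intro allI impI near_injD[OF assms(1) specialisation_subset[OF _ assms(2)]])

text \<open>\<open>p\<close> and \<open>D\<close> are fixed before \<open>g\<close>, hence so is the
  common difference. If a value of \<open>g\<close> on the progression were nonzero, a
  specialisation preserving it would contradict \<open>orbit_zeros\<close>. The specialisations are
  asked to invert only \<open>h = 1\<close>, since the units that matter have their inverses in
  \<open>gen G\<close> already.\<close>

theorem etale_orbit_zeros:
  fixes G :: "'a::{field_char_0, alg_closed_field} set"
  assumes G: "finite G" and I: "finite I" and F: "\<And>i. i \<in> I \<Longrightarrow> F i \<in> pexps I (gen G)"
    and x: "\<And>n i. i \<in> I \<Longrightarrow> x n i \<in> gen G"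
    and step: "\<And>n i. i \<in> I \<Longrightarrow> x (Suc n) i = peval (x n) (F i)"
    and inj: "\<And>n. near_inj (gen G) I F (x n)"
  shows "\<exists>N\<ge>1. \<exists>j0. \<forall>g\<in>pexps I (gen G). \<forall>a\<ge>j0. infinite {l. peval (x (a + N * l)) g = 0} \<longrightarrow>
    (\<forall>l. peval (x (a + N * l)) g = 0)"
proof -
  let ?A = "gen G"
  note A = subring_gen[of G]
  have "1 \<in> ?A - {0}" using sr_one[OF A] by simp
  then obtain p D where p2: "p > 2" and spec: "\<And>y. y \<in> ?A - {0} \<Longrightarrow> \<exists>\<phi> R.
     hom_on ?A \<phi> \<and> \<phi> ` ?A \<subseteq> R \<and> good_ring p D (R :: 'a set) \<and> \<phi> y \<noteq> 0"
    using finite_has_specialisations[OF G] unfolding has_specialisations_def by meson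
  \<comment> \<open>This is the constant \<open>S\<close> of each instance of
    \<open>lattice_mod_p\<close> below; it involves neither \<open>\<phi>\<close> nor
    \<open>R\<close>.\<close>
  define T where "T = (p ^ D) ^ card I"
  show ?thesis
  proof (rule exI[of _ "fact T * fact T"], rule conjI[OF _ exI[of _ T]], simp add: Suc_le_eq,
      intro ballI allI impI)
    fix g a l assume g: "g \<in> pexps I ?A" and a: "T \<le> a"
      and inf: "infinite {l. peval (x (a + fact T * fact T * l)) g = 0}"
    show "peval (x (a + fact T * fact T * l)) g = 0"
    proof (rule ccontr)
      assume nz: "peval (x (a + fact T * fact T * l)) g \<noteq> 0"
      have gA: "peval (x n) g \<in> ?A" for n using g x by (intro peval_in[OF A])
      then obtain \<phi> R where \<phi>: "hom_on ?A \<phi>" "\<phi> ` ?A \<subseteq> R" and Rg: "good_ring p D (R :: 'a set)"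
        and \<phi>nz: "\<phi> (peval (x (a + fact T * fact T * l)) g) \<noteq> 0"
        using spec[of "peval (x (a + fact T * fact T * l)) g"] nz by blast
      interpret lattice_mod_p p D R I by unfold_locales (use Rg p2 I in auto)
      have spc: "specialisation ?A \<phi> p D R" using \<phi> Rg p2 by (simp add: specialisation_def)
      have S: "S = T" by (simp add: S_def T_def)
      define x' where "x' n v = \<phi> (x n v)" for n v
      define F' where "F' i = pmap (\<lambda>v. v) \<phi> (F i)" for i
      define g' where "g' = pmap (\<lambda>v. v) \<phi> g"
      have val: "\<phi> (peval (x n) e) = peval (x' n) (pmap (\<lambda>v. v) \<phi> e)" if "e \<in> pexps I ?A" for e n
        unfolding x'_def using that x by (intro peval_hom[OF A \<phi>(1)])
      have "peval (x' (a + fact T * fact T * l)) g' = 0"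
        unfolding S[symmetric]
      proof (rule orbit_zeros[of F' x'])
        show "F' i \<in> pexps I R" if "i \<in> I" for i
          unfolding F'_def using F[OF that] \<phi>(2) by (rule pmap_pexps)
        show "x' n \<in> pts" for n using x \<phi>(2) by (auto simp: pts_def x'_def)
        show "x' (Suc n) i = peval (x' n) (F' i)" if "i \<in> I" for n i
          unfolding F'_def using val[OF F[OF that], of n] step[OF that] by (simp add: x'_def)
        show "g' \<in> pexps I R" unfolding g'_def using g \<phi>(2) by (rule pmap_pexps)
        show "infinite {l. peval (x' (a + fact S * fact S * l)) g' = 0}"
        proof (rule infinite_super[OF _ inf], safe)
          fix l assume "peval (x (a + fact T * fact T * l)) g = 0"
          then show "peval (x' (a + fact S * fact S * l)) g' = 0"
            using val[OF g] hom_on_zero[OF A \<phi>(1)] by (metis g'_def S)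
        qed
      next
        fix n y y' assume "y \<in> pts" "y' \<in> pts" and
          d: "\<And>i. i \<in> I \<Longrightarrow> peval (\<lambda>v. x' n v + of_nat p * y v) (F' i) -
            peval (\<lambda>v. x' n v + of_nat p * y' v) (F' i) \<in> pideal p R 2"
        then have "y ` I \<subseteq> R" "y' ` I \<subseteq> R" by (auto simp: pts_def)
        moreover have "\<forall>i\<in>I. pev \<phi> (near \<phi> p (x n) y) (F i) - pev \<phi> (near \<phi> p (x n) y') (F i) \<in> pideal p R 2"
          using d by (auto simp: pev_def near_def[abs_def] x'_def F'_def)
        ultimately show "cg y y'" unfolding cg_def by (rule near_injD[OF inj spc])
      qed (use a S in auto)
      with \<phi>nz val[OF g] show False by (simp add: g'_def)
    qed
  qed
qed

section \<open>Sums, renamings and sizes of expressions\<close>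

primrec psum :: "nat \<Rightarrow> (nat \<Rightarrow> ('v, 'a::zero) pexp) \<Rightarrow> ('v, 'a) pexp" where
  "psum 0 e = PConst 0"
| "psum (Suc n) e = PAdd (psum n e) (e n)"

lemma peval_psum [simp]: "peval x (psum n e) = (\<Sum>i<n. peval x (e i))"
  by (induction n) auto

lemma psum_pexps: "subring_set A \<Longrightarrow> (\<And>i. i < n \<Longrightarrow> e i \<in> pexps I A) \<Longrightarrow> psum n e \<in> pexps I A"
  by (induction n) (auto intro: sr_zero)

lemma pmap_psum: "\<phi> 0 = 0 \<Longrightarrow> pmap (\<lambda>v. v) \<phi> (psum n e) = psum n (\<lambda>i. pmap (\<lambda>v. v) \<phi> (e i))"
  by (induction n) auto

lemma pmap_ppow: "\<phi> 1 = 1 \<Longrightarrow> pmap (\<lambda>v. v) \<phi> (ppow e n) = ppow (pmap (\<lambda>v. v) \<phi> e) n"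
  by (induction n) auto

definition prename :: "('v \<Rightarrow> 'w) \<Rightarrow> ('v, 'a) pexp \<Rightarrow> ('w, 'a) pexp" where
  "prename \<iota> = psubst (\<lambda>v. PVar (\<iota> v))"

lemma peval_prename [simp]: "peval x (prename \<iota> e) = peval (\<lambda>v. x (\<iota> v)) e"
  by (simp add: prename_def peval_psubst)

lemma prename_pexps: "e \<in> pexps I A \<Longrightarrow> \<iota> ` I \<subseteq> J \<Longrightarrow> prename \<iota> e \<in> pexps J A"
  unfolding prename_def by (rule psubst_pexps) auto

lemma pmap_prename: "pmap (\<lambda>v. v) \<phi> (prename \<iota> e) = prename \<iota> (pmap (\<lambda>v. v) \<phi> e)"
  unfolding prename_def by (induction e) auto

text \<open>Degree and logarithmic height are additive under products, so a fixed expression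
  enlarges sizes by a constant factor. The condition \<open>s \<ge> 1\<close> allows additive
  constants to be absorbed into \<open>K * s\<close>.\<close>

lemma sz_peval:
  assumes "e \<in> pexps I (gen G)"
  shows "\<exists>K. \<forall>x s. s \<ge> 1 \<longrightarrow> (\<forall>v\<in>I. sz G s (2 ^ s) (x v)) \<longrightarrow> sz G (K * s) (2 ^ (K * s)) (peval x e)"
  using assms
  proof (induction e)
    case (PConst c)
    then obtain K where K: "sz G K (2 ^ K) c" using finite_sz_common[of "{c}" G] by auto
    have "sz G (K * s) (2 ^ (K * s)) c" if "s \<ge> 1" for s
      using K that by (elim sz_mono) (auto intro!: power_increasing)
    then show ?case by auto
  next
    case (PVar v)
    then show ?case by (intro exI[of _ 1]) auto
  next
    case (PAdd e f)
    then obtain K L where K: "\<And>x s. s \<ge> 1 \<Longrightarrow> \<forall>v\<in>I. sz G s (2 ^ s) (x v) \<Longrightarrow> sz G (K * s) (2 ^ (K * s)) (peval x e)"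
      and L: "\<And>x s. s \<ge> 1 \<Longrightarrow> \<forall>v\<in>I. sz G s (2 ^ s) (x v) \<Longrightarrow> sz G (L * s) (2 ^ (L * s)) (peval x f)"
      by auto
    have "sz G ((K + L + 1) * s) (2 ^ ((K + L + 1) * s)) (peval x (PAdd e f))"
      if s: "s \<ge> 1" and x: "\<forall>v\<in>I. sz G s (2 ^ s) (x v)" for x s
    proof -
      let ?M = "(K + L) * s"
      have "sz G ?M (2 ^ ?M) (peval x e)" "sz G ?M (2 ^ ?M) (peval x f)"
        by (rule sz_mono[OF K[OF s x]] sz_mono[OF L[OF s x]]; auto intro: power_increasing simp: algebra_simps)+
      then have "sz G ?M (2 ^ ?M + 2 ^ ?M) (peval x (PAdd e f))" by (auto intro: sz_add)
      moreover have "2 ^ ?M + 2 ^ ?M = (2::nat) ^ (?M + 1)" by simp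
      moreover have "?M + 1 \<le> (K + L + 1) * s" using s by (simp add: algebra_simps)
      ultimately show ?thesis by (auto elim!: sz_mono simp del: power_Suc intro: power_increasing)
    qed
    then show ?case by blast
  next
    case (PMul e f)
    then obtain K L where K: "\<And>x s. s \<ge> 1 \<Longrightarrow> \<forall>v\<in>I. sz G s (2 ^ s) (x v) \<Longrightarrow> sz G (K * s) (2 ^ (K * s)) (peval x e)"
      and L: "\<And>x s. s \<ge> 1 \<Longrightarrow> \<forall>v\<in>I. sz G s (2 ^ s) (x v) \<Longrightarrow> sz G (L * s) (2 ^ (L * s)) (peval x f)"
      by auto
    have "sz G ((K + L) * s) (2 ^ ((K + L) * s)) (peval x (PMul e f))"
      if s: "s \<ge> 1" and x: "\<forall>v\<in>I. sz G s (2 ^ s) (x v)" for x s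
      using sz_mult[OF K[OF s x] L[OF s x]] by (simp add: distrib_right power_add)
    then show ?case by blast
  qed

lemma pideal_cancel:
  assumes "p > 0" "of_nat p * x \<in> pideal p (R :: 'a::field_char_0 set) (Suc j)"
  shows "x \<in> pideal p R j"
  using assms by (auto simp: pideal_def mult.assoc)

lemma pideal_unit:
  fixes R :: "'a::field_char_0 set"
  assumes "subring_set R" "x * u \<in> pideal p R j" "v \<in> R" "u * v = 1"
  shows "x \<in> pideal p R j"
  using pideal_mult2[OF assms(1,3,2)] assms(4) by (simp add: mult.assoc)

text \<open>The skew product as a system in the variables \<open>Inl\<close> (base), \<open>Inr j\<close> for \<open>j < r\<close> (fibre) and
  \<open>Inr r\<close> (scalar); \<open>CE\<close> describes the scalar coordinate.\<close>

definition sysF :: "nat \<Rightarrow> ('b \<Rightarrow> ('b, 'a::comm_ring_1) pexp) \<Rightarrow> (nat \<Rightarrow> nat \<Rightarrow> ('b, 'a) pexp) \<Rightarrow>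
    ('b + nat, 'a) pexp \<Rightarrow> 'b + nat \<Rightarrow> ('b + nat, 'a) pexp" where
  "sysF r TE ME CE v = (case v of Inl b \<Rightarrow> prename Inl (TE b)
     | Inr j \<Rightarrow> if j < r then psum r (\<lambda>l. PMul (prename Inl (ME j l)) (PVar (Inr l))) else CE)"

text \<open>The system is triangular. The base yields congruence of the base coordinates mod
  \<open>p\<close>; the corresponding points of the disc then agree mod \<open>p ^ 2\<close>, and so
  do the matrix entries. What remains of the fibre equations mod \<open>p\<close> is the matrix at
  the centre applied to the fibre differences, and \<open>N\<close> inverts it. The scalar
  coordinate is left to the hypothesis \<open>CE\<close>, so that different scalar rules can be
  plugged in.\<close>

lemma sysF_near_inj:
  fixes A :: "'a::field_char_0 set"
  assumes A: "subring_set A"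
    and base: "near_inj A Ib TE (\<lambda>b. x (Inl b))"
    and ME: "\<And>j l. j < r \<Longrightarrow> l < r \<Longrightarrow> ME j l \<in> pexps Ib A"
    and x: "\<And>v. v \<in> Inl ` Ib \<union> Inr ` {..r} \<Longrightarrow> x v \<in> A"
    and N: "\<And>i j. i < r \<Longrightarrow> j < r \<Longrightarrow> N i j \<in> A"
    and NM: "\<And>i l. i < r \<Longrightarrow> l < r \<Longrightarrow> (\<Sum>j<r. N i j * peval (\<lambda>b. x (Inl b)) (ME j l)) = (if i = l then 1 else 0)"
    and CE: "\<And>\<phi> p D R y y'. specialisation A \<phi> p D R \<Longrightarrow> y ` (Inl ` Ib \<union> Inr ` {..r}) \<subseteq> R \<Longrightarrow>
      y' ` (Inl ` Ib \<union> Inr ` {..r}) \<subseteq> R \<Longrightarrow> \<forall>i\<in>Inl ` Ib \<union> Inr ` {..<r}. y i - y' i \<in> pideal p R 1 \<Longrightarrow>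
      pev \<phi> (near \<phi> p x y) CE - pev \<phi> (near \<phi> p x y') CE \<in> pideal p R 2 \<Longrightarrow>
      y (Inr r) - y' (Inr r) \<in> pideal p R 1"
  shows "near_inj A (Inl ` Ib \<union> Inr ` {..r}) (sysF r TE ME CE) x"
  unfolding near_inj_def
proof (intro allI impI)
  let ?I = "Inl ` Ib \<union> Inr ` {..r}"
  fix \<phi> p D R y y'
  assume sp: "specialisation A \<phi> p D R" and y: "y ` ?I \<subseteq> R" "y' ` ?I \<subseteq> R"
    and diff: "\<forall>i\<in>?I. pev \<phi> (near \<phi> p x y) (sysF r TE ME CE i) - pev \<phi> (near \<phi> p x y') (sysF r TE ME CE i) \<in> pideal p R 2"
  have \<phi>: "hom_on A \<phi>" "\<phi> ` A \<subseteq> R" and R: "subring_set R" and p: "p > 0"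
    using sp by (auto simp: specialisation_def good_ring_def)
  note \<phi>0 = hom_on_zero[OF A \<phi>(1)] and \<phi>1 = hom_on_one[OF A \<phi>(1)]
  have yR: "y v \<in> R" "y' v \<in> R" if "v \<in> ?I" for v using y that by auto
  have pR: "of_nat p \<in> R" by (rule sr_of_nat[OF R])
  have nR: "near \<phi> p x z v \<in> R" if "v \<in> ?I" "z ` ?I \<subseteq> R" for v z
    using that x \<phi>(2) by (auto simp: near_def intro!: sr_add[OF R] sr_mult[OF R] pR)
  have bd: "\<forall>b\<in>Ib. y (Inl b) - y' (Inl b) \<in> pideal p R 1"
  proof -
    have "\<forall>b\<in>Ib. pev \<phi> (near \<phi> p (\<lambda>b. x (Inl b)) (\<lambda>b. y (Inl b))) (TE b) -
      pev \<phi> (near \<phi> p (\<lambda>b. x (Inl b)) (\<lambda>b. y' (Inl b))) (TE b) \<in> pideal p R 2"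
    proof
      fix b assume "b \<in> Ib"
      then have "Inl b \<in> ?I" by auto
      from bspec[OF diff this] show "pev \<phi> (near \<phi> p (\<lambda>b. x (Inl b)) (\<lambda>b. y (Inl b))) (TE b) -
        pev \<phi> (near \<phi> p (\<lambda>b. x (Inl b)) (\<lambda>b. y' (Inl b))) (TE b) \<in> pideal p R 2"
        by (simp add: sysF_def pev_def pmap_prename near_def[abs_def])
    qed
    moreover have "(\<lambda>b. y (Inl b)) ` Ib \<subseteq> R" "(\<lambda>b. y' (Inl b)) ` Ib \<subseteq> R" using y by auto
    ultimately show ?thesis by (intro near_injD[OF base sp])
  qed
  define t where "t l = y (Inr l) - y' (Inr l)" for l
  define m where "m j l = pev \<phi> (\<lambda>b. near \<phi> p x y (Inl b)) (ME j l)" for j l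
  define m' where "m' j l = pev \<phi> (\<lambda>b. near \<phi> p x y' (Inl b)) (ME j l)" for j l
  define M where "M j l = peval (\<lambda>b. x (Inl b)) (ME j l)" for j l
  have tR: "t l \<in> R" if "l \<le> r" for l using yR that by (auto simp: t_def intro!: sr_diff[OF R])
  have MA: "M j l \<in> A" if "j < r" "l < r" for j l
    unfolding M_def using x ME[OF that] by (intro peval_in[OF A]) auto
  have MEp: "pmap (\<lambda>v. v) \<phi> (ME j l) \<in> pexps Ib R" if "j < r" "l < r" for j l
    using ME[OF that] \<phi>(2) by (rule pmap_pexps)
  have mm': "m j l - m' j l \<in> pideal p R 2" if "j < r" "l < r" for j l
    unfolding m_def m'_def pev_def
  proof (rule peval_diff_in[OF R MEp[OF that]])
    fix v assume v: "v \<in> Ib"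
    show "near \<phi> p x y (Inl v) \<in> R" "near \<phi> p x y' (Inl v) \<in> R" using nR y v by auto
    obtain z where "z \<in> R" "y (Inl v) - y' (Inl v) = of_nat p * z" using bd v by (auto simp: pideal_def)
    moreover from this have "near \<phi> p x y (Inl v) - near \<phi> p x y' (Inl v) = of_nat p ^ 2 * z"
      by (simp add: near_def power2_eq_square mult.assoc flip: right_diff_distrib)
    ultimately show "near \<phi> p x y (Inl v) - near \<phi> p x y' (Inl v) \<in> pideal p R 2" by (auto simp: pideal_def)
  qed
  have mM: "m j l - \<phi> (M j l) \<in> pideal p R 1" if "j < r" "l < r" for j l
  proof -
    have "\<phi> (M j l) = peval (\<lambda>b. \<phi> (x (Inl b))) (pmap (\<lambda>v. v) \<phi> (ME j l))"
      unfolding M_def using x ME[OF that] by (intro peval_hom[OF A \<phi>(1), where I = Ib]) auto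
    moreover have "m j l - peval (\<lambda>b. \<phi> (x (Inl b))) (pmap (\<lambda>v. v) \<phi> (ME j l)) \<in> pideal p R 1"
      unfolding m_def pev_def
    proof (rule peval_diff_in[OF R MEp[OF that]])
      fix v assume v: "v \<in> Ib"
      show "near \<phi> p x y (Inl v) \<in> R" "\<phi> (x (Inl v)) \<in> R" using nR y v x \<phi>(2) by auto
      show "near \<phi> p x y (Inl v) - \<phi> (x (Inl v)) \<in> pideal p R 1"
        using yR v by (auto simp: near_def pideal_def)
    qed
    ultimately show ?thesis by simp
  qed
  have wd: "t i \<in> pideal p R 1" if i: "i < r" for i
  proof -
    have row: "(\<Sum>l<r. \<phi> (M j l) * t l) \<in> pideal p R 1" if j: "j < r" for j
    proof -
      have "Inr j \<in> ?I" using j by auto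
      from bspec[OF diff this] have "(\<Sum>l<r. m j l * near \<phi> p x y (Inr l)) - (\<Sum>l<r. m' j l * near \<phi> p x y' (Inr l)) \<in> pideal p R 2"
        using j by (simp add: sysF_def pev_def pmap_psum[of \<phi>, OF \<phi>0] pmap_prename m_def m'_def)
      moreover have "(\<Sum>l<r. (m j l - m' j l) * near \<phi> p x y' (Inr l)) \<in> pideal p R 2"
        using mm' j nR y by (intro pideal_sum[OF R] pideal_mult2[OF R]) auto
      ultimately have "(\<Sum>l<r. m j l * near \<phi> p x y (Inr l)) - (\<Sum>l<r. m' j l * near \<phi> p x y' (Inr l)) -
        (\<Sum>l<r. (m j l - m' j l) * near \<phi> p x y' (Inr l)) \<in> pideal p R 2" by (rule pideal_diff[OF R])
      also have "(\<Sum>l<r. m j l * near \<phi> p x y (Inr l)) - (\<Sum>l<r. m' j l * near \<phi> p x y' (Inr l)) -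
        (\<Sum>l<r. (m j l - m' j l) * near \<phi> p x y' (Inr l)) = of_nat p * (\<Sum>l<r. m j l * t l)"
        by (simp add: sum_subtractf[symmetric] sum_distrib_left near_def t_def algebra_simps)
      finally have "(\<Sum>l<r. m j l * t l) \<in> pideal p R 1"
        using pideal_cancel[OF p, of _ R 1] by (simp add: numeral_2_eq_2)
      moreover have "(\<Sum>l<r. (m j l - \<phi> (M j l)) * t l) \<in> pideal p R 1"
        using mM j tR by (intro pideal_sum[OF R] pideal_mult2[OF R]) auto
      ultimately have "(\<Sum>l<r. m j l * t l) - (\<Sum>l<r. (m j l - \<phi> (M j l)) * t l) \<in> pideal p R 1"
        by (rule pideal_diff[OF R])
      then show ?thesis by (simp add: sum_subtractf[symmetric] algebra_simps)
    qed
    have "(\<Sum>j<r. \<phi> (N i j) * (\<Sum>l<r. \<phi> (M j l) * t l)) \<in> pideal p R 1"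
    proof (rule pideal_sum[OF R])
      fix j assume "j \<in> {..<r}"
      then show "\<phi> (N i j) * (\<Sum>l<r. \<phi> (M j l) * t l) \<in> pideal p R 1"
        using row N i \<phi>(2) by (intro pideal_mult[OF R]) auto
    qed
    also have "(\<Sum>j<r. \<phi> (N i j) * (\<Sum>l<r. \<phi> (M j l) * t l)) = (\<Sum>l<r. (\<Sum>j<r. \<phi> (N i j) * \<phi> (M j l)) * t l)"
      by (simp add: sum_distrib_left sum_distrib_right mult.assoc) (rule sum.swap)
    also have "\<dots> = (\<Sum>l<r. (if i = l then 1 else 0) * t l)"
    proof (intro sum.cong refl)
      fix l assume l: "l \<in> {..<r}"
      have "(\<Sum>j<r. \<phi> (N i j) * \<phi> (M j l)) = \<phi> (\<Sum>j<r. N i j * M j l)"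
        using N MA i l by (subst hom_on_sum[OF A \<phi>(1)]) (auto simp: hom_on_mult[OF A \<phi>(1)] intro: sr_mult[OF A])
      then show "(\<Sum>j<r. \<phi> (N i j) * \<phi> (M j l)) * t l = (if i = l then 1 else 0) * t l"
        using NM[of i l] i l by (simp add: M_def \<phi>0 \<phi>1)
    qed
    also have "\<dots> = t i" using i by (simp add: if_distrib[of "\<lambda>x. x * _"] cong: if_cong)
    finally show ?thesis .
  qed
  have JW: "\<forall>i\<in>Inl ` Ib \<union> Inr ` {..<r}. y i - y' i \<in> pideal p R 1"
    using bd wd by (auto simp: t_def)
  have "Inr r \<in> ?I" by auto
  from bspec[OF diff this] have "pev \<phi> (near \<phi> p x y) CE - pev \<phi> (near \<phi> p x y') CE \<in> pideal p R 2"
    by (simp add: sysF_def)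
  from CE[OF sp y JW this] JW show "\<forall>i\<in>?I. y i - y' i \<in> pideal p R 1"
    by (auto simp: le_less)
qed

text \<open>The derivative of \<open>c ^ d * P\<close> with respect to the scalar \<open>c\<close>
  is a unit by \<open>u\<close>. The other coordinates already agree mod \<open>p\<close>, so the
  two values of \<open>P\<close> agree mod \<open>p ^ 2\<close> and only the difference of the d-th
  powers matters.\<close>

lemma power_scalar_inj:
  fixes A :: "'a::field_char_0 set" and r :: nat
  assumes A: "subring_set A" and PE: "PE \<in> pexps (Inl ` Ib \<union> Inr ` {..<r}) A"
    and x: "\<And>v. v \<in> Inl ` Ib \<union> Inr ` {..r} \<Longrightarrow> x v \<in> A"
    and u: "u \<in> A" "of_nat d * x (Inr r) ^ (d - 1) * peval x PE * u = 1"
    and sp: "specialisation A \<phi> p D R" and y: "y ` (Inl ` Ib \<union> Inr ` {..r}) \<subseteq> R"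
      "y' ` (Inl ` Ib \<union> Inr ` {..r}) \<subseteq> R" and JW: "\<forall>i\<in>Inl ` Ib \<union> Inr ` {..<r}. y i - y' i \<in> pideal p R 1"
    and diff: "pev \<phi> (near \<phi> p x y) (PMul (ppow (PVar (Inr r)) d) PE) -
      pev \<phi> (near \<phi> p x y') (PMul (ppow (PVar (Inr r)) d) PE) \<in> pideal p R 2"
  shows "y (Inr r) - y' (Inr r) \<in> pideal p R 1"
proof -
  let ?I = "Inl ` Ib \<union> Inr ` {..r}" and ?J = "Inl ` Ib \<union> Inr ` {..<r}"
  have \<phi>: "hom_on A \<phi>" "\<phi> ` A \<subseteq> R" and R: "subring_set R" and p: "p > 0"
    using sp by (auto simp: specialisation_def good_ring_def)
  note \<phi>0 = hom_on_zero[OF A \<phi>(1)] and \<phi>1 = hom_on_one[OF A \<phi>(1)]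
  have JI: "?J \<subseteq> ?I" by (intro Un_mono image_mono) auto
  have yR: "y v \<in> R" "y' v \<in> R" if "v \<in> ?I" for v using y that by auto
  have pR: "of_nat p \<in> R" by (rule sr_of_nat[OF R])
  have nR: "near \<phi> p x z v \<in> R" if "v \<in> ?I" "z ` ?I \<subseteq> R" for v z
    using that x \<phi>(2) by (auto simp: near_def intro!: sr_add[OF R] sr_mult[OF R] pR)
  have PEp: "pmap (\<lambda>v. v) \<phi> PE \<in> pexps ?J R" using PE \<phi>(2) by (rule pmap_pexps)
  define q where "q = pev \<phi> (near \<phi> p x y) PE"
  define q' where "q' = pev \<phi> (near \<phi> p x y') PE"
  define C where "C = near \<phi> p x y (Inr r)"
  define C' where "C' = near \<phi> p x y' (Inr r)"
  define t where "t = y (Inr r) - y' (Inr r)"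
  have rI: "Inr r \<in> ?I" by auto
  have CR: "C \<in> R" "C' \<in> R" unfolding C_def C'_def using nR[OF rI] y by auto
  have tR: "t \<in> R" unfolding t_def using yR[OF rI] by (intro sr_diff[OF R])
  have qR: "q \<in> R" unfolding q_def pev_def
    using nR[OF _ y(1)] JI by (intro peval_in[OF R PEp]) auto
  have "q - q' \<in> pideal p R 2" unfolding q_def q'_def pev_def
  proof (rule peval_diff_in[OF R PEp])
    fix v assume v: "v \<in> ?J"
    with JI have vI: "v \<in> ?I" by blast
    show "near \<phi> p x y v \<in> R" "near \<phi> p x y' v \<in> R" by (rule nR[OF vI y(1)] nR[OF vI y(2)])+
    obtain z where "z \<in> R" "y v - y' v = of_nat p * z" using JW v by (auto simp: pideal_def)
    moreover from this have "near \<phi> p x y v - near \<phi> p x y' v = of_nat p ^ 2 * z"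
      by (simp add: near_def power2_eq_square mult.assoc flip: right_diff_distrib)
    ultimately show "near \<phi> p x y v - near \<phi> p x y' v \<in> pideal p R 2" by (auto simp: pideal_def)
  qed
  then have "C' ^ d * (q - q') \<in> pideal p R 2" by (intro pideal_mult[OF R] sr_power[OF R] CR)
  moreover have "C ^ d * q - C' ^ d * q' \<in> pideal p R 2"
    using diff by (simp add: pev_def pmap_ppow[of \<phi>, OF \<phi>1] C_def C'_def q_def q'_def)
  ultimately have "(C ^ d * q - C' ^ d * q') - C' ^ d * (q - q') \<in> pideal p R 2" using pideal_diff[OF R] by blast
  also have "(C ^ d * q - C' ^ d * q') - C' ^ d * (q - q') = (C ^ d - C' ^ d) * q" by (simp add: algebra_simps)
  also have "C ^ d - C' ^ d = (C - C') * (\<Sum>i<d. C' ^ (d - Suc i) * C ^ i)" by (rule power_diff_sumr2)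
  also have "C - C' = of_nat p * t" by (simp add: C_def C'_def near_def t_def algebra_simps)
  finally have 1: "t * ((\<Sum>i<d. C' ^ (d - Suc i) * C ^ i) * q) \<in> pideal p R 1"
    using pideal_cancel[OF p, of _ R 1] by (simp add: numeral_2_eq_2 mult.assoc)
  define \<gamma> where "\<gamma> = \<phi> (x (Inr r))"
  define \<pi> where "\<pi> = \<phi> (peval x PE)"
  have \<gamma>R: "\<gamma> \<in> R" unfolding \<gamma>_def using x \<phi>(2) by auto
  have C\<gamma>: "C - \<gamma> \<in> pideal p R 1" "C' - \<gamma> \<in> pideal p R 1"
    using yR[OF rI] by (auto simp: C_def C'_def near_def \<gamma>_def pideal_def)
  have pxA: "peval x PE \<in> A" using x JI by (intro peval_in[OF A PE]) auto
  have q\<pi>: "q - \<pi> \<in> pideal p R 1"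
  proof -
    have "\<pi> = peval (\<lambda>v. \<phi> (x v)) (pmap (\<lambda>v. v) \<phi> PE)"
      unfolding \<pi>_def using x JI by (intro peval_hom[OF A \<phi>(1) PE]) auto
    moreover have "q - peval (\<lambda>v. \<phi> (x v)) (pmap (\<lambda>v. v) \<phi> PE) \<in> pideal p R 1"
      unfolding q_def pev_def
    proof (rule peval_diff_in[OF R PEp])
      fix v assume v: "v \<in> ?J"
      with JI have vI: "v \<in> ?I" by blast
      show "near \<phi> p x y v \<in> R" "\<phi> (x v) \<in> R" using nR[OF vI y(1)] x[OF vI] \<phi>(2) by auto
      show "near \<phi> p x y v - \<phi> (x v) \<in> pideal p R 1"
        using yR[OF vI] by (auto simp: near_def pideal_def)
    qed
    ultimately show ?thesis by simp
  qed
  have pw: "a ^ i - b ^ i \<in> pideal p R 1" if "a \<in> R" "b \<in> R" "a - b \<in> pideal p R 1" for a b i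
    unfolding power_diff_sumr2 using that
    by (intro pideal_mult2[OF R] sr_sum[OF R] sr_mult[OF R] sr_power[OF R])
  \<comment> \<open>\<open>C\<close> and \<open>C'\<close> both reduce to \<open>\<gamma>\<close>
    mod \<open>p\<close>, so the divided difference of the d-th power reduces to its
    derivative.\<close>
  have "(\<Sum>i<d. C' ^ (d - Suc i) * C ^ i) - (\<Sum>i<d. \<gamma> ^ (d - Suc i) * \<gamma> ^ i) \<in> pideal p R 1"
    unfolding sum_subtractf[symmetric]
  proof (rule pideal_sum[OF R])
    fix i
    have "(C' ^ (d - Suc i) - \<gamma> ^ (d - Suc i)) * C ^ i + \<gamma> ^ (d - Suc i) * (C ^ i - \<gamma> ^ i) \<in> pideal p R 1"
      by (intro pideal_add[OF R] pideal_mult[OF R] pideal_mult2[OF R] pw sr_power[OF R] CR \<gamma>R C\<gamma>)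
    then show "C' ^ (d - Suc i) * C ^ i - \<gamma> ^ (d - Suc i) * \<gamma> ^ i \<in> pideal p R 1"
      by (simp add: algebra_simps)
  qed
  also have "(\<Sum>i<d. \<gamma> ^ (d - Suc i) * \<gamma> ^ i) = of_nat d * \<gamma> ^ (d - 1)"
    by (simp flip: power_add)
  finally have Z: "(\<Sum>i<d. C' ^ (d - Suc i) * C ^ i) - of_nat d * \<gamma> ^ (d - 1) \<in> pideal p R 1" .
  have "((\<Sum>i<d. C' ^ (d - Suc i) * C ^ i) - of_nat d * \<gamma> ^ (d - 1)) * q + of_nat d * \<gamma> ^ (d - 1) * (q - \<pi>) \<in> pideal p R 1"
    by (intro pideal_add[OF R] pideal_mult[OF R] pideal_mult2[OF R] Z q\<pi> qR sr_mult[OF R] sr_of_nat[OF R] sr_power[OF R] \<gamma>R)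
  then have "t * ((\<Sum>i<d. C' ^ (d - Suc i) * C ^ i) * q - of_nat d * \<gamma> ^ (d - 1) * \<pi>) \<in> pideal p R 1"
    using tR by (intro pideal_mult[OF R]) (simp_all add: algebra_simps)
  from pideal_diff[OF R 1 this] have 3: "t * (of_nat d * \<gamma> ^ (d - 1) * \<pi>) \<in> pideal p R 1"
    by (simp add: algebra_simps)
  have 4: "(of_nat d * \<gamma> ^ (d - 1) * \<pi>) * \<phi> u = 1"
  proof -
    have xr: "x (Inr r) \<in> A" using x rI by blast
    have "\<phi> (of_nat d * x (Inr r) ^ (d - 1) * peval x PE * u) = of_nat d * \<gamma> ^ (d - 1) * \<pi> * \<phi> u"
      using xr pxA u(1)
      by (simp add: hom_on_mult[OF A \<phi>(1)] hom_on_power[OF A \<phi>(1)] hom_on_of_nat[OF A \<phi>(1)]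
          sr_mult[OF A] sr_power[OF A] sr_of_nat[OF A] \<gamma>_def \<pi>_def)
    then show ?thesis using u(2) \<phi>1 by simp
  qed
  have "\<phi> u \<in> R" using u \<phi>(2) by auto
  from pideal_unit[OF R 3 this 4] show ?thesis by (simp only: t_def)
qed


section \<open>The skew product as a system\<close>

text \<open>\<open>(U n, w n)\<close> is the orbit of the linear skew product and \<open>c n\<close>
  the accumulated scalar. \<open>\<sigma> n\<close> bounds the size of the base point, and the
  factor \<open>n + 1\<close> in the growth condition pays for \<open>w n\<close>, to which
  \<open>n\<close> matrices have been applied. \<open>NV n\<close> inverts the matrix along the
  orbit; \<open>dinv\<close> inverts the factor \<open>d\<close> in the derivative of the d-th
  power.\<close>

locale skew_system =
  fixes G :: "'a::{field_char_0, alg_closed_field} set" and Ib :: "'b set"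
    and TE :: "'b \<Rightarrow> ('b, 'a) pexp" and U :: "nat \<Rightarrow> 'b \<Rightarrow> 'a" and r d :: nat
    and ME :: "nat \<Rightarrow> nat \<Rightarrow> ('b, 'a) pexp" and NV :: "nat \<Rightarrow> nat \<Rightarrow> nat \<Rightarrow> 'a"
    and PE :: "('b + nat, 'a) pexp" and w :: "nat \<Rightarrow> nat \<Rightarrow> 'a" and c :: "nat \<Rightarrow> 'a" and \<sigma> :: "nat \<Rightarrow> nat"
  assumes finG: "finite G" and finI: "finite Ib"
    and TE: "\<And>b. b \<in> Ib \<Longrightarrow> TE b \<in> pexps Ib (gen G)"
    and U: "\<And>n b. b \<in> Ib \<Longrightarrow> U n b \<in> gen G"
    and Ustep: "\<And>n b. b \<in> Ib \<Longrightarrow> U (Suc n) b = peval (U n) (TE b)"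
    and Uinj: "\<And>n. near_inj (gen G) Ib TE (U n)"
    and ME: "\<And>j l. j < r \<Longrightarrow> l < r \<Longrightarrow> ME j l \<in> pexps Ib (gen G)"
    and NV: "\<And>n i j. i < r \<Longrightarrow> j < r \<Longrightarrow> NV n i j \<in> gen G"
    and NM: "\<And>n i l. i < r \<Longrightarrow> l < r \<Longrightarrow>
      (\<Sum>j<r. NV n i j * peval (U n) (ME j l)) = (if i = l then 1 else 0)"
    and PE: "PE \<in> pexps (Inl ` Ib \<union> Inr ` {..<r}) (gen G)"
    and w0: "\<And>j. j < r \<Longrightarrow> w 0 j \<in> gen G"
    and wstep: "\<And>n j. j < r \<Longrightarrow> w (Suc n) j = (\<Sum>l<r. peval (U n) (ME j l) * w n l)"
    and c0: "c 0 = 1" and cstep: "\<And>n. c (Suc n) = c n ^ d * peval (case_sum (U n) (w n)) PE"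
    and d: "d \<ge> 2" and dinv: "\<exists>u\<in>gen G. of_nat d * u = (1::'a)"
    and \<sigma>: "mono \<sigma>" "\<And>n. \<sigma> n \<ge> 1" "(\<lambda>n. real ((n + 1) * \<sigma> n) / real d ^ n) \<longlonglongrightarrow> 0"
    and szU: "\<And>n b. b \<in> Ib \<Longrightarrow> sz G (\<sigma> n) (2 ^ \<sigma> n) (U n b)"
begin

abbreviation J :: "('b + nat) set" where "J \<equiv> Inl ` Ib \<union> Inr ` {..<r}"
abbreviation J' :: "('b + nat) set" where "J' \<equiv> Inl ` Ib \<union> Inr ` {..r}"
abbreviation X :: "nat \<Rightarrow> 'b + nat \<Rightarrow> 'a" where "X n \<equiv> case_sum (U n) (w n)"

text \<open>The coordinate \<open>Inr r\<close> holds a scalar sequence \<open>cc\<close> that is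
  left open: the same system is used with the constant 1 and with \<open>c\<close>.\<close>

definition Y :: "(nat \<Rightarrow> 'a) \<Rightarrow> nat \<Rightarrow> 'b + nat \<Rightarrow> 'a" where
  "Y cc n = case_sum (U n) (\<lambda>j. if j < r then w n j else cc n)"

lemma A: "subring_set (gen G)"
  by (rule subring_gen)

lemma JJ': "J \<subseteq> J'"
  by (intro Un_mono image_mono) auto

lemma w: "j < r \<Longrightarrow> w n j \<in> gen G"
proof (induction n arbitrary: j)
  case (Suc n)
  then show ?case unfolding wstep[OF Suc.prems]
    by (intro sr_sum[OF A] sr_mult[OF A] peval_in[OF A ME] U) auto
qed (rule w0)

lemma X: "v \<in> J \<Longrightarrow> X n v \<in> gen G"
  using U w by auto

lemma c: "c n \<in> gen G"
proof (induction n)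
  case (Suc n)
  then show ?case unfolding cstep
    by (intro sr_mult[OF A] sr_power[OF A] peval_in[OF A PE] X)
qed (simp add: c0 sr_one[OF A])

lemma Y_eq_X: "e \<in> pexps J B \<Longrightarrow> peval (Y cc n) e = peval (X n) e"
  by (erule peval_cong) (auto simp: Y_def)

text \<open>\<open>G'\<close> may exceed \<open>G\<close> because the case of a genuine scalar
  coordinate needs one more inverse in the ring.\<close>

lemma system_zeros:
  assumes G': "finite G'" "G \<subseteq> G'" and CE: "CE \<in> pexps J' (gen G')"
    and cc: "\<And>n. cc n \<in> gen G'" "\<And>n. cc (Suc n) = peval (Y cc n) CE"
    and inj: "\<And>\<phi> p D R y y' n. specialisation (gen G') \<phi> p D R \<Longrightarrow> y ` J' \<subseteq> R \<Longrightarrow>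
      y' ` J' \<subseteq> R \<Longrightarrow> \<forall>i\<in>J. y i - y' i \<in> pideal p R 1 \<Longrightarrow>
      pev \<phi> (near \<phi> p (Y cc n) y) CE - pev \<phi> (near \<phi> p (Y cc n) y') CE \<in> pideal p R 2 \<Longrightarrow>
      y (Inr r) - y' (Inr r) \<in> pideal p R 1"
  shows "\<exists>N\<ge>1. \<exists>j0. \<forall>g\<in>pexps J' (gen G'). \<forall>a\<ge>j0. infinite {l. peval (Y cc (a + N * l)) g = 0} \<longrightarrow>
    (\<forall>l. peval (Y cc (a + N * l)) g = 0)"
proof (rule etale_orbit_zeros[OF G'(1), where F = "sysF r TE ME CE"])
  note A' = subring_gen[of G']
  have sub: "gen G \<subseteq> gen G'" by (rule gen_mono[OF G'(2)])
  show "finite J'" using finI by simp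
  show "sysF r TE ME CE i \<in> pexps J' (gen G')" if i: "i \<in> J'" for i
  proof (cases i)
    case (Inl b)
    then have "b \<in> Ib" using i by auto
    then have "TE b \<in> pexps Ib (gen G')" using TE pexps_mono[OF _ order_refl sub] by blast
    then show ?thesis unfolding Inl by (simp add: sysF_def) (rule prename_pexps, auto)
  next
    case (Inr j)
    show ?thesis
    proof (cases "j < r")
      case True
      have "PMul (prename Inl (ME j l)) (PVar (Inr l)) \<in> pexps J' (gen G')" if "l < r" for l
        using prename_pexps[OF pexps_mono[OF ME[OF True that] order_refl sub], of Inl J'] that by auto
      with True show ?thesis unfolding Inr by (simp add: sysF_def psum_pexps[OF A'])
    qed (use Inr CE in \<open>simp add: sysF_def\<close>)
  qed
  show YA: "Y cc n i \<in> gen G'" if "i \<in> J'" for n i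
    using that subsetD[OF sub U] subsetD[OF sub w] cc(1) by (auto simp: Y_def)
  show "Y cc (Suc n) i = peval (Y cc n) (sysF r TE ME CE i)" if "i \<in> J'" for n i
    using that by (auto simp: Y_def sysF_def Ustep wstep cc(2))
  show "near_inj (gen G') J' (sysF r TE ME CE) (Y cc n)" for n
  proof (rule sysF_near_inj[OF A', where N = "NV n"])
    have eq: "(\<lambda>b. Y cc n (Inl b)) = U n" by (simp add: Y_def)
    show "near_inj (gen G') Ib TE (\<lambda>b. Y cc n (Inl b))"
      unfolding eq by (rule near_inj_mono[OF Uinj sub])
    show "ME j l \<in> pexps Ib (gen G')" if "j < r" "l < r" for j l
      by (rule pexps_mono[OF ME[OF that] order_refl sub])
    show "NV n i j \<in> gen G'" if "i < r" "j < r" for i j using NV[OF that] sub by blast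
    show "(\<Sum>j<r. NV n i j * peval (\<lambda>b. Y cc n (Inl b)) (ME j l)) = (if i = l then 1 else 0)"
      if "i < r" "l < r" for i l unfolding eq by (rule NM[OF that])
    show "Y cc n v \<in> gen G'" if "v \<in> J'" for v using that by (rule YA)
  qed (rule inj)
qed

text \<open>The scalar coordinate idles at 1 and is mapped identically, which is trivially injective
  on discs.\<close>

lemma base_zeros:
  "\<exists>N\<ge>1. \<exists>j0. \<forall>g\<in>pexps J (gen G). \<forall>a\<ge>j0. infinite {l. peval (X (a + N * l)) g = 0} \<longrightarrow>
    (\<forall>l. peval (X (a + N * l)) g = 0)"
proof -
  have "\<exists>N\<ge>1. \<exists>j0. \<forall>g\<in>pexps J' (gen G). \<forall>a\<ge>j0. infinite {l. peval (Y (\<lambda>_. 1) (a + N * l)) g = 0} \<longrightarrow>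
    (\<forall>l. peval (Y (\<lambda>_. 1) (a + N * l)) g = 0)"
  proof (rule system_zeros[OF finG order_refl])
    show "PVar (Inr r) \<in> pexps J' (gen G)" by simp
    show "1 \<in> gen G" by (rule sr_one[OF A])
    show "1 = peval (Y (\<lambda>_. 1) n) (PVar (Inr r))" for n by (simp add: Y_def)
    fix \<phi> p D n and R :: "'a set" and y y' :: "'b + nat \<Rightarrow> 'a"
    assume sp: "specialisation (gen G) \<phi> p D R" and
      *: "pev \<phi> (near \<phi> p (Y (\<lambda>_. 1) n) y) (PVar (Inr r)) - pev \<phi> (near \<phi> p (Y (\<lambda>_. 1) n) y') (PVar (Inr r)) \<in> pideal p R 2"
    have p: "p > 0" using sp by (auto simp: specialisation_def)
    have "of_nat p * (y (Inr r) - y' (Inr r)) \<in> pideal p R (Suc 1)"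
      using * by (simp add: pev_def near_def right_diff_distrib numeral_2_eq_2)
    then show "y (Inr r) - y' (Inr r) \<in> pideal p R 1" by (rule pideal_cancel[OF p])
  qed
  then obtain N j0 where N: "N \<ge> 1" and *: "\<And>g a l. g \<in> pexps J' (gen G) \<Longrightarrow> a \<ge> j0 \<Longrightarrow>
    infinite {l. peval (Y (\<lambda>_. 1) (a + N * l)) g = 0} \<Longrightarrow> peval (Y (\<lambda>_. 1) (a + N * l)) g = 0"
    by metis
  show ?thesis
  proof (rule exI[of _ N], rule conjI[OF N exI[of _ j0]], intro ballI allI impI)
    fix g a l assume g: "g \<in> pexps J (gen G)" and "a \<ge> j0" "infinite {l. peval (X (a + N * l)) g = 0}"
    moreover have "g \<in> pexps J' (gen G)" by (rule pexps_mono[OF g JJ' order_refl])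
    ultimately show "peval (X (a + N * l)) g = 0" using *[of g a l] by (simp add: Y_eq_X[OF g])
  qed
qed

lemma size_X:
  obtains K where "\<And>n v. v \<in> J \<Longrightarrow> sz G (K * ((n + 1) * \<sigma> n)) (2 ^ (K * ((n + 1) * \<sigma> n))) (X n v)"
proof -
  have "\<exists>K. \<forall>j<r. \<forall>l<r. \<forall>n. sz G (K * \<sigma> n) (2 ^ (K * \<sigma> n)) (peval (U n) (ME j l))"
  proof -
    have "\<forall>z\<in>{..<r} \<times> {..<r}. \<exists>K. \<forall>n. sz G (K * \<sigma> n) (2 ^ (K * \<sigma> n)) (peval (U n) (ME (fst z) (snd z)))"
    proof
      fix z assume z: "z \<in> {..<r} \<times> {..<r}"
      then have "ME (fst z) (snd z) \<in> pexps Ib (gen G)" using ME by auto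
      then obtain K where K: "\<forall>x s. s \<ge> 1 \<longrightarrow> (\<forall>v\<in>Ib. sz G s (2 ^ s) (x v)) \<longrightarrow>
        sz G (K * s) (2 ^ (K * s)) (peval x (ME (fst z) (snd z)))" using sz_peval by blast
      have "sz G (K * \<sigma> n) (2 ^ (K * \<sigma> n)) (peval (U n) (ME (fst z) (snd z)))" for n
        by (rule K[rule_format, OF \<sigma>(2) szU])
      then show "\<exists>K. \<forall>n. sz G (K * \<sigma> n) (2 ^ (K * \<sigma> n)) (peval (U n) (ME (fst z) (snd z)))" by blast
    qed
    from bchoice[OF this] obtain K where K: "\<And>z n. z \<in> {..<r} \<times> {..<r} \<Longrightarrow>
      sz G (K z * \<sigma> n) (2 ^ (K z * \<sigma> n)) (peval (U n) (ME (fst z) (snd z)))" by blast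
    have "sz G (sum K ({..<r} \<times> {..<r}) * \<sigma> n) (2 ^ (sum K ({..<r} \<times> {..<r}) * \<sigma> n)) (peval (U n) (ME j l))"
      if "j < r" "l < r" for j l n
    proof -
      have z: "(j, l) \<in> {..<r} \<times> {..<r}" using that by simp
      have "K (j, l) \<le> sum K ({..<r} \<times> {..<r})" using z by (intro member_le_sum) auto
      then show ?thesis using K[OF z, of n] by (auto elim!: sz_mono intro!: power_increasing mult_le_mono1)
    qed
    then show ?thesis by blast
  qed
  then obtain K where K: "\<And>j l n. j < r \<Longrightarrow> l < r \<Longrightarrow> sz G (K * \<sigma> n) (2 ^ (K * \<sigma> n)) (peval (U n) (ME j l))"
    by blast
  obtain s0 where s0: "\<And>y. y \<in> w 0 ` {..<r} \<Longrightarrow> sz G s0 (2 ^ s0) y"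
    using finite_sz_common[of "w 0 ` {..<r}" G] w0 by auto
  \<comment> \<open>Each of the \<open>n\<close> steps adds the size of a matrix entry, at most
    \<open>K * \<sigma> n\<close> by monotonicity, and \<open>r\<close> for the sum of
    \<open>r\<close> terms.\<close>
  define \<omega> where "\<omega> n = s0 + n * (K * \<sigma> n + r)" for n
  have szw: "sz G (\<omega> n) (2 ^ \<omega> n) (w n j)" if "j < r" for n j
    using that
  proof (induction n arbitrary: j)
    case 0
    then show ?case using s0 by (simp add: \<omega>_def)
  next
    case (Suc n)
    let ?s = "K * \<sigma> n + \<omega> n"
    have "sz G ?s (2 ^ (K * \<sigma> n) * 2 ^ \<omega> n) (peval (U n) (ME j l) * w n l)" if "l < r" for l
      by (intro sz_mult K Suc that)
    then have "sz G ?s (\<Sum>l<r. 2 ^ (K * \<sigma> n) * 2 ^ \<omega> n) (w (Suc n) j)"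
      unfolding wstep[OF Suc.prems] by (intro sz_sum) auto
    then have "sz G ?s (r * 2 ^ ?s) (w (Suc n) j)" by (simp add: power_add)
    moreover have "r * 2 ^ ?s \<le> 2 ^ (r + ?s)"
      unfolding power_add using less_exp[of r] by (intro mult_le_mono1) simp
    moreover have "r + ?s \<le> \<omega> (Suc n)"
    proof -
      have m: "\<sigma> n \<le> \<sigma> (Suc n)" using \<sigma>(1) by (simp add: mono_def)
      have "r + ?s = s0 + Suc n * (K * \<sigma> n + r)" by (simp add: \<omega>_def)
      also have "\<dots> \<le> s0 + Suc n * (K * \<sigma> (Suc n) + r)"
        using m by (intro add_left_mono mult_le_mono2 add_right_mono)
      finally show ?thesis by (simp only: \<omega>_def)
    qed
    ultimately show ?case
      by (elim sz_mono) (auto intro: order_trans[OF _ power_increasing])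
  qed
  define K' where "K' = s0 + K + r + 1"
  have le: "\<omega> n \<le> K' * ((n + 1) * \<sigma> n)" for n
  proof -
    let ?q = "(n + 1) * \<sigma> n"
    have "n \<le> ?q" "n * \<sigma> n \<le> ?q" "1 \<le> ?q"
      using \<sigma>(2)[of n] by (auto simp: Suc_le_eq) (metis Suc_le_eq le_add2 le_trans mult.right_neutral mult_le_mono2 One_nat_def)
    have "s0 \<le> s0 * ?q" using \<open>1 \<le> ?q\<close> by simp
    moreover have "n * (K * \<sigma> n) \<le> K * ?q" using mult_le_mono2[OF \<open>n * \<sigma> n \<le> ?q\<close>, of K] by (simp add: ac_simps)
    moreover have "n * r \<le> r * ?q" using mult_le_mono2[OF \<open>n \<le> ?q\<close>, of r] by (simp add: ac_simps)
    ultimately have "\<omega> n \<le> s0 * ?q + K * ?q + r * ?q"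
      unfolding \<omega>_def distrib_left by linarith
    then show ?thesis unfolding K'_def distrib_right by linarith
  qed
  have le2: "\<sigma> n \<le> K' * ((n + 1) * \<sigma> n)" for n
    by (simp add: K'_def)
  have "sz G (K' * ((n + 1) * \<sigma> n)) (2 ^ (K' * ((n + 1) * \<sigma> n))) (X n v)" if "v \<in> J" for n v
    using that
  proof
    assume "v \<in> Inl ` Ib"
    then obtain b where "v = Inl b" "b \<in> Ib" by auto
    then show ?thesis using sz_mono[OF szU le2 power_increasing[OF le2]] by simp
  next
    assume "v \<in> Inr ` {..<r}"
    then obtain j where "v = Inr j" "j < r" by auto
    then show ?thesis using sz_mono[OF szw le power_increasing[OF le]] by simp
  qed
  with that show ?thesis by blast
qed

text \<open>The value along the orbit of the nonlinear map of a polynomial with parts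
  \<open>f e\<close> of degree \<open>e\<close> in the fibre variables.\<close>

definition Q :: "nat \<Rightarrow> (nat \<Rightarrow> ('b + nat, 'a) pexp) \<Rightarrow> nat \<Rightarrow> 'a" where
  "Q E f n = (\<Sum>e\<le>E. c n ^ e * peval (X n) (f e))"

lemma c_eventually_zero:
  assumes "c m = 0" "m \<le> n" shows "c n = 0"
  using assms(2)
proof (induction n rule: dec_induct)
  case (step n)
  then show ?case using d by (simp add: cstep)
qed (rule assms(1))

text \<open>The value of \<open>P\<close> at time \<open>j\<close> enters \<open>c (Suc j)\<close>
  once, and each later step raises it to the d-th power.\<close>

lemma c_divisible:
  assumes "n > j"
  shows "\<exists>z\<in>gen G. c n = peval (X j) PE ^ (d ^ (n - Suc j)) * z"
proof -
  have "Suc j \<le> n" using assms by simp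
  then show ?thesis
  proof (induction n rule: dec_induct)
    case base
    show ?case using c[of j] by (intro bexI[of _ "c j ^ d"]) (auto simp: cstep intro: sr_power[OF A])
  next
    case (step n)
    then obtain z where z: "z \<in> gen G" "c n = peval (X j) PE ^ (d ^ (n - Suc j)) * z" by auto
    have "Suc n - Suc j = Suc (n - Suc j)" using step by simp
    then have "c (Suc n) = peval (X j) PE ^ (d ^ (Suc n - Suc j)) * (z ^ d * peval (X n) PE)"
      unfolding cstep z(2) by (simp add: power_mult_distrib power_mult[symmetric] mult.commute)
    moreover have "z ^ d * peval (X n) PE \<in> gen G"
      by (intro sr_mult[OF A] sr_power[OF A] z peval_in[OF A PE] X)
    ultimately show ?case by blast
  qed
qed

text \<open>If some value of \<open>P\<close> can be divided out only boundedly often, then \<open>c n\<close>, being divisible by a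
  doubly exponential power of it, eventually divides no nonzero value of the \<open>f e\<close>; hence all
  homogeneous parts vanish.\<close>

lemma homogeneous_parts_vanish:
  assumes cnz: "\<And>n. c n \<noteq> 0"
    and bm: "bounded_mult G 1 (peval (X j) PE)" and f: "\<And>e. e \<le> E \<Longrightarrow> f e \<in> pexps J (gen G)"
  obtains n0 where "\<And>n e. n \<ge> n0 \<Longrightarrow> Q E f n = 0 \<Longrightarrow> e \<le> E \<Longrightarrow> peval (X n) (f e) = 0"
proof -
  let ?y = "peval (X j) PE"
  obtain C where C: "\<And>s k i f z. f \<noteq> 0 \<Longrightarrow> sz G s (2 ^ s) f \<Longrightarrow> z \<in> gen G \<Longrightarrow>
      ?y ^ k * z = 1 ^ i * f \<Longrightarrow> k \<le> C * (s + 1)"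
    using bm unfolding bounded_mult_def by blast
  obtain K where K: "\<And>n v. v \<in> J \<Longrightarrow> sz G (K * ((n + 1) * \<sigma> n)) (2 ^ (K * ((n + 1) * \<sigma> n))) (X n v)"
    using size_X by blast
  have "\<forall>e\<in>{..E}. \<exists>L. \<forall>x s. s \<ge> 1 \<longrightarrow> (\<forall>v\<in>J. sz G s (2 ^ s) (x v)) \<longrightarrow>
      sz G (L * s) (2 ^ (L * s)) (peval x (f e))"
  proof
    fix e assume "e \<in> {..E}"
    then have "f e \<in> pexps J (gen G)" using f by auto
    then show "\<exists>L. \<forall>x s. s \<ge> 1 \<longrightarrow> (\<forall>v\<in>J. sz G s (2 ^ s) (x v)) \<longrightarrow> sz G (L * s) (2 ^ (L * s)) (peval x (f e))"
      by (rule sz_peval)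
  qed
  from bchoice[OF this] obtain L where L: "\<And>e x s. e \<le> E \<Longrightarrow> s \<ge> 1 \<Longrightarrow> \<forall>v\<in>J. sz G s (2 ^ s) (x v) \<Longrightarrow>
      sz G (L e * s) (2 ^ (L e * s)) (peval x (f e))" by (meson atMost_iff)
  define K1 where "K1 = sum L {..E} * (K + 1)"
  define q where "q n = (n + 1) * \<sigma> n" for n
  have q1: "q n \<ge> 1" for n using \<sigma>(2)[of n] by (simp add: q_def)
  have szf: "sz G (K1 * q n) (2 ^ (K1 * q n)) (peval (X n) (f e))" if e: "e \<le> E" for n e
  proof -
    have "sz G ((K + 1) * q n) (2 ^ ((K + 1) * q n)) (X n v)" if "v \<in> J" for v
      by (rule sz_mono[OF K[OF that, of n]]) (auto simp: q_def intro!: power_increasing)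
    then have "sz G (L e * ((K + 1) * q n)) (2 ^ (L e * ((K + 1) * q n))) (peval (X n) (f e))"
      using q1[of n] by (intro L e) auto
    moreover have "L e * ((K + 1) * q n) \<le> K1 * q n"
    proof -
      have "L e \<le> sum L {..E}" using e by (intro member_le_sum) auto
      then show ?thesis unfolding K1_def mult.assoc by (rule mult_le_mono1)
    qed
    ultimately show ?thesis by (elim sz_mono) (auto intro: power_increasing)
  qed
  \<comment> \<open>Chosen so that \<open>q n * B < d ^ n\<close> puts the largest admissible
    multiplicity below the forced one, \<open>d ^ (n - Suc j)\<close>; the final 1 keeps
    \<open>B\<close> positive.\<close>
  define B where "B = C * (K1 + 1) * d ^ Suc j + 1"
  have "0 < 1 / real B" by (simp add: B_def add_pos_nonneg)
  then have "\<forall>\<^sub>F n in sequentially. real (q n) / real d ^ n < 1 / real B"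
    unfolding q_def by (rule order_tendstoD(2)[OF \<sigma>(3)])
  then obtain n1 where n1: "\<And>n. n \<ge> n1 \<Longrightarrow> real (q n) / real d ^ n < 1 / real B"
    by (auto simp: eventually_sequentially)
  have small: "C * (K1 * q n + 1) < d ^ (n - Suc j)" if "n \<ge> n1" "n > j" for n
  proof -
    have "d > 0" using d by simp
    have "real B > 0" by (simp add: B_def add_pos_nonneg)
    then have "real (q n) * real B < real d ^ n"
      using n1[OF that(1)] \<open>d > 0\<close> by (simp add: field_simps)
    then have "real (q n * B) < real (d ^ n)" by simp
    then have 1: "q n * B < d ^ n" by (simp only: of_nat_less_iff)
    have "C * (K1 * q n + 1) \<le> C * ((K1 + 1) * q n)" using q1[of n] by (intro mult_le_mono2) simp
    then have "C * (K1 * q n + 1) * d ^ Suc j \<le> C * ((K1 + 1) * q n) * d ^ Suc j" by (rule mult_le_mono1)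
    also have "\<dots> \<le> q n * B" by (simp add: B_def algebra_simps)
    also have "\<dots> < d ^ n" by (rule 1)
    also have "d ^ n = d ^ ((n - Suc j) + Suc j)" using that by simp
    also have "\<dots> = d ^ (n - Suc j) * d ^ Suc j" by (rule power_add)
    finally show ?thesis by simp
  qed
  have main: "peval (X n) (f e) = 0" if n: "n \<ge> max n1 (Suc j)" and Q0: "Q E f n = 0" and e: "e \<le> E" for n e
  proof (rule ccontr)
    assume "peval (X n) (f e) \<noteq> 0"
    \<comment> \<open>Dividing the equation by \<open>c n ^ e0\<close> makes \<open>c n\<close> a
      divisor of the lowest nonzero part.\<close>
    define e0 where "e0 = (LEAST e. e \<le> E \<and> peval (X n) (f e) \<noteq> 0)"
    have e0: "e0 \<le> E" "peval (X n) (f e0) \<noteq> 0"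
      using LeastI[of "\<lambda>e. e \<le> E \<and> peval (X n) (f e) \<noteq> 0" e] e \<open>peval (X n) (f e) \<noteq> 0\<close>
      by (auto simp: e0_def)
    have low: "peval (X n) (f i) = 0" if "i < e0" for i
      using not_less_Least[of i "\<lambda>e. e \<le> E \<and> peval (X n) (f e) \<noteq> 0"] that e0(1) by (auto simp: e0_def)
    obtain z where z: "z \<in> gen G" "c n = ?y ^ (d ^ (n - Suc j)) * z"
      using c_divisible[of j n] n by auto
    define S where "S = (\<Sum>e\<in>{Suc e0..E}. c n ^ (e - Suc e0) * peval (X n) (f e))"
    have SA: "S \<in> gen G"
      unfolding S_def using f by (intro sr_sum[OF A] sr_mult[OF A] sr_power[OF A] c peval_in[OF A _ X]) auto
    have "Q E f n = (\<Sum>e\<in>{e0..E}. c n ^ e * peval (X n) (f e))"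
      unfolding Q_def using low by (intro sum.mono_neutral_right) auto
    also have "\<dots> = c n ^ e0 * peval (X n) (f e0) + (\<Sum>e\<in>{Suc e0..E}. c n ^ e * peval (X n) (f e))"
      using e0(1) by (subst sum.atLeast_Suc_atMost) auto
    also have "(\<Sum>e\<in>{Suc e0..E}. c n ^ e * peval (X n) (f e)) = c n ^ e0 * (c n * S)"
      unfolding S_def sum_distrib_left
    proof (intro sum.cong refl)
      fix e assume "e \<in> {Suc e0..E}"
      then have "c n ^ e = c n ^ e0 * (c n * c n ^ (e - Suc e0))"
        by (simp flip: power_Suc power_add)
      then show "c n ^ e * peval (X n) (f e) = c n ^ e0 * (c n * (c n ^ (e - Suc e0) * peval (X n) (f e)))"
        by simp
    qed
    finally have "c n ^ e0 * (peval (X n) (f e0) + c n * S) = 0" using Q0 by (simp add: distrib_left)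
    then have "peval (X n) (f e0) = - (c n * S)" using cnz by (simp add: eq_neg_iff_add_eq_0)
    then have eq: "?y ^ (d ^ (n - Suc j)) * (- (z * S)) = 1 ^ 0 * peval (X n) (f e0)"
      by (simp add: z(2))
    have "- (z * S) \<in> gen G" by (intro sr_uminus[OF A] sr_mult[OF A] z SA)
    from C[OF e0(2) szf[OF e0(1)] this eq] small[of n] n show False by simp
  qed
  with that show ?thesis by blast
qed

text \<open>There is a degenerate case besides the dichotomy: once the scalar is 0 it stays 0, and
  only the part of degree 0 is left. In this case and in the bounded one, \<open>N\<close> comes
  from the linear system; in the unit case it comes from the system with the scalar as a coordinate.
  The case distinction depends on the orbit alone, so \<open>N\<close> and \<open>j0\<close> can
  precede \<open>E\<close> and \<open>f\<close>.\<close>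

theorem skew_zeros:
  "\<exists>N\<ge>1. \<exists>j0. \<forall>E f. (\<forall>e\<le>E. f e \<in> pexps J (gen G)) \<longrightarrow> (\<forall>a\<ge>j0.
    infinite {l. Q E f (a + N * l) = 0} \<longrightarrow> (\<forall>l. Q E f (a + N * l) = 0))"
proof -
  obtain N j0 where N: "N \<ge> 1" and base0: "\<forall>g\<in>pexps J (gen G). \<forall>a\<ge>j0.
    infinite {l. peval (X (a + N * l)) g = 0} \<longrightarrow> (\<forall>l. peval (X (a + N * l)) g = 0)"
    using base_zeros by (elim exE conjE) (rule that)
  note base = base0[rule_format]
  show ?thesis
  proof (cases "\<exists>m. c m = 0")
    case True
    then obtain m where m: "c m = 0" by auto
    \<comment> \<open>Where \<open>c n = 0\<close>, the term \<open>e = 0\<close> survives because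
      \<open>0 ^ 0 = 1\<close>.\<close>
    have Qm: "Q E f n = peval (X n) (f 0)" if "n \<ge> m" for E f n
    proof -
      have "Q E f n = (\<Sum>e\<in>{0}. c n ^ e * peval (X n) (f e))"
        unfolding Q_def using c_eventually_zero[OF m that] by (intro sum.mono_neutral_right) auto
      then show ?thesis by simp
    qed
    show ?thesis
    proof (rule exI[of _ N], rule conjI[OF N exI[of _ "max j0 m"]], intro allI impI)
      fix E f a l
      assume "\<forall>e\<le>E. f e \<in> pexps J (gen G)" "max j0 m \<le> a" "infinite {l. Q E f (a + N * l) = 0}"
      then show "Q E f (a + N * l) = 0"
        using base[of "f 0" a l] by (simp add: Qm)
    qed
  next
    case False
    then have cnz: "\<And>n. c n \<noteq> 0" by auto
    have ynz: "peval (X n) PE \<noteq> 0" for n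
      using cnz[of "Suc n"] by (auto simp: cstep)
    have yA: "peval (X n) PE \<in> gen G" for n by (rule peval_in[OF A PE X])
    have "1 \<in> gen G - {0}" using sr_one[OF A] by simp
    from bspec[OF finite_unit_or_bounded[OF finG, unfolded unit_or_bounded_def] this]
    obtain H where H0: "H \<in> gen G - {0}" "\<forall>y\<in>gen G - {0}.
      (\<exists>i. \<exists>z\<in>gen G. y * z = H ^ i) \<or> bounded_mult G 1 y" by (rule bexE)
    then have H: "H \<in> gen G" "H \<noteq> 0" by auto
    have Hy: "(\<exists>i. \<exists>z\<in>gen G. peval (X n) PE * z = H ^ i) \<or> bounded_mult G 1 (peval (X n) PE)" for n
      using yA ynz by (intro bspec[OF H0(2)]) auto
    show ?thesis
    proof (cases "\<exists>j. bounded_mult G 1 (peval (X j) PE)")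
      case True
      then obtain j where j: "bounded_mult G 1 (peval (X j) PE)" by auto
      show ?thesis
      proof (rule exI[of _ N], rule conjI[OF N exI[of _ j0]], intro allI impI)
        fix E f a l
        assume f: "\<forall>e\<le>E. f e \<in> pexps J (gen G)" and a: "j0 \<le> a" and inf: "infinite {l. Q E f (a + N * l) = 0}"
        obtain n0 where n0: "\<And>n e. n \<ge> n0 \<Longrightarrow> Q E f n = 0 \<Longrightarrow> e \<le> E \<Longrightarrow> peval (X n) (f e) = 0"
          using homogeneous_parts_vanish[OF cnz j, of E f] f by metis
        have "peval (X (a + N * l)) (f e) = 0" if e: "e \<le> E" for e
        proof (rule base)
          \<comment> \<open>Since \<open>N \<ge> 1\<close>, discarding the finitely many
            \<open>l < n0\<close> is enough to have \<open>a + N * l \<ge> n0\<close>.\<close>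
          have "infinite ({l. Q E f (a + N * l) = 0} - {..<n0})" using inf by simp
          moreover have "{l. Q E f (a + N * l) = 0} - {..<n0} \<subseteq> {l. peval (X (a + N * l)) (f e) = 0}"
          proof
            fix l assume l: "l \<in> {l. Q E f (a + N * l) = 0} - {..<n0}"
            have "n0 \<le> l" using l by auto
            also have "l \<le> N * l" using mult_le_mono1[OF N, of l] by simp
            also have "\<dots> \<le> a + N * l" by simp
            finally have "n0 \<le> a + N * l" .
            then show "l \<in> {l. peval (X (a + N * l)) (f e) = 0}" using n0 l e by simp
          qed
          ultimately show "infinite {l. peval (X (a + N * l)) (f e) = 0}" using infinite_super by blast
        qed (use f e a in auto)
        then show "Q E f (a + N * l) = 0" by (simp add: Q_def)
      qed
    next
      case False
      \<comment> \<open>This one inverse makes all values of \<open>P\<close> along the orbit units,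
        and with them all \<open>c n\<close>.\<close>
      define G' where "G' = insert (inverse H) G"
      note A' = subring_gen[of G']
      have G': "finite G'" "G \<subseteq> G'" using finG by (auto simp: G'_def)
      have sub: "gen G \<subseteq> gen G'" by (rule gen_mono[OF G'(2)])
      have iH: "inverse H \<in> gen G'" using gen_superset[of G'] by (auto simp: G'_def)
      have yinv: "\<exists>u\<in>gen G'. peval (X n) PE * u = 1" for n
      proof -
        obtain i z where z: "z \<in> gen G" "peval (X n) PE * z = H ^ i"
          using Hy[of n] False by blast
        have "peval (X n) PE * (z * inverse H ^ i) = H ^ i * inverse H ^ i" using z by simp
        also have "\<dots> = 1" using H(2) by (simp flip: power_mult_distrib)
        finally have "peval (X n) PE * (z * inverse H ^ i) = 1" .
        moreover have "z * inverse H ^ i \<in> gen G'"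
          using z sub iH by (intro sr_mult[OF A'] sr_power[OF A']) auto
        ultimately show ?thesis by blast
      qed
      have cinv: "\<exists>u\<in>gen G'. c n * u = 1" for n
      proof (induction n)
        case 0
        show ?case using sr_one[OF A'] by (auto simp: c0)
      next
        case (Suc n)
        then obtain u where u: "u \<in> gen G'" "c n * u = 1" by auto
        obtain v where v: "v \<in> gen G'" "peval (X n) PE * v = 1" using yinv by auto
        have "c (Suc n) * (u ^ d * v) = (c n * u) ^ d * (peval (X n) PE * v)"
          by (simp add: cstep power_mult_distrib algebra_simps)
        also have "\<dots> = 1" using u v by simp
        finally show ?case using u v by (blast intro: sr_mult[OF A'] sr_power[OF A'])
      qed
      define CE where "CE = PMul (ppow (PVar (Inr r)) d) PE"
      have PE': "PE \<in> pexps J (gen G')" by (rule pexps_mono[OF PE order_refl sub])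
      have YA: "Y c n v \<in> gen G'" if "v \<in> J'" for n v
        using that subsetD[OF sub U] subsetD[OF sub w] subsetD[OF sub c] by (auto simp: Y_def)
      have "\<exists>N\<ge>1. \<exists>j0. \<forall>g\<in>pexps J' (gen G'). \<forall>a\<ge>j0. infinite {l. peval (Y c (a + N * l)) g = 0} \<longrightarrow>
        (\<forall>l. peval (Y c (a + N * l)) g = 0)"
      proof (rule system_zeros[OF G'])
        show "CE \<in> pexps J' (gen G')"
          unfolding CE_def using pexps_mono[OF PE' JJ' order_refl] by (auto intro!: ppow_pexps[OF A'])
        show "c n \<in> gen G'" for n using c sub by blast
        show "c (Suc n) = peval (Y c n) CE" for n
          by (simp add: CE_def cstep Y_eq_X[OF PE]) (simp add: Y_def)
        fix \<phi> p D n and R :: "'a set" and y y' :: "'b + nat \<Rightarrow> 'a"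
        assume sp: "specialisation (gen G') \<phi> p D R" and y: "y ` J' \<subseteq> R" "y' ` J' \<subseteq> R"
          and JW: "\<forall>i\<in>J. y i - y' i \<in> pideal p R 1"
          and diff: "pev \<phi> (near \<phi> p (Y c n) y) CE - pev \<phi> (near \<phi> p (Y c n) y') CE \<in> pideal p R 2"
        obtain u1 where u1: "u1 \<in> gen G" "of_nat d * u1 = (1::'a)" using dinv by auto
        obtain u2 where u2: "u2 \<in> gen G'" "c n * u2 = 1" using cinv by auto
        obtain u3 where u3: "u3 \<in> gen G'" "peval (X n) PE * u3 = 1" using yinv by auto
        have "of_nat d * Y c n (Inr r) ^ (d - 1) * peval (Y c n) PE * (u1 * u2 ^ (d - 1) * u3) =
          (of_nat d * u1) * (c n * u2) ^ (d - 1) * (peval (X n) PE * u3)"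
          by (simp add: Y_eq_X[OF PE] power_mult_distrib algebra_simps) (simp add: Y_def)
        also have "\<dots> = 1" using u1 u2 u3 by simp
        finally have unit: "of_nat d * Y c n (Inr r) ^ (d - 1) * peval (Y c n) PE * (u1 * u2 ^ (d - 1) * u3) = 1" .
        have "u1 * u2 ^ (d - 1) * u3 \<in> gen G'"
          using u1 u2 u3 sub by (intro sr_mult[OF A'] sr_power[OF A']) auto
        from power_scalar_inj[OF A' PE' YA this unit sp y JW diff[unfolded CE_def]]
        show "y (Inr r) - y' (Inr r) \<in> pideal p R 1" .
      qed
      then obtain N j0 where N: "N \<ge> 1" and *: "\<forall>g\<in>pexps J' (gen G'). \<forall>a\<ge>j0.
        infinite {l. peval (Y c (a + N * l)) g = 0} \<longrightarrow> (\<forall>l. peval (Y c (a + N * l)) g = 0)"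
        by (elim exE conjE) (rule that)
      show ?thesis
      proof (rule exI[of _ N], rule conjI[OF N exI[of _ j0]], intro allI impI)
        fix E f a l
        assume f: "\<forall>e\<le>E. f e \<in> pexps J (gen G)" and a: "j0 \<le> a" and inf: "infinite {l. Q E f (a + N * l) = 0}"
        define g where "g = psum (Suc E) (\<lambda>e. PMul (ppow (PVar (Inr r)) e) (f e))"
        have g: "g \<in> pexps J' (gen G')"
          unfolding g_def using f pexps_mono[OF _ JJ' sub] by (auto intro!: psum_pexps[OF A'] ppow_pexps[OF A'])
        have "peval (Y c n) g = Q E f n" for n
        proof -
          have "peval (Y c n) g = (\<Sum>e<Suc E. c n ^ e * peval (Y c n) (f e))"
            by (simp add: g_def Y_def)
          also have "\<dots> = Q E f n" unfolding Q_def lessThan_Suc_atMost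
            using f by (intro sum.cong refl) (auto simp: Y_eq_X)
          finally show ?thesis .
        qed
        with *[rule_format, OF g a, of l] inf show "Q E f (a + N * l) = 0" by simp
      qed
    qed
  qed
qed

end


section \<open>Polynomials as expressions\<close>

definition mono_val :: "(nat \<Rightarrow>\<^sub>0 nat) \<Rightarrow> (nat \<Rightarrow> 'a::comm_ring_1) \<Rightarrow> 'a" where
  "mono_val \<alpha> x = (\<Prod>i\<in>Poly_Mapping.keys \<alpha>. x i ^ Poly_Mapping.lookup \<alpha> i)"

text \<open>Evaluation at a function instead of a vector, to match \<open>peval\<close> and to be
  free of dimensions.\<close>

definition mev :: "(nat \<Rightarrow> 'a::comm_ring_1) \<Rightarrow> 'a mpoly \<Rightarrow> 'a" where
  "mev x p = (\<Sum>\<alpha>\<in>Poly_Mapping.keys p. Poly_Mapping.lookup p \<alpha> * mono_val \<alpha> x)"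

lemma meval_mev: "meval x p = mev (\<lambda>i. x $ i) p"
  by (simp add: meval_def msubst_def mev_def mono_val_def)

lemma mono_val_superset:
  assumes "finite S" "Poly_Mapping.keys \<alpha> \<subseteq> S"
  shows "mono_val \<alpha> x = (\<Prod>i\<in>S. x i ^ Poly_Mapping.lookup \<alpha> i)"
  unfolding mono_val_def using assms
  by (intro prod.mono_neutral_left) (auto simp: in_keys_iff)

lemma mono_val_add: "mono_val (\<alpha> + \<beta>) x = mono_val \<alpha> x * mono_val \<beta> x"
proof -
  let ?S = "Poly_Mapping.keys \<alpha> \<union> Poly_Mapping.keys \<beta>"
  have "mono_val (\<alpha> + \<beta>) x = (\<Prod>i\<in>?S. x i ^ Poly_Mapping.lookup (\<alpha> + \<beta>) i)"
    by (rule mono_val_superset) (auto dest: subsetD[OF Poly_Mapping.keys_add])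
  also have "\<dots> = (\<Prod>i\<in>?S. x i ^ Poly_Mapping.lookup \<alpha> i) * (\<Prod>i\<in>?S. x i ^ Poly_Mapping.lookup \<beta> i)"
    by (simp add: lookup_add power_add prod.distrib)
  also have "\<dots> = mono_val \<alpha> x * mono_val \<beta> x"
    by (simp add: mono_val_superset[of ?S])
  finally show ?thesis .
qed

lemma mono_val_0 [simp]: "mono_val 0 x = 1"
  by (simp add: mono_val_def)

lemma mev_superset:
  assumes "finite S" "Poly_Mapping.keys p \<subseteq> S"
  shows "mev x p = (\<Sum>\<alpha>\<in>S. Poly_Mapping.lookup p \<alpha> * mono_val \<alpha> x)"
  unfolding mev_def using assms
  by (intro sum.mono_neutral_left) (auto simp: in_keys_iff)

lemma mev_zero [simp]: "mev x 0 = 0"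
  by (simp add: mev_def)

lemma mev_add: "mev x (p + q) = mev x p + mev x q"
proof -
  let ?S = "Poly_Mapping.keys p \<union> Poly_Mapping.keys q"
  have "mev x (p + q) = (\<Sum>\<alpha>\<in>?S. Poly_Mapping.lookup (p + q) \<alpha> * mono_val \<alpha> x)"
    by (rule mev_superset) (auto dest: subsetD[OF Poly_Mapping.keys_add])
  also have "\<dots> = (\<Sum>\<alpha>\<in>?S. Poly_Mapping.lookup p \<alpha> * mono_val \<alpha> x) + (\<Sum>\<alpha>\<in>?S. Poly_Mapping.lookup q \<alpha> * mono_val \<alpha> x)"
    by (simp add: lookup_add distrib_right sum.distrib)
  also have "\<dots> = mev x p + mev x q"
    by (simp add: mev_superset[of ?S])
  finally show ?thesis .
qed

lemma mev_sum: "mev x (sum f S) = (\<Sum>i\<in>S. mev x (f i))"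
  by (induction S rule: infinite_finite_induct) (auto simp: mev_add)

lemma mev_single [simp]: "mev x (Poly_Mapping.single \<alpha> c) = c * mono_val \<alpha> x"
  by (subst mev_superset[of "{\<alpha>}"]) (auto simp: lookup_single)

lemma sum_single_keys: "p = (\<Sum>\<alpha>\<in>Poly_Mapping.keys p. Poly_Mapping.single \<alpha> (Poly_Mapping.lookup p \<alpha>))"
  by (rule poly_mapping_eqI) (auto simp: lookup_sum lookup_single when_def in_keys_iff)

lemma mev_mult: "mev x (p * q) = mev x p * mev x q"
proof -
  have s: "mev x (Poly_Mapping.single \<alpha> a * q) = a * mono_val \<alpha> x * mev x q" for \<alpha> a
  proof -
    have "Poly_Mapping.single \<alpha> a * q =
        (\<Sum>\<beta>\<in>Poly_Mapping.keys q. Poly_Mapping.single (\<alpha> + \<beta>) (a * Poly_Mapping.lookup q \<beta>))"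
      by (subst sum_single_keys[of q]) (simp add: sum_distrib_left mult_single)
    then show ?thesis
      by (simp add: mev_sum mono_val_add mev_def[of x q] sum_distrib_left algebra_simps)
  qed
  have "p * q = (\<Sum>\<alpha>\<in>Poly_Mapping.keys p. Poly_Mapping.single \<alpha> (Poly_Mapping.lookup p \<alpha>) * q)"
    by (subst sum_single_keys[of p]) (simp add: sum_distrib_right)
  then show ?thesis
    by (simp add: mev_sum s mev_def[of x p] sum_distrib_right)
qed

lemma mev_one [simp]: "mev x 1 = 1"
  using mev_single[of x 0 1] by simp

lemma mev_mconst [simp]: "mev x (mconst c) = c"
  by (simp add: mconst_def)

lemma mev_mvar [simp]: "mev x (mvar i) = x i"
  by (simp add: mvar_def mono_val_def lookup_single)

lemma mev_power: "mev x (p ^ n) = mev x p ^ n"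
  by (induction n) (auto simp: mev_mult)

lemma mev_prod: "mev x (prod f S) = (\<Prod>i\<in>S. mev x (f i))"
  by (induction S rule: infinite_finite_induct) (auto simp: mev_mult)

lemma mev_msubst: "mev x (msubst mconst g p) = mev (\<lambda>i. mev x (g i)) p"
  by (simp add: msubst_def mev_sum mev_mult mev_prod mev_power)
    (simp add: mev_def mono_val_def)

lemma mono_val_cong:
  assumes "Poly_Mapping.keys \<alpha> \<subseteq> {..<n}" "\<And>i. i < n \<Longrightarrow> x i = y i"
  shows "mono_val \<alpha> x = mono_val \<alpha> y"
  unfolding mono_val_def using assms by (intro prod.cong) auto

lemma mev_cong:
  assumes "p \<in> poly_ring n" "\<And>i. i < n \<Longrightarrow> x i = y i"
  shows "mev x p = mev y p"
  unfolding mev_def using assms mono_val_cong[of _ n x y]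
  by (intro sum.cong) (auto simp: poly_ring_def)

text \<open>The derivatives are recorded together with the value, since the Jacobian is defined
  through \<open>mpderiv\<close> while the injectivity argument works with
  \<open>pder\<close>.\<close>

lemma prod_power_pexp:
  fixes A :: "'a::comm_ring_1 set"
  assumes "finite S" "subring_set A" "S \<subseteq> I"
  shows "\<exists>e\<in>pexps I A. \<forall>x. peval x e = (\<Prod>i\<in>S. x i ^ m i) \<and> (\<forall>v. peval x (pder v e) =
    (if v \<in> S then of_nat (m v) * x v ^ (m v - 1) * (\<Prod>i\<in>S - {v}. x i ^ m i) else 0))"
  using assms
proof (induction S rule: finite_induct)
  case empty
  then show ?case by (intro bexI[of _ "PConst 1"]) (auto intro: sr_one)
next
  case (insert k S)
  have pw: "peval x (pder v (ppow (PVar k) n)) = (if v = k then of_nat n * x k ^ (n - 1) else 0)"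
    for x and v n
  proof (induction n)
    case (Suc n)
    then show ?case by (cases n) (auto simp: algebra_simps)
  qed simp
  from insert obtain e where e: "e \<in> pexps I A" "\<And>x. peval x e = (\<Prod>i\<in>S. x i ^ m i)"
    "\<And>x v. peval x (pder v e) = (if v \<in> S then of_nat (m v) * x v ^ (m v - 1) * (\<Prod>i\<in>S - {v}. x i ^ m i) else 0)"
    by auto
  have "peval x (pder v (PMul (ppow (PVar k) (m k)) e)) = (if v \<in> insert k S
    then of_nat (m v) * x v ^ (m v - 1) * (\<Prod>i\<in>insert k S - {v}. x i ^ m i) else 0)" for x v
  proof (cases "v = k")
    case True
    then have "insert k S - {v} = S" "v \<notin> S" using insert by auto
    with True show ?thesis by (simp add: pw e)
  next
    case False
    then have "insert k S - {v} = insert k (S - {v})" by auto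
    with False insert show ?thesis by (simp add: pw e algebra_simps)
  qed
  with insert e show ?case
    by (intro bexI[of _ "PMul (ppow (PVar k) (m k)) e"]) (auto intro: ppow_pexps)
qed

definition mono_der :: "nat \<Rightarrow> (nat \<Rightarrow>\<^sub>0 nat) \<Rightarrow> (nat \<Rightarrow> 'a::comm_ring_1) \<Rightarrow> 'a" where
  "mono_der j \<alpha> x = of_nat (Poly_Mapping.lookup \<alpha> j) * mono_val (\<alpha> - Poly_Mapping.single j 1) x"

lemma mono_der_eq:
  "mono_der v \<alpha> x = (if v \<in> Poly_Mapping.keys \<alpha> then of_nat (Poly_Mapping.lookup \<alpha> v) *
    x v ^ (Poly_Mapping.lookup \<alpha> v - 1) * (\<Prod>i\<in>Poly_Mapping.keys \<alpha> - {v}. x i ^ Poly_Mapping.lookup \<alpha> i) else 0)"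
proof (cases "v \<in> Poly_Mapping.keys \<alpha>")
  case True
  define \<beta> where "\<beta> = \<alpha> - Poly_Mapping.single v 1"
  have l: "Poly_Mapping.lookup \<beta> i = (if i = v then Poly_Mapping.lookup \<alpha> v - 1 else Poly_Mapping.lookup \<alpha> i)" for i
    by (simp add: \<beta>_def lookup_minus lookup_single when_def)
  have "Poly_Mapping.keys \<beta> \<subseteq> Poly_Mapping.keys \<alpha>"
    by (auto simp: in_keys_iff l split: if_splits)
  then have "mono_val \<beta> x = (\<Prod>i\<in>Poly_Mapping.keys \<alpha>. x i ^ Poly_Mapping.lookup \<beta> i)"
    by (intro mono_val_superset) auto
  also have "\<dots> = x v ^ (Poly_Mapping.lookup \<alpha> v - 1) * (\<Prod>i\<in>Poly_Mapping.keys \<alpha> - {v}. x i ^ Poly_Mapping.lookup \<beta> i)"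
    using True by (subst prod.remove[of _ v]) (auto simp: l)
  also have "(\<Prod>i\<in>Poly_Mapping.keys \<alpha> - {v}. x i ^ Poly_Mapping.lookup \<beta> i) =
      (\<Prod>i\<in>Poly_Mapping.keys \<alpha> - {v}. x i ^ Poly_Mapping.lookup \<alpha> i)"
    by (intro prod.cong) (auto simp: l)
  finally show ?thesis using True by (simp add: mono_der_def \<beta>_def)
qed (simp add: mono_der_def in_keys_iff)

lemma mev_mpderiv: "mev x (mpderiv v p) = (\<Sum>\<alpha>\<in>Poly_Mapping.keys p. Poly_Mapping.lookup p \<alpha> * mono_der v \<alpha> x)"
  by (simp add: mpderiv_def mev_sum mono_der_def algebra_simps)

lemma mono_pexp:
  assumes "subring_set A" "Poly_Mapping.keys \<alpha> \<subseteq> I"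
  shows "\<exists>e\<in>pexps I A. \<forall>x. peval x e = mono_val \<alpha> x \<and> (\<forall>v. peval x (pder v e) = mono_der v \<alpha> x)"
  using prod_power_pexp[OF _ assms, where m = "Poly_Mapping.lookup \<alpha>"]
  by (simp add: mono_val_def mono_der_eq)

lemma mono_sum_pexp:
  assumes "finite S" "subring_set A" "\<And>\<alpha>. \<alpha> \<in> S \<Longrightarrow> Poly_Mapping.keys \<alpha> \<subseteq> I" "\<And>\<alpha>. \<alpha> \<in> S \<Longrightarrow> g \<alpha> \<in> A"
  shows "\<exists>e\<in>pexps I A. \<forall>x. peval x e = (\<Sum>\<alpha>\<in>S. g \<alpha> * mono_val \<alpha> x) \<and>
    (\<forall>v. peval x (pder v e) = (\<Sum>\<alpha>\<in>S. g \<alpha> * mono_der v \<alpha> x))"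
  using assms
proof (induction S rule: finite_induct)
  case empty
  then show ?case by (intro bexI[of _ "PConst 0"]) (auto intro: sr_zero)
next
  case (insert \<alpha> S)
  then obtain e where e: "e \<in> pexps I A" "\<And>x. peval x e = (\<Sum>\<alpha>\<in>S. g \<alpha> * mono_val \<alpha> x)"
    "\<And>x v. peval x (pder v e) = (\<Sum>\<alpha>\<in>S. g \<alpha> * mono_der v \<alpha> x)" by auto
  have "Poly_Mapping.keys \<alpha> \<subseteq> I" using insert by auto
  from mono_pexp[OF insert.prems(1) this] obtain f where f: "f \<in> pexps I A" "\<And>x. peval x f = mono_val \<alpha> x"
    "\<And>x v. peval x (pder v f) = mono_der v \<alpha> x" by blast
  show ?case using insert e f
    by (intro bexI[of _ "PAdd (PMul (PConst (g \<alpha>)) f) e"]) auto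
qed

lemma mpoly_pexp:
  assumes "subring_set A" "p \<in> poly_ring n" "range (Poly_Mapping.lookup p) \<subseteq> A"
  shows "\<exists>e\<in>pexps {..<n} A. \<forall>x. peval x e = mev x p \<and> (\<forall>v. peval x (pder v e) = mev x (mpderiv v p))"
proof -
  have "\<exists>e\<in>pexps {..<n} A. \<forall>x. peval x e = (\<Sum>\<alpha>\<in>Poly_Mapping.keys p. Poly_Mapping.lookup p \<alpha> * mono_val \<alpha> x) \<and>
    (\<forall>v. peval x (pder v e) = (\<Sum>\<alpha>\<in>Poly_Mapping.keys p. Poly_Mapping.lookup p \<alpha> * mono_der v \<alpha> x))"
    using assms by (intro mono_sum_pexp) (auto simp: poly_ring_def)
  then show ?thesis by (simp only: mev_mpderiv) (simp only: mev_def)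
qed

section \<open>Polynomial endomorphisms and the sizes of their values\<close>

lemma endo_apply_nth: "i < dim_vec F \<Longrightarrow> endo_apply F x $ i = mev (\<lambda>i. x $ i) (F $ i)"
  by (simp add: endo_apply_def meval_mev)

lemma endo_apply_carrier: "F \<in> carrier_vec n \<Longrightarrow> endo_apply F x \<in> carrier_vec n"
  by (simp add: endo_apply_def)

lemma poly_endos_nth: "F \<in> poly_endos n \<Longrightarrow> i < n \<Longrightarrow> F $ i \<in> poly_ring n"
  by (force simp: poly_endos_def vec_set_def)

lemma endo_iter_carrier: "T \<in> carrier_vec m \<Longrightarrow> endo_iter T q \<in> carrier_vec m"
  by (cases q) (auto simp: endo_comp_def)

lemma endo_apply_iter:
  fixes T :: "'a::comm_ring_1 mpoly vec"
  assumes T: "T \<in> poly_endos m" and u: "u \<in> carrier_vec m"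
  shows "endo_apply (endo_iter T q) u = (endo_apply T ^^ q) u"
proof (induction q)
  case 0
  have "dim_vec T = m" using T by (auto simp: poly_endos_def)
  then show ?case using u by (intro eq_vecI) (auto simp: endo_apply_def meval_mev)
next
  case (Suc q)
  have dT: "dim_vec T = m" using T by (auto simp: poly_endos_def)
  have dq: "dim_vec (endo_iter T q) = m"
    using endo_iter_carrier[of T m q] T by (auto simp: poly_endos_def)
  have "endo_apply (endo_comp T (endo_iter T q)) u = endo_apply T (endo_apply (endo_iter T q) u)"
  proof (rule eq_vecI)
    fix i assume "i < dim_vec (endo_apply T (endo_apply (endo_iter T q) u))"
    then have i: "i < m" using dT by (simp add: endo_apply_def)
    have "endo_apply (endo_comp T (endo_iter T q)) u $ i =
        mev (\<lambda>j. mev (\<lambda>i. u $ i) (endo_iter T q $ j)) (T $ i)"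
      using i dT by (simp add: endo_apply_def endo_comp_def meval_mev mev_msubst)
    also have "\<dots> = mev (\<lambda>j. endo_apply (endo_iter T q) u $ j) (T $ i)"
      by (rule mev_cong[OF poly_endos_nth[OF T i]]) (simp add: endo_apply_nth dq)
    finally show "endo_apply (endo_comp T (endo_iter T q)) u $ i =
        endo_apply T (endo_apply (endo_iter T q) u) $ i"
      using i dT by (simp add: endo_apply_nth)
  qed (simp add: endo_apply_def endo_comp_def)
  then show ?case by (simp add: Suc)
qed

text \<open>Here the factor of \<open>s\<close> is the degree bound itself and not an unspecified
  constant; this is how the degree of an iterate controls the growth rate. Coefficients and the
  number of terms go into the additive constant.\<close>

lemma sz_mev:
  assumes p: "finite K" "\<And>\<alpha>. \<alpha> \<in> K \<Longrightarrow> Poly_Mapping.keys \<alpha> \<subseteq> {..<n} \<and>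
      (\<Sum>i\<in>Poly_Mapping.keys \<alpha>. Poly_Mapping.lookup \<alpha> i) \<le> E \<and> sz G s0 (2 ^ s0) (g \<alpha>)"
    and x: "\<And>i. i < n \<Longrightarrow> sz G s (2 ^ s) (x i)"
  shows "sz G (E * s + (s0 + card K)) (2 ^ (E * s + (s0 + card K))) (\<Sum>\<alpha>\<in>K. g \<alpha> * mono_val \<alpha> x)"
proof -
  have "sz G (E * s + s0) (2 ^ (E * s + s0)) (g \<alpha> * mono_val \<alpha> x)" if \<alpha>: "\<alpha> \<in> K" for \<alpha>
  proof -
    let ?l = "Poly_Mapping.lookup \<alpha>" and ?k = "Poly_Mapping.keys \<alpha>"
    have "sz G (s0 + (\<Sum>i\<in>?k. ?l i * s)) (2 ^ s0 * (\<Prod>i\<in>?k. (2 ^ s) ^ ?l i)) (g \<alpha> * mono_val \<alpha> x)"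
      unfolding mono_val_def using p(2)[OF \<alpha>] x by (intro sz_mult sz_prod sz_power) auto
    moreover have "(\<Sum>i\<in>?k. ?l i * s) = (\<Sum>i\<in>?k. ?l i) * s" by (simp add: sum_distrib_right)
    moreover have "(\<Prod>i\<in>?k. ((2::nat) ^ s) ^ ?l i) = 2 ^ ((\<Sum>i\<in>?k. ?l i) * s)"
      by (simp add: power_mult[symmetric] power_sum[symmetric] sum_distrib_left mult.commute)
    moreover have "(\<Sum>i\<in>?k. ?l i) * s \<le> E * s" using p(2)[OF \<alpha>] by (intro mult_le_mono1) auto
    ultimately show ?thesis
      by (auto elim!: sz_mono simp flip: power_add intro!: power_increasing)
  qed
  then have "sz G (E * s + s0) (\<Sum>\<alpha>\<in>K. 2 ^ (E * s + s0)) (\<Sum>\<alpha>\<in>K. g \<alpha> * mono_val \<alpha> x)"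
    using p(1) by (intro sz_sum)
  moreover have "(\<Sum>\<alpha>\<in>K. 2 ^ (E * s + s0)) \<le> (2::nat) ^ (E * s + (s0 + card K))"
    using less_exp[of "card K"] by (simp add: power_add)
  ultimately show ?thesis by (elim sz_mono) auto
qed

lemma total_degree_ge:
  "\<alpha> \<in> Poly_Mapping.keys p \<Longrightarrow> (\<Sum>i\<in>Poly_Mapping.keys \<alpha>. Poly_Mapping.lookup \<alpha> i) \<le> total_degree p"
  unfolding total_degree_def by (intro Max_ge) auto

lemma endo_degree_ge:
  "i < dim_vec F \<Longrightarrow> F $ i \<noteq> 0 \<Longrightarrow> total_degree (F $ i) \<le> endo_degree F"
  unfolding endo_degree_def by (intro Max_ge) (auto simp: vec_set_def)

text \<open>This lets one replace equations with coefficients in the whole field by equations over \<open>gen G\<close>, so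
  that the periods do not depend on the coefficients of the closed subvariety.\<close>

lemma annihilator_descent:
  fixes f v :: "'i \<Rightarrow> 'a::idom"
  assumes A: "subring_set A" and "finite I"
    and W: "\<And>u i. u \<in> W \<Longrightarrow> i \<in> I \<Longrightarrow> u i \<in> A" and v: "\<And>i. i \<in> I \<Longrightarrow> v i \<in> A"
    and f: "\<And>u. u \<in> W \<Longrightarrow> (\<Sum>i\<in>I. f i * u i) = 0" "(\<Sum>i\<in>I. f i * v i) \<noteq> 0"
  shows "\<exists>g. (\<forall>i\<in>I. g i \<in> A) \<and> (\<forall>u\<in>W. (\<Sum>i\<in>I. g i * u i) = 0) \<and> (\<Sum>i\<in>I. g i * v i) \<noteq> 0"
  using assms(2-)
proof (induction I arbitrary: W v rule: finite_psubset_induct)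
  case (psubset I)
  show ?case
  proof (cases "\<exists>w\<in>W. \<exists>k\<in>I. w k \<noteq> 0")
    case False
    have "\<exists>k\<in>I. v k \<noteq> 0"
    proof (rule ccontr)
      assume "\<not> (\<exists>k\<in>I. v k \<noteq> 0)"
      then have "(\<Sum>i\<in>I. f i * v i) = 0" by (intro sum.neutral) auto
      with psubset.prems(4) show False by simp
    qed
    then obtain k where k: "k \<in> I" "v k \<noteq> 0" by blast
    have *: "(\<Sum>i\<in>I. (if i = k then 1 else 0) * u i) = u k" for u :: "'i \<Rightarrow> 'a"
      using k psubset.hyps(1) by (simp add: if_distrib[of "\<lambda>x. x * _"] cong: if_cong)
    show ?thesis
      using k False sr_one[OF A] sr_zero[OF A]
      by (intro exI[of _ "\<lambda>i. if i = k then 1 else 0"]) (auto simp: *)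
  next
    case True
    then obtain w k where w: "w \<in> W" "k \<in> I" "w k \<noteq> 0" by auto
    \<comment> \<open>Fraction-free elimination: after scaling \<open>u\<close> by
      \<open>w k\<close>, a multiple of \<open>w\<close> is subtracted that makes coordinate
      \<open>k\<close> vanish.\<close>
    define red where "red u i = w k * u i - u k * w i" for u i
    have redA: "red u i \<in> A" if "\<And>i. i \<in> I \<Longrightarrow> u i \<in> A" "i \<in> I" for u i
      unfolding red_def using that psubset.prems(1)[OF w(1)] w(2)
      by (intro sr_diff[OF A] sr_mult[OF A])
    have red_sum: "(\<Sum>i\<in>I - {k}. h i * red u i) = w k * (\<Sum>i\<in>I. h i * u i) - u k * (\<Sum>i\<in>I. h i * w i)" for h u
    proof -
      have "(\<Sum>i\<in>I - {k}. h i * red u i) = (\<Sum>i\<in>I. h i * red u i)"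
        using psubset.hyps(1) w(2) by (subst (2) sum.remove[of _ k]) (auto simp: red_def mult.commute)
      then show ?thesis
        by (simp add: red_def right_diff_distrib sum_subtractf sum_distrib_left mult.left_commute)
    qed
    have "\<exists>g. (\<forall>i\<in>I - {k}. g i \<in> A) \<and> (\<forall>u\<in>red ` W. (\<Sum>i\<in>I - {k}. g i * u i) = 0) \<and>
      (\<Sum>i\<in>I - {k}. g i * red v i) \<noteq> 0"
    proof (rule psubset.IH)
      show "I - {k} \<subset> I" using w(2) by auto
      show "u i \<in> A" if "u \<in> red ` W" "i \<in> I - {k}" for u i
        using that redA psubset.prems(1) by auto
      show "red v i \<in> A" if "i \<in> I - {k}" for i using that redA psubset.prems(2) by auto
      show "(\<Sum>i\<in>I - {k}. f i * u i) = 0" if "u \<in> red ` W" for u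
        using that psubset.prems(3) w(1) by (auto simp: red_sum)
      show "(\<Sum>i\<in>I - {k}. f i * red v i) \<noteq> 0"
        using psubset.prems(3)[OF w(1)] psubset.prems(4) w(3) by (simp add: red_sum)
    qed
    then obtain g where g: "\<And>i. i \<in> I - {k} \<Longrightarrow> g i \<in> A" "\<And>u. u \<in> W \<Longrightarrow> (\<Sum>i\<in>I - {k}. g i * red u i) = 0"
      "(\<Sum>i\<in>I - {k}. g i * red v i) \<noteq> 0" by auto
    \<comment> \<open>Coordinate \<open>k\<close> is set so that \<open>g'\<close> annihilates
      \<open>w\<close>; scaling the others by \<open>w k\<close> avoids a division.\<close>
    define g' where "g' i = (if i = k then - (\<Sum>i\<in>I - {k}. g i * w i) else w k * g i)" for i
    have g'sum: "(\<Sum>i\<in>I. g' i * u i) = (\<Sum>i\<in>I - {k}. g i * red u i)" for u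
    proof -
      have "(\<Sum>i\<in>I. g' i * u i) = g' k * u k + (\<Sum>i\<in>I - {k}. g' i * u i)"
        using psubset.hyps(1) w(2) by (rule sum.remove)
      also have "(\<Sum>i\<in>I - {k}. g' i * u i) = (\<Sum>i\<in>I - {k}. w k * g i * u i)"
        by (intro sum.cong) (auto simp: g'_def)
      finally show ?thesis
        by (simp add: g'_def red_def right_diff_distrib sum_subtractf sum_distrib_left sum_distrib_right
            algebra_simps)
    qed
    have "g' i \<in> A" if "i \<in> I" for i
      using that g(1) psubset.prems(1)[OF w(1)] w(2)
      by (auto simp: g'_def intro!: sr_uminus[OF A] sr_sum[OF A] sr_mult[OF A])
    with g show ?thesis by (intro exI[of _ g']) (auto simp: g'sum)
  qed
qed


section \<open>Base systems\<close>

text \<open>Up to multiples of \<open>p ^ 2\<close>, differences on the disc are \<open>p\<close>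
  times the Jacobian at the centre applied to the differences of coordinates. After cancelling one
  \<open>p\<close>, the specialised left inverse \<open>L\<close> recovers these differences mod
  \<open>p\<close>.\<close>

lemma near_inj_left_inverse:
  fixes A :: "'a::field_char_0 set"
  assumes A: "subring_set A" and I: "finite I" and F: "\<And>i. i \<in> I \<Longrightarrow> F i \<in> pexps I A"
    and x: "\<And>v. v \<in> I \<Longrightarrow> x v \<in> A" and L: "\<And>k i. k \<in> I \<Longrightarrow> i \<in> I \<Longrightarrow> L k i \<in> A"
    and inv: "\<And>k v. k \<in> I \<Longrightarrow> v \<in> I \<Longrightarrow> (\<Sum>i\<in>I. L k i * peval x (pder v (F i))) = (if k = v then 1 else 0)"
  shows "near_inj A I F x"
  unfolding near_inj_def
proof (intro allI impI ballI)
  fix \<phi> p D R y y' k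
  assume sp: "specialisation A \<phi> p D R" and y: "y ` I \<subseteq> R" "y' ` I \<subseteq> R" and k: "k \<in> I"
    and diff: "\<forall>i\<in>I. pev \<phi> (near \<phi> p x y) (F i) - pev \<phi> (near \<phi> p x y') (F i) \<in> pideal p R 2"
  have \<phi>: "hom_on A \<phi>" "\<phi> ` A \<subseteq> R" and R: "subring_set R" and p: "p > 0"
    using sp by (auto simp: specialisation_def good_ring_def)
  note \<phi>0 = hom_on_zero[OF A \<phi>(1)] and \<phi>1 = hom_on_one[OF A \<phi>(1)]
  define t where "t v = y v - y' v" for v
  have xR: "\<phi> (x v) \<in> R" if "v \<in> I" for v using x \<phi>(2) that by auto
  have pR: "of_nat p \<in> R" by (rule sr_of_nat[OF R])
  have dA: "peval x (pder v (F i)) \<in> A" if "i \<in> I" for i v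
    using that F x by (intro peval_in[OF A pder_pexps[OF A]]) auto
  have row: "(\<Sum>v\<in>I. \<phi> (peval x (pder v (F i))) * t v) \<in> pideal p R 1" if i: "i \<in> I" for i
  proof -
    have Fi: "pmap (\<lambda>v. v) \<phi> (F i) \<in> pexps I R" using F[OF i] \<phi>(2) by (rule pmap_pexps)
    have D: "peval (\<lambda>v. \<phi> (x v)) (pder v (pmap (\<lambda>v. v) \<phi> (F i))) = \<phi> (peval x (pder v (F i)))" for v
      using F[OF i] x by (simp add: pder_pmap[of \<phi>, OF \<phi>0 \<phi>1] peval_hom[OF A \<phi>(1) pder_pexps[OF A]])
    obtain f where f: "f \<in> pexps I R" "\<And>z. pev \<phi> (near \<phi> p x z) (F i) = peval (\<lambda>v. \<phi> (x v)) (pmap (\<lambda>v. v) \<phi> (F i)) +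
        of_nat p * (\<Sum>v\<in>I. \<phi> (peval x (pder v (F i))) * z v) + (of_nat p)\<^sup>2 * peval z f"
      using peval_taylor[OF R I pR, of "\<lambda>v. \<phi> (x v)", OF xR Fi] unfolding pev_def near_def[abs_def] D by blast
    have eq: "pev \<phi> (near \<phi> p x y) (F i) - pev \<phi> (near \<phi> p x y') (F i) =
        of_nat p * (\<Sum>v\<in>I. \<phi> (peval x (pder v (F i))) * t v) + of_nat p ^ 2 * (peval y f - peval y' f)"
      by (simp add: f(2) t_def right_diff_distrib sum_subtractf)
    have "peval z f \<in> R" if "z ` I \<subseteq> R" for z
      using that by (intro peval_in[OF R f(1)]) auto
    then have "of_nat p ^ 2 * (peval y f - peval y' f) \<in> pideal p R 2"
      unfolding pideal_def using y by (intro imageI sr_diff[OF R])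
    from pideal_diff[OF R bspec[OF diff i] this]
    have "of_nat p * (\<Sum>v\<in>I. \<phi> (peval x (pder v (F i))) * t v) \<in> pideal p R 2"
      unfolding eq by simp
    then show ?thesis using pideal_cancel[OF p, of _ R 1] by (simp add: numeral_2_eq_2)
  qed
  have "(\<Sum>i\<in>I. \<phi> (L k i) * (\<Sum>v\<in>I. \<phi> (peval x (pder v (F i))) * t v)) \<in> pideal p R 1"
  proof (rule pideal_sum[OF R])
    fix i assume i: "i \<in> I"
    then have "\<phi> (L k i) \<in> R" using L k \<phi>(2) by auto
    then show "\<phi> (L k i) * (\<Sum>v\<in>I. \<phi> (peval x (pder v (F i))) * t v) \<in> pideal p R 1"
      using row[OF i] by (rule pideal_mult[OF R])
  qed
  also have "(\<Sum>i\<in>I. \<phi> (L k i) * (\<Sum>v\<in>I. \<phi> (peval x (pder v (F i))) * t v)) =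
      (\<Sum>v\<in>I. (\<Sum>i\<in>I. \<phi> (L k i) * \<phi> (peval x (pder v (F i)))) * t v)"
    by (simp add: sum_distrib_left sum_distrib_right mult.assoc) (rule sum.swap)
  also have "\<dots> = (\<Sum>v\<in>I. (if k = v then 1 else 0) * t v)"
  proof (intro sum.cong refl)
    fix v assume v: "v \<in> I"
    have "(\<Sum>i\<in>I. \<phi> (L k i) * \<phi> (peval x (pder v (F i)))) = \<phi> (\<Sum>i\<in>I. L k i * peval x (pder v (F i)))"
      using L dA k v by (subst hom_on_sum[OF A \<phi>(1)]) (auto simp: hom_on_mult[OF A \<phi>(1)] intro: sr_mult[OF A])
    then show "(\<Sum>i\<in>I. \<phi> (L k i) * \<phi> (peval x (pder v (F i)))) * t v = (if k = v then 1 else 0) * t v"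
      using inv[OF k v] by (simp add: \<phi>0 \<phi>1)
  qed
  also have "\<dots> = t k" using I k by (simp add: if_distrib[of "\<lambda>x. x * _"] cong: if_cong)
  finally show "y k - y' k \<in> pideal p R 1" by (simp add: t_def)
qed

text \<open>With t = \<open>n div q\<close>, the expression is \<open>C\<close> times the square of
  (t+1) sqrt(\<theta>)^t, which tends to 0. Of the two factors t+1, one will come from the size
  bound and one from the factor \<open>n + 1\<close> in the growth condition.\<close>

lemma div_square_geometric_limit:
  fixes \<theta> :: real
  assumes "0 \<le> \<theta>" "\<theta> < 1" "q > 0"
  shows "(\<lambda>n. C * real (n div q + 1) ^ 2 * \<theta> ^ (n div q)) \<longlonglongrightarrow> 0"
proof -
  have s: "sqrt \<theta> < 1" using assms by (simp add: real_sqrt_lt_1_iff)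
  have "(\<lambda>t. real t * sqrt \<theta> ^ t + sqrt \<theta> ^ t) \<longlonglongrightarrow> 0 + 0"
    using s assms powser_times_n_limit_0[of "sqrt \<theta>"] by (intro tendsto_add LIMSEQ_power_zero) auto
  then have "(\<lambda>t. C * (real t * sqrt \<theta> ^ t + sqrt \<theta> ^ t) ^ 2) \<longlonglongrightarrow> C * (0 + 0) ^ 2"
    by (intro tendsto_mult tendsto_const tendsto_power)
  moreover have "C * (real t * sqrt \<theta> ^ t + sqrt \<theta> ^ t) ^ 2 = C * real (t + 1) ^ 2 * \<theta> ^ t" for t
  proof -
    have "(sqrt \<theta> ^ t) ^ 2 = \<theta> ^ t" using assms by (simp add: power2_eq_square flip: power_mult_distrib)
    moreover have "real t * sqrt \<theta> ^ t + sqrt \<theta> ^ t = real (t + 1) * sqrt \<theta> ^ t" by (simp add: distrib_right)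
    ultimately show ?thesis by (simp only: power_mult_distrib mult.assoc)
  qed
  ultimately have 1: "(\<lambda>t. C * real (t + 1) ^ 2 * \<theta> ^ t) \<longlonglongrightarrow> 0" by simp
  have "filterlim (\<lambda>n. n div q) sequentially sequentially"
    unfolding filterlim_at_top
  proof
    fix Z
    have "Z \<le> n div q" if "n \<ge> Z * q" for n using that assms(3) by (simp add: less_eq_div_iff_mult_less_eq)
    then show "\<forall>\<^sub>F n in sequentially. Z \<le> n div q" unfolding eventually_sequentially by blast
  qed
  from filterlim_compose[OF 1 this] show ?thesis by simp
qed

text \<open>The sequence \<open>C * (t + 1) * E' ^ t\<close> dominates the recursion that multiplies
  by \<open>E\<close> and adds \<open>K\<close>; the factor \<open>t + 1\<close> collects the
  additive constants, which grow linearly when \<open>E' = 1\<close>.\<close>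

lemma size_growth:
  fixes U :: "nat \<Rightarrow> 'b \<Rightarrow> 'a::comm_ring_1"
  assumes "finite Ib" and d: "d \<ge> 2" and q: "q \<ge> 1" and E: "E < d ^ q"
    and U: "\<And>n b. b \<in> Ib \<Longrightarrow> U n b \<in> gen G"
    and grow: "\<And>n s. (\<And>b. b \<in> Ib \<Longrightarrow> sz G s (2 ^ s) (U n b)) \<Longrightarrow>
      (\<And>b. b \<in> Ib \<Longrightarrow> sz G (E * s + K) (2 ^ (E * s + K)) (U (n + q) b))"
  shows "\<exists>\<sigma>. mono \<sigma> \<and> (\<forall>n. \<sigma> n \<ge> 1) \<and> (\<lambda>n. real ((n + 1) * \<sigma> n) / real d ^ n) \<longlonglongrightarrow> 0 \<and>
    (\<forall>n. \<forall>b\<in>Ib. sz G (\<sigma> n) (2 ^ \<sigma> n) (U n b))"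
proof -
  \<comment> \<open>The degree \<open>E\<close> may be 0; a base of at least 1 keeps the bound
    monotone and positive.\<close>
  define E' where "E' = max E 1"
  have "d ^ 1 \<le> d ^ q" using d q by (intro power_increasing) auto
  then have E': "1 \<le> E'" "E \<le> E'" "E' < d ^ q" using E d by (auto simp: E'_def)
  obtain K1 where K1: "\<And>y. y \<in> (\<lambda>(n, b). U n b) ` ({..<q} \<times> Ib) \<Longrightarrow> sz G K1 (2 ^ K1) y"
  proof -
    have "finite ((\<lambda>(n, b). U n b) ` ({..<q} \<times> Ib))" using assms(1) by simp
    moreover have "(\<lambda>(n, b). U n b) ` ({..<q} \<times> Ib) \<subseteq> gen G" using U by auto
    ultimately show ?thesis using that finite_sz_common by metis
  qed
  define C where "C = K + K1 + 1"
  define \<tau> where "\<tau> t = C * (t + 1) * E' ^ t" for t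
  define \<sigma> where "\<sigma> n = \<tau> (n div q)" for n
  have "\<tau> t \<le> \<tau> t'" if "t \<le> t'" for t t'
    unfolding \<tau>_def using that E'(1) by (intro mult_le_mono power_increasing) auto
  then have "mono \<sigma>" unfolding \<sigma>_def mono_def by (auto intro: div_le_mono)
  moreover have "\<sigma> n \<ge> 1" for n
    unfolding \<sigma>_def \<tau>_def using E' by (simp add: C_def Suc_le_eq)
  moreover have "(\<lambda>n. real ((n + 1) * \<sigma> n) / real d ^ n) \<longlonglongrightarrow> 0"
  proof (rule tendsto_sandwich[OF _ _ tendsto_const])
    define \<theta> where "\<theta> = real E' / real d ^ q"
    have "real E' < real (d ^ q)" using E'(3) by (simp only: of_nat_less_iff)
    then have \<theta>: "0 \<le> \<theta>" "\<theta> < 1" using d by (auto simp: \<theta>_def field_simps)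
    show "(\<lambda>n. (real q * real C) * real (n div q + 1) ^ 2 * \<theta> ^ (n div q)) \<longlonglongrightarrow> 0"
      by (rule div_square_geometric_limit[OF \<theta>]) (use q in simp)
    show "\<forall>\<^sub>F n in sequentially. 0 \<le> real ((n + 1) * \<sigma> n) / real d ^ n" by simp
    show "\<forall>\<^sub>F n in sequentially. real ((n + 1) * \<sigma> n) / real d ^ n \<le>
      (real q * real C) * real (n div q + 1) ^ 2 * \<theta> ^ (n div q)"
    proof (rule always_eventually, rule allI)
      fix n
      let ?t = "n div q"
      have "n + 1 \<le> q * (?t + 1)"
      proof -
        have "n mod q < q" using q by simp
        moreover have "q * ?t + n mod q = n" by (rule mult_div_mod_eq)
        ultimately show ?thesis unfolding distrib_left by linarith
      qed
      then have "(n + 1) * \<sigma> n \<le> q * (?t + 1) * \<sigma> n" by (rule mult_le_mono1)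
      also have "\<dots> = q * C * (?t + 1) ^ 2 * E' ^ ?t"
        by (simp add: \<sigma>_def \<tau>_def power2_eq_square algebra_simps)
      finally have "real ((n + 1) * \<sigma> n) \<le> real (q * C * (?t + 1) ^ 2 * E' ^ ?t)" by (simp only: of_nat_le_iff)
      moreover have "real d ^ (q * ?t) \<le> real d ^ n"
        using d by (intro power_increasing) auto
      ultimately have "real ((n + 1) * \<sigma> n) / real d ^ n \<le>
          real (q * C * (?t + 1) ^ 2 * E' ^ ?t) / real d ^ (q * ?t)"
        using d by (intro frac_le) auto
      also have "\<dots> = (real q * real C) * real (?t + 1) ^ 2 * \<theta> ^ ?t"
        by (simp add: \<theta>_def power_divide power_mult)
      finally show "real ((n + 1) * \<sigma> n) / real d ^ n \<le> (real q * real C) * real (?t + 1) ^ 2 * \<theta> ^ ?t" .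
    qed
  qed
  moreover have "sz G (\<tau> t) (2 ^ \<tau> t) (U (q * t + j) b)" if "b \<in> Ib" "j < q" for t j b
    using that(1)
  proof (induction t arbitrary: b)
    case 0
    have "sz G K1 (2 ^ K1) (U j b)" using 0 that(2) by (intro K1) auto
    moreover have "K1 \<le> \<tau> 0" by (simp add: \<tau>_def C_def)
    ultimately show ?case by (auto elim!: sz_mono intro: power_increasing)
  next
    case (Suc t)
    have "sz G (E * \<tau> t + K) (2 ^ (E * \<tau> t + K)) (U ((q * t + j) + q) b)"
      by (rule grow[OF Suc.IH Suc.prems])
    moreover have "E * \<tau> t + K \<le> \<tau> (Suc t)"
    proof -
      have "E * \<tau> t \<le> E' * \<tau> t" using E'(2) by (rule mult_le_mono1)
      also have "\<dots> = C * (t + 1) * E' ^ Suc t" by (simp add: \<tau>_def)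
      finally have "E * \<tau> t \<le> C * (t + 1) * E' ^ Suc t" .
      moreover have "K \<le> C * E' ^ Suc t"
      proof -
        have "C * 1 \<le> C * E' ^ Suc t" using E'(1) by (intro mult_le_mono2) (simp add: Suc_le_eq)
        then show ?thesis by (simp add: C_def)
      qed
      ultimately show ?thesis by (simp add: \<tau>_def algebra_simps)
    qed
    moreover have "q * t + j + q = q * Suc t + j" by simp
    ultimately show ?case by (metis sz_mono power_increasing one_le_numeral)
  qed
  then have "sz G (\<sigma> n) (2 ^ \<sigma> n) (U n b)" if "b \<in> Ib" for n b
    using that q mult_div_mod_eq[of q n] unfolding \<sigma>_def by (metis mod_less_divisor less_eq_Suc_le One_nat_def)
  ultimately show ?thesis by blast
qed

text \<open>Beyond \<open>j0\<close>, a residue class mod \<open>N\<close> either consists of common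
  zeros or contains finitely many, because a single sequence that is not identically 0 on it has
  finitely many zeros there. The exceptional points are progressions with difference 0. The set of
  sequences may be infinite.\<close>

lemma finite_union_of_APsI:
  fixes \<S> :: "(nat \<Rightarrow> 'a::zero) set"
  assumes N: "N \<ge> 1" and uni: "\<And>s a. s \<in> \<S> \<Longrightarrow> a \<ge> j0 \<Longrightarrow> infinite {l. s (a + N * l) = 0} \<Longrightarrow> (\<forall>l. s (a + N * l) = 0)"
  shows "finite_union_of_APs {n. \<forall>s\<in>\<S>. s n = 0}"
proof -
  let ?Z = "{n. \<forall>s\<in>\<S>. s n = 0}"
  define full where "full a \<longleftrightarrow> (\<forall>s\<in>\<S>. \<forall>l. s (a + N * l) = 0)" for a
  define I where "I = (\<lambda>n. (n, 0)) ` (?Z \<inter> {..<j0}) \<union>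
    (\<Union>a\<in>{j0..<j0 + N}. if full a then {(a, N)} else (\<lambda>l. (a + N * l, 0)) ` {l. a + N * l \<in> ?Z})"
  have AP0: "arith_prog a 0 = {a}" for a by (auto simp: arith_prog_def)
  have fin: "finite {l. a + N * l \<in> ?Z}" if a: "a \<ge> j0" "\<not> full a" for a
  proof -
    from a obtain s l where s: "s \<in> \<S>" "s (a + N * l) \<noteq> 0" by (auto simp: full_def)
    then have "finite {l. s (a + N * l) = 0}" using uni[OF s(1) a(1)] by blast
    then show ?thesis by (rule rev_finite_subset) (use s in auto)
  qed
  have "finite I" unfolding I_def using fin by auto
  moreover have "?Z = (\<Union>(a, b)\<in>I. arith_prog a b)"
  proof (intro equalityI subsetI)
    fix n assume n: "n \<in> ?Z"
    show "n \<in> (\<Union>(a, b)\<in>I. arith_prog a b)"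
    proof (cases "n < j0")
      case True
      then have "(n, 0) \<in> I" using n unfolding I_def by blast
      then show ?thesis using AP0 by blast
    next
      case False
      define a where "a = j0 + (n - j0) mod N"
      define l where "l = (n - j0) div N"
      have a: "a \<in> {j0..<j0 + N}" using N by (auto simp: a_def)
      have nal: "n = a + N * l" using False by (simp add: a_def l_def)
      show ?thesis
      proof (cases "full a")
        case True
        then have "(a, N) \<in> I" using a unfolding I_def by auto
        moreover have "n \<in> arith_prog a N" using nal by (auto simp: arith_prog_def)
        ultimately show ?thesis by blast
      next
        case False
        have "(n, 0) \<in> (\<lambda>l. (a + N * l, 0)) ` {l. a + N * l \<in> ?Z}" using n nal by (intro image_eqI[of _ _ l]) auto
        then have "(n, 0) \<in> I" using a False unfolding I_def by auto
        then show ?thesis using AP0 by blast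
      qed
    qed
  next
    fix n assume "n \<in> (\<Union>(a, b)\<in>I. arith_prog a b)"
    then obtain a b where ab: "(a, b) \<in> I" "n \<in> arith_prog a b" by auto
    from ab(1) consider "b = 0" "a \<in> ?Z" | "b = N" "full a"
      by (auto simp: I_def split: if_splits)
    then show "n \<in> ?Z"
    proof cases
      case 1
      then show ?thesis using ab(2) AP0 by auto
    next
      case 2
      then show ?thesis using ab(2) by (auto simp: arith_prog_def full_def)
    qed
  qed
  ultimately show ?thesis unfolding finite_union_of_APs_def by blast
qed

lemma mev_line: "\<exists>g. \<forall>t. poly g t = mev (\<lambda>i. a i + t * b i) p"
  by (rule exI[of _ "\<Sum>\<alpha>\<in>Poly_Mapping.keys p. smult (Poly_Mapping.lookup p \<alpha>)
      (\<Prod>i\<in>Poly_Mapping.keys \<alpha>. [:a i, b i:] ^ Poly_Mapping.lookup \<alpha> i)"])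
    (simp add: mev_def mono_val_def poly_sum poly_prod)

text \<open>The restriction of the determinant to the line joining two points is a univariate polynomial
  without roots, hence constant.\<close>

lemma etale_det_constant:
  fixes T :: "'a::alg_closed_field mpoly vec"
  assumes T: "etale m T" and u: "u \<in> carrier_vec m" and v: "v \<in> carrier_vec m"
  shows "det (jacobian_at T u) = det (jacobian_at T v)" "det (jacobian_at T u) \<noteq> 0"
proof -
  have dT: "dim_vec T = m" using T by (auto simp: etale_def poly_endos_def)
  have car: "jacobian_at T x \<in> carrier_mat m m" for x by (simp add: jacobian_at_def dT)
  have nz: "det (jacobian_at T x) \<noteq> 0" if x: "x \<in> carrier_vec m" for x
  proof -
    from T x obtain B where B: "inverts_mat (jacobian_at T x) B" "inverts_mat B (jacobian_at T x)"
      by (auto simp: etale_def invertible_mat_def)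
    then have eq: "jacobian_at T x * B = 1\<^sub>m m" using car[of x] by (simp add: inverts_mat_def)
    have "B \<in> carrier_mat m m"
    proof
      show "dim_col B = m" using arg_cong[OF eq, of dim_col] by simp
      show "dim_row B = m" using B(2) car[of x] unfolding inverts_mat_def
        by (metis carrier_matD(2) index_mult_mat(3) index_one_mat(3))
    qed
    then have "det (jacobian_at T x) * det B = 1" using det_mult[OF car] eq by (metis det_one)
    then show ?thesis by auto
  qed
  show "det (jacobian_at T u) \<noteq> 0" by (rule nz[OF u])
  define ln where "ln t = vec m (\<lambda>i. u $ i + t * (v $ i - u $ i))" for t
  have "\<forall>i j. \<exists>g. i < m \<longrightarrow> j < m \<longrightarrow> (\<forall>t. poly g t = jacobian_at T (ln t) $$ (i, j))"
  proof (intro allI)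
    fix i j
    let ?p = "mpderiv j (T $ i)"
    obtain g where g: "\<And>t. poly g t = mev (\<lambda>i. u $ i + t * (v $ i - u $ i)) ?p"
      using mev_line[of "\<lambda>i. u $ i" "\<lambda>i. v $ i - u $ i" ?p] by blast
    have "poly g t = jacobian_at T (ln t) $$ (i, j)" if ij: "i < m" "j < m" for t
    proof -
      have Ti: "T $ i \<in> poly_ring m" using T ij by (intro poly_endos_nth) (auto simp: etale_def)
      \<comment> \<open>The coordinates of \<open>ln t\<close> are known only below
        \<open>m\<close>; membership in \<open>pexps {..<m} UNIV\<close> shows that the derivative
        uses no others.\<close>
      obtain e where e: "e \<in> pexps {..<m} UNIV" "\<And>x v. peval x (pder v e) = mev x (mpderiv v (T $ i))"
        using mpoly_pexp[OF _ Ti, of UNIV] by (auto simp: subring_set_def)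
      have "poly g t = peval (\<lambda>i. u $ i + t * (v $ i - u $ i)) (pder j e)" by (simp add: g e)
      also have "\<dots> = peval (\<lambda>i. ln t $ i) (pder j e)"
        using e(1) by (intro peval_cong[OF pder_pexps]) (auto simp: ln_def subring_set_def)
      also have "\<dots> = jacobian_at T (ln t) $$ (i, j)"
        using ij by (simp add: e jacobian_at_def dT meval_mev)
      finally show ?thesis .
    qed
    then show "\<exists>g. i < m \<longrightarrow> j < m \<longrightarrow> (\<forall>t. poly g t = jacobian_at T (ln t) $$ (i, j))" by blast
  qed
  then obtain g where g: "\<And>i j t. i < m \<Longrightarrow> j < m \<Longrightarrow> poly (g i j) t = jacobian_at T (ln t) $$ (i, j)" by metis
  define h where "h = (\<Sum>p\<in>{p. p permutes {0..<m}}. [:signof p:] * (\<Prod>i = 0..<m. g i (p i)))"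
  have h: "poly h t = det (jacobian_at T (ln t))" for t
    unfolding det_def'[OF car] h_def
    by (auto simp: poly_sum poly_prod g permutes_in_image intro!: sum.cong prod.cong arg_cong2[of _ _ _ _ times])
  have "degree h = 0"
  proof (rule ccontr)
    assume "degree h \<noteq> 0"
    then obtain t where "poly h t = 0" using alg_closed_imp_poly_has_root[of h] by auto
    moreover have "ln t \<in> carrier_vec m" by (simp add: ln_def)
    ultimately show False using nz h by auto
  qed
  then have "poly h 0 = poly h 1" by (metis degree_eq_zeroE poly_const_conv)
  moreover have "ln 0 = u" "ln 1 = v" using u v by (auto simp: ln_def)
  ultimately show "det (jacobian_at T u) = det (jacobian_at T v)" by (simp add: h)
qed

text \<open>Since \<open>r 0 \<noteq> 0\<close>, the shift on blocks of \<open>g\<close> consecutive points is invertible even if the affine map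
  itself is not.\<close>

lemma affine_orbit_recurrence:
  fixes u :: "nat \<Rightarrow> nat \<Rightarrow> 'a::field"
  assumes step: "\<And>n i. i < m \<Longrightarrow> u (Suc n) i = (\<Sum>j<m. a i j * u n j) + b i"
  obtains e g and r :: "nat \<Rightarrow> 'a" where "g \<ge> 1" "r 0 \<noteq> 0"
    "\<And>n i. n \<ge> e \<Longrightarrow> i < m \<Longrightarrow> u (n + g) i = (\<Sum>k<g. r k * u (n + k) i)"
proof -
  \<comment> \<open>Any \<open>m + 2\<close> points of affine \<open>m\<close>-space are affinely
    dependent. A row of ones forces the weights to sum to 0; there are two such rows, which makes
    the matrix square and singular.\<close>
  define B where "B = mat (m + 2) (m + 2) (\<lambda>(i, j). if i < m then u j i else 1)"
  have B: "B \<in> carrier_mat (m + 2) (m + 2)" by (simp add: B_def)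
  have "row B m = row B (m + 1)" by (intro eq_vecI) (auto simp: B_def)
  then have "det B = 0" by (intro det_identical_rows[OF B, of m "m + 1"]) auto
  then obtain q where q: "q \<in> carrier_vec (m + 2)" "q \<noteq> 0\<^sub>v (m + 2)" "B *\<^sub>v q = 0\<^sub>v (m + 2)"
    using det_0_iff_vec_prod_zero_field[OF B] by blast
  have rows: "(\<Sum>j<m + 2. B $$ (i, j) * q $ j) = 0" if "i < m + 2" for i
  proof -
    have "(B *\<^sub>v q) $ i = 0" using q(3) that by simp
    then show ?thesis using B q(1) that by (simp add: scalar_prod_def atLeast0LessThan)
  qed
  have q0: "(\<Sum>j<m + 2. q $ j) = 0" using rows[of m] by (simp add: B_def)
  have rel: "(\<Sum>j<m + 2. q $ j * u (n + j) i) = 0" if "i < m" for n i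
    using that
  proof (induction n arbitrary: i)
    case 0
    then show ?case using rows[of i] by (simp add: B_def mult.commute)
  next
    case (Suc n)
    have "(\<Sum>j<m + 2. q $ j * u (Suc n + j) i) =
        (\<Sum>j<m + 2. (\<Sum>l<m. a i l * (q $ j * u (n + j) l)) + b i * q $ j)"
      using Suc.prems by (intro sum.cong refl) (simp add: step sum_distrib_left algebra_simps)
    also have "\<dots> = (\<Sum>l<m. a i l * (\<Sum>j<m + 2. q $ j * u (n + j) l)) + b i * (\<Sum>j<m + 2. q $ j)"
      unfolding sum.distrib sum_distrib_left by (subst sum.swap) simp
    also have "\<dots> = 0" using Suc.IH q0 by simp
    finally show ?case .
  qed
  \<comment> \<open>Starting at the first nonzero weight \<open>e\<close> makes the recurrence
    reversible, and ending at the last one, \<open>f\<close>, allows solving for the newest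
    point.\<close>
  define Nz where "Nz = {j. j < m + 2 \<and> q $ j \<noteq> 0}"
  have "finite Nz" by (auto simp: Nz_def)
  have "Nz \<noteq> {}" using q(1,2) by (auto simp: Nz_def)
  define e where "e = Min Nz"
  define f where "f = Max Nz"
  have e: "e < m + 2" "q $ e \<noteq> 0" using Min_in[OF \<open>finite Nz\<close> \<open>Nz \<noteq> {}\<close>] by (auto simp: e_def Nz_def)
  have f: "f < m + 2" "q $ f \<noteq> 0" using Max_in[OF \<open>finite Nz\<close> \<open>Nz \<noteq> {}\<close>] by (auto simp: f_def Nz_def)
  have low: "q $ j = 0" if "j < e" for j
  proof (rule ccontr)
    assume "q $ j \<noteq> 0"
    then have "j \<in> Nz" using that e(1) by (simp add: Nz_def)
    from Min_le[OF \<open>finite Nz\<close> this] that show False by (simp add: e_def)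
  qed
  have high: "q $ j = 0" if "f < j" "j < m + 2" for j
  proof (rule ccontr)
    assume "q $ j \<noteq> 0"
    then have "j \<in> Nz" using that by (simp add: Nz_def)
    from Max_ge[OF \<open>finite Nz\<close> this] that show False by (simp add: f_def)
  qed
  have ef: "e \<le> f" using low f by (meson not_le)
  have split: "(\<Sum>j<m + 2. q $ j * h j) = (\<Sum>k<f - e. q $ (e + k) * h (e + k)) + q $ f * h f" for h :: "nat \<Rightarrow> 'a"
  proof -
    have "(\<Sum>j<m + 2. q $ j * h j) = (\<Sum>j\<in>{e..<Suc f}. q $ j * h j)"
      using f(1) low high by (intro sum.mono_neutral_right) (auto simp: not_le not_less_eq)
    also have "\<dots> = (\<Sum>j\<in>{e..<f}. q $ j * h j) + q $ f * h f" using ef by simp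
    also have "(\<Sum>j\<in>{e..<f}. q $ j * h j) = (\<Sum>k<f - e. q $ (e + k) * h (e + k))"
      using ef by (intro sum.reindex_bij_witness[of _ "\<lambda>k. e + k" "\<lambda>j. j - e"]) auto
    finally show ?thesis .
  qed
  \<comment> \<open>A single nonzero weight cannot sum to 0, so the recurrence has positive
    order.\<close>
  have "e \<noteq> f"
  proof
    assume "e = f"
    then have "(\<Sum>j<m + 2. q $ j) = q $ f" using split[of "\<lambda>_. 1"] by simp
    with q0 f show False by simp
  qed
  show ?thesis
  proof (rule that[of "f - e" "\<lambda>k. - (q $ (e + k) / q $ f)" e])
    show "1 \<le> f - e" using ef \<open>e \<noteq> f\<close> by simp
    show "- (q $ (e + 0) / q $ f) \<noteq> 0" using e f by simp
    fix n i assume n: "e \<le> n" and i: "i < m"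
    have "(\<Sum>k<f - e. q $ (e + k) * u (n - e + (e + k)) i) + q $ f * u (n - e + f) i = 0"
      using rel[OF i, of "n - e"] unfolding split[of "\<lambda>j. u (n - e + j) i"] .
    moreover have "n - e + (e + k) = n + k" for k using n by simp
    moreover have "n - e + f = n + (f - e)" using n ef by simp
    ultimately have "(\<Sum>k<f - e. q $ (e + k) * u (n + k) i) + q $ f * u (n + (f - e)) i = 0"
      by (simp only:)
    then have "q $ f * u (n + (f - e)) i = - (\<Sum>k<f - e. q $ (e + k) * u (n + k) i)"
      by (rule add_eq_0_iff[THEN iffD1])
    then have "u (n + (f - e)) i = - (\<Sum>k<f - e. q $ (e + k) * u (n + k) i) / q $ f"
      using f(2) by (metis nonzero_mult_div_cancel_left)
    then show "u (n + (f - e)) i = (\<Sum>k<f - e. - (q $ (e + k) / q $ f) * u (n + k) i)"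
      by (simp add: sum_negf sum_divide_distrib)
  qed
qed


section \<open>The Dynamical Mordell--Lang property of the skew product\<close>

definition coeffs_of :: "'a::zero mpoly \<Rightarrow> 'a set" where
  "coeffs_of p = Poly_Mapping.lookup p ` Poly_Mapping.keys p"

lemma finite_coeffs_of: "finite (coeffs_of p)"
  by (simp add: coeffs_of_def)

lemma range_lookup_gen:
  assumes "coeffs_of p \<subseteq> G" shows "range (Poly_Mapping.lookup p) \<subseteq> gen G"
proof
  fix y assume "y \<in> range (Poly_Mapping.lookup p)"
  then obtain \<alpha> where "y = Poly_Mapping.lookup p \<alpha>" by auto
  then have "y = 0 \<or> y \<in> G"
    using assms by (cases "\<alpha> \<in> Poly_Mapping.keys p") (auto simp: coeffs_of_def in_keys_iff)
  then show "y \<in> gen G" using gen_superset sr_zero[OF subring_gen] by blast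
qed

lemma mev_in:
  assumes "subring_set A" "p \<in> poly_ring n" "range (Poly_Mapping.lookup p) \<subseteq> A" "\<And>i. i < n \<Longrightarrow> x i \<in> A"
  shows "mev x p \<in> A"
proof -
  obtain e where "e \<in> pexps {..<n} A" "peval x e = mev x p" using mpoly_pexp[OF assms(1-3)] by blast
  then show ?thesis using peval_in[OF assms(1), of e "{..<n}" x] assms(4) by simp
qed

lemma mono_val_scale:
  fixes a b :: "nat \<Rightarrow> 'a::comm_ring_1"
  assumes "Poly_Mapping.keys \<alpha> \<subseteq> {..<m + r}"
  shows "mono_val \<alpha> (\<lambda>i. if i < m then a i else c * b i) =
    c ^ (\<Sum>j\<in>{m..<m + r}. Poly_Mapping.lookup \<alpha> j) * mono_val \<alpha> (\<lambda>i. if i < m then a i else b i)"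
proof -
  let ?l = "Poly_Mapping.lookup \<alpha>"
  have "mono_val \<alpha> (\<lambda>i. if i < m then a i else c * b i) =
      (\<Prod>i\<in>{..<m + r}. (if i < m then 1 else c ^ ?l i) * (if i < m then a i else b i) ^ ?l i)"
    unfolding mono_val_superset[OF finite_lessThan assms]
    by (intro prod.cong) (auto simp: power_mult_distrib)
  also have "\<dots> = (\<Prod>i\<in>{..<m + r}. if i < m then 1 else c ^ ?l i) * mono_val \<alpha> (\<lambda>i. if i < m then a i else b i)"
    unfolding mono_val_superset[OF finite_lessThan assms] prod.distrib ..
  also have "(\<Prod>i\<in>{..<m + r}. if i < m then 1 else c ^ ?l i) = (\<Prod>i\<in>{m..<m + r}. c ^ ?l i)"
    by (intro prod.mono_neutral_cong_right) auto
  also have "\<dots> = c ^ (\<Sum>j\<in>{m..<m + r}. ?l j)" by (rule power_sum[symmetric])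
  finally show ?thesis .
qed

text \<open>By homogeneity, scaling the fibre by \<open>c n\<close> multiplies \<open>P\<close> by
  \<open>c n ^ (d - 1)\<close> and the linear part by \<open>c n\<close>, which gives the
  factorisation \<open>z n = c n * w n\<close>. \<open>N\<close> and \<open>j0\<close> are fixed
  before \<open>p\<close>, whose coefficients may lie outside \<open>gen G\<close>. In a supposed
  counterexample they are exchanged for coefficients in \<open>gen G\<close> that keep the given
  zeros and the given nonzero value.\<close>

theorem skew_orbit_zeros:
  fixes G0 :: "'a::{field_char_0, alg_closed_field} set" and \<iota> :: "nat \<Rightarrow> 'b"
    and P :: "'a mpoly" and Mp Np :: "nat \<Rightarrow> nat \<Rightarrow> 'a mpoly"
  assumes G0: "finite G0" and Ib: "finite Ib" and \<iota>: "\<And>i. i < m \<Longrightarrow> \<iota> i \<in> Ib"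
    and TE: "\<And>b. b \<in> Ib \<Longrightarrow> TE b \<in> pexps Ib (gen G0)"
    and U: "\<And>n b. b \<in> Ib \<Longrightarrow> U n b \<in> gen G0"
    and Ustep: "\<And>n b. b \<in> Ib \<Longrightarrow> U (Suc n) b = peval (U n) (TE b)"
    and Uinj: "\<And>n. near_inj (gen G0) Ib TE (U n)"
    and \<sigma>: "mono \<sigma>" "\<And>n. \<sigma> n \<ge> 1" "(\<lambda>n. real ((n + 1) * \<sigma> n) / real d ^ n) \<longlonglongrightarrow> 0"
    and szU: "\<And>n b. b \<in> Ib \<Longrightarrow> sz G0 (\<sigma> n) (2 ^ \<sigma> n) (U n b)"
    and d: "d \<ge> 2" and P: "P \<in> poly_ring (m + r)" "homogeneous_in {m..<m + r} (d - 1) P"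
    and Mp: "\<And>i j. i < r \<Longrightarrow> j < r \<Longrightarrow> Mp i j \<in> poly_ring m"
    and Np: "\<And>i j. i < r \<Longrightarrow> j < r \<Longrightarrow> Np i j \<in> poly_ring m"
    and NM: "\<And>x i l. i < r \<Longrightarrow> l < r \<Longrightarrow> (\<Sum>j<r. mev x (Np i j) * mev x (Mp j l)) = (if i = l then 1 else 0)"
    and xx: "\<And>n i. xx n i = (if i < m then U n (\<iota> i) else z n (i - m))"
    and zstep: "\<And>n j. j < r \<Longrightarrow> z (Suc n) j = mev (xx n) P * (\<Sum>l<r. mev (xx n) (Mp j l) * z n l)"
  shows "\<exists>N\<ge>1. \<exists>j0. \<forall>p\<in>poly_ring (m + r). \<forall>a\<ge>j0. infinite {l. mev (xx (a + N * l)) p = 0} \<longrightarrow>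
    (\<forall>l. mev (xx (a + N * l)) p = 0)"
proof -
  define G where "G = G0 \<union> coeffs_of P \<union> (\<Union>i<r. \<Union>j<r. coeffs_of (Mp i j) \<union> coeffs_of (Np i j)) \<union>
    z 0 ` {..<r} \<union> {inverse (of_nat d)}"
  let ?A = "gen G"
  note A = subring_gen[of G]
  have finG: "finite G" using G0 by (simp add: G_def finite_coeffs_of)
  have G0G: "G0 \<subseteq> G" by (auto simp: G_def)
  have sub: "gen G0 \<subseteq> ?A" by (rule gen_mono[OF G0G])
  have Pc: "range (Poly_Mapping.lookup P) \<subseteq> ?A" by (rule range_lookup_gen) (auto simp: G_def)
  have Mc: "range (Poly_Mapping.lookup (Mp i j)) \<subseteq> ?A" if "i < r" "j < r" for i j
    by (rule range_lookup_gen) (use that in \<open>force simp: G_def\<close>)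
  have Nc: "range (Poly_Mapping.lookup (Np i j)) \<subseteq> ?A" if "i < r" "j < r" for i j
    by (rule range_lookup_gen) (use that in \<open>force simp: G_def\<close>)
  define ren :: "nat \<Rightarrow> 'b + nat" where "ren i = (if i < m then Inl (\<iota> i) else Inr (i - m))" for i
  define ub where "ub n i = U n (\<iota> i)" for n i
  have UA: "U n b \<in> ?A" if "b \<in> Ib" for n b using U[OF that] sub by blast
  have ubA: "ub n i \<in> ?A" if "i < m" for n i unfolding ub_def by (rule UA[OF \<iota>[OF that]])
  have "\<forall>j l. \<exists>e. j < r \<longrightarrow> l < r \<longrightarrow> e \<in> pexps {..<m} ?A \<and> (\<forall>x. peval x e = mev x (Mp j l))"
    using mpoly_pexp[OF A Mp Mc] by meson
  then obtain me where me: "\<And>j l. j < r \<Longrightarrow> l < r \<Longrightarrow> me j l \<in> pexps {..<m} ?A"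
    "\<And>j l x. j < r \<Longrightarrow> l < r \<Longrightarrow> peval x (me j l) = mev x (Mp j l)" by metis
  obtain pe where pe: "pe \<in> pexps {..<m + r} ?A" "\<And>x. peval x pe = mev x P"
    using mpoly_pexp[OF A P(1) Pc] by blast
  define ME where "ME j l = prename \<iota> (me j l)" for j l
  define PE where "PE = prename ren pe"
  define w where "w = rec_nat (z 0) (\<lambda>n v j. \<Sum>l<r. mev (ub n) (Mp j l) * v l)"
  have weq: "w 0 = z 0" "\<And>n j. w (Suc n) j = (\<Sum>l<r. mev (ub n) (Mp j l) * w n l)" by (simp_all add: w_def)
  define c where "c = rec_nat 1 (\<lambda>n c. c ^ d * peval (case_sum (U n) (w n)) PE)"
  have ceq: "c 0 = 1" "\<And>n. c (Suc n) = c n ^ d * peval (case_sum (U n) (w n)) PE" by (simp_all add: c_def)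
  define NV where "NV n i j = mev (ub n) (Np i j)" for n i j
  have renJ: "ren ` {..<m + r} \<subseteq> Inl ` Ib \<union> Inr ` {..<r}"
    using \<iota> by (auto simp: ren_def)
  have MEv: "peval (U n) (ME j l) = mev (ub n) (Mp j l)" if "j < r" "l < r" for n j l
    by (simp add: ME_def me(2)[OF that] ub_def[abs_def])
  interpret skew_system G Ib TE U r d ME NV PE w c \<sigma>
  proof
    show "finite G" "finite Ib" by (fact finG Ib)+
    show "TE b \<in> pexps Ib ?A" if "b \<in> Ib" for b by (rule pexps_mono[OF TE[OF that] order_refl sub])
    show "U n b \<in> ?A" if "b \<in> Ib" for n b by (rule UA[OF that])
    show "U (Suc n) b = peval (U n) (TE b)" if "b \<in> Ib" for n b by (rule Ustep[OF that])
    show "near_inj ?A Ib TE (U n)" for n by (rule near_inj_mono[OF Uinj sub])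
    show "ME j l \<in> pexps Ib ?A" if "j < r" "l < r" for j l
      unfolding ME_def using \<iota> by (intro prename_pexps[OF me(1)[OF that]]) auto
    show "NV n i j \<in> ?A" if "i < r" "j < r" for n i j
      unfolding NV_def using ubA by (intro mev_in[OF A Np[OF that] Nc[OF that]])
    show "(\<Sum>j<r. NV n i j * peval (U n) (ME j l)) = (if i = l then 1 else 0)" if "i < r" "l < r" for n i l
      using NM[OF that, of "ub n"] that by (simp add: NV_def MEv)
    show "PE \<in> pexps (Inl ` Ib \<union> Inr ` {..<r}) ?A"
      unfolding PE_def by (rule prename_pexps[OF pe(1) renJ])
    show "w 0 j \<in> ?A" if "j < r" for j
      using that gen_superset[of G] by (auto simp: weq G_def)
    show "w (Suc n) j = (\<Sum>l<r. peval (U n) (ME j l) * w n l)" if "j < r" for n j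
      unfolding weq(2) using that by (intro sum.cong) (auto simp: MEv)
    show "c 0 = 1" by (rule ceq)
    show "c (Suc n) = c n ^ d * peval (case_sum (U n) (w n)) PE" for n by (rule ceq)
    show "d \<ge> 2" by (rule d)
    show "\<exists>u\<in>?A. of_nat d * u = (1 :: 'a)"
      using gen_superset[of G] d by (intro bexI[of _ "inverse (of_nat d)"]) (auto simp: G_def)
    show "mono \<sigma>" "\<sigma> n \<ge> 1" "(\<lambda>n. real ((n + 1) * \<sigma> n) / real d ^ n) \<longlonglongrightarrow> 0" for n by (fact \<sigma>)+
    show "sz G (\<sigma> n) (2 ^ \<sigma> n) (U n b)" if "b \<in> Ib" for n b by (rule sz_gens_mono[OF szU[OF that] G0G])
  qed
  define X' where "X' n i = (if i < m then ub n i else w n (i - m))" for n i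
  have Xren: "(\<lambda>i. case_sum (U n) (w n) (ren i)) = X' n" for n
    by (auto simp: ren_def X'_def ub_def)
  have PEv: "peval (case_sum (U n) (w n)) PE = mev (X' n) P" for n
    by (simp add: PE_def pe Xren)
  have scale: "mono_val \<alpha> (xx n) = c n ^ (\<Sum>j\<in>{m..<m + r}. Poly_Mapping.lookup \<alpha> j) * mono_val \<alpha> (X' n)"
    if \<alpha>: "Poly_Mapping.keys \<alpha> \<subseteq> {..<m + r}" and z: "\<And>j. j < r \<Longrightarrow> z n j = c n * w n j" for \<alpha> n
  proof -
    have "mono_val \<alpha> (xx n) = mono_val \<alpha> (\<lambda>i. if i < m then ub n i else c n * w n (i - m))"
      using z by (intro mono_val_cong[OF \<alpha>]) (auto simp: xx ub_def)
    also have "\<dots> = c n ^ (\<Sum>j\<in>{m..<m + r}. Poly_Mapping.lookup \<alpha> j) * mono_val \<alpha> (X' n)"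
      unfolding mono_val_scale[OF \<alpha>] X'_def[abs_def] ..
    finally show ?thesis .
  qed
  have zc: "z n j = c n * w n j" if "j < r" for n j
    using that
  proof (induction n arbitrary: j)
    case 0
    then show ?case by (simp add: ceq weq)
  next
    case (Suc n)
    have "mev (xx n) P = c n ^ (d - 1) * mev (X' n) P"
      unfolding mev_def sum_distrib_left
    proof (intro sum.cong refl)
      fix \<alpha> assume \<alpha>: "\<alpha> \<in> Poly_Mapping.keys P"
      then have "Poly_Mapping.keys \<alpha> \<subseteq> {..<m + r}" "(\<Sum>j\<in>{m..<m + r}. Poly_Mapping.lookup \<alpha> j) = d - 1"
        using P by (auto simp: poly_ring_def homogeneous_in_def)
      with scale[OF this(1) Suc.IH] show "Poly_Mapping.lookup P \<alpha> * mono_val \<alpha> (xx n) =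
          c n ^ (d - 1) * (Poly_Mapping.lookup P \<alpha> * mono_val \<alpha> (X' n))" by simp
    qed
    moreover have "(\<Sum>l<r. mev (xx n) (Mp j l) * z n l) = c n * w (Suc n) j"
      unfolding weq(2) sum_distrib_left
    proof (intro sum.cong refl)
      fix l assume l: "l \<in> {..<r}"
      have "mev (xx n) (Mp j l) = mev (ub n) (Mp j l)"
        using l Suc.prems by (intro mev_cong[OF Mp]) (auto simp: xx ub_def)
      then show "mev (xx n) (Mp j l) * z n l = c n * (mev (ub n) (Mp j l) * w n l)"
        using Suc.IH[of l] l by simp
    qed
    moreover have "c n ^ d = c n ^ (d - 1) * c n" using d by (cases d) auto
    ultimately show ?case unfolding zstep[OF Suc.prems] ceq(2) PEv by (simp add: algebra_simps)
  qed
  have xxA: "xx n i \<in> ?A" if "i < m + r" for n i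
  proof (cases "i < m")
    case True
    then show ?thesis using ubA by (simp add: xx ub_def)
  next
    case False
    then have "i - m < r" using that by simp
    have "w n j \<in> ?A" if "j < r" for j using X[of "Inr j" n] that by simp
    moreover have "c n \<in> ?A" by (rule c)
    ultimately show ?thesis using False \<open>i - m < r\<close> by (auto simp: xx zc intro: sr_mult[OF A])
  qed
  have mvA: "mono_val \<alpha> (xx n) \<in> ?A" if "Poly_Mapping.keys \<alpha> \<subseteq> {..<m + r}" for \<alpha> n
    unfolding mono_val_def using that xxA by (intro sr_prod[OF A] sr_power[OF A]) auto
  obtain N j0 where N: "N \<ge> 1" and skew: "\<forall>E f. (\<forall>e\<le>E. f e \<in> pexps J ?A) \<longrightarrow> (\<forall>a\<ge>j0.
    infinite {l. Q E f (a + N * l) = 0} \<longrightarrow> (\<forall>l. Q E f (a + N * l) = 0))"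
    using skew_zeros by (elim exE conjE) (rule that)
  show ?thesis
  proof (rule exI[of _ N], rule conjI[OF N exI[of _ j0]], intro ballI allI impI)
    fix p a l0
    assume p: "p \<in> poly_ring (m + r)" and a: "j0 \<le> a" and inf: "infinite {l. mev (xx (a + N * l)) p = 0}"
    let ?K = "Poly_Mapping.keys p"
    have K: "Poly_Mapping.keys \<alpha> \<subseteq> {..<m + r}" if "\<alpha> \<in> ?K" for \<alpha> using p that by (auto simp: poly_ring_def)
    show "mev (xx (a + N * l0)) p = 0"
    proof (rule ccontr)
      assume nz: "mev (xx (a + N * l0)) p \<noteq> 0"
      \<comment> \<open>A polynomial with the monomials of \<open>p\<close> is a linear form on the
        vectors of monomial values, so the exchange of coefficients is linear algebra.\<close>
      define vv where "vv n \<alpha> = mono_val \<alpha> (xx n)" for n \<alpha>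
      define W where "W = (\<lambda>l. vv (a + N * l)) ` {l. mev (xx (a + N * l)) p = 0}"
      have "\<exists>g. (\<forall>\<alpha>\<in>?K. g \<alpha> \<in> ?A) \<and> (\<forall>u\<in>W. (\<Sum>\<alpha>\<in>?K. g \<alpha> * u \<alpha>) = 0) \<and>
        (\<Sum>\<alpha>\<in>?K. g \<alpha> * vv (a + N * l0) \<alpha>) \<noteq> 0"
      proof (rule annihilator_descent[OF A finite_keys, where f = "Poly_Mapping.lookup p"])
        show "u \<alpha> \<in> ?A" if "u \<in> W" "\<alpha> \<in> ?K" for u \<alpha> using that mvA[OF K] by (auto simp: W_def vv_def)
        show "vv (a + N * l0) \<alpha> \<in> ?A" if "\<alpha> \<in> ?K" for \<alpha> using that mvA[OF K] by (auto simp: vv_def)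
        show "(\<Sum>\<alpha>\<in>?K. Poly_Mapping.lookup p \<alpha> * u \<alpha>) = 0" if "u \<in> W" for u
          using that by (auto simp: W_def vv_def mev_def)
        show "(\<Sum>\<alpha>\<in>?K. Poly_Mapping.lookup p \<alpha> * vv (a + N * l0) \<alpha>) \<noteq> 0"
          using nz by (simp add: vv_def mev_def)
      qed
      then obtain g where g: "\<And>\<alpha>. \<alpha> \<in> ?K \<Longrightarrow> g \<alpha> \<in> ?A" "\<And>u. u \<in> W \<Longrightarrow> (\<Sum>\<alpha>\<in>?K. g \<alpha> * u \<alpha>) = 0"
        "(\<Sum>\<alpha>\<in>?K. g \<alpha> * vv (a + N * l0) \<alpha>) \<noteq> 0" by blast
      \<comment> \<open>Sorting the monomials by their degree in the fibre variables turns the new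
        linear form into some \<open>Q E f'\<close>.\<close>
      define zd where "zd \<alpha> = (\<Sum>j\<in>{m..<m + r}. Poly_Mapping.lookup \<alpha> j)" for \<alpha> :: "nat \<Rightarrow>\<^sub>0 nat"
      define E where "E = sum zd ?K"
      have zdE: "zd \<alpha> \<le> E" if "\<alpha> \<in> ?K" for \<alpha> unfolding E_def using that by (intro member_le_sum) auto
      have "\<forall>e. \<exists>f. f \<in> pexps {..<m + r} ?A \<and> (\<forall>x. peval x f = (\<Sum>\<alpha>\<in>{\<alpha>\<in>?K. zd \<alpha> = e}. g \<alpha> * mono_val \<alpha> x))"
      proof
        fix e
        have "\<exists>f\<in>pexps {..<m + r} ?A. \<forall>x. peval x f = (\<Sum>\<alpha>\<in>{\<alpha>\<in>?K. zd \<alpha> = e}. g \<alpha> * mono_val \<alpha> x) \<and>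
            (\<forall>v. peval x (pder v f) = (\<Sum>\<alpha>\<in>{\<alpha>\<in>?K. zd \<alpha> = e}. g \<alpha> * mono_der v \<alpha> x))"
          using K g(1) by (intro mono_sum_pexp A) auto
        then show "\<exists>f. f \<in> pexps {..<m + r} ?A \<and> (\<forall>x. peval x f = (\<Sum>\<alpha>\<in>{\<alpha>\<in>?K. zd \<alpha> = e}. g \<alpha> * mono_val \<alpha> x))"
          by blast
      qed
      then obtain f where f: "\<And>e. f e \<in> pexps {..<m + r} ?A"
        "\<And>e x. peval x (f e) = (\<Sum>\<alpha>\<in>{\<alpha>\<in>?K. zd \<alpha> = e}. g \<alpha> * mono_val \<alpha> x)" by metis
      define f' where "f' e = prename ren (f e)" for e
      have f': "f' e \<in> pexps J ?A" for e unfolding f'_def by (rule prename_pexps[OF f(1) renJ])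
      have Q: "Q E f' n = (\<Sum>\<alpha>\<in>?K. g \<alpha> * vv n \<alpha>)" for n
      proof -
        have "Q E f' n = (\<Sum>e\<le>E. \<Sum>\<alpha>\<in>{\<alpha>\<in>?K. zd \<alpha> = e}. c n ^ e * (g \<alpha> * mono_val \<alpha> (X' n)))"
          by (simp add: Q_def f'_def f(2) Xren sum_distrib_left)
        also have "\<dots> = (\<Sum>e\<le>E. \<Sum>\<alpha>\<in>{\<alpha>\<in>?K. zd \<alpha> = e}. g \<alpha> * vv n \<alpha>)"
          using scale[OF K zc] by (intro sum.cong refl) (auto simp: vv_def zd_def)
        also have "\<dots> = (\<Sum>\<alpha>\<in>?K. g \<alpha> * vv n \<alpha>)"
          using zdE by (intro sum.group) auto
        finally show ?thesis .
      qed
      have "{l. mev (xx (a + N * l)) p = 0} \<subseteq> {l. Q E f' (a + N * l) = 0}"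
        using g(2) by (auto simp: Q W_def)
      then have "infinite {l. Q E f' (a + N * l) = 0}" using inf infinite_super by blast
      then have "Q E f' (a + N * l0) = 0" using skew f' a by blast
      then show False using g(3) by (simp add: Q)
    qed
  qed
qed

text \<open>The shift by \<open>e\<close> allows for dropping the beginning of an orbit of a non-invertible affine map.\<close>

definition base_system :: "'b itself \<Rightarrow> nat \<Rightarrow> nat \<Rightarrow> (nat \<Rightarrow> nat \<Rightarrow> 'a::field_char_0) \<Rightarrow> bool" where
  "base_system TYPE('b) d m v \<longleftrightarrow> (\<exists>G (Ib :: 'b set) \<iota> TE U \<sigma> e. finite G \<and> finite Ib \<and> (\<forall>i<m. \<iota> i \<in> Ib) \<and>
     (\<forall>b\<in>Ib. TE b \<in> pexps Ib (gen G)) \<and> (\<forall>n. \<forall>b\<in>Ib. U n b \<in> gen G) \<and>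
     (\<forall>n. \<forall>b\<in>Ib. U (Suc n) b = peval (U n) (TE b)) \<and> (\<forall>n. near_inj (gen G) Ib TE (U n)) \<and>
     mono \<sigma> \<and> (\<forall>n. \<sigma> n \<ge> 1) \<and> (\<lambda>n. real ((n + 1) * \<sigma> n) / real d ^ n) \<longlonglongrightarrow> 0 \<and>
     (\<forall>n. \<forall>b\<in>Ib. sz G (\<sigma> n) (2 ^ \<sigma> n) (U n b)) \<and> (\<forall>n. \<forall>i<m. U n (\<iota> i) = v (n + e) i))"

lemma base_systemE:
  fixes v :: "nat \<Rightarrow> nat \<Rightarrow> 'a::field_char_0"
  assumes "base_system TYPE('b) d m v"
  obtains G and Ib :: "'b set" and \<iota> TE U \<sigma> e where "finite G" "finite Ib" "\<And>i. i < m \<Longrightarrow> \<iota> i \<in> Ib"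
    "\<And>b. b \<in> Ib \<Longrightarrow> TE b \<in> pexps Ib (gen G)" "\<And>n b. b \<in> Ib \<Longrightarrow> U n b \<in> gen G"
    "\<And>n b. b \<in> Ib \<Longrightarrow> U (Suc n) b = peval (U n) (TE b)" "\<And>n. near_inj (gen G) Ib TE (U n)"
    "mono \<sigma>" "\<And>n. \<sigma> n \<ge> 1" "(\<lambda>n. real ((n + 1) * \<sigma> n) / real d ^ n) \<longlonglongrightarrow> 0"
    "\<And>n b. b \<in> Ib \<Longrightarrow> sz G (\<sigma> n) (2 ^ \<sigma> n) (U n b)" "\<And>n i. i < m \<Longrightarrow> U n (\<iota> i) = v (n + e) i"
proof -
  from assms[unfolded base_system_def] obtain G and Ib :: "'b set" and \<iota> TE U \<sigma> e where
    "finite G \<and> finite Ib \<and> (\<forall>i<m. \<iota> i \<in> Ib) \<and>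
     (\<forall>b\<in>Ib. TE b \<in> pexps Ib (gen G)) \<and> (\<forall>n. \<forall>b\<in>Ib. U n b \<in> gen G) \<and>
     (\<forall>n. \<forall>b\<in>Ib. U (Suc n) b = peval (U n) (TE b)) \<and> (\<forall>n. near_inj (gen G) Ib TE (U n)) \<and>
     mono \<sigma> \<and> (\<forall>n. \<sigma> n \<ge> 1) \<and> (\<lambda>n. real ((n + 1) * \<sigma> n) / real d ^ n) \<longlonglongrightarrow> 0 \<and>
     (\<forall>n. \<forall>b\<in>Ib. sz G (\<sigma> n) (2 ^ \<sigma> n) (U n b)) \<and> (\<forall>n. \<forall>i<m. U n (\<iota> i) = v (n + e) i)"
    by (elim exE) (rule that)
  then show ?thesis by (intro that[of G Ib \<iota> TE U \<sigma> e]) blast+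
qed

lemma elements_mat_nth: "elements_mat M \<subseteq> S \<Longrightarrow> M \<in> carrier_mat r s \<Longrightarrow> i < r \<Longrightarrow> j < s \<Longrightarrow> M $$ (i, j) \<in> S"
  by blast

text \<open>A closed set may be given by infinitely many equations; the modulus common to all of
  them reduces the claim to \<open>finite_union_of_APsI\<close>. The shift \<open>e\<close> of the
  base system only raises the threshold from \<open>j0\<close> to \<open>j0 + e\<close>.\<close>

lemma satisfies_DML_skew_map:
  fixes T :: "'a::{alg_closed_field, field_char_0} mpoly vec"
  assumes d: "d \<ge> 2" and M: "M \<in> GL_poly r m" and P: "P \<in> poly_ring (m + r)"
    "homogeneous_in {m..<m + r} (d - 1) P" and T: "T \<in> poly_endos m"
    and base: "\<And>u. u \<in> carrier_vec m \<Longrightarrow> base_system TYPE('b) d m (\<lambda>n i. (endo_apply T ^^ n) u $ i)"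
  shows "satisfies_DML (m + r) (skew_map m r T P M)"
  unfolding satisfies_DML_def
proof (intro ballI allI impI)
  let ?F = "skew_map m r T P M"
  fix x :: "'a vec" and V :: "'a vec set" assume x: "x \<in> carrier_vec (m + r)" and V: "closed_subvariety (m + r) V"
  from V obtain S where S: "S \<subseteq> poly_ring (m + r)" "V = {x \<in> carrier_vec (m + r). \<forall>p\<in>S. meval x p = 0}"
    by (auto simp: closed_subvariety_def)
  from M obtain N where Mc: "M \<in> carrier_mat r r" "elements_mat M \<subseteq> poly_ring m"
    and Nc: "N \<in> carrier_mat r r" "elements_mat N \<subseteq> poly_ring m" and NM: "inverts_mat N M"
    by (auto simp: GL_poly_def)
  have dT: "dim_vec T = m" using T by (auto simp: poly_endos_def)
  have dF: "dim_vec ?F = m + r" using dT Mc by (simp add: skew_map_def)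
  have F1: "?F $ i = T $ i" if "i < m" for i using that dT Mc by (simp add: skew_map_def)
  have F2: "?F $ (m + j) = P * (\<Sum>l<r. M $$ (j, l) * mvar (m + l))" if "j < r" for j
    using that dT Mc by (simp add: skew_map_def scalar_prod_def atLeast0LessThan)
  define X where "X n = (endo_apply ?F ^^ n) x" for n
  have Xc: "X n \<in> carrier_vec (m + r)" for n
  proof (cases n)
    case 0
    then show ?thesis using x by (simp add: X_def)
  next
    case (Suc k)
    have "?F \<in> carrier_vec (m + r)" using dF by (rule carrier_vecI)
    then have "endo_apply ?F (X k) \<in> carrier_vec (m + r)" by (rule endo_apply_carrier)
    then show ?thesis by (simp add: X_def Suc)
  qed
  have Xs: "X (Suc n) $ i = mev (\<lambda>i. X n $ i) (?F $ i)" if "i < m + r" for n i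
    using that dF by (simp add: X_def endo_apply_nth)
  define u where "u = vec m (\<lambda>i. x $ i)"
  have Xu: "X n $ i = (endo_apply T ^^ n) u $ i" if "i < m" for n i
    using that
  proof (induction n arbitrary: i)
    case 0
    then show ?case by (simp add: X_def u_def)
  next
    case (Suc n)
    have "X (Suc n) $ i = mev (\<lambda>i. X n $ i) (T $ i)" using Suc.prems by (simp add: Xs F1)
    also have "\<dots> = mev (\<lambda>i. (endo_apply T ^^ n) u $ i) (T $ i)"
      by (rule mev_cong[OF poly_endos_nth[OF T Suc.prems] Suc.IH])
    finally show ?case using Suc.prems dT by (simp add: endo_apply_nth)
  qed
  have "u \<in> carrier_vec m" by (simp add: u_def)
  from base[OF this] obtain G and Ib :: "'b set" and \<iota> TE U \<sigma> e where bs: "finite G" "finite Ib"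
    "\<And>i. i < m \<Longrightarrow> \<iota> i \<in> Ib"
    "\<And>b. b \<in> Ib \<Longrightarrow> TE b \<in> pexps Ib (gen G)" "\<And>n b. b \<in> Ib \<Longrightarrow> U n b \<in> gen G"
    "\<And>n b. b \<in> Ib \<Longrightarrow> U (Suc n) b = peval (U n) (TE b)" "\<And>n. near_inj (gen G) Ib TE (U n)"
    "mono \<sigma>" "\<And>n. \<sigma> n \<ge> 1" "(\<lambda>n. real ((n + 1) * \<sigma> n) / real d ^ n) \<longlonglongrightarrow> 0"
    "\<And>n b. b \<in> Ib \<Longrightarrow> sz G (\<sigma> n) (2 ^ \<sigma> n) (U n b)"
    and Ue: "\<And>n i. i < m \<Longrightarrow> U n (\<iota> i) = (endo_apply T ^^ (n + e)) u $ i" by (rule base_systemE) blast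
  define z where "z n j = X (n + e) $ (m + j)" for n j
  define xx where "xx n i = (if i < m then U n (\<iota> i) else z n (i - m))" for n i
  have xxX: "xx n i = X (n + e) $ i" for n i
    by (auto simp: xx_def z_def Ue Xu)
  have ex: "\<exists>N\<ge>1. \<exists>j0. \<forall>p\<in>poly_ring (m + r). \<forall>a\<ge>j0. infinite {l. mev (xx (a + N * l)) p = 0} \<longrightarrow>
    (\<forall>l. mev (xx (a + N * l)) p = 0)"
  proof (rule skew_orbit_zeros[OF bs d P, where Mp = "\<lambda>i j. M $$ (i, j)" and Np = "\<lambda>i j. N $$ (i, j)"
        and z = z])
    show "M $$ (i, j) \<in> poly_ring m" if "i < r" "j < r" for i j
      by (rule elements_mat_nth[OF Mc(2,1) that])
    show "N $$ (i, j) \<in> poly_ring m" if "i < r" "j < r" for i j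
      by (rule elements_mat_nth[OF Nc(2,1) that])
    show "(\<Sum>j<r. mev x (N $$ (i, j)) * mev x (M $$ (j, l))) = (if i = l then 1 else 0)" if "i < r" "l < r" for x i l
    proof -
      have "(N * M) $$ (i, l) = (if i = l then 1 else 0)" using NM Nc that by (simp add: inverts_mat_def)
      then have "(\<Sum>j<r. N $$ (i, j) * M $$ (j, l)) = (if i = l then 1 else 0)"
        using Nc Mc that by (simp add: scalar_prod_def atLeast0LessThan)
      from arg_cong[OF this, of "mev x"] show ?thesis by (simp add: mev_sum mev_mult)
    qed
    show "xx n i = (if i < m then U n (\<iota> i) else z n (i - m))" for n i by (simp add: xx_def)
    show "z (Suc n) j = mev (xx n) P * (\<Sum>l<r. mev (xx n) (M $$ (j, l)) * z n l)" if j: "j < r" for n j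
    proof -
      have "xx n = (\<lambda>i. X (n + e) $ i)" by (rule ext) (rule xxX)
      then show ?thesis using j by (simp add: z_def Xs F2 mev_mult mev_sum)
    qed
  qed
  then obtain K j0 where K: "K \<ge> 1" and uni: "\<forall>p\<in>poly_ring (m + r). \<forall>a\<ge>j0.
    infinite {l. mev (xx (a + K * l)) p = 0} \<longrightarrow> (\<forall>l. mev (xx (a + K * l)) p = 0)"
    by (elim exE conjE) (rule that)
  have "finite_union_of_APs {n. \<forall>s\<in>(\<lambda>p n. meval (X n) p) ` S. s n = 0}"
  proof (rule finite_union_of_APsI[OF K, where ?j0.0 = "j0 + e"])
    fix s a assume "s \<in> (\<lambda>p n. meval (X n) p) ` S" and a: "j0 + e \<le> a" and inf: "infinite {l. s (a + K * l) = 0}"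
    then obtain p where p: "p \<in> S" "s = (\<lambda>n. meval (X n) p)" by auto
    have eq: "s (a + K * l) = mev (xx ((a - e) + K * l)) p" for l
    proof -
      have "(a - e) + K * l + e = a + K * l" using a by simp
      then show ?thesis by (simp add: p(2) meval_mev xxX[abs_def])
    qed
    have "a - e \<ge> j0" using a by simp
    then show "\<forall>l. s (a + K * l) = 0" using uni p S(1) inf unfolding eq by blast
  qed
  moreover have "{l. (endo_apply ?F ^^ l) x \<in> V} = {n. \<forall>s\<in>(\<lambda>p n. meval (X n) p) ` S. s n = 0}"
    using Xc by (auto simp: S(2) X_def)
  ultimately show "finite_union_of_APs {l. (endo_apply ?F ^^ l) x \<in> V}" by simp
qed

section \<open>The base systems of etale and of affine maps\<close>

lemma subring_poly_ring: "subring_set (poly_ring n :: 'a::comm_ring_1 mpoly set)"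
  unfolding subring_set_def
proof (intro conjI ballI)
  show "1 \<in> (poly_ring n :: 'a mpoly set)" by (simp add: poly_ring_def)
next
  fix p q :: "'a mpoly" assume pq: "p \<in> poly_ring n" "q \<in> poly_ring n"
  then show "p + q \<in> poly_ring n"
    using Poly_Mapping.keys_add[of p q] by (fastforce simp: poly_ring_def)
  show "p * q \<in> poly_ring n"
    unfolding poly_ring_def
  proof (intro CollectI ballI)
    fix \<gamma> assume "\<gamma> \<in> Poly_Mapping.keys (p * q)"
    then obtain \<alpha> \<beta> where "\<gamma> = \<alpha> + \<beta>" "\<alpha> \<in> Poly_Mapping.keys p" "\<beta> \<in> Poly_Mapping.keys q"
      using keys_mult[of p q] by blast
    then show "Poly_Mapping.keys \<gamma> \<subseteq> {..<n}"
      using pq Poly_Mapping.keys_add[of \<alpha> \<beta>] by (fastforce simp: poly_ring_def)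
  qed
qed (auto simp: poly_ring_def)

lemma msubst_poly_ring:
  assumes "p \<in> poly_ring m" "\<And>i. i < m \<Longrightarrow> g i \<in> poly_ring n"
  shows "msubst mconst g p \<in> (poly_ring n :: 'a::comm_ring_1 mpoly set)"
proof -
  have c: "mconst c \<in> (poly_ring n :: 'a mpoly set)" for c by (simp add: poly_ring_def mconst_def)
  have "g i \<in> poly_ring n" if "\<alpha> \<in> Poly_Mapping.keys p" "i \<in> Poly_Mapping.keys \<alpha>" for \<alpha> i
  proof -
    have "i < m" using assms(1) that by (auto simp: poly_ring_def)
    then show ?thesis by (rule assms(2))
  qed
  then show ?thesis unfolding msubst_def
    by (intro sr_sum sr_mult sr_prod sr_power subring_poly_ring c)
qed

lemma endo_iter_poly_endos:
  fixes T :: "'a::comm_ring_1 mpoly vec"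
  assumes T: "T \<in> poly_endos m" shows "endo_iter T q \<in> poly_endos m"
proof -
  have dT: "dim_vec T = m" using T by (auto simp: poly_endos_def)
  have "endo_iter T q $ i \<in> poly_ring m" if "i < m" for i
    using that
  proof (induction q arbitrary: i)
    case 0
    then show ?case using dT by (simp add: poly_ring_def mvar_def)
  next
    case (Suc q)
    then show ?case using dT msubst_poly_ring[OF poly_endos_nth[OF T Suc.prems] Suc.IH]
      by (simp add: endo_comp_def)
  qed
  moreover have "endo_iter T q \<in> carrier_vec m" using endo_iter_carrier[of T m q] T by (auto simp: poly_endos_def)
  ultimately show ?thesis by (auto simp: poly_endos_def vec_set_def)
qed

text \<open>The Jacobian determinant has the same value at all points, so adjoining one inverse
  provides, through adjugates, the inverse Jacobian along the whole orbit. The growth is measured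
  over \<open>q\<close> steps at once, where the degree is below \<open>d ^ q\<close>.\<close>

lemma base_system_etale:
  fixes T :: "'a::{alg_closed_field, field_char_0} mpoly vec"
  assumes T: "etale m T" and d: "d \<ge> 2" and q: "q \<ge> 1" "endo_degree (endo_iter T q) < d ^ q"
    and u: "u \<in> carrier_vec m"
  shows "base_system TYPE(nat) d m (\<lambda>n i. (endo_apply T ^^ n) u $ i)"
proof -
  have Tp: "T \<in> poly_endos m" using T by (simp add: etale_def)
  then have dT: "dim_vec T = m" by (auto simp: poly_endos_def)
  define Tq where "Tq = endo_iter T q"
  have Tqp: "Tq \<in> poly_endos m" unfolding Tq_def by (rule endo_iter_poly_endos[OF Tp])
  then have dTq: "dim_vec Tq = m" by (auto simp: poly_endos_def)
  define un where "un n = (endo_apply T ^^ n) u" for n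
  have unc: "un n \<in> carrier_vec m" for n
  proof (cases n)
    case 0
    then show ?thesis using u by (simp add: un_def)
  next
    case (Suc k)
    have "T \<in> carrier_vec m" using Tp by (auto simp: poly_endos_def)
    then have "endo_apply T (un k) \<in> carrier_vec m" by (rule endo_apply_carrier)
    then show ?thesis by (simp add: un_def Suc)
  qed
  define \<kappa> where "\<kappa> = det (jacobian_at T u)"
  have \<kappa>: "\<kappa> \<noteq> 0" "\<And>n. det (jacobian_at T (un n)) = \<kappa>"
    using etale_det_constant[OF T unc u] etale_det_constant(2)[OF T u u] by (auto simp: \<kappa>_def)
  define G where "G = (\<Union>i<m. coeffs_of (T $ i) \<union> coeffs_of (Tq $ i)) \<union> (\<lambda>i. u $ i) ` {..<m} \<union> {inverse \<kappa>}"
  let ?A = "gen G"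
  note A = subring_gen[of G]
  have finG: "finite G" by (simp add: G_def finite_coeffs_of)
  have Tc: "range (Poly_Mapping.lookup (T $ i)) \<subseteq> ?A" if "i < m" for i
    by (rule range_lookup_gen) (use that in \<open>auto simp: G_def\<close>)
  define U where "U n i = un n $ i" for n i
  have Us: "U (Suc n) i = mev (U n) (T $ i)" if "i < m" for n i
    using that dT by (simp add: U_def[abs_def] un_def endo_apply_nth)
  have UA: "U n i \<in> ?A" if "i < m" for n i
    using that
  proof (induction n arbitrary: i)
    case 0
    then show ?case using gen_superset[of G] by (auto simp: U_def un_def G_def)
  next
    case (Suc n)
    then show ?case unfolding Us[OF Suc.prems] by (intro mev_in[OF A poly_endos_nth[OF Tp Suc.prems] Tc])
  qed
  have "\<forall>i. \<exists>e. i < m \<longrightarrow> e \<in> pexps {..<m} ?A \<and> (\<forall>x. peval x e = mev x (T $ i)) \<and>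
      (\<forall>x v. peval x (pder v e) = mev x (mpderiv v (T $ i)))"
    using mpoly_pexp[OF A poly_endos_nth[OF Tp] Tc] by meson
  then obtain TE where TE: "\<And>i. i < m \<Longrightarrow> TE i \<in> pexps {..<m} ?A" "\<And>i x. i < m \<Longrightarrow> peval x (TE i) = mev x (T $ i)"
    "\<And>i x v. i < m \<Longrightarrow> peval x (pder v (TE i)) = mev x (mpderiv v (T $ i))" by metis
  have inj: "near_inj ?A {..<m} TE (U n)" for n
  proof (rule near_inj_left_inverse[OF A finite_lessThan,
        where L = "\<lambda>k i. inverse \<kappa> * adj_mat (jacobian_at T (un n)) $$ (k, i)"])
    let ?J = "jacobian_at T (un n)"
    have J: "?J \<in> carrier_mat m m" by (simp add: jacobian_at_def dT)
    have Je: "?J $$ (i, v) = peval (U n) (pder v (TE i))" if "i < m" "v < m" for i v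
      using that by (simp add: jacobian_at_def dT TE(3) meval_mev U_def[abs_def])
    have JA: "?J $$ (i, v) \<in> ?A" if "i < m" "v < m" for i v
      unfolding Je[OF that] using TE(1)[OF that(1)] UA by (intro peval_in[OF A pder_pexps[OF A]]) auto
    show "TE i \<in> pexps {..<m} ?A" if "i \<in> {..<m}" for i using TE(1) that by simp
    show "U n v \<in> ?A" if "v \<in> {..<m}" for v using UA that by simp
    have "inverse \<kappa> \<in> ?A" using gen_superset[of G] by (auto simp: G_def)
    then show "inverse \<kappa> * adj_mat ?J $$ (k, i) \<in> ?A" if "k \<in> {..<m}" "i \<in> {..<m}" for k i
      using that by (intro sr_mult[OF A] adj_mat_in_subring[OF A J JA]) auto
    show "(\<Sum>i<m. inverse \<kappa> * adj_mat ?J $$ (k, i) * peval (U n) (pder v (TE i))) = (if k = v then 1 else 0)"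
      if kv: "k \<in> {..<m}" "v \<in> {..<m}" for k v
    proof -
      have "(\<Sum>i<m. inverse \<kappa> * adj_mat ?J $$ (k, i) * peval (U n) (pder v (TE i))) =
          inverse \<kappa> * (\<Sum>i<m. adj_mat ?J $$ (k, i) * ?J $$ (i, v))"
        unfolding sum_distrib_left using kv by (intro sum.cong) (auto simp: Je)
      also have "(\<Sum>i<m. adj_mat ?J $$ (k, i) * ?J $$ (i, v)) = (adj_mat ?J * ?J) $$ (k, v)"
        using kv J adj_mat(1)[OF J] by (simp add: scalar_prod_def atLeast0LessThan)
      also have "\<dots> = (if k = v then \<kappa> else 0)" using kv by (simp add: adj_mat(3)[OF J] \<kappa>(2))
      finally show ?thesis using \<kappa>(1) by simp
    qed
  qed
  have UTq: "U (n + q) i = mev (U n) (Tq $ i)" if "i < m" for n i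
  proof -
    have "un (n + q) = endo_apply Tq (un n)"
      unfolding Tq_def endo_apply_iter[OF Tp unc] by (simp add: un_def funpow_add add.commute[of n])
    then show ?thesis using that dTq by (simp add: U_def[abs_def] endo_apply_nth)
  qed
  define E where "E = endo_degree Tq"
  obtain s0 where s0: "\<And>y. y \<in> insert 0 (\<Union>i<m. coeffs_of (Tq $ i)) \<Longrightarrow> sz G s0 (2 ^ s0) y"
  proof -
    have "finite (insert 0 (\<Union>i<m. coeffs_of (Tq $ i)))" by (simp add: finite_coeffs_of)
    moreover have "insert 0 (\<Union>i<m. coeffs_of (Tq $ i)) \<subseteq> ?A"
      using gen_superset[of G] sr_zero[OF A] by (auto simp: G_def)
    ultimately show ?thesis using that finite_sz_common by metis
  qed
  define K where "K = s0 + (\<Sum>i<m. card (Poly_Mapping.keys (Tq $ i)))"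
  have "\<exists>\<sigma>. mono \<sigma> \<and> (\<forall>n. \<sigma> n \<ge> 1) \<and> (\<lambda>n. real ((n + 1) * \<sigma> n) / real d ^ n) \<longlonglongrightarrow> 0 \<and>
    (\<forall>n. \<forall>b\<in>{..<m}. sz G (\<sigma> n) (2 ^ \<sigma> n) (U n b))"
  proof (rule size_growth[OF finite_lessThan d q(1), where E = E and K = K])
    show "E < d ^ q" using q(2) by (simp add: E_def Tq_def)
    show "U n b \<in> ?A" if "b \<in> {..<m}" for n b using UA that by simp
    fix n s b assume IH: "\<And>b. b \<in> {..<m} \<Longrightarrow> sz G s (2 ^ s) (U n b)" and b: "b \<in> {..<m}"
    let ?k = "Poly_Mapping.keys (Tq $ b)"
    have "sz G (E * s + (s0 + card ?k)) (2 ^ (E * s + (s0 + card ?k)))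
      (\<Sum>\<alpha>\<in>?k. Poly_Mapping.lookup (Tq $ b) \<alpha> * mono_val \<alpha> (U n))"
    proof (rule sz_mev[where n = m])
      fix \<alpha> assume \<alpha>: "\<alpha> \<in> ?k"
      have "Tq $ b \<noteq> 0" using \<alpha> by auto
      then have "total_degree (Tq $ b) \<le> E" unfolding E_def using b dTq by (intro endo_degree_ge) auto
      moreover have "Poly_Mapping.keys \<alpha> \<subseteq> {..<m}"
        using poly_endos_nth[OF Tqp, of b] b \<alpha> by (auto simp: poly_ring_def)
      moreover have "sz G s0 (2 ^ s0) (Poly_Mapping.lookup (Tq $ b) \<alpha>)"
        using \<alpha> b by (intro s0) (auto simp: coeffs_of_def)
      ultimately show "Poly_Mapping.keys \<alpha> \<subseteq> {..<m} \<and> (\<Sum>i\<in>Poly_Mapping.keys \<alpha>. Poly_Mapping.lookup \<alpha> i) \<le> E \<and>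
          sz G s0 (2 ^ s0) (Poly_Mapping.lookup (Tq $ b) \<alpha>)"
        using total_degree_ge[OF \<alpha>] by simp
    qed (use IH in auto)
    moreover have "card ?k \<le> (\<Sum>i<m. card (Poly_Mapping.keys (Tq $ i)))"
      using b by (intro member_le_sum) auto
    moreover have "U (n + q) b = (\<Sum>\<alpha>\<in>?k. Poly_Mapping.lookup (Tq $ b) \<alpha> * mono_val \<alpha> (U n))"
      using UTq[of b n] b by (simp add: mev_def)
    ultimately show "sz G (E * s + K) (2 ^ (E * s + K)) (U (n + q) b)"
      by (auto simp: K_def elim!: sz_mono intro!: power_increasing)
  qed
  then obtain \<sigma> where \<sigma>: "mono \<sigma>" "\<forall>n. \<sigma> n \<ge> 1" "(\<lambda>n. real ((n + 1) * \<sigma> n) / real d ^ n) \<longlonglongrightarrow> 0"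
    "\<forall>n. \<forall>b\<in>{..<m}. sz G (\<sigma> n) (2 ^ \<sigma> n) (U n b)" by blast
  show ?thesis
    unfolding base_system_def
    by (rule exI[of _ G], rule exI[of _ "{..<m}"], rule exI[of _ "\<lambda>i. i"], rule exI[of _ TE],
        rule exI[of _ U], rule exI[of _ \<sigma>], rule exI[of _ 0])
      (use finG TE UA Us inj \<sigma> in \<open>simp add: U_def un_def\<close>)
qed

text \<open>The variable \<open>(k, i)\<close> holds coordinate \<open>i\<close> of the k-th point
  in a window of \<open>g\<close> consecutive points. Moving the window by one is a companion map,
  for which only \<open>\<rho> 0\<close> has to be inverted. Sizes grow by a constant in each step,
  hence \<open>E = 1\<close>, which is below \<open>d\<close>.\<close>

lemma base_system_affine:
  fixes T :: "'a::{alg_closed_field, field_char_0} mpoly vec"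
  assumes T: "affine_linear m T" and d: "d \<ge> 2" and u: "u \<in> carrier_vec m"
  shows "base_system TYPE(nat \<times> nat) d m (\<lambda>n i. (endo_apply T ^^ n) u $ i)"
proof -
  obtain B b where B: "B \<in> carrier_mat m m" and b: "b \<in> carrier_vec m"
    and Teq: "T = map_mat mconst B *\<^sub>v vec m mvar + map_vec mconst b" using T by (auto simp: affine_linear_def)
  define v where "v n i = (endo_apply T ^^ n) u $ i" for n i
  have dT: "dim_vec T = m" using B b by (simp add: Teq)
  have Ti: "T $ i = (\<Sum>j<m. mconst (B $$ (i, j)) * mvar j) + mconst (b $ i)" if "i < m" for i
    using that B b by (simp add: Teq scalar_prod_def atLeast0LessThan)
  have step: "v (Suc n) i = (\<Sum>j<m. B $$ (i, j) * v n j) + b $ i" if "i < m" for n i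
    using that dT by (simp add: v_def endo_apply_nth Ti mev_add mev_sum mev_mult)
  from affine_orbit_recurrence[of m v "\<lambda>i j. B $$ (i, j)" "\<lambda>i. b $ i", OF step]
  obtain e g and \<rho> :: "nat \<Rightarrow> 'a" where g: "g \<ge> 1" and \<rho>: "\<rho> 0 \<noteq> 0"
    and rec: "\<And>n i. n \<ge> e \<Longrightarrow> i < m \<Longrightarrow> v (n + g) i = (\<Sum>k<g. \<rho> k * v (n + k) i)" by metis
  define Ib where "Ib = {..<g} \<times> {..<m}"
  define U where "U n z = v (n + e + fst z) (snd z)" for n and z :: "nat \<times> nat"
  define TE where "TE z = (if Suc (fst z) < g then PVar (Suc (fst z), snd z)
    else psum g (\<lambda>k. PMul (PConst (\<rho> k)) (PVar (k, snd z))))" for z :: "nat \<times> nat"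
  define G where "G = \<rho> ` {..<g} \<union> {inverse (\<rho> 0)} \<union> U 0 ` Ib"
  let ?A = "gen G"
  note A = subring_gen[of G]
  have finI: "finite Ib" by (simp add: Ib_def)
  have finG: "finite G" using finI by (simp add: G_def)
  have \<rho>A: "\<rho> k \<in> ?A" if "k < g" for k using that gen_superset[of G] by (auto simp: G_def)
  have TE: "TE z \<in> pexps Ib ?A" if "z \<in> Ib" for z
    using that \<rho>A by (auto simp: TE_def Ib_def intro!: psum_pexps[OF A])
  have Us: "U (Suc n) z = peval (U n) (TE z)" if z: "z \<in> Ib" for n z
  proof (cases "Suc (fst z) < g")
    case True
    then show ?thesis by (simp add: U_def TE_def)
  next
    case False
    then have eq: "Suc n + e + fst z = (n + e) + g" using z by (auto simp: Ib_def)
    have "U (Suc n) z = v ((n + e) + g) (snd z)" unfolding U_def eq ..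
    also have "\<dots> = (\<Sum>k<g. \<rho> k * v (n + e + k) (snd z))" using z by (intro rec) (auto simp: Ib_def)
    finally show ?thesis using False by (simp add: U_def TE_def)
  qed
  have UA: "U n z \<in> ?A" if "z \<in> Ib" for n z
    using that
  proof (induction n arbitrary: z)
    case 0
    then show ?case using gen_superset[of G] by (auto simp: G_def)
  next
    case (Suc n)
    then show ?case unfolding Us[OF Suc.prems] by (intro peval_in[OF A TE])
  qed
  have inj: "near_inj ?A Ib TE (U n)" for n
    unfolding near_inj_def
  proof (intro allI impI ballI)
    fix \<phi> p D R y y' z
    assume sp: "specialisation ?A \<phi> p D R" and y: "y ` Ib \<subseteq> R" "y' ` Ib \<subseteq> R" and z: "z \<in> Ib"
      and diff: "\<forall>i\<in>Ib. pev \<phi> (near \<phi> p (U n) y) (TE i) - pev \<phi> (near \<phi> p (U n) y') (TE i) \<in> pideal p R 2"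
    have \<phi>: "hom_on ?A \<phi>" "\<phi> ` ?A \<subseteq> R" and R: "subring_set R" and p: "p > 0"
      using sp by (auto simp: specialisation_def good_ring_def)
    define t where "t z = y z - y' z" for z
    have tR: "t z \<in> R" if "z \<in> Ib" for z using y that by (auto simp: t_def intro!: sr_diff[OF R])
    have nd: "near \<phi> p (U n) y z - near \<phi> p (U n) y' z = of_nat p * t z" for z
      by (simp add: near_def t_def right_diff_distrib)
    \<comment> \<open>Entries that stay in the window are copied, so their differences are read off
      directly. The entry that leaves it, with index 0, has to be recovered from the
      recurrence.\<close>
    have up: "t (Suc k, i) \<in> pideal p R 1" if "Suc k < g" "i < m" for k i
    proof -
      have "(k, i) \<in> Ib" using that by (simp add: Ib_def)
      from bspec[OF diff this] have "of_nat p * t (Suc k, i) \<in> pideal p R (Suc 1)"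
        using that by (simp add: TE_def pev_def nd numeral_2_eq_2)
      then show ?thesis by (rule pideal_cancel[OF p])
    qed
    obtain k i where ki: "z = (k, i)" "k < g" "i < m" using z by (auto simp: Ib_def)
    show "y z - y' z \<in> pideal p R 1"
    proof (cases k)
      case (Suc k')
      then show ?thesis using up[of k' i] ki by (simp add: t_def)
    next
      case 0
      have "(g - 1, i) \<in> Ib" using g ki by (simp add: Ib_def)
      from bspec[OF diff this] have "(\<Sum>k<g. \<phi> (\<rho> k) * near \<phi> p (U n) y (k, i)) -
          (\<Sum>k<g. \<phi> (\<rho> k) * near \<phi> p (U n) y' (k, i)) \<in> pideal p R (Suc 1)"
        using g by (simp add: TE_def pev_def pmap_psum[of \<phi>, OF hom_on_zero[OF A \<phi>(1)]] numeral_2_eq_2)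
      also have "(\<Sum>k<g. \<phi> (\<rho> k) * near \<phi> p (U n) y (k, i)) - (\<Sum>k<g. \<phi> (\<rho> k) * near \<phi> p (U n) y' (k, i)) =
          of_nat p * (\<Sum>k<g. \<phi> (\<rho> k) * t (k, i))"
        by (simp add: sum_subtractf[symmetric] sum_distrib_left nd mult.left_commute flip: right_diff_distrib)
      finally have "(\<Sum>k<g. \<phi> (\<rho> k) * t (k, i)) \<in> pideal p R 1" by (rule pideal_cancel[OF p])
      moreover have "(\<Sum>k\<in>{..<g} - {0}. \<phi> (\<rho> k) * t (k, i)) \<in> pideal p R 1"
      proof (rule pideal_sum[OF R])
        fix k assume k: "k \<in> {..<g} - {0}"
        then obtain k' where k': "k = Suc k'" by (cases k) auto
        have "\<phi> (\<rho> k) \<in> R" using \<rho>A \<phi>(2) k by auto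
        then show "\<phi> (\<rho> k) * t (k, i) \<in> pideal p R 1"
          using up[of k' i] k k' ki by (intro pideal_mult[OF R]) auto
      qed
      ultimately have "(\<Sum>k<g. \<phi> (\<rho> k) * t (k, i)) - (\<Sum>k\<in>{..<g} - {0}. \<phi> (\<rho> k) * t (k, i)) \<in> pideal p R 1"
        by (rule pideal_diff[OF R])
      moreover have "(\<Sum>k<g. \<phi> (\<rho> k) * t (k, i)) = \<phi> (\<rho> 0) * t (0, i) + (\<Sum>k\<in>{..<g} - {0}. \<phi> (\<rho> k) * t (k, i))"
        using g by (intro sum.remove) auto
      ultimately have 1: "t (0, i) * \<phi> (\<rho> 0) \<in> pideal p R 1" by (simp add: mult.commute)
      have iA: "inverse (\<rho> 0) \<in> ?A" using gen_superset[of G] by (auto simp: G_def)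
      then have 2: "\<phi> (inverse (\<rho> 0)) \<in> R" using \<phi>(2) by auto
      have "\<phi> (\<rho> 0) * \<phi> (inverse (\<rho> 0)) = \<phi> (\<rho> 0 * inverse (\<rho> 0))"
        using hom_on_mult[OF A \<phi>(1) \<rho>A iA, of 0] g by simp
      then have 3: "\<phi> (\<rho> 0) * \<phi> (inverse (\<rho> 0)) = 1" using \<rho> hom_on_one[OF A \<phi>(1)] by simp
      show ?thesis using pideal_unit[OF R 1 2 3] ki 0 by (simp add: t_def)
    qed
  qed
  obtain s0 where s0: "\<And>y. y \<in> \<rho> ` {..<g} \<Longrightarrow> sz G s0 (2 ^ s0) y"
  proof -
    have "finite (\<rho> ` {..<g})" "\<rho> ` {..<g} \<subseteq> ?A" using \<rho>A by auto
    then show ?thesis using that finite_sz_common by metis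
  qed
  have "\<exists>\<sigma>. mono \<sigma> \<and> (\<forall>n. \<sigma> n \<ge> 1) \<and> (\<lambda>n. real ((n + 1) * \<sigma> n) / real d ^ n) \<longlonglongrightarrow> 0 \<and>
    (\<forall>n. \<forall>z\<in>Ib. sz G (\<sigma> n) (2 ^ \<sigma> n) (U n z))"
  proof (rule size_growth[OF finI d, where q = 1 and E = 1 and K = "s0 + g"])
    show "U n z \<in> ?A" if "z \<in> Ib" for n z by (rule UA[OF that])
    fix n s z assume IH: "\<And>z. z \<in> Ib \<Longrightarrow> sz G s (2 ^ s) (U n z)" and z: "z \<in> Ib"
    let ?s = "1 * s + (s0 + g)"
    show "sz G ?s (2 ^ ?s) (U (n + 1) z)"
    proof (cases "Suc (fst z) < g")
      case True
      then have "(Suc (fst z), snd z) \<in> Ib" using z by (auto simp: Ib_def)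
      from IH[OF this] have "sz G s (2 ^ s) (U (n + 1) z)" by (simp add: U_def)
      then show ?thesis by (elim sz_mono) (auto intro: power_increasing)
    next
      case False
      have "sz G (s0 + s) (2 ^ s0 * 2 ^ s) (\<rho> k * U n (k, snd z))" if "k < g" for k
        using that z by (intro sz_mult s0 IH) (auto simp: Ib_def)
      then have "sz G (s0 + s) (\<Sum>k<g. 2 ^ s0 * 2 ^ s) (\<Sum>k<g. \<rho> k * U n (k, snd z))"
        by (intro sz_sum) auto
      moreover have "U (n + 1) z = (\<Sum>k<g. \<rho> k * U n (k, snd z))"
        using Us[OF z, of n] False by (simp add: TE_def)
      moreover have "(\<Sum>k<g. 2 ^ s0 * 2 ^ s) \<le> (2::nat) ^ ?s"
        using less_exp[of g] by (simp add: power_add)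
      ultimately show ?thesis by (auto elim: sz_mono)
    qed
  qed (use d in auto)
  then obtain \<sigma> where \<sigma>: "mono \<sigma>" "\<forall>n. \<sigma> n \<ge> 1" "(\<lambda>n. real ((n + 1) * \<sigma> n) / real d ^ n) \<longlonglongrightarrow> 0"
    "\<forall>n. \<forall>z\<in>Ib. sz G (\<sigma> n) (2 ^ \<sigma> n) (U n z)" by blast
  have \<iota>: "\<forall>i<m. (0, i) \<in> Ib" using g by (simp add: Ib_def)
  have "\<forall>n. \<forall>i<m. U n (0, i) = (endo_apply T ^^ (n + e)) u $ i" by (simp add: U_def v_def)
  with \<iota> show ?thesis
    unfolding base_system_def
    by (intro exI[of _ G] exI[of _ Ib] exI[of _ "\<lambda>i. (0, i)"] exI[of _ TE]
        exI[of _ U] exI[of _ \<sigma>] exI[of _ e] conjI finG finI ballI allI TE UA Us inj \<sigma>) (use \<sigma> in auto)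
qed

theorem corollary6p5:
  fixes m r d :: nat
    and T :: "'k::{alg_closed_field, field_char_0} mpoly vec"
    and P :: "'k mpoly"
    and M :: "'k mpoly mat"
  assumes "r \<ge> 1" and "d \<ge> 2"
    and "M \<in> GL_poly r m"
    and "P \<in> poly_ring (m + r)" and "P \<noteq> 0" and "homogeneous_in {m..<m + r} (d - 1) P"
    and "T \<in> poly_endos m"
  shows "(affine_linear m T \<longrightarrow> satisfies_DML (m + r) (skew_map m r T P M)) \<and>
    (m \<ge> 1 \<and> etale m T \<and> (\<exists>q\<ge>1. endo_degree (endo_iter T q) < d ^ q) \<longrightarrow>
       satisfies_DML (m + r) (skew_map m r T P M))"
proof (intro conjI impI)
  assume "affine_linear m T"
  \<comment> \<open>Here the base variables are pairs of a window position and a coordinate; in the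
    etale case they are the coordinates themselves.\<close>
  then show "satisfies_DML (m + r) (skew_map m r T P M)"
    by (intro satisfies_DML_skew_map[where 'b = "nat \<times> nat", OF assms(2-4,6,7)]
        base_system_affine[OF _ assms(2)])
next
  assume *: "m \<ge> 1 \<and> etale m T \<and> (\<exists>q\<ge>1. endo_degree (endo_iter T q) < d ^ q)"
  then obtain q where "q \<ge> 1" "endo_degree (endo_iter T q) < d ^ q" by blast
  with * show "satisfies_DML (m + r) (skew_map m r T P M)"
    by (intro satisfies_DML_skew_map[where 'b = nat, OF assms(2-4,6,7)] base_system_etale[OF _ assms(2)]) auto
qed

end
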